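(* Let $\xi_0,\xi_1,\ldots$ be i.i.d. real-valued random variables with $\mathbb{E}\,\xi_0=0$ and $\mathbb{E}[\xi_0^2]=1$. Let $P_n(z)=\sum_{k=0}^\infty f_{n,k}\xi_k z^k$, $n\in\mathbb{N}$, where the coefficients $f_{n,k}$ are those of any one of the four ensembles SP, FAF, HAF, WP, and let the corresponding set $J\subset\mathbb{R}$ and function $p:J\to\mathbb{R}$ be as in the context. Let $[a,b]\subset J\setminus\{0\}$ and let $N_n[a,b]$ be the number of real zeroes of $P_n$ in $[a,b]$. Then $$\lim_{n\to\infty}\frac{\mathbb{E}\,N_n[a,b]}{\sqrt n}=\frac{1}{2\pi}\int_a^b\sqrt{\frac{p'(t)}{t}+p''(t)}\;dt .$$
   Context: The four ensembles are given by the following coefficients ($n\in\mathbb{N}$, $k\in\mathbb{N}_0$), together with a set $J\subset\mathbb{R}$ and a function $p:J\to\mathbb{R}$: - SP (spherical polynomials): $f_{n,k}=\sqrt{\binom nk}$ for $k\le n$ and $f_{n,k}=0$ for $k>n$; $J=\mathbb{R}$, $p(t)=\log(1+t^2)$. - FAF (flat random analytic function): $f_{n,k}=\sqrt{n^k/k!}$; $J=\mathbb{R}$, $p(t)=t^2$. - HAF (hyperbolic random analytic function): $f_{n,k}=\sqrt{\binom{n+k-1}{k}}$; $J=(-1,1)$, $p(t)=-\log(1-t^2)$. - WP (Weyl polynomials): $f_{n,k}=\sqrt{n^k/k!}$ for $k\le n$ and $f_{n,k}=0$ for $k>n$; $J=(-1,1)$, $p(t)=t^2$. In the SP and WP cases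 $P_n$ is a polynomial; with probability one $P_n$ is an entire function in the FAF case and is analytic on the open unit disk in the HAF case. $N_n[a,b]$ denotes the number of points $x\in[a,b]$ with $P_n(x)=0$; on the event that $P_n$ vanishes identically, set $N_n[a,b]=0$. *)

theory Defs
  imports "HOL-Probability.Probability"
begin

text \<open>
  The four ensembles: spherical polynomials, flat random analytic functions,
  hyperbolic random analytic functions, Weyl polynomials.
\<close>

datatype ensemble = SP | FAF | HAF | WP

fun ens_coeff :: "ensemble \<Rightarrow> nat \<Rightarrow> nat \<Rightarrow> real" where
  "ens_coeff SP n k = (if k \<le> n then sqrt (real (n choose k)) else 0)"
| "ens_coeff FAF n k = sqrt (real n ^ k / fact k)"
| "ens_coeff HAF n k = sqrt (real ((n + k - 1) choose k))"
| "ens_coeff WP n k = (if k \<le> n then sqrt (real n ^ k / fact k) else 0)"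

fun ens_J :: "ensemble \<Rightarrow> real set" where
  "ens_J SP = UNIV"
| "ens_J FAF = UNIV"
| "ens_J HAF = {-1<..<1}"
| "ens_J WP = {-1<..<1}"

text \<open>
  Only the values on \<^term>\<open>ens_J e\<close> are meaningful. This set is open, so derivatives
  at its points do not depend on the values outside it.
\<close>

fun ens_p :: "ensemble \<Rightarrow> real \<Rightarrow> real" where
  "ens_p SP t = ln (1 + t\<^sup>2)"
| "ens_p FAF t = t\<^sup>2"
| "ens_p HAF t = - ln (1 - t\<^sup>2)"
| "ens_p WP t = t\<^sup>2"

text \<open>
  The set on which the random function is (almost surely) analytic. Weyl polynomials are
  entire although their \<^term>\<open>ens_J\<close> is bounded.
\<close>

fun ens_domain :: "ensemble \<Rightarrow> complex set" where
  "ens_domain SP = UNIV"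
| "ens_domain FAF = UNIV"
| "ens_domain HAF = ball 0 1"
| "ens_domain WP = UNIV"

text \<open>The function \<open>P\<^sub>n\<close> for one realisation \<open>x\<^sub>0, x\<^sub>1, \<dots>\<close> of the random coefficients.\<close>

definition ens_fun :: "ensemble \<Rightarrow> nat \<Rightarrow> (nat \<Rightarrow> real) \<Rightarrow> complex \<Rightarrow> complex" where
  "ens_fun e n x z = (\<Sum>k. complex_of_real (ens_coeff e n k * x k) * z ^ k)"

text \<open>
  The number of zeros in \<open>[a, b]\<close>, without multiplicity. It is measured by
  \<^const>\<open>count_space\<close> rather than \<^const>\<open>card\<close>, so that an infinite set counts as \<open>\<infinity>\<close>
  instead of 0; the value 0 in the identically vanishing case is a convention.
\<close>

definition num_zeros :: "ensemble \<Rightarrow> nat \<Rightarrow> (nat \<Rightarrow> real) \<Rightarrow> real \<Rightarrow> real \<Rightarrow> ennreal" where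
  "num_zeros e n x a b =
     (if \<forall>z\<in>ens_domain e. ens_fun e n x z = 0 then 0
      else emeasure (count_space UNIV) {t \<in> {a..b}. ens_fun e n x (complex_of_real t) = 0})"

end

theory Submission
  imports Defs "HOL-Complex_Analysis.Complex_Analysis" "HOL-Real_Asymp.Real_Asymp"
begin

text \<open>Let \<open>h = \<delta> / sqrt n\<close>. Averaging over translates of a window of length \<open>h\<close>, \<open>h\<close> times the
  number of zeros in \<open>[a, b]\<close> is the integral over \<open>t\<close> of the number of zeros in \<open>[t, t + h]\<close>, up to
  boundary terms. A sign change between \<open>t\<close> and \<open>t + h\<close> forces a zero, which gives the lower bound.
  Conversely, a window containing a zero but no sign change contains at least two zeros. If it
  contains \<open>m\<close> zeros, dividing them out by Blaschke factors on the disc of radius \<open>1 / sqrt n\<close> about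
  \<open>t\<close> shows that \<open>P n t\<close> is smaller by a factor \<open>\<delta> ^ m\<close> than the circle mean of \<open>P n\<close>; since the
  characteristic function of the normalised \<open>P n t\<close> decays on a range polynomial in \<open>n\<close>, a
  small-ball estimate makes this event negligible compared with \<open>\<delta>\<close>. The remaining, very large
  values of \<open>m\<close> are absorbed by an \<open>O(n)\<close> bound for the total number of zeros.

  The pair \<open>(P n t, P n (t + h))\<close>, normalised, converges in law to a Gaussian pair with
  correlation \<open>exp (- (\<kappa> t * \<delta>)\<^sup>2 / 2)\<close>, so the probability of a sign change tends to the arc cosine
  of this number divided by \<open>pi\<close>, which is asymptotic to \<open>\<kappa> t * \<delta> / pi\<close> as \<open>\<delta>\<close> tends to 0. Here
  \<open>2 * \<kappa> t\<close> is the integrand of the theorem.\<close>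

section \<open>Zeros of holomorphic functions and circle means\<close>

text \<open>The law of the coefficients may be discrete, so \<open>P n t\<close> need not have a
  density and multiple zeros cannot be ruled out; no formula based on a joint density of value and
  derivative applies. Anti-concentration has to come from independence alone: many coefficients must
  contribute comparable shares to the variance of \<open>P n t\<close>. This holds where the
  variance profile varies slowly over many indices. It fails at \<open>t = 0\<close>, where a single
  coefficient carries everything, and for WP the bound \<open>|t| < 1\<close> keeps the mode of the
  profile below the truncation index. Exponents: with \<delta> = d^3 the probability that m zeros
  crowd into one window is O(d^(2 m) + n^(-2)). The cases m \<ge> 2 then cost O(d^4), against a main
  term of order d^3. The index m runs up to n + 2, so that the errors n^(-2) add up to O(1/n), while
  the O(n) zeros left over are multiplied by a probability O(n^(-2)). For fixed \<delta> the limit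
  in n is taken first; \<delta> tends to 0 afterwards.\<close>

lemma holomorphic_factor_zeros:
  assumes "open S" "f holomorphic_on S" "distinct zs" "set zs \<subseteq> S" "\<And>z. z \<in> set zs \<Longrightarrow> f z = 0"
  shows "\<exists>g. g holomorphic_on S \<and> (\<forall>z. f z = (\<Prod>w\<leftarrow>zs. z - w) * g z)"
  using assms(2-5)
proof (induction zs arbitrary: f)
  case Nil
  then show ?case by auto
next
  case (Cons a zs)
  define f1 where "f1 = (\<lambda>z. if z = a then deriv f a else (f z - f a) / (z - a))"
  have f1: "f1 holomorphic_on S"
    unfolding f1_def using pole_lemma_open[OF Cons.prems(1) \<open>open S\<close>] by simp
  have fa: "f a = 0" using Cons.prems(4) by simp
  have f_eq: "f z = (z - a) * f1 z" for z
    by (simp add: f1_def fa)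
  have "f1 z = 0" if "z \<in> set zs" for z
  proof -
    have "z \<noteq> a" using that Cons.prems(2) by auto
    then show ?thesis using Cons.prems(4)[of z] that by (simp add: f1_def fa)
  qed
  then obtain g where "g holomorphic_on S" "\<And>z. f1 z = (\<Prod>w\<leftarrow>zs. z - w) * g z"
    using Cons.IH[OF f1] Cons.prems by auto
  then show ?case
    by (intro exI[of _ g]) (auto simp: f_eq mult.assoc)
qed

text \<open>Cauchy's formula, with \<open>r - norm (w - c)\<close> as a lower bound for the distance
  from w to the circle. The circle is parametrised over [0, 1], so that the integral is a mean and
  can be exchanged with the expectation.\<close>

lemma norm_le_circle_mean:
  assumes f: "f holomorphic_on ball c R" and r: "0 < r" "r < R" and w: "norm (w - c) < r"
  shows "norm (f w) \<le> r / (r - norm (w - c)) * integral {0..1} (\<lambda>x. norm (f (circlepath c r x)))"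
proof -
  let ?d = "r - norm (w - c)"
  have cb: "cball c r \<subseteq> ball c R" using r by auto
  have d: "?d > 0" using w by simp
  have cp: "circlepath c r x \<in> ball c R" "norm (circlepath c r x - c) = r" for x
    using r by (auto simp: circlepath dist_norm norm_mult)
  have "((\<lambda>u. f u / (u - w)) has_contour_integral (2 * of_real pi * \<i> * f w)) (circlepath c r)"
    by (rule Cauchy_integral_circlepath_simple) (use f cb w holomorphic_on_subset in auto)
  then have hi: "((\<lambda>x. f (circlepath c r x) / (circlepath c r x - w) * vector_derivative (circlepath c r) (at x within {0..1}))
      has_integral (2 * of_real pi * \<i> * f w)) {0..1}"
    unfolding has_contour_integral_def .
  have ne: "norm (circlepath c r x - w) \<ge> ?d" for x
    using norm_triangle_ineq2[of "circlepath c r x - c" "w - c"] cp(2)[of x] by simp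
  have cont: "continuous_on {0..1} (\<lambda>x. norm (f (circlepath c r x)))"
  proof -
    have "continuous_on (ball c R) f" using f by (rule holomorphic_on_imp_continuous_on)
    moreover have "continuous_on {0..1} (circlepath c r)"
      by (auto simp: circlepath intro!: continuous_intros)
    ultimately show ?thesis
      by (intro continuous_on_norm) (rule continuous_on_compose2, use cp in auto)
  qed
  have "norm (integral {0..1} (\<lambda>x. f (circlepath c r x) / (circlepath c r x - w) * vector_derivative (circlepath c r) (at x within {0..1})))
     \<le> integral {0..1} (\<lambda>x. (2 * pi * r / ?d) * norm (f (circlepath c r x)))"
  proof (rule integral_norm_bound_integral)
    show "(\<lambda>x. 2 * pi * r / ?d * norm (f (circlepath c r x))) integrable_on {0..1}"
      by (intro integrable_continuous_real continuous_on_mult_left cont)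
    fix x :: real assume x: "x \<in> {0..1}"
    have "norm (vector_derivative (circlepath c r) (at x within {0..1})) = 2 * pi * r"
      using x r by (simp add: vector_derivative_circlepath01 norm_mult)
    then have "norm (f (circlepath c r x) / (circlepath c r x - w) * vector_derivative (circlepath c r) (at x within {0..1}))
      = norm (f (circlepath c r x)) * (2 * pi * r) / norm (circlepath c r x - w)"
      by (simp add: norm_mult norm_divide)
    also have "\<dots> \<le> norm (f (circlepath c r x)) * (2 * pi * r) / ?d"
      using ne[of x] d r by (intro divide_left_mono mult_pos_pos mult_nonneg_nonneg) auto
    finally show "norm (f (circlepath c r x) / (circlepath c r x - w) * vector_derivative (circlepath c r) (at x within {0..1}))
       \<le> 2 * pi * r / ?d * norm (f (circlepath c r x))" by (simp add: field_simps)
  qed (use hi in blast)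
  then have "2 * pi * norm (f w) \<le> (2 * pi * r / ?d) * integral {0..1} (\<lambda>x. norm (f (circlepath c r x)))"
    using integral_unique[OF hi] by (simp only: integral_mult_right) (simp add: norm_mult)
  also have "\<dots> = 2 * pi * (r / ?d * integral {0..1} (\<lambda>x. norm (f (circlepath c r x))))" by simp
  finally show ?thesis by (subst (asm) mult_le_cancel_left_pos) simp_all
qed

lemma norm_prod_list: "norm (\<Prod>w\<leftarrow>ws. f w :: 'a :: {real_normed_div_algebra, comm_monoid_mult}) = (\<Prod>w\<leftarrow>ws. norm (f w))"
  by (induction ws) (auto simp: norm_mult)

lemma prod_list_le_power:
  fixes f :: "'a \<Rightarrow> real"
  assumes "\<And>w. w \<in> set ws \<Longrightarrow> 0 \<le> f w \<and> f w \<le> q * g w" "0 \<le> q" "\<And>w. w \<in> set ws \<Longrightarrow> 0 \<le> g w"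
  shows "(\<Prod>w\<leftarrow>ws. f w) \<le> q ^ length ws * (\<Prod>w\<leftarrow>ws. g w) \<and> 0 \<le> (\<Prod>w\<leftarrow>ws. f w) \<and> 0 \<le> (\<Prod>w\<leftarrow>ws. g w)"
  using assms(1,3)
proof (induction ws)
  case (Cons a ws)
  have "f a * (\<Prod>w\<leftarrow>ws. f w) \<le> (q * g a) * (q ^ length ws * (\<Prod>w\<leftarrow>ws. g w))"
    using Cons assms(2) by (intro mult_mono) auto
  then show ?case using Cons assms(2) by (auto simp: mult_ac)
qed auto

text \<open>On the circle of radius r about c the factors \<open>z - w\<close> and
  \<open>(r^2 - cnj (w - c) * (z - c)) / r\<close> have the same modulus. Exchanging them turns F
  into a holomorphic H with the same circle mean, which bounds \<open>H^2\<close> inside the disc;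
  going back from H to F at z gains one factor q per zero. Squares are used because second moments
  are what the randomness controls.\<close>

lemma blaschke_bound:
  fixes F :: "complex \<Rightarrow> complex"
  assumes F: "\<And>z. z \<in> ball c R \<Longrightarrow> F z = (\<Prod>w\<leftarrow>ws. z - w) * g z" and g: "g holomorphic_on ball c R"
    and r: "0 < r" "r < R" and z: "norm (z - c) < r" and q: "0 \<le> q"
    and ws: "\<And>w. w \<in> set ws \<Longrightarrow> r * norm (z - w) \<le> q * norm ((of_real r)\<^sup>2 - cnj (w - c) * (z - c))"
  shows "(norm (F z))\<^sup>2 \<le> r / (r - norm (z - c)) * q ^ (2 * length ws)
           * integral {0..1} (\<lambda>x. (norm (F (circlepath c r x)))\<^sup>2)"
proof -
  define H where "H = (\<lambda>z. g z * (\<Prod>w\<leftarrow>ws. ((of_real r)\<^sup>2 - cnj (w - c) * (z - c)) / of_real r))"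
  have "(\<lambda>z. \<Prod>w\<leftarrow>ws. ((of_real r)\<^sup>2 - cnj (w - c) * (z - c)) / of_real r) holomorphic_on A" for A
    by (induction ws) (auto intro!: holomorphic_intros simp: r)
  then have H: "(\<lambda>z. (H z)\<^sup>2) holomorphic_on ball c R"
    unfolding H_def using g by (intro holomorphic_intros) auto
  have eq: "norm (H (circlepath c r x)) = norm (F (circlepath c r x))" for x
  proof -
    define u where "u = circlepath c r x"
    have u: "norm (u - c) = r" "u \<in> ball c R"
      using r by (auto simp: u_def circlepath dist_norm norm_mult)
    have "norm (((of_real r)\<^sup>2 - cnj (w - c) * (u - c)) / of_real r) = norm (u - w)" for w
    proof -
      have "(of_real r)\<^sup>2 = (u - c) * cnj (u - c)"
        using u(1) complex_norm_square[of "u - c"] by simp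
      then have "(of_real r)\<^sup>2 - cnj (w - c) * (u - c) = (u - c) * cnj (u - w)"
        by (simp add: algebra_simps)
      then have "norm ((of_real r)\<^sup>2 - cnj (w - c) * (u - c)) = r * norm (u - w)"
        using u(1) by (simp only: norm_mult complex_mod_cnj)
      then show ?thesis using r by (simp add: norm_divide)
    qed
    then show ?thesis unfolding u_def[symmetric]
      by (simp only: F[OF u(2)] H_def norm_mult norm_prod_list mult.commute)
  qed
  have zb: "z \<in> ball c R" using z r by (auto simp: dist_norm norm_minus_commute)
  have "norm (F z) \<le> q ^ length ws * norm (H z)"
  proof -
    have "(\<Prod>w\<leftarrow>ws. norm (z - w)) \<le> q ^ length ws * (\<Prod>w\<leftarrow>ws. norm (((of_real r)\<^sup>2 - cnj (w - c) * (z - c)) / of_real r))"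
      using prod_list_le_power[of ws "\<lambda>w. norm (z - w)" q "\<lambda>w. norm (((of_real r)\<^sup>2 - cnj (w - c) * (z - c)) / of_real r)"] ws q r
      by (auto simp: norm_divide field_simps)
    then have "(\<Prod>w\<leftarrow>ws. norm (z - w)) * norm (g z) \<le> q ^ length ws * (\<Prod>w\<leftarrow>ws. norm (((of_real r)\<^sup>2 - cnj (w - c) * (z - c)) / of_real r)) * norm (g z)"
      by (rule mult_right_mono) simp
    then show ?thesis unfolding F[OF zb] H_def by (simp only: norm_mult norm_prod_list mult_ac)
  qed
  then have "(norm (F z))\<^sup>2 \<le> (q ^ length ws * norm (H z))\<^sup>2"
    by (rule power_mono) simp
  also have "\<dots> = q ^ (2 * length ws) * norm ((H z)\<^sup>2)"
    by (simp add: power_mult_distrib norm_power power_mult[symmetric] mult.commute)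
  also have "norm ((H z)\<^sup>2) \<le> r / (r - norm (z - c)) * integral {0..1} (\<lambda>x. norm ((H (circlepath c r x))\<^sup>2))"
    by (rule norm_le_circle_mean[OF H r z])
  also have "(\<lambda>x. norm ((H (circlepath c r x))\<^sup>2)) = (\<lambda>x. (norm (F (circlepath c r x)))\<^sup>2)"
    by (simp add: norm_power eq)
  finally have "(norm (F z))\<^sup>2 \<le> q ^ (2 * length ws) * (r / (r - norm (z - c)) * integral {0..1} (\<lambda>x. (norm (F (circlepath c r x)))\<^sup>2))"
    using q by (simp add: mult_left_mono)
  then show ?thesis by (simp only: mult_ac)
qed

lemma nn_integral_eq_integral_continuous:
  fixes f :: "real \<Rightarrow> real"
  assumes "continuous_on {a..b} f" "\<And>x. x \<in> {a..b} \<Longrightarrow> 0 \<le> f x"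
  shows "(\<integral>\<^sup>+x\<in>{a..b}. ennreal (f x) \<partial>lborel) = ennreal (integral {a..b} f)"
proof -
  have "set_integrable lborel {a..b} f"
    by (rule borel_integrable_atLeastAtMost') (rule assms)
  then have i: "integrable lborel (\<lambda>x. indicator {a..b} x * f x)" by (simp add: set_integrable_def)
  have "(\<integral>\<^sup>+x\<in>{a..b}. ennreal (f x) \<partial>lborel) = (\<integral>\<^sup>+x. ennreal (indicator {a..b} x * f x) \<partial>lborel)"
    by (intro nn_integral_cong) (auto simp: indicator_def)
  also have "\<dots> = ennreal (LINT x|lborel. indicator {a..b} x * f x)"
    by (rule nn_integral_eq_integral[OF i]) (auto simp: indicator_def assms(2))
  also have "(LINT x|lborel. indicator {a..b} x * f x) = integral {a..b} f"
    using set_borel_integral_eq_integral(2)[OF \<open>set_integrable lborel {a..b} f\<close>]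
    by (simp add: set_lebesgue_integral_def)
  finally show ?thesis .
qed

text \<open>An \<open>ennreal\<close>-valued integral, so that exchanging it with the expectation is
  a matter of measurability only.\<close>

definition circ_mean :: "complex \<Rightarrow> real \<Rightarrow> (complex \<Rightarrow> complex) \<Rightarrow> ennreal" where
  "circ_mean c r F = (\<integral>\<^sup>+x\<in>{0..1}. ennreal ((norm (F (circlepath c r x)))\<^sup>2) \<partial>lborel)"

lemma blaschke_bound_circ_mean:
  fixes F :: "complex \<Rightarrow> complex"
  assumes "\<And>z. z \<in> ball c R \<Longrightarrow> F z = (\<Prod>w\<leftarrow>ws. z - w) * g z" and g: "g holomorphic_on ball c R"
    and r: "0 < r" "r < R" and z: "norm (z - c) < r" and q: "0 \<le> q"
    and "\<And>w. w \<in> set ws \<Longrightarrow> r * norm (z - w) \<le> q * norm ((of_real r)\<^sup>2 - cnj (w - c) * (z - c))"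
  shows "ennreal ((norm (F z))\<^sup>2) \<le> ennreal (r / (r - norm (z - c)) * q ^ (2 * length ws)) * circ_mean c r F"
proof -
  have "(\<lambda>z. (\<Prod>w\<leftarrow>ws. z - w) * g z) holomorphic_on ball c R"
  proof -
    have "(\<lambda>z. \<Prod>w\<leftarrow>ws. z - w) holomorphic_on ball c R"
      by (induction ws) (auto intro!: holomorphic_intros)
    then show ?thesis using g by (intro holomorphic_intros)
  qed
  then have cont: "continuous_on (ball c R) F"
    using assms(1) by (metis (no_types, lifting) holomorphic_cong holomorphic_on_imp_continuous_on)
  have "circlepath c r x \<in> ball c R" for x
    using r by (auto simp: circlepath dist_norm norm_mult)
  moreover have "continuous_on {0..1} (circlepath c r)"
    by (auto simp: circlepath intro!: continuous_intros)
  ultimately have "continuous_on {0..1} (\<lambda>x. (norm (F (circlepath c r x)))\<^sup>2)"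
    by (intro continuous_intros) (rule continuous_on_compose2[OF cont], auto)
  then have "circ_mean c r F = ennreal (integral {0..1} (\<lambda>x. (norm (F (circlepath c r x)))\<^sup>2))"
    unfolding circ_mean_def by (rule nn_integral_eq_integral_continuous) simp
  then show ?thesis using blaschke_bound[OF assms] z r q
    by (simp add: ennreal_mult'[symmetric] ennreal_leI)
qed

text \<open>With \<open>N = |r^2 - cnj w * z|\<close> one has
  \<open>N^2 - r^2 * |z - w|^2 = (r^2 - |w|^2) * (r^2 - |z|^2)\<close>. Together with
  \<open>N \<le> 2 * r^2\<close> this keeps the Blaschke factor below a constant that depends on r,
  s and e alone.\<close>

lemma blaschke_factor_real:
  fixes w z :: complex
  assumes "norm w \<le> s" "norm z \<le> e" "0 < r" "s < r" "e < r" "0 \<le> s" "0 \<le> e"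
  shows "r * norm (z - w) \<le> sqrt (1 - (r\<^sup>2 - s\<^sup>2) * (r\<^sup>2 - e\<^sup>2) / (4 * r ^ 4)) * norm ((of_real r)\<^sup>2 - cnj w * z)"
proof -
  let ?q = "(r\<^sup>2 - s\<^sup>2) * (r\<^sup>2 - e\<^sup>2) / (4 * r ^ 4)"
  let ?N = "norm ((of_real r)\<^sup>2 - cnj w * z)"
  have id: "?N\<^sup>2 - r\<^sup>2 * (norm (z - w))\<^sup>2 = (r\<^sup>2 - (norm w)\<^sup>2) * (r\<^sup>2 - (norm z)\<^sup>2)"
    unfolding cmod_power2 by (simp add: power2_eq_square algebra_simps)
  have s2: "s\<^sup>2 < r\<^sup>2" "e\<^sup>2 < r\<^sup>2" using assms by (auto intro!: power_strict_mono)
  have w2: "(norm w)\<^sup>2 \<le> s\<^sup>2" "(norm z)\<^sup>2 \<le> e\<^sup>2" using assms by (auto intro!: power_mono)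
  have "?N \<le> r\<^sup>2 + norm w * norm z"
    using norm_triangle_ineq4[of "(of_real r)\<^sup>2 :: complex" "cnj w * z"] assms
    by (simp add: norm_mult norm_power)
  also have "norm w * norm z \<le> r * r" using assms by (intro mult_mono) auto
  finally have N: "?N \<le> 2 * r\<^sup>2" by (simp add: power2_eq_square)
  then have N2: "?N\<^sup>2 \<le> 4 * r ^ 4"
    using power_mono[OF N, of 2] by (simp add: power_mult_distrib power_mult[symmetric])
  have q0: "0 \<le> ?q" using s2 by simp
  have "?q * ?N\<^sup>2 \<le> ?q * (4 * r ^ 4)" using N2 q0 by (rule mult_left_mono)
  also have "\<dots> = (r\<^sup>2 - s\<^sup>2) * (r\<^sup>2 - e\<^sup>2)" using assms by simp
  also have "\<dots> \<le> (r\<^sup>2 - (norm w)\<^sup>2) * (r\<^sup>2 - (norm z)\<^sup>2)"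
    using w2 s2 by (intro mult_mono) auto
  finally have *: "(r * norm (z - w))\<^sup>2 \<le> (1 - ?q) * ?N\<^sup>2"
    using id by (simp add: algebra_simps power_mult_distrib)
  have "sqrt ((r * norm (z - w))\<^sup>2) \<le> sqrt ((1 - ?q) * ?N\<^sup>2)"
    by (rule real_sqrt_le_mono) (rule *)
  then show ?thesis using assms by (simp add: real_sqrt_mult)
qed

text \<open>After one zero is divided out, the quotient g is real on the interval, at
  \<open>z1\<close> by continuity. Either g has a further zero, possibly \<open>z1\<close> again, or
  g keeps its sign and \<open>(x - z1) * g x\<close> changes sign. The zeros form a list because a
  double zero has to be listed twice.\<close>

lemma holomorphic_zeros_or_sign_change:
  fixes F :: "complex \<Rightarrow> complex"
  assumes S: "open S" and F: "F holomorphic_on S" and I: "\<And>x. x \<in> {s..t} \<Longrightarrow> complex_of_real x \<in> S"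
    and real: "\<And>x. x \<in> {s..t} \<Longrightarrow> F (of_real x) \<in> \<real>"
    and z1: "z1 \<in> {s..t}" "F (of_real z1) = 0"
  shows "Re (F (of_real s)) * Re (F (of_real t)) \<le> 0 \<or>
    (\<exists>ws g. length ws = 2 \<and> set ws \<subseteq> {s..t} \<and> g holomorphic_on S \<and>
       (\<forall>z. F z = (\<Prod>w\<leftarrow>ws. z - of_real w) * g z))"
proof -
  obtain g where g: "g holomorphic_on S" "\<And>z. F z = (z - of_real z1) * g z"
    using holomorphic_factor_zeros[OF S F, of "[of_real z1]"] z1 I by auto
  show ?thesis
  proof (cases "\<exists>z2\<in>{s..t}. g (of_real z2) = 0")
    case True
    then obtain z2 where z2: "z2 \<in> {s..t}" "g (of_real z2) = 0" by auto
    obtain g2 where g2: "g2 holomorphic_on S" "\<And>z. g z = (z - of_real z2) * g2 z"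
      using holomorphic_factor_zeros[OF S g(1), of "[of_real z2]"] z2 I by auto
    show ?thesis
      by (intro disjI2 exI[of _ "[z1, z2]"] exI[of _ g2]) (use z1 z2 g g2 in auto)
  next
    case False
    have contg: "continuous_on {s..t} (\<lambda>x. g (of_real x))"
      by (rule continuous_on_compose2[OF holomorphic_on_imp_continuous_on[OF g(1)]])
         (auto intro!: continuous_intros I)
    have real_ne: "Im (g (of_real x)) = 0" if x: "x \<in> {s..t}" "x \<noteq> z1" for x
    proof -
      have "F (of_real x) = of_real (x - z1) * g (of_real x)" using g(2)[of "of_real x"] by simp
      then have "Im (F (of_real x)) = (x - z1) * Im (g (of_real x))" by simp
      then show ?thesis using real[OF x(1)] x(2) by (simp add: complex_is_Real_iff)
    qed
    show ?thesis
    proof (cases "z1 = s \<or> z1 = t")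
      case True
      then have "F (of_real s) = 0 \<or> F (of_real t) = 0" using z1 by auto
      then show ?thesis by auto
    next
      case ends: False
      then have lt: "s < z1" "z1 < t" using z1 by auto
      have im1: "Im (g (of_real z1)) = 0"
      proof (rule ccontr)
        assume "Im (g (of_real z1)) \<noteq> 0"
        moreover have "continuous_on {s..t} (\<lambda>x. Im (g (of_real x)))" using contg by (intro continuous_intros)
        then have "isCont (\<lambda>x. Im (g (of_real x))) z1"
          using lt by (auto simp: continuous_on_interior)
        ultimately have "eventually (\<lambda>x. Im (g (of_real x)) \<noteq> 0) (at z1)"
          unfolding isCont_def using tendsto_imp_eventually_ne by blast
        moreover have "eventually (\<lambda>x. x \<in> {s<..<t} - {z1}) (at z1)"
          using lt by (intro eventually_at_in_open) auto
        ultimately have "eventually (\<lambda>x. False) (at z1)"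
          by eventually_elim (use real_ne in auto)
        then show False by simp
      qed
      have im: "Im (g (of_real x)) = 0" if "x \<in> {s..t}" for x
        using im1 real_ne that by blast
      have ne: "Re (g (of_real x)) \<noteq> 0" if "x \<in> {s..t}" for x
        using False that im[OF that] by (metis complex_eqI zero_complex.sel)
      have contr: "continuous_on {s..t} (\<lambda>x. Re (g (of_real x)))" using contg by (intro continuous_intros)
      have "Re (g (of_real s)) * Re (g (of_real t)) > 0"
      proof (rule ccontr)
        assume "\<not> ?thesis"
        then have "Re (g (of_real s)) \<le> 0 \<and> 0 \<le> Re (g (of_real t)) \<or> Re (g (of_real t)) \<le> 0 \<and> 0 \<le> Re (g (of_real s))"
          by (auto simp: not_less mult_le_0_iff)
        then have "\<exists>x. s \<le> x \<and> x \<le> t \<and> Re (g (of_real x)) = 0"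
          using IVT'[of "\<lambda>x. Re (g (of_real x))" s 0 t] IVT2'[of "\<lambda>x. Re (g (of_real x))" t 0 s] contr lt by auto
        then show False using ne by auto
      qed
      moreover have "Re (F (of_real x)) = (x - z1) * Re (g (of_real x))" for x
        using g(2)[of "of_real x"] by simp
      ultimately have "Re (F (of_real s)) * Re (F (of_real t)) = ((s - z1) * (t - z1)) * (Re (g (of_real s)) * Re (g (of_real t)))"
        by simp
      also have "\<dots> \<le> 0" using lt \<open>0 < Re (g (of_real s)) * Re (g (of_real t))\<close>
        by (intro mult_nonpos_nonneg) (auto simp: mult_le_0_iff)
      finally show ?thesis ..
    qed
  qed
qed

section \<open>Coefficient weights\<close>

definition ens_w :: "ensemble \<Rightarrow> nat \<Rightarrow> nat \<Rightarrow> real" where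
  "ens_w e n k = (ens_coeff e n k)\<^sup>2"

text \<open>The covariance kernel: its value at \<open>s * t\<close> is the covariance of
  \<open>P n s\<close> and \<open>P n t\<close> for real s, t, and its value at \<open>|z|^2\<close>
  is the second moment of \<open>P n z\<close>.\<close>

definition ens_ker :: "ensemble \<Rightarrow> nat \<Rightarrow> real \<Rightarrow> real" where
  "ens_ker e n x = (\<Sum>k. ens_w e n k * x ^ k)"

text \<open>The parameter \<sigma> in the recursion
  \<open>w (k + 1) * (k + 1) = (n + \<sigma> * k) * w k\<close> shared by the ensembles, through
  which all variance profiles are handled at once.\<close>

fun ens_sigma :: "ensemble \<Rightarrow> real" where
  "ens_sigma SP = -1"
| "ens_sigma FAF = 0"
| "ens_sigma HAF = 1"
| "ens_sigma WP = 0"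

text \<open>The kernel is the n-th power of this function: exactly for SP, FAF and HAF, and up to an
  exponentially small relative error for WP as long as x stays away from 1.\<close>

fun ens_g :: "ensemble \<Rightarrow> real \<Rightarrow> real" where
  "ens_g SP x = 1 + x"
| "ens_g FAF x = exp x"
| "ens_g HAF x = 1 / (1 - x)"
| "ens_g WP x = exp x"

lemma ens_w_nonneg [simp]: "0 \<le> ens_w e n k"
  by (simp add: ens_w_def)

lemma ens_coeff_nonneg [simp]: "0 \<le> ens_coeff e n k"
  by (cases e) auto

lemma ens_w_simps:
  "ens_w SP n k = real (n choose k)"
  "ens_w FAF n k = real n ^ k / fact k"
  "ens_w HAF n k = real ((n + k - 1) choose k)"
  "ens_w WP n k = (if k \<le> n then real n ^ k / fact k else 0)"
  by (auto simp: ens_w_def)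

text \<open>For SP the right-hand side vanishes at \<open>k = n\<close> by itself. The truncation of
  WP breaks the recursion at that index, hence the side condition.\<close>

lemma ens_w_Suc:
  assumes "n \<ge> 1" "e = WP \<Longrightarrow> k < n"
  shows "ens_w e n (Suc k) * real (Suc k) = (real n + ens_sigma e * real k) * ens_w e n k"
proof (cases e)
  case SP
  have "(n choose Suc k) * Suc k = (n - k) * (n choose k)"
    by (metis binomial_absorb_comp binomial_absorption mult.commute)
  then have "real (n choose Suc k) * real (Suc k) = real (n - k) * real (n choose k)"
    by (metis of_nat_mult)
  then show ?thesis using SP by (cases "k \<le> n") (auto simp: ens_w_simps of_nat_diff not_le binomial_eq_0)
next
  case FAF
  have "real n ^ Suc k / fact (Suc k) * real (Suc k) = real n * (real n ^ k / fact k)"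
    by (simp add: field_simps del: of_nat_Suc)
  then show ?thesis using FAF by (simp add: ens_w_simps)
next
  case HAF
  have "Suc (n + k - 1) * ((n + k - 1) choose k) = (Suc (n + k - 1) choose Suc k) * Suc k"
    by (rule Suc_times_binomial_eq)
  then have "real (n + k) * real ((n + k - 1) choose k) = real ((n + k) choose Suc k) * real (Suc k)"
    using assms by (metis Suc_diff_1 add_gr_0 less_eq_Suc_le One_nat_def of_nat_mult)
  then show ?thesis using HAF by (simp add: ens_w_simps)
next
  case WP
  have "real n ^ Suc k / fact (Suc k) * real (Suc k) = real n * (real n ^ k / fact k)"
    by (simp add: field_simps del: of_nat_Suc)
  then show ?thesis using WP assms by (simp add: ens_w_simps)
qed

text \<open>The binomial theorem, the exponential series and the negative binomial series.\<close>

lemma ens_w_sums: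
  assumes "n \<ge> 1" "0 \<le> x" "e = HAF \<Longrightarrow> x < 1" "e \<noteq> WP"
  shows "(\<lambda>k. ens_w e n k * x ^ k) sums (ens_g e x ^ n)"
proof (cases e)
  case SP
  have "(\<lambda>k. real (n choose k) * x ^ k) sums (\<Sum>k\<le>n. real (n choose k) * x ^ k)"
    by (rule sums_finite) (auto simp: not_le)
  then show ?thesis using SP binomial_ring[of x 1 n] by (simp add: ens_w_simps add.commute)
next
  case FAF
  have "(\<lambda>k. (real n * x) ^ k /\<^sub>R fact k) sums exp (real n * x)" by (rule exp_converges)
  then show ?thesis using FAF
    by (simp add: ens_w_simps exp_of_nat_mult[symmetric] power_mult_distrib field_simps)
next
  case HAF
  have "(\<lambda>k. (- real n gchoose k) * (- x) ^ k) sums (1 + (- x)) powr (- real n)"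
    by (rule gen_binomial_real) (use assms HAF in auto)
  moreover have "(- real n gchoose k) * (- x) ^ k = real ((n + k - 1) choose k) * x ^ k" for k
  proof -
    have "(- real n gchoose k) = (-1) ^ k * ((real n + real k - 1) gchoose k)"
      by (rule gbinomial_minus)
    also have "real n + real k - 1 = real (n + k - 1)" using assms by simp
    finally have "(- real n gchoose k) * (- x) ^ k = ((-1) ^ k * (-1) ^ k) * (real ((n + k - 1) choose k) * x ^ k)"
      by (simp add: binomial_gbinomial power_minus[of x])
    then show ?thesis by (simp add: power_mult_distrib[symmetric])
  qed
  moreover have "(1 + (- x)) powr (- real n) = (1 / (1 - x)) ^ n"
    using assms HAF by (simp add: powr_minus powr_realpow power_one_over inverse_eq_divide)
  ultimately show ?thesis using HAF by (simp add: ens_w_simps)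
qed (use assms in auto)

lemma ens_w_summable:
  assumes "n \<ge> 1" "0 \<le> x" "e = HAF \<Longrightarrow> x < 1"
  shows "summable (\<lambda>k. ens_w e n k * x ^ k)"
proof (cases "e = WP")
  case True
  then show ?thesis
    by (intro summable_finite[of "{..n}"]) (auto simp: ens_w_simps)
qed (use ens_w_sums[OF assms] sums_summable in blast)

lemma ens_ker_sums:
  assumes "n \<ge> 1" "0 \<le> x" "e = HAF \<Longrightarrow> x < 1"
  shows "(\<lambda>k. ens_w e n k * x ^ k) sums ens_ker e n x"
  unfolding ens_ker_def by (rule summable_sums) (rule ens_w_summable[OF assms])

lemma ens_w_0 [simp]: "n \<ge> 1 \<Longrightarrow> ens_w e n 0 = 1"
  by (cases e) (auto simp: ens_w_simps)

lemma ens_ker_ge_1: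
  assumes "n \<ge> 1" "0 \<le> x" "e = HAF \<Longrightarrow> x < 1"
  shows "1 \<le> ens_ker e n x"
proof -
  have "sum (\<lambda>k. ens_w e n k * x ^ k) {0} \<le> ens_ker e n x"
    unfolding ens_ker_def
    by (rule sum_le_suminf) (use ens_w_summable[OF assms] assms in auto)
  then show ?thesis using assms by simp
qed

text \<open>For the Weyl polynomials, the tail of the exponential series is bounded by
  comparing \<open>x ^ k\<close> with \<open>(x / x1) ^ k * x1 ^ n\<close> for \<open>k > n\<close>.\<close>

lemma ens_ker_bounds:
  assumes "0 \<le> x1" "e \<in> {HAF, WP} \<Longrightarrow> x1 < 1"
  shows "\<exists>\<eta>. 0 \<le> \<eta> \<and> \<eta> < 1 \<and> (\<forall>n\<ge>1. \<forall>x. 0 \<le> x \<and> x \<le> x1 \<longrightarrow>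
     ens_g e x ^ n * (1 - \<eta> ^ n) \<le> ens_ker e n x \<and> ens_ker e n x \<le> ens_g e x ^ n)"
proof (cases "e = WP")
  case False
  have "ens_ker e n x = ens_g e x ^ n" if "n \<ge> 1" "0 \<le> x" "x \<le> x1" for n x
  proof -
    have "(\<lambda>k. ens_w e n k * x ^ k) sums (ens_g e x ^ n)"
      by (rule ens_w_sums) (use that assms False in auto)
    then show ?thesis unfolding ens_ker_def by (rule sums_unique[symmetric])
  qed
  then show ?thesis
    by (intro exI[of _ 0]) (auto simp: power_0_left)
next
  case True
  with assms have x1: "0 \<le> x1" "x1 < 1" by auto
  \<comment> \<open>The tail is at most \<open>(x1 * exp (x / x1 - x)) ^ n\<close> relative to
    \<open>exp x ^ n\<close>. The base increases with x, and \<eta> is its value at the endpoint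
    \<open>x = x1\<close>.\<close>
  define \<eta> where "\<eta> = x1 * exp (1 - x1)"
  have \<eta>: "0 \<le> \<eta>" "\<eta> < 1"
  proof -
    show "0 \<le> \<eta>" using x1 by (simp add: \<eta>_def)
    have "x1 < exp (x1 - 1)" using exp_minus_greater[of "1 - x1"] x1 by simp
    then have "x1 * exp (1 - x1) < exp (x1 - 1) * exp (1 - x1)" by (intro mult_strict_right_mono) auto
    then show "\<eta> < 1" by (simp add: \<eta>_def exp_add[symmetric])
  qed
  have "exp x ^ n * (1 - \<eta> ^ n) \<le> ens_ker WP n x \<and> ens_ker WP n x \<le> exp x ^ n"
    if n: "n \<ge> 1" and x: "0 \<le> x" "x \<le> x1" for n x
  proof -
    define a where "a k = (real n * x) ^ k / fact k" for k
    have a0: "a k \<ge> 0" for k using x by (simp add: a_def)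
    have s: "a sums (exp x ^ n)"
      using ens_w_sums[of n x FAF] n x unfolding a_def by (simp add: ens_w_simps power_mult_distrib)
    have ker: "ens_ker WP n x = (\<Sum>k\<le>n. a k)"
    proof -
      have "(\<lambda>k. ens_w WP n k * x ^ k) sums (\<Sum>k\<le>n. ens_w WP n k * x ^ k)"
        by (rule sums_finite) (auto simp: not_le ens_w_simps)
      then show ?thesis unfolding ens_ker_def
        by (simp add: sums_iff ens_w_simps a_def power_mult_distrib cong: sum.cong_simp)
    qed
    have le: "(\<Sum>k\<le>n. a k) \<le> exp x ^ n"
      using sum_le_suminf[of a "{..n}"] s a0 by (auto simp: sums_iff)
    have tail: "exp x ^ n - (\<Sum>k\<le>n. a k) \<le> exp x ^ n * \<eta> ^ n"
    proof (cases "x1 = 0")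
      case True
      then have "a k = (if k = 0 then 1 else 0)" for k using x by (auto simp: a_def power_0_left)
      then have "(\<Sum>k\<le>n. a k) = 1" by simp
      moreover have "x = 0" using True x by simp
      ultimately show ?thesis using \<eta> by simp
    next
      case False
      with x1 have x1p: "0 < x1" by simp
      define b where "b k = x1 ^ n * ((real n * (x / x1)) ^ k / fact k)" for k
      have b: "b sums (x1 ^ n * exp (real n * (x / x1)))"
        unfolding b_def using exp_converges[of "real n * (x / x1)"]
        by (intro sums_mult) (simp add: field_simps)
      have b0: "b k \<ge> 0" for k using x x1p by (simp add: b_def)
      have ab: "a k \<le> b k" if "k > n" for k
      proof -
        have "x1 ^ k \<le> x1 ^ n" using that x1 by (intro power_decreasing) auto
        then have "a k * x1 ^ k \<le> a k * x1 ^ n" using a0 by (intro mult_left_mono) auto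
        then show ?thesis using x1p by (simp add: a_def b_def field_simps power_mult_distrib power_divide)
      qed
      have "exp x ^ n - (\<Sum>k\<le>n. a k) = (\<Sum>k. a (k + Suc n))"
        using suminf_split_initial_segment[of a "Suc n"] s by (simp add: sums_iff lessThan_Suc_atMost)
      also have "\<dots> \<le> (\<Sum>k. b (k + Suc n))"
        using s b by (intro suminf_le ab summable_ignore_initial_segment) (auto simp: sums_iff)
      also have "\<dots> \<le> (\<Sum>k. b k)"
        using suminf_split_initial_segment[of b "Suc n"] b b0
        by (simp add: sums_iff sum_nonneg)
      also have "\<dots> = x1 ^ n * exp (real n * (x / x1))" using b by (simp add: sums_iff)
      also have "\<dots> = exp x ^ n * (x1 * exp (x / x1 - x)) ^ n"
        using exp_of_nat_mult[of n "x / x1"] by (simp add: power_mult_distrib exp_diff power_divide)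
      also have "\<dots> \<le> exp x ^ n * \<eta> ^ n"
      proof (intro mult_left_mono power_mono)
        have "x / x1 - x = (x / x1) * (1 - x1)" using x1p by (simp add: field_simps)
        also have "\<dots> \<le> 1 * (1 - x1)" using x x1 x1p by (intro mult_right_mono) auto
        finally show "x1 * exp (x / x1 - x) \<le> \<eta>" unfolding \<eta>_def using x1 by (intro mult_left_mono) auto
      qed (use x1 in auto)
      finally show ?thesis .
    qed
    show ?thesis using le tail unfolding ker by (simp add: algebra_simps)
  qed
  then show ?thesis using True \<eta> by (intro exI[of _ \<eta>]) auto
qed

text \<open>A slightly larger radius s still lies in the domain of convergence, and
  \<open>ens_coeff e n k * r ^ k\<close> is the product of \<open>ens_coeff e n k * s ^ k\<close>
  and \<open>(r / s) ^ k\<close>; it is bounded by the sum of the squares of the two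
  factors.\<close>

lemma ens_coeff_summable:
  assumes "n \<ge> 1" "0 \<le> r" "e = HAF \<Longrightarrow> r < 1"
  shows "summable (\<lambda>k. ens_coeff e n k * r ^ k)"
proof -
  obtain s where s: "r < s" "e = HAF \<Longrightarrow> s < 1"
    using assms(3) dense[of r 1] by (cases "e = HAF") (auto intro: that[of "r+1"])
  have s0: "0 < s" using s assms by simp
  have "s\<^sup>2 < 1" if "e = HAF" using s(2)[OF that] s0 by (simp add: power_less_one_iff)
  then have 1: "summable (\<lambda>k. ens_w e n k * (s\<^sup>2) ^ k)"
    by (intro ens_w_summable) (use assms in auto)
  have 2: "summable (\<lambda>k. ((r / s)\<^sup>2) ^ k)"
    using s s0 assms by (intro summable_geometric) (auto simp: abs_square_less_1)
  show ?thesis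
  proof (rule summable_comparison_test')
    show "summable (\<lambda>k. ens_w e n k * (s\<^sup>2) ^ k + ((r / s)\<^sup>2) ^ k)" by (intro summable_add 1 2)
    fix k
    have "r ^ k = s ^ k * (r / s) ^ k" using s0 by (simp add: power_divide)
    then have "ens_coeff e n k * r ^ k = (ens_coeff e n k * s ^ k) * (r / s) ^ k" by simp
    moreover have "2 * ((ens_coeff e n k * s ^ k) * (r / s) ^ k) \<le> (ens_coeff e n k * s ^ k)\<^sup>2 + ((r / s) ^ k)\<^sup>2"
      using sum_squares_bound[of "ens_coeff e n k * s ^ k" "(r / s) ^ k"] by (simp add: mult_ac)
    moreover have "0 \<le> ens_coeff e n k * r ^ k" using assms by simp
    ultimately have "ens_coeff e n k * r ^ k \<le> (ens_coeff e n k * s ^ k)\<^sup>2 + ((r / s) ^ k)\<^sup>2"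
      by linarith
    then show "norm (ens_coeff e n k * r ^ k) \<le> ens_w e n k * (s\<^sup>2) ^ k + ((r / s)\<^sup>2) ^ k"
      using \<open>0 \<le> ens_coeff e n k * r ^ k\<close>
      by (simp add: ens_w_def power_mult_distrib power_mult[symmetric] mult.commute[of k 2])
  qed
qed

text \<open>A crude bound, strong enough for the total number of zeros: there j is at most about
  sqrt m, and such a factorial is negligible against an exponential in m.\<close>

lemma ens_w_ge_inverse_fact:
  assumes "e \<in> {FAF, HAF}" "n \<ge> 1"
  shows "1 / fact j \<le> ens_w e n j"
proof (cases "e = FAF")
  case True
  then show ?thesis using assms by (simp add: ens_w_simps divide_right_mono)
next
  case False
  then have "e = HAF" using assms by auto
  moreover have "0 < (n + j - 1) choose j" using assms by (intro zero_less_binomial) auto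
  then have "1 \<le> real ((n + j - 1) choose j)" by linarith
  moreover have "1 / fact j \<le> (1 :: real)" by simp
  ultimately have "1 / fact j \<le> real ((n + j - 1) choose j)" by linarith
  then show ?thesis using \<open>e = HAF\<close> by (simp add: ens_w_simps)
qed

section \<open>Correlation of neighbouring values\<close>

fun ens_kappa :: "ensemble \<Rightarrow> real \<Rightarrow> real" where
  "ens_kappa SP t = 1 / (1 + t\<^sup>2)"
| "ens_kappa FAF t = 1"
| "ens_kappa HAF t = 1 / (1 - t\<^sup>2)"
| "ens_kappa WP t = 1"

lemma tendsto_one_plus_over_n_power:
  fixes a :: "nat \<Rightarrow> real"
  assumes "a \<longlonglongrightarrow> l"
  shows "(\<lambda>n. (1 + a n / real n) ^ n) \<longlonglongrightarrow> exp l"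
proof -
  have 0: "(\<lambda>n. a n / real n) \<longlonglongrightarrow> 0"
    by (rule real_tendsto_divide_at_top[OF assms filterlim_real_sequentially])
  have ev: "eventually (\<lambda>n. \<bar>a n / real n\<bar> < 1/2) sequentially"
    using tendstoD[OF 0, of "1/2"] by (simp add: dist_real_def)
  have "(\<lambda>n. real n * ln (1 + a n / real n) - a n) \<longlonglongrightarrow> 0"
  proof (rule Lim_null_comparison)
    show "eventually (\<lambda>n. norm (real n * ln (1 + a n / real n) - a n) \<le> 2 * (a n)\<^sup>2 / real n) sequentially"
      using ev eventually_gt_at_top[of 0]
    proof eventually_elim
      case (elim n)
      have "real n * ln (1 + a n / real n) - a n = real n * (ln (1 + a n / real n) - a n / real n)"
        using elim by (simp add: right_diff_distrib)
      also have "norm \<dots> = real n * \<bar>ln (1 + a n / real n) - a n / real n\<bar>"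
        by (simp add: abs_mult)
      also have "\<dots> \<le> real n * (2 * (a n / real n)\<^sup>2)"
        using elim by (intro mult_left_mono abs_ln_one_plus_x_minus_x_bound) auto
      also have "\<dots> = 2 * (a n)\<^sup>2 / real n" using elim by (simp add: power2_eq_square)
      finally show ?case .
    qed
    show "(\<lambda>n. 2 * (a n)\<^sup>2 / real n) \<longlonglongrightarrow> 0"
    proof (rule real_tendsto_divide_at_top[OF _ filterlim_real_sequentially])
      show "(\<lambda>n. 2 * (a n)\<^sup>2) \<longlonglongrightarrow> 2 * l\<^sup>2" by (intro tendsto_intros assms)
    qed
  qed
  from tendsto_add[OF this assms] have "(\<lambda>n. exp (real n * ln (1 + a n / real n))) \<longlonglongrightarrow> exp l"
    by (intro tendsto_exp) simp
  moreover have "eventually (\<lambda>n. exp (real n * ln (1 + a n / real n)) = (1 + a n / real n) ^ n) sequentially"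
    using ev
  proof eventually_elim
    case (elim n)
    then have "0 < 1 + a n / real n" unfolding abs_less_iff by linarith
    then show ?case by (simp only: exp_of_nat_mult exp_ln)
  qed
  ultimately show ?thesis by (rule Lim_transform_eventually)
qed

text \<open>Lets pure powers replace the kernels in a correlation. The bounds of
  \<open>ens_ker_bounds\<close> are uniform in x, so the argument may move with n.\<close>

lemma ens_ker_over_g_tendsto:
  assumes x: "x \<longlonglongrightarrow> l" and l: "0 < l" and J: "e \<in> {HAF, WP} \<Longrightarrow> l < 1"
  shows "(\<lambda>n. ens_ker e n (x n) / ens_g e (x n) ^ n) \<longlonglongrightarrow> 1"
proof -
  obtain x1 where x1: "l < x1" "e \<in> {HAF, WP} \<Longrightarrow> x1 < 1"
    using J dense[of l 1] by (cases "e \<in> {HAF, WP}") (auto intro: that[of "l+1"])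
  obtain \<eta> where \<eta>: "0 \<le> \<eta>" "\<eta> < 1" and
    b: "\<And>n x. n \<ge> 1 \<Longrightarrow> 0 \<le> x \<Longrightarrow> x \<le> x1 \<Longrightarrow>
     ens_g e x ^ n * (1 - \<eta> ^ n) \<le> ens_ker e n x \<and> ens_ker e n x \<le> ens_g e x ^ n"
    using ens_ker_bounds[of x1 e] x1 l by (metis less_eq_real_def less_trans)
  have ev: "eventually (\<lambda>n. 0 < x n) sequentially" "eventually (\<lambda>n. x n < x1) sequentially"
    using order_tendstoD[OF x] l x1 by auto
  show ?thesis
  proof (rule tendsto_sandwich)
    show "eventually (\<lambda>n. 1 - \<eta> ^ n \<le> ens_ker e n (x n) / ens_g e (x n) ^ n) sequentially"
      using ev eventually_ge_at_top[of 1]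
    proof eventually_elim
      case (elim n)
      have "0 < ens_g e (x n)" using elim x1 by (cases e) auto
      then show ?case using b[of n "x n"] elim by (simp add: field_simps)
    qed
    show "eventually (\<lambda>n. ens_ker e n (x n) / ens_g e (x n) ^ n \<le> 1) sequentially"
      using ev eventually_ge_at_top[of 1]
    proof eventually_elim
      case (elim n)
      have "0 < ens_g e (x n)" using elim x1 by (cases e) auto
      then show ?case using b[of n "x n"] elim by (simp add: field_simps)
    qed
    show "(\<lambda>n. 1 - \<eta> ^ n) \<longlonglongrightarrow> 1"
      using tendsto_diff[OF tendsto_const LIMSEQ_realpow_zero[OF \<eta>], of 1] by simp
  qed auto
qed

text \<open>The squared correlation of the values at t and s is essentially an n-th power whose base
  is \<open>1 - O((s - t)^2)\<close>. This rests on
  \<open>(1 + t^2) * (1 + s^2) - (1 + t * s)^2 = (s - t)^2\<close> for SP and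
  \<open>(1 - t * s)^2 - (1 - t^2) * (1 - s^2) = (s - t)^2\<close> for HAF; for \<open>exp\<close>
  the base equals \<open>exp (- (s - t)^2)\<close>.\<close>

lemma ens_g_ratio_tendsto:
  fixes t \<delta> :: real
  assumes t: "t \<in> ens_J e"
  defines "s \<equiv> \<lambda>n. t + \<delta> / sqrt (real n)"
  shows "(\<lambda>n. ((ens_g e (t * s n))\<^sup>2 / (ens_g e (t\<^sup>2) * ens_g e ((s n)\<^sup>2))) ^ n) \<longlonglongrightarrow> exp (- (ens_kappa e t * \<delta>)\<^sup>2)"
proof -
  have s: "s \<longlonglongrightarrow> t" unfolding s_def by real_asymp
  have h: "(s n - t)\<^sup>2 = \<delta>\<^sup>2 / n" if "n \<ge> 1" for n
    using that by (simp add: s_def power_divide)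
  have ex: ?thesis if "\<And>x. ens_g e x = exp x" "ens_kappa e t = 1"
  proof -
    have "(exp (- \<delta>\<^sup>2)) = ((ens_g e (t * s n))\<^sup>2 / (ens_g e (t\<^sup>2) * ens_g e ((s n)\<^sup>2))) ^ n" if n: "n \<ge> 1" for n
    proof -
      have "(ens_g e (t * s n))\<^sup>2 / (ens_g e (t\<^sup>2) * ens_g e ((s n)\<^sup>2)) = exp (2 * (t * s n) - (t\<^sup>2 + (s n)\<^sup>2))"
        by (simp add: \<open>\<And>x. ens_g e x = exp x\<close> exp_diff exp_add exp_double)
      also have "2 * (t * s n) - (t\<^sup>2 + (s n)\<^sup>2) = - (\<delta>\<^sup>2 / n)"
        using h[OF n] by (simp add: power2_eq_square algebra_simps)
      finally show ?thesis using n by (simp add: exp_of_nat_mult[symmetric])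
    qed
    then show ?thesis using that(2)
      by (intro Lim_transform_eventually[OF tendsto_const]) (auto simp: eventually_at_top_linorder)
  qed
  show ?thesis
  proof (cases e)
    case SP
    define a where "a n = - \<delta>\<^sup>2 / ((1 + t\<^sup>2) * (1 + (s n)\<^sup>2))" for n
    have p: "1 + x\<^sup>2 \<noteq> 0" for x :: real by (metis add.commute sum_power2_eq_zero_iff one_neq_zero power_one)
    have "a \<longlonglongrightarrow> - \<delta>\<^sup>2 / ((1 + t\<^sup>2) * (1 + t\<^sup>2))"
      unfolding a_def by (intro tendsto_intros s) (simp add: p)
    from tendsto_one_plus_over_n_power[OF this]
    have "(\<lambda>n. (1 + a n / real n) ^ n) \<longlonglongrightarrow> exp (- (ens_kappa e t * \<delta>)\<^sup>2)"
      by (simp add: SP power2_eq_square)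
    moreover have "1 + a n / real n = (ens_g e (t * s n))\<^sup>2 / (ens_g e (t\<^sup>2) * ens_g e ((s n)\<^sup>2))" if "n \<ge> 1" for n
    proof -
      have "a n / real n = - (s n - t)\<^sup>2 / ((1 + t\<^sup>2) * (1 + (s n)\<^sup>2))" using h[OF that] by (simp add: a_def)
      then have "1 + a n / real n = (((1 + t\<^sup>2) * (1 + (s n)\<^sup>2)) - (s n - t)\<^sup>2) / ((1 + t\<^sup>2) * (1 + (s n)\<^sup>2))"
        using p[of t] p[of "s n"] by (simp add: diff_divide_distrib)
      also have "((1 + t\<^sup>2) * (1 + (s n)\<^sup>2)) - (s n - t)\<^sup>2 = (1 + t * s n)\<^sup>2"
        by (simp add: power2_eq_square algebra_simps)
      finally show ?thesis unfolding SP by simp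
    qed
    ultimately show ?thesis
      by (elim Lim_transform_eventually) (auto simp: eventually_at_top_linorder intro!: exI[of _ 1])
  next
    case HAF
    define a where "a n = - \<delta>\<^sup>2 / (1 - t * s n)\<^sup>2" for n
    have t1: "t\<^sup>2 < 1" using t HAF by (simp add: abs_square_less_1 abs_less_iff)
    have "a \<longlonglongrightarrow> - \<delta>\<^sup>2 / (1 - t * t)\<^sup>2"
      unfolding a_def by (intro tendsto_intros s) (use t1 in \<open>auto simp: power2_eq_square\<close>)
    from tendsto_one_plus_over_n_power[OF this]
    have "(\<lambda>n. (1 + a n / real n) ^ n) \<longlonglongrightarrow> exp (- (ens_kappa e t * \<delta>)\<^sup>2)"
      by (simp add: HAF power2_eq_square)
    moreover have "eventually (\<lambda>n. 1 + a n / real n = (ens_g e (t * s n))\<^sup>2 / (ens_g e (t\<^sup>2) * ens_g e ((s n)\<^sup>2))) sequentially"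
    proof -
      have "(\<lambda>n. (s n)\<^sup>2) \<longlonglongrightarrow> t\<^sup>2" "(\<lambda>n. t * s n) \<longlonglongrightarrow> t * t" by (intro tendsto_intros s)+
      then have "eventually (\<lambda>n. (s n)\<^sup>2 < 1) sequentially" "eventually (\<lambda>n. t * s n < 1) sequentially"
        using t1 by (auto intro: order_tendstoD simp: power2_eq_square)
      then show ?thesis using eventually_ge_at_top[of 1]
      proof eventually_elim
        case (elim n)
        have "a n / real n = - (s n - t)\<^sup>2 / (1 - t * s n)\<^sup>2" using h[OF elim(3)] by (simp add: a_def)
        then show ?case using elim t1 unfolding HAF
          by (simp add: divide_simps) (simp add: power2_eq_square algebra_simps)
      qed
    qed
    ultimately show ?thesis
      by (elim Lim_transform_eventually) (auto elim: eventually_mono)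
  qed (use ex in auto)
qed

text \<open>The square root of the preceding limit, up to quotients of kernels and powers that tend
  to 1. As t is nonzero, \<open>t * s n\<close> is eventually positive, where these quotients are
  controlled.\<close>

lemma ens_corr_tendsto:
  fixes t \<delta> :: real
  assumes t: "t \<in> ens_J e" "t \<noteq> 0"
  defines "s \<equiv> \<lambda>n. t + \<delta> / sqrt (real n)"
  shows "(\<lambda>n. ens_ker e n (t * s n) / sqrt (ens_ker e n (t\<^sup>2) * ens_ker e n ((s n)\<^sup>2))) \<longlonglongrightarrow> exp (- (ens_kappa e t * \<delta>)\<^sup>2 / 2)"
proof -
  have s: "s \<longlonglongrightarrow> t" unfolding s_def by real_asymp
  have t1: "t\<^sup>2 < 1" if "e \<in> {HAF, WP}" using t that by (auto simp: abs_square_less_1 abs_less_iff)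
  have l1: "(\<lambda>n. t\<^sup>2) \<longlonglongrightarrow> t\<^sup>2" and l2: "(\<lambda>n. (s n)\<^sup>2) \<longlonglongrightarrow> t\<^sup>2" and l3: "(\<lambda>n. t * s n) \<longlonglongrightarrow> t\<^sup>2"
    by (auto simp: power2_eq_square intro!: tendsto_intros s)
  have t0: "0 < t\<^sup>2" using t by simp
  note u = ens_ker_over_g_tendsto[OF l1 t0 t1] ens_ker_over_g_tendsto[OF l2 t0 t1] ens_ker_over_g_tendsto[OF l3 t0 t1]
  let ?u = "\<lambda>n x. ens_ker e n x / ens_g e x ^ n"
  let ?Q = "\<lambda>n. ((ens_g e (t * s n))\<^sup>2 / (ens_g e (t\<^sup>2) * ens_g e ((s n)\<^sup>2))) ^ n"
  have Q: "?Q \<longlonglongrightarrow> exp (- (ens_kappa e t * \<delta>)\<^sup>2)" unfolding s_def by (rule ens_g_ratio_tendsto[OF t(1)])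
  have "(\<lambda>n. sqrt (?Q n) * (?u n (t * s n) / sqrt (?u n (t\<^sup>2) * ?u n ((s n)\<^sup>2)))) \<longlonglongrightarrow>
      sqrt (exp (- (ens_kappa e t * \<delta>)\<^sup>2)) * (1 / sqrt (1 * 1))"
    by (intro tendsto_intros u Q) auto
  moreover have "sqrt (exp (- (ens_kappa e t * \<delta>)\<^sup>2)) = exp (- (ens_kappa e t * \<delta>)\<^sup>2 / 2)"
    by (simp add: real_sqrt_unique power2_eq_square exp_add[symmetric])
  moreover have "eventually (\<lambda>n. sqrt (?Q n) * (?u n (t * s n) / sqrt (?u n (t\<^sup>2) * ?u n ((s n)\<^sup>2)))
      = ens_ker e n (t * s n) / sqrt (ens_ker e n (t\<^sup>2) * ens_ker e n ((s n)\<^sup>2))) sequentially"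
  proof -
    have "eventually (\<lambda>n. 0 < t * s n) sequentially" using order_tendstoD(1)[OF l3 t0] .
    moreover have "eventually (\<lambda>n. e = HAF \<longrightarrow> t * s n < 1) sequentially"
      using order_tendstoD(2)[OF l3, of 1] t1 by (cases "e = HAF") auto
    moreover have "eventually (\<lambda>n. e = HAF \<longrightarrow> (s n)\<^sup>2 < 1) sequentially"
      using order_tendstoD(2)[OF l2, of 1] t1 by (cases "e = HAF") auto
    ultimately show ?thesis
    proof eventually_elim
      case (elim n)
      have pos: "0 < ens_g e (t * s n)" "0 < ens_g e (t\<^sup>2)" "0 < ens_g e ((s n)\<^sup>2)"
        using elim t1 by (cases e; auto intro: add_pos_nonneg)+
      have "?Q n = (ens_g e (t * s n) ^ n)\<^sup>2 / (ens_g e (t\<^sup>2) ^ n * ens_g e ((s n)\<^sup>2) ^ n)"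
        by (simp add: power_divide power_mult_distrib power_mult[symmetric] mult.commute)
      then have "sqrt (?Q n) = ens_g e (t * s n) ^ n / sqrt (ens_g e (t\<^sup>2) ^ n * ens_g e ((s n)\<^sup>2) ^ n)"
        using pos by (simp add: real_sqrt_divide)
      then show ?case using pos
        by (simp add: real_sqrt_divide real_sqrt_mult)
    qed
  qed
  ultimately show ?thesis by (auto elim: Lim_transform_eventually)
qed

text \<open>Half of the derivative of \<open>ln (ens_g e (t^2))\<close> with respect to t, hence the
  linear rate per unit of n at which the logarithm of the typical size of \<open>P n\<close> changes
  near t.\<close>

fun ens_drift :: "ensemble \<Rightarrow> real \<Rightarrow> real" where
  "ens_drift SP t = t / (1 + t\<^sup>2)"
| "ens_drift FAF t = t"
| "ens_drift HAF t = t / (1 - t\<^sup>2)"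
| "ens_drift WP t = t"

lemma inverse_one_minus_le_exp:
  assumes "\<bar>u\<bar> \<le> 1/2"
  shows "1 / (1 - u) \<le> exp (u + 2 * u\<^sup>2 :: real)"
proof -
  have "\<bar>ln (1 + (-u)) - (-u)\<bar> \<le> 2 * (-u)\<^sup>2"
    by (rule abs_ln_one_plus_x_minus_x_bound) (use assms in auto)
  then have "ln (1 / (1 - u)) \<le> u + 2 * u\<^sup>2" using assms by (simp add: ln_div abs_le_iff)
  then show ?thesis using assms by (subst ln_le_cancel_iff[symmetric]) auto
qed

text \<open>On the circle, \<open>|z|^2 - t^2 = 2 * t * (Re z - t) + 1 / n\<close>. The first term
  has order \<open>1 / sqrt n\<close> and its effect would grow like \<open>exp (c * sqrt n)\<close>
  in the n-th power; the exponential factor cancels it exactly, so that only O(1/n) remains.\<close>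

lemma ens_g_local_growth:
  assumes b: "0 < b" "e \<in> {HAF, WP} \<Longrightarrow> b < 1"
  shows "\<exists>C. eventually (\<lambda>n. \<forall>t z. \<bar>t\<bar> \<le> b \<longrightarrow> norm (z - complex_of_real t) = 1 / sqrt (real n) \<longrightarrow>
     (e \<in> {HAF, WP} \<longrightarrow> norm z < 1) \<and>
     ens_g e ((norm z)\<^sup>2) * exp (- 2 * ens_drift e t * (Re z - t)) \<le> exp (C / real n) * ens_g e (t\<^sup>2)) sequentially"
proof -
  define q where "q = 1 - b\<^sup>2"
  have ev1: "eventually (\<lambda>n. b + 1 / sqrt (real n) < (if b < 1 then 1 else b + 1)) sequentially"
    using b by (auto intro!: order_tendstoD(2)[of "\<lambda>n. b + 1 / sqrt (real n)" b]) real_asymp+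
  have ev2: "eventually (\<lambda>n. b < 1 \<longrightarrow> (2 * b + 1) / sqrt (real n) < q / 2) sequentially"
  proof (cases "b < 1")
    case True
    then have "0 < q / 2" using b by (simp add: q_def power_less_one_iff)
    moreover have "(\<lambda>n. (2 * b + 1) / sqrt (real n)) \<longlonglongrightarrow> 0" by real_asymp
    ultimately have "eventually (\<lambda>n. (2 * b + 1) / sqrt (real n) < q / 2) sequentially"
      by (intro order_tendstoD(2))
    then show ?thesis by eventually_elim simp
  qed auto
  \<comment> \<open>For HAF, \<open>1 / q\<close> comes from the term \<open>1 / n\<close> divided
    by \<open>1 - t^2\<close>. The other summand bounds the second-order term in
    \<open>1 / (1 - u) \<le> exp (u + 2 * u^2)\<close>, where |u| is at most
    \<open>(2 * b + 1) / q / sqrt n\<close>. In the other cases \<open>1 + v \<le> exp v\<close> or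
    exactness makes 1 sufficient.\<close>
  define C where "C = (if e = HAF then 1 / q + 2 * ((2 * b + 1) / q)\<^sup>2 else 1)"
  show ?thesis
  proof (rule exI[of _ C], use ev1 ev2 eventually_ge_at_top[of 1] in eventually_elim, intro allI impI)
    fix n t z
    assume n1: "b + 1 / sqrt (real n) < (if b < 1 then 1 else b + 1)" and n2: "b < 1 \<longrightarrow> (2 * b + 1) / sqrt (real n) < q / 2"
      and n: "1 \<le> n" and t: "\<bar>t\<bar> \<le> b" and z: "norm (z - complex_of_real t) = 1 / sqrt (real n)"
    have "norm z \<le> norm (complex_of_real t) + norm (z - complex_of_real t)"
      using norm_triangle_ineq[of "complex_of_real t" "z - complex_of_real t"] by simp
    then have 1: "e \<in> {HAF, WP} \<longrightarrow> norm z < 1" using z t n1 b by auto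
    define y where "y = (norm z)\<^sup>2 - t\<^sup>2"
    have z2: "(norm (z - complex_of_real t))\<^sup>2 = 1 / real n" using n by (simp add: z power_divide)
    have y: "y = 2 * t * (Re z - t) + 1 / real n"
      unfolding y_def z2[symmetric] cmod_power2 by (simp add: power2_eq_square algebra_simps)
    have nz: "(norm z)\<^sup>2 = t\<^sup>2 + y" by (simp add: y_def)
    have ex: "ens_g e ((norm z)\<^sup>2) * exp (- 2 * ens_drift e t * (Re z - t)) \<le> exp (C / real n) * ens_g e (t\<^sup>2)"
      if "\<And>x. ens_g e x = exp x" "ens_drift e t = t" "C = 1"
      unfolding that nz y by (simp add: exp_add[symmetric] algebra_simps)
    have "ens_g e ((norm z)\<^sup>2) * exp (- 2 * ens_drift e t * (Re z - t)) \<le> exp (C / real n) * ens_g e (t\<^sup>2)"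
    proof (cases e)
      case SP
      have p: "0 < 1 + t\<^sup>2" by (simp add: add_pos_nonneg)
      have "1 + (norm z)\<^sup>2 = (1 + t\<^sup>2) * (1 + y / (1 + t\<^sup>2))" using p by (simp add: nz field_simps)
      also have "\<dots> \<le> (1 + t\<^sup>2) * exp (y / (1 + t\<^sup>2))" using p by (intro mult_left_mono exp_ge_add_one_self) auto
      finally have "(1 + (norm z)\<^sup>2) * exp (- 2 * ens_drift e t * (Re z - t)) \<le> (1 + t\<^sup>2) * exp (y / (1 + t\<^sup>2)) * exp (- 2 * ens_drift e t * (Re z - t))"
        by (rule mult_right_mono) simp
      also have "\<dots> = (1 + t\<^sup>2) * exp (y / (1 + t\<^sup>2) - 2 * (t / (1 + t\<^sup>2)) * (Re z - t))" using SP by (simp add: exp_diff exp_minus field_simps)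
      also have "y / (1 + t\<^sup>2) - 2 * (t / (1 + t\<^sup>2)) * (Re z - t) = (1 / real n) / (1 + t\<^sup>2)"
        unfolding y using p by (simp add: add_divide_distrib)
      also have "(1 + t\<^sup>2) * exp ((1 / real n) / (1 + t\<^sup>2)) \<le> (1 + t\<^sup>2) * exp (1 / real n)"
      proof (intro mult_left_mono)
        have "(1 / real n) / (1 + t\<^sup>2) \<le> (1 / real n) / 1" using p by (intro divide_left_mono) auto
        then show "exp ((1 / real n) / (1 + t\<^sup>2)) \<le> exp (1 / real n)" by simp
      qed (use p in auto)
      finally show ?thesis using SP by (simp add: C_def mult.commute)
    next
      case HAF
      have b1: "b < 1" using b HAF by auto
      have q0: "0 < q" using b b1 by (simp add: q_def power_less_one_iff)
      have tb: "t\<^sup>2 \<le> b\<^sup>2" using t by (metis abs_le_square_iff abs_of_pos b(1))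
      then have p: "q \<le> 1 - t\<^sup>2" "0 < 1 - t\<^sup>2" using q0 by (auto simp: q_def)
      have "\<bar>Re z - t\<bar> \<le> 1 / sqrt (real n)" using abs_Re_le_cmod[of "z - of_real t"] z by simp
      then have "\<bar>2 * t * (Re z - t)\<bar> \<le> 2 * b * (1 / sqrt (real n))"
        unfolding abs_mult using t b by (intro mult_mono) auto
      moreover have "1 / real n \<le> 1 / sqrt (real n)"
        using n by (intro divide_left_mono) (auto intro!: real_le_lsqrt simp: self_le_power)
      ultimately have yb: "\<bar>y\<bar> \<le> (2 * b + 1) / sqrt (real n)"
      proof -
        assume A: "\<bar>2 * t * (Re z - t)\<bar> \<le> 2 * b * (1 / sqrt (real n))" "1 / real n \<le> 1 / sqrt (real n)"
        have "\<bar>y\<bar> \<le> \<bar>2 * t * (Re z - t)\<bar> + \<bar>1 / real n\<bar>" unfolding y by (rule abs_triangle_ineq)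
        then show ?thesis using A by (simp add: add_divide_distrib)
      qed
      define u where "u = y / (1 - t\<^sup>2)"
      have "\<bar>u\<bar> = \<bar>y\<bar> / (1 - t\<^sup>2)" using p by (simp add: u_def abs_divide)
      also have "\<dots> \<le> ((2 * b + 1) / sqrt (real n)) / q" using p q0 yb by (intro frac_le) auto
      finally have u0: "\<bar>u\<bar> \<le> ((2 * b + 1) / sqrt (real n)) / q" .
      then have u: "\<bar>u\<bar> \<le> ((2 * b + 1) / q) / sqrt (real n)" by (simp add: mult.commute)
      have "((2 * b + 1) / sqrt (real n)) / q \<le> (q / 2) / q" using n2 b1 q0 by (intro divide_right_mono) auto
      from order_trans[OF u0 this] have u2: "\<bar>u\<bar> \<le> 1/2" using q0 by simp
      have "u\<^sup>2 \<le> (((2 * b + 1) / q) / sqrt (real n))\<^sup>2" using power_mono[OF u, of 2] by (simp only: power2_abs)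
      then have uu: "u\<^sup>2 \<le> ((2 * b + 1) / q)\<^sup>2 / real n" by (simp add: power_divide power_mult_distrib)
      have "1 - (norm z)\<^sup>2 = (1 - t\<^sup>2) * (1 - u)" using p by (simp add: nz u_def field_simps)
      then have "ens_g e ((norm z)\<^sup>2) = ens_g e (t\<^sup>2) * (1 / (1 - u))" using HAF by simp
      also have "\<dots> \<le> ens_g e (t\<^sup>2) * exp (u + 2 * u\<^sup>2)"
        using HAF p by (intro mult_left_mono inverse_one_minus_le_exp u2) auto
      finally have "ens_g e ((norm z)\<^sup>2) * exp (- 2 * ens_drift e t * (Re z - t))
          \<le> ens_g e (t\<^sup>2) * exp (u + 2 * u\<^sup>2) * exp (- 2 * ens_drift e t * (Re z - t))"
        by (rule mult_right_mono) simp
      also have "\<dots> = ens_g e (t\<^sup>2) * exp (u + 2 * u\<^sup>2 - 2 * (t / (1 - t\<^sup>2)) * (Re z - t))" using HAF by (simp add: exp_diff exp_minus field_simps)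
      also have "u + 2 * u\<^sup>2 - 2 * (t / (1 - t\<^sup>2)) * (Re z - t) = (1 / real n) / (1 - t\<^sup>2) + 2 * u\<^sup>2"
        unfolding u_def y using p by (simp add: add_divide_distrib)
      also have "ens_g e (t\<^sup>2) * exp ((1 / real n) / (1 - t\<^sup>2) + 2 * u\<^sup>2) \<le> ens_g e (t\<^sup>2) * exp (C / real n)"
      proof -
        have "(1 / real n) / (1 - t\<^sup>2) \<le> (1 / real n) / q" using p q0 by (intro divide_left_mono) auto
        then have "(1 / real n) / (1 - t\<^sup>2) + 2 * u\<^sup>2 \<le> (1 / real n) / q + 2 * (((2 * b + 1) / q)\<^sup>2 / real n)"
          using uu by linarith
        also have "\<dots> = C / real n" using HAF by (simp add: C_def add_divide_distrib[of "1 / q"] mult.commute)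
        finally have "(1 / real n) / (1 - t\<^sup>2) + 2 * u\<^sup>2 \<le> C / real n" .
        then show ?thesis using HAF p by (intro mult_left_mono) auto
      qed
      finally show ?thesis by (simp add: mult.commute)
    qed (use ex C_def in auto)
    with 1 show "(e \<in> {HAF, WP} \<longrightarrow> norm z < 1) \<and>
     ens_g e ((norm z)\<^sup>2) * exp (- 2 * ens_drift e t * (Re z - t)) \<le> exp (C / real n) * ens_g e (t\<^sup>2)" ..
  qed
qed

text \<open>The n-th power of the previous bound: the error \<open>exp (C / n)\<close> becomes the
  constant \<open>exp C\<close>, and a factor 2 pays for replacing the power of \<open>ens_g\<close>
  at \<open>t^2\<close> by the kernel.\<close>

lemma ens_ker_local_growth:
  assumes b: "0 < b" "e \<in> {HAF, WP} \<Longrightarrow> b < 1"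
  shows "\<exists>C. eventually (\<lambda>n. \<forall>t z. \<bar>t\<bar> \<le> b \<longrightarrow> norm (z - complex_of_real t) = 1 / sqrt (real n) \<longrightarrow>
     (e = HAF \<longrightarrow> norm z < 1) \<and>
     ens_ker e n ((norm z)\<^sup>2) * exp (- 2 * real n * ens_drift e t * (Re z - t)) \<le> C * ens_ker e n (t\<^sup>2)) sequentially"
proof -
  obtain C where C: "eventually (\<lambda>n. \<forall>t z. \<bar>t\<bar> \<le> b \<longrightarrow> norm (z - complex_of_real t) = 1 / sqrt (real n) \<longrightarrow>
     (e \<in> {HAF, WP} \<longrightarrow> norm z < 1) \<and>
     ens_g e ((norm z)\<^sup>2) * exp (- 2 * ens_drift e t * (Re z - t)) \<le> exp (C / real n) * ens_g e (t\<^sup>2)) sequentially"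
    using ens_g_local_growth[OF b] by blast
  have b2: "b\<^sup>2 < 1" if "e \<in> {HAF, WP}" using b that by (simp add: power_less_one_iff)
  obtain \<eta> where \<eta>: "0 \<le> \<eta>" "\<eta> < 1" and
    lo: "\<And>n x. n \<ge> 1 \<Longrightarrow> 0 \<le> x \<Longrightarrow> x \<le> b\<^sup>2 \<Longrightarrow> ens_g e x ^ n * (1 - \<eta> ^ n) \<le> ens_ker e n x"
    using ens_ker_bounds[of "b\<^sup>2" e] b2 by (metis zero_le_power2)
  have sm: "eventually (\<lambda>n. \<eta> ^ n < 1/2) sequentially"
    by (rule order_tendstoD(2)[OF LIMSEQ_realpow_zero[OF \<eta>]]) simp
  show ?thesis
  proof (rule exI[of _ "2 * exp C"], use C sm eventually_ge_at_top[of 1] in eventually_elim, intro allI impI)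
    fix n t z
    assume 1: "\<forall>t z. \<bar>t\<bar> \<le> b \<longrightarrow> norm (z - complex_of_real t) = 1 / sqrt (real n) \<longrightarrow>
     (e \<in> {HAF, WP} \<longrightarrow> norm z < 1) \<and>
     ens_g e ((norm z)\<^sup>2) * exp (- 2 * ens_drift e t * (Re z - t)) \<le> exp (C / real n) * ens_g e (t\<^sup>2)"
      and n: "1 \<le> n" and small: "\<eta> ^ n < 1/2"
      and t: "\<bar>t\<bar> \<le> b" and z: "norm (z - complex_of_real t) = 1 / sqrt (real n)"
    let ?x = "(norm z)\<^sup>2"
    have z1: "e \<in> {HAF, WP} \<longrightarrow> norm z < 1" and
      g: "ens_g e ?x * exp (- 2 * ens_drift e t * (Re z - t)) \<le> exp (C / real n) * ens_g e (t\<^sup>2)"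
      using 1 t z by blast+
    have x1: "?x < 1" if "e \<in> {HAF, WP}"
    proof -
      have "norm z < 1" using z1 that by blast
      then show ?thesis by (simp add: abs_square_less_1)
    qed
    have tb: "t\<^sup>2 \<le> b\<^sup>2" using t by (metis abs_le_square_iff abs_of_pos b(1))
    obtain \<eta>' where \<eta>': "ens_ker e n ?x \<le> ens_g e ?x ^ n"
      using ens_ker_bounds[of ?x e] x1 n by (metis order_refl zero_le_power2)
    have gp: "0 \<le> ens_g e ?x" "0 \<le> ens_g e (t\<^sup>2)"
      using x1 tb b2 by (cases e; auto)+
    have eexp: "exp (- 2 * real n * ens_drift e t * (Re z - t)) = exp (- 2 * ens_drift e t * (Re z - t)) ^ n"
      by (simp add: exp_of_nat_mult[symmetric] mult_ac)
    have "ens_ker e n ?x * exp (- 2 * real n * ens_drift e t * (Re z - t))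
        \<le> ens_g e ?x ^ n * exp (- 2 * real n * ens_drift e t * (Re z - t))"
      by (intro mult_right_mono \<eta>') simp
    also note eexp
    also have "ens_g e ?x ^ n * exp (- 2 * ens_drift e t * (Re z - t)) ^ n \<le> (exp (C / real n) * ens_g e (t\<^sup>2)) ^ n"
      unfolding power_mult_distrib[symmetric] by (intro power_mono g) (use gp in simp)
    also have "\<dots> = exp C * ens_g e (t\<^sup>2) ^ n" using n by (simp add: power_mult_distrib exp_of_nat_mult[symmetric])
    also have "\<dots> \<le> exp C * (2 * ens_ker e n (t\<^sup>2))"
    proof (intro mult_left_mono)
      have "ens_g e (t\<^sup>2) ^ n * (1/2) \<le> ens_g e (t\<^sup>2) ^ n * (1 - \<eta> ^ n)"
        using gp small by (intro mult_left_mono) auto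
      also have "\<dots> \<le> ens_ker e n (t\<^sup>2)" using lo[OF n _ tb] by simp
      finally show "ens_g e (t\<^sup>2) ^ n \<le> 2 * ens_ker e n (t\<^sup>2)" by simp
    qed simp
    finally have "ens_ker e n ?x * exp (- 2 * real n * ens_drift e t * (Re z - t)) \<le> 2 * exp C * ens_ker e n (t\<^sup>2)"
      unfolding eexp by simp
    with z1 show "(e = HAF \<longrightarrow> norm z < 1) \<and>
      ens_ker e n ?x * exp (- 2 * real n * ens_drift e t * (Re z - t)) \<le> 2 * exp C * ens_ker e n (t\<^sup>2)" by simp
  qed
qed

text \<open>The share of the k-th coefficient in the variance of \<open>P n t\<close> when
  \<open>x = t^2\<close>. As a distribution in k it is binomial for SP, Poisson for FAF, negative
  binomial for HAF and a truncated Poisson distribution for WP.\<close>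

definition ens_prob :: "ensemble \<Rightarrow> nat \<Rightarrow> real \<Rightarrow> nat \<Rightarrow> real" where
  "ens_prob e n x k = ens_w e n k * x ^ k / ens_ker e n x"

lemma ens_prob_sums:
  assumes "n \<ge> 1" "0 \<le> x" "e = HAF \<Longrightarrow> x < 1"
  shows "ens_prob e n x sums 1"
proof -
  have "(\<lambda>k. ens_w e n k * x ^ k) sums ens_ker e n x" "1 \<le> ens_ker e n x"
    using assms by (auto intro: ens_ker_sums ens_ker_ge_1)
  then show ?thesis
    using sums_divide[where c = "ens_ker e n x"] unfolding ens_prob_def[abs_def] by fastforce
qed

lemma ens_prob_nonneg:
  assumes "n \<ge> 1" "0 \<le> x" "e = HAF \<Longrightarrow> x < 1"
  shows "0 \<le> ens_prob e n x k"
proof -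
  have "1 \<le> ens_ker e n x" by (intro ens_ker_ge_1; use assms in simp)
  then show ?thesis using assms by (simp add: ens_prob_def)
qed

lemma sum_ens_prob_le_1:
  assumes "n \<ge> 1" "0 \<le> x" "e = HAF \<Longrightarrow> x < 1" "finite K"
  shows "sum (ens_prob e n x) K \<le> 1"
proof -
  have s: "ens_prob e n x sums 1" by (rule ens_prob_sums) (use assms in auto)
  have p: "0 \<le> ens_prob e n x k" for k by (rule ens_prob_nonneg) (use assms in auto)
  show ?thesis using sum_le_suminf[of "ens_prob e n x" K] s p assms(4) by (auto simp: sums_iff)
qed

lemma summable_attains_max:
  fixes p :: "nat \<Rightarrow> real"
  assumes "summable p" "\<And>k. 0 \<le> p k" "0 < p j"
  shows "\<exists>k0. \<forall>k. p k \<le> p k0"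
proof -
  have "eventually (\<lambda>k. p k < p j) sequentially"
    using summable_LIMSEQ_zero[OF assms(1)] assms(3) by (rule order_tendstoD(2))
  then obtain N where N: "\<And>k. k \<ge> N \<Longrightarrow> p k < p j" by (auto simp: eventually_at_top_linorder)
  have jN: "j \<le> N" using N[of j] by (cases "j \<le> N") auto
  define m where "m = Max (p ` {..N})"
  have "m \<in> p ` {..N}" unfolding m_def by (rule Max_in) auto
  then obtain k0 where k0: "p k0 = m" by auto
  have "p k \<le> m" for k
  proof (cases "k \<le> N")
    case True
    then show ?thesis unfolding m_def by (intro Max_ge) auto
  next
    case False
    then have "p k \<le> p j" using N[of k] by simp
    also have "p j \<le> m" using jN unfolding m_def by (intro Max_ge) auto
    finally show ?thesis .
  qed
  then show ?thesis using k0 by auto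
qed

text \<open>To the right of its maximum the sequence decreases, but slowly enough that at
  least \<open>L\<close> of its values lie within a factor 2 of any level that it crosses.\<close>

lemma slowly_decreasing_block:
  fixes p :: "nat \<Rightarrow> real"
  assumes p0: "\<And>k. 0 \<le> p k"
    and dec: "\<And>j. j < J + L \<Longrightarrow> p (m + Suc j) \<le> p (m + j)"
    and slow: "\<And>j. j < J + L \<Longrightarrow> (1 - 1 / (2 * real L)) * p (m + j) \<le> p (m + Suc j)"
    and y: "y < p m" "p (m + J) \<le> y" and L: "0 < L"
  shows "\<exists>K. finite K \<and> card K = L \<and> (\<forall>k\<in>K. y / 2 \<le> p k \<and> p k \<le> y)"
proof -
  \<comment> \<open>The block starts at the first index where the level is reached, so that its
    predecessor still exceeds y.\<close>
  define i where "i = (LEAST j. p (m + j) \<le> y)"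
  have i: "p (m + i) \<le> y" "i \<le> J" unfolding i_def using y by (auto intro: LeastI Least_le)
  have "i \<noteq> 0" using i(1) y(1) by (intro notI) simp
  then obtain i' where i': "i = Suc i'" by (cases i) auto
  have yi: "y < p (m + i')"
    using not_less_Least[of i' "\<lambda>j. p (m + j) \<le> y"] i' by (auto simp: i_def[symmetric] not_le)
  let ?q = "1 - 1 / (2 * real L)"
  have q: "0 \<le> ?q" using L by (simp add: field_simps)
  have low: "?q ^ l * p (m + i') \<le> p (m + (i' + l))" if "l \<le> L" for l
    using that
  proof (induction l)
    case (Suc l)
    have "?q ^ Suc l * p (m + i') = ?q * (?q ^ l * p (m + i'))" by simp
    also have "\<dots> \<le> ?q * p (m + (i' + l))" using Suc q by (intro mult_left_mono) auto
    also have "\<dots> \<le> p (m + Suc (i' + l))" using slow[of "i' + l"] Suc.prems i(2) i' by simp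
    finally show ?case by simp
  qed simp
  have up: "p (m + (i + l)) \<le> y" if "l < L" for l
    using that
  proof (induction l)
    case (Suc l)
    then show ?case using dec[of "i + l"] i(2) by simp
  qed (use i in simp)
  \<comment> \<open>By Bernoulli's inequality L steps with ratio at least
    \<open>1 - 1 / (2 * L)\<close> lose at most a factor 2.\<close>
  have half: "1 / 2 \<le> ?q ^ l" if "l \<le> L" for l
  proof -
    have "1 + real l * (- 1 / (2 * real L)) \<le> (1 + (- 1 / (2 * real L))) ^ l"
      by (rule Bernoulli_inequality) (use L in \<open>simp add: field_simps\<close>)
    moreover have "real l * (1 / (2 * real L)) \<le> 1 / 2" using that L by (simp add: field_simps)
    ultimately show ?thesis by simp
  qed
  have pin: "0 \<le> p (m + i')" by (rule p0)
  show ?thesis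
  proof (intro exI[of _ "(\<lambda>l. m + (i + l)) ` {..<L}"] conjI ballI)
    show "card ((\<lambda>l. m + (i + l)) ` {..<L}) = L" by (subst card_image) (auto simp: inj_on_def)
    fix k assume "k \<in> (\<lambda>l. m + (i + l)) ` {..<L}"
    then obtain l where l: "l < L" "k = m + (i + l)" by auto
    show "p k \<le> y" using up[OF l(1)] l(2) by simp
    have "y / 2 \<le> (1 / 2) * p (m + i')" using yi by simp
    also have "\<dots> \<le> ?q ^ Suc l * p (m + i')" using half[of "Suc l"] l pin by (intro mult_right_mono) auto
    also have "\<dots> \<le> p k" using low[of "Suc l"] l i' by simp
    finally show "y / 2 \<le> p k" .
  qed simp
qed

lemma ens_prob_Suc:
  assumes "n \<ge> 1" "e = WP \<Longrightarrow> k < n"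
  shows "ens_prob e n x (Suc k) * real (Suc k) = (real n + ens_sigma e * real k) * x * ens_prob e n x k"
proof -
  have "ens_prob e n x (Suc k) * real (Suc k) = (ens_w e n (Suc k) * real (Suc k)) * x ^ Suc k / ens_ker e n x"
    by (simp add: ens_prob_def)
  also have "ens_w e n (Suc k) * real (Suc k) = (real n + ens_sigma e * real k) * ens_w e n k"
    by (rule ens_w_Suc) (use assms in auto)
  finally show ?thesis by (simp add: ens_prob_def)
qed

text \<open>The mode \<open>k0\<close> satisfies \<open>k0 (1 - \<sigma> x) = n x + O(1)\<close>, and the ratio of consecutive
  probabilities at \<open>k0 + j\<close> is \<open>1 - (k0 (1 - \<sigma> x) - n x + 1 + j (1 - \<sigma> x)) / (k0 + j + 1)\<close>.\<close>

lemma ens_prob_ratio: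
  fixes x0 x1 :: real
  assumes x01: "0 < x0" "x0 \<le> x1" "e \<in> {HAF, WP} \<Longrightarrow> x1 < 1"
  obtains c C :: real where "0 < c" "0 < C"
    "\<And>n x. n \<ge> 1 \<Longrightarrow> real n * x0 \<ge> 2 \<Longrightarrow> (e = WP \<Longrightarrow> real n * x1 + 1 < real n) \<Longrightarrow> x0 \<le> x \<Longrightarrow> x \<le> x1 \<Longrightarrow>
       \<exists>k0. (\<forall>k. ens_prob e n x k \<le> ens_prob e n x k0) \<and>
         (\<forall>j. j \<le> n \<longrightarrow> (e = WP \<longrightarrow> real n * x1 + 1 + real j < real n) \<longrightarrow>
           (1 - C * (real j + 2) / n) * ens_prob e n x (k0 + j) \<le> ens_prob e n x (k0 + Suc j) \<and>
           ens_prob e n x (k0 + Suc j) \<le> (1 - c * real j / n) * ens_prob e n x (k0 + j))"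
proof -
  define \<sigma> where "\<sigma> = ens_sigma e"
  have s1: "\<sigma> \<le> 1" "-1 \<le> \<sigma>" unfolding \<sigma>_def by (cases e; simp)+
  \<comment> \<open>\<open>l0\<close> and \<open>l1\<close> enclose the factor
    \<open>1 - \<sigma> * x\<close>, which sets the distance of the mode and the speed at which the
    ratios leave 1.\<close>
  define l0 where "l0 = (if e = HAF then 1 - x1 else 1)"
  define l1 where "l1 = 1 + x1"
  have l0: "0 < l0" "l0 \<le> 1" using x01 by (auto simp: l0_def)
  have l1: "1 \<le> l1" using x01 by (auto simp: l1_def)
  have lam: "l0 \<le> 1 - \<sigma> * x" "1 - \<sigma> * x \<le> l1" if "x0 \<le> x" "x \<le> x1" for x
    using that x01 unfolding l0_def l1_def \<sigma>_def by (cases e; simp)+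
  \<comment> \<open>In the notation of \<open>ratio\<close> below, N lies between
    \<open>l0 * j\<close> and \<open>l1 * (j + 2)\<close>, and q between
    \<open>n * x0 / (2 * l1)\<close> and \<open>n * ((2 * x1 + 1) / l0 + 2)\<close>; c and C are the
    resulting bounds for the quotient of N by q.\<close>
  define c where "c = l0 / ((2 * x1 + 1) / l0 + 2)"
  define C where "C = 2 * l1 * l1 / x0"
  have den: "0 < (2 * x1 + 1) / l0 + 2" using x01 l0 by (intro add_pos_pos divide_pos_pos) auto
  have c: "0 < c" unfolding c_def using l0 den by simp
  have C: "0 < C" unfolding C_def using l1 x01 by simp
  show ?thesis
  proof (rule that[OF c C])
    fix n :: nat and x :: real
    assume n: "n \<ge> 1" and nx0: "real n * x0 \<ge> 2" and W: "e = WP \<Longrightarrow> real n * x1 + 1 < real n"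
      and x: "x0 \<le> x" "x \<le> x1"
    define p where "p = ens_prob e n x"
    have xh: "0 \<le> x" "e = HAF \<Longrightarrow> x < 1" using x x01 by auto
    have psum: "p sums 1" unfolding p_def by (rule ens_prob_sums) (use n xh in auto)
    have p0: "0 \<le> p k" for k unfolding p_def by (rule ens_prob_nonneg) (use n xh in auto)
    have rec: "p (Suc k) * real (Suc k) = (real n + \<sigma> * real k) * x * p k" if "e = WP \<Longrightarrow> k < n" for k
      unfolding p_def \<sigma>_def by (rule ens_prob_Suc) (use n that in auto)
    have "\<exists>j. 0 < p j"
    proof (rule ccontr)
      assume "\<not> ?thesis"
      then have "p = (\<lambda>_. 0)" using p0 by (auto simp: fun_eq_iff not_less intro: antisym)
      then show False using psum by (simp add: sums_iff)
    qed
    then obtain j0 where j0: "0 < p j0" ..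
    obtain k0 where k0: "\<And>k. p k \<le> p k0"
      using summable_attains_max[of p j0] psum p0 j0 by (auto simp: sums_iff)
    have pk0: "0 < p k0" using j0 k0[of j0] by simp
    have nonWP: "k0 \<le> n" if "e \<in> {SP, WP}"
    proof (rule ccontr)
      assume "\<not> ?thesis"
      then have "p k0 = 0" using that by (auto simp: p_def ens_prob_def ens_w_simps)
      then show False using pk0 by simp
    qed
    let ?l = "1 - \<sigma> * x"
    note l = lam[OF x]
    have sx: "- \<sigma> * x \<le> x1" "e = WP \<Longrightarrow> - \<sigma> * x = 0" using x x01 unfolding \<sigma>_def by (cases e; simp)+
    \<comment> \<open>Comparison of the maximum with its left neighbour; \<open>lo\<close> compares
      it with its right neighbour. The term \<open>max 0 (- \<sigma> * x)\<close> arises because the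
      recursion is used at \<open>k0 - 1\<close>.\<close>
    have up: "real k0 * ?l \<le> real n * x + max 0 (- \<sigma> * x)"
    proof (cases k0)
      case 0
      then show ?thesis using xh by simp
    next
      case (Suc k)
      have "p k0 * real k0 = (real n + \<sigma> * real k) * x * p k"
        unfolding Suc using nonWP Suc by (intro rec) auto
      also have "\<dots> \<le> (real n + \<sigma> * real k) * x * p k0"
      proof (intro mult_left_mono k0 mult_nonneg_nonneg xh)
        show "0 \<le> real n + \<sigma> * real k"
          using nonWP Suc unfolding \<sigma>_def by (cases e) auto
      qed
      finally have "real k0 \<le> (real n + \<sigma> * real k) * x" using pk0 by (simp add: mult.commute)
      then show ?thesis using Suc by (simp add: algebra_simps)
    qed
    have k0W: "real k0 \<le> real n * x1" if "e = WP"
    proof -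
      have "real n * x \<le> real n * x1" using x by (intro mult_left_mono) auto
      moreover have "\<sigma> = 0" using that by (simp add: \<sigma>_def)
      ultimately show ?thesis using up by simp
    qed
    \<comment> \<open>For WP the mode is at most \<open>n * x1\<close>, so the recursion at
      \<open>k0\<close> stays clear of the truncation.\<close>
    have lo: "real n * x - 1 \<le> real k0 * ?l"
    proof -
      have "(real n + \<sigma> * real k0) * x * p k0 = p (Suc k0) * real (Suc k0)"
        by (intro rec[symmetric]) (use k0W W in force)
      also have "\<dots> \<le> p k0 * real (Suc k0)" by (intro mult_right_mono k0) simp
      finally have "(real n + \<sigma> * real k0) * x \<le> real (Suc k0)" using pk0 by (simp add: mult.commute)
      then show ?thesis by (simp add: algebra_simps)
    qed
    have k0_up: "real k0 \<le> (real n * x1 + x1) / l0"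
    proof -
      have "real k0 * l0 \<le> real k0 * ?l" using l by (intro mult_left_mono) auto
      also have "\<dots> \<le> real n * x1 + x1"
        using up sx(1) x x01 mult_left_mono[OF x(2), of "real n"] by (auto simp: max_def split: if_splits)
      finally show ?thesis using l0 by (simp add: field_simps)
    qed
    have k0_lo: "real n * x0 / (2 * l1) \<le> real k0 + 1"
    proof -
      have "real n * x0 / 2 \<le> real n * x0 - 1" using nx0 by linarith
      also have "\<dots> \<le> real k0 * ?l" using lo mult_left_mono[OF x(1), of "real n"] by simp
      also have "\<dots> \<le> (real k0 + 1) * l1" using l l1 l0 by (intro mult_mono) auto
      finally show ?thesis using l1 by (simp add: field_simps)
    qed
    have ratio: "(1 - C * (real j + 2) / n) * p (k0 + j) \<le> p (k0 + Suc j) \<and>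
           p (k0 + Suc j) \<le> (1 - c * real j / n) * p (k0 + j)"
      if j: "j \<le> n" "e = WP \<longrightarrow> real n * x1 + 1 + real j < real n" for j
    proof -
      define N where "N = real k0 * ?l - real n * x + 1 + real j * ?l"
      define q where "q = real k0 + real j + 1"
      have q: "0 < q" unfolding q_def by simp
      have "p (Suc (k0 + j)) * real (Suc (k0 + j)) = (real n + \<sigma> * real (k0 + j)) * x * p (k0 + j)"
        by (intro rec) (use k0W j in force)
      also have "(real n + \<sigma> * real (k0 + j)) * x = q - N" by (simp add: N_def q_def algebra_simps)
      finally have "p (k0 + Suc j) * q = (q - N) * p (k0 + j)" by (simp add: q_def add_ac)
      then have pe: "p (k0 + Suc j) = (1 - N / q) * p (k0 + j)" using q by (simp add: field_simps)
      have "N \<le> x1 + 1 + real j * l1"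
        using up sx(1) l(2) x01 mult_left_mono[OF l(2), of "real j"] by (auto simp: N_def max_def split: if_splits)
      also have "\<dots> \<le> l1 * (real j + 2)" using x01 by (simp add: l1_def algebra_simps)
      finally have N1: "N \<le> l1 * (real j + 2)" .
      have N2: "l0 * real j \<le> N"
        using lo mult_left_mono[OF l(1), of "real j"] by (simp add: N_def mult.commute)
      have "N / q \<le> (l1 * (real j + 2)) / (real n * x0 / (2 * l1))"
        using N1 N2 l0 l1 k0_lo n x01 by (intro frac_le) (auto simp: q_def intro!: mult_pos_pos divide_pos_pos)
      also have "\<dots> = C * (real j + 2) / n" by (simp add: C_def mult_ac)
      finally have b1: "N / q \<le> C * (real j + 2) / n" .
      have "c * real j / n = (l0 * real j) / (real n * ((2 * x1 + 1) / l0 + 2))" by (simp add: c_def)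
      also have "\<dots> \<le> N / q"
      proof (rule frac_le)
        have "x1 / l0 + 1 \<le> real n * (x1 / l0 + 1)"
          using n x01 l0 mult_right_mono[of 1 "real n" "x1 / l0 + 1"] by simp
        then have "q \<le> real n * (x1 / l0) + real n * (x1 / l0 + 1) + real n"
          using k0_up j n by (simp add: q_def add_divide_distrib)
        also have "\<dots> \<le> real n * ((2 * x1 + 1) / l0 + 2)"
          using l0 by (simp add: algebra_simps add_divide_distrib)
        finally show "q \<le> real n * ((2 * x1 + 1) / l0 + 2)" .
      qed (use N2 q l0 in \<open>auto intro: order_trans[OF _ N2]\<close>)
      finally have b2: "c * real j / n \<le> N / q" .
      show ?thesis unfolding pe using b1 b2 p0[of "k0 + j"] by (intro conjI mult_right_mono) auto
    qed
    show "\<exists>k0. (\<forall>k. ens_prob e n x k \<le> ens_prob e n x k0) \<and>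
         (\<forall>j. j \<le> n \<longrightarrow> (e = WP \<longrightarrow> real n * x1 + 1 + real j < real n) \<longrightarrow>
           (1 - C * (real j + 2) / n) * ens_prob e n x (k0 + j) \<le> ens_prob e n x (k0 + Suc j) \<and>
           ens_prob e n x (k0 + Suc j) \<le> (1 - c * real j / n) * ens_prob e n x (k0 + j))"
      using k0 ratio unfolding p_def by blast
  qed
qed

text \<open>Each factor is at most \<open>exp (- c * j / n)\<close>, and the numbers below J add up
  to \<open>J * (J - 1) / 2\<close>: a Gaussian decay away from the mode.\<close>

lemma prod_one_minus_le_exp:
  fixes p :: "nat \<Rightarrow> real" and n :: real
  assumes "\<And>j. j < J \<Longrightarrow> p (Suc j) \<le> (1 - c * real j / n) * p j" "\<And>j. 0 \<le> p j"
  shows "p J \<le> exp (- c * (real J * (real J - 1)) / (2 * n)) * p 0"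
  using assms(1)
proof (induction J)
  case (Suc J)
  have "p (Suc J) \<le> (1 - c * real J / n) * p J" using Suc.prems[of J] by simp
  also have "\<dots> \<le> exp (- c * real J / n) * p J"
    using exp_ge_add_one_self[of "- c * real J / n"] assms(2) by (intro mult_right_mono) auto
  also have "\<dots> \<le> exp (- c * real J / n) * (exp (- c * (real J * (real J - 1)) / (2 * n)) * p 0)"
    by (intro mult_left_mono Suc) (use Suc.prems in auto)
  also have "\<dots> = exp (- c * (real (Suc J) * (real (Suc J) - 1)) / (2 * n)) * p 0"
    unfolding mult.assoc[symmetric] exp_add[symmetric] by (simp add: add_divide_distrib diff_divide_distrib algebra_simps)
  finally show ?case .
qed simp

text \<open>The source of anti-concentration: every level y between \<open>n^(-7)\<close> and the
  maximum has about \<open>ln n\<close> indices whose share of the variance is comparable to y. The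
  power 7 is chosen for frequencies s up to \<open>n^3\<close>, whose relevant level is a constant
  over \<open>s^2\<close> and thus eventually above \<open>n^(-7)\<close>.\<close>

lemma ens_prob_block:
  fixes x0 x1 A :: real
  assumes x01: "0 < x0" "x0 \<le> x1" "e \<in> {HAF, WP} \<Longrightarrow> x1 < 1" and A: "0 < A"
  shows "eventually (\<lambda>n. \<forall>x y. x0 \<le> x \<longrightarrow> x \<le> x1 \<longrightarrow> 1 / real n ^ 7 \<le> y \<longrightarrow>
     (\<forall>k. ens_prob e n x k \<le> y) \<or>
     (\<exists>K. finite K \<and> A * ln (real n) \<le> card K \<and> (\<forall>k\<in>K. y / 2 \<le> ens_prob e n x k \<and> ens_prob e n x k \<le> y))) sequentially"
proof -
  obtain c C :: real where cC: "0 < c" "0 < C" and ratio: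
    "\<And>n x. n \<ge> 1 \<Longrightarrow> real n * x0 \<ge> 2 \<Longrightarrow> (e = WP \<Longrightarrow> real n * x1 + 1 < real n) \<Longrightarrow> x0 \<le> x \<Longrightarrow> x \<le> x1 \<Longrightarrow>
       \<exists>k0. (\<forall>k. ens_prob e n x k \<le> ens_prob e n x k0) \<and>
         (\<forall>j. j \<le> n \<longrightarrow> (e = WP \<longrightarrow> real n * x1 + 1 + real j < real n) \<longrightarrow>
           (1 - C * (real j + 2) / n) * ens_prob e n x (k0 + j) \<le> ens_prob e n x (k0 + Suc j) \<and>
           ens_prob e n x (k0 + Suc j) \<le> (1 - c * real j / n) * ens_prob e n x (k0 + j))"
    using ens_prob_ratio[OF x01] by metis
  \<comment> \<open>The exponent 3/4 lies strictly between 1/2 and 1. Thus \<open>J^2 / n\<close>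
    grows like a power of n and the profile falls below \<open>n^(-7)\<close> within J steps, while
    \<open>J * ln n / n\<close> tends to 0 and the decrease is slow on the scale of L.\<close>
  define J where "J n = nat \<lceil>real n powr (3/4)\<rceil>" for n
  define L where "L n = nat \<lceil>A * ln (real n)\<rceil>" for n
  have Jb: "real n powr (3/4) \<le> real (J n)" "real (J n) \<le> real n powr (3/4) + 1" for n
    unfolding J_def by (simp_all add: of_nat_ceiling)
  have Lb: "A * ln (real n) \<le> real (L n)" "real (L n) \<le> A * ln (real n) + 1" if "n \<ge> 1" for n
    unfolding L_def using that A by (simp_all add: of_nat_ceiling)
  let ?S = "\<lambda>n. real n powr (3/4) + A * ln (real n) + 3"
  define d where "d = (if e = WP then 1 - x1 else 1)"
  have d: "0 < d" using x01 by (auto simp: d_def)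
  have e1: "eventually (\<lambda>n. real n * x0 \<ge> 2) sequentially" using x01(1) by real_asymp
  have e2: "eventually (\<lambda>n. ?S n + 2 < d * real n) sequentially" using d A by real_asymp
  have e2': "eventually (\<lambda>n. ?S n < real n) sequentially" using A by real_asymp
  have e3: "eventually (\<lambda>n. C * (?S n + 2) * (2 * (A * ln (real n) + 1)) \<le> real n) sequentially" using cC A by real_asymp
  have e4: "eventually (\<lambda>n. exp (- c * (real n powr (3/4) * (real n powr (3/4) - 1)) / (2 * real n)) \<le> 1 / real n ^ 7) sequentially"
    using cC by real_asymp
  have e5: "eventually (\<lambda>n. 0 < A * ln (real n)) sequentially" using A by real_asymp
  from e1 e2 e2' e3 e4 e5 eventually_ge_at_top[of 2] show ?thesis
  proof (eventually_elim, intro allI impI)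
    case (elim n)
    fix x y assume x: "x0 \<le> x" "x \<le> x1" and y: "1 / real n ^ 7 \<le> y"
    have W: "e = WP \<Longrightarrow> real n * x1 + 1 + ?S n < real n"
      using elim(2) by (simp add: d_def algebra_simps)
    have S0: "0 \<le> ?S n" using elim(6) by (simp add: add_nonneg_nonneg)
    obtain k0 where k0: "\<And>k. ens_prob e n x k \<le> ens_prob e n x k0"
      and r: "\<And>j. j \<le> n \<Longrightarrow> (e = WP \<longrightarrow> real n * x1 + 1 + real j < real n) \<Longrightarrow>
           (1 - C * (real j + 2) / n) * ens_prob e n x (k0 + j) \<le> ens_prob e n x (k0 + Suc j) \<and>
           ens_prob e n x (k0 + Suc j) \<le> (1 - c * real j / n) * ens_prob e n x (k0 + j)"
      using ratio[of n x] elim(1,7) W S0 x by force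
    define p where "p = ens_prob e n x"
    have xh: "0 \<le> x" "e = HAF \<Longrightarrow> x < 1" using x x01 by auto
    have p0: "0 \<le> p k" for k unfolding p_def by (rule ens_prob_nonneg) (use elim(7) xh in auto)
    have p1: "p k \<le> 1" for k
      using sum_ens_prob_le_1[of n x e "{k}"] elim(7) xh unfolding p_def by auto
    have rr: "(1 - C * (real j + 2) / n) * p (k0 + j) \<le> p (k0 + Suc j) \<and>
        p (k0 + Suc j) \<le> (1 - c * real j / n) * p (k0 + j)" if "j < J n + L n" for j
    proof -
      have "real j + 1 \<le> real (J n) + real (L n)" using that by linarith
      then have "real j \<le> ?S n" using Jb(2)[of n] Lb(2)[of n] elim(7) by simp
      then show ?thesis unfolding p_def using elim(3) W by (intro r) auto
    qed
    show "(\<forall>k. ens_prob e n x k \<le> y) \<or>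
     (\<exists>K. finite K \<and> A * ln (real n) \<le> card K \<and> (\<forall>k\<in>K. y / 2 \<le> ens_prob e n x k \<and> ens_prob e n x k \<le> y))"
    proof (cases "p k0 \<le> y")
      case True
      then show ?thesis using k0 order_trans unfolding p_def by blast
    next
      case False
      have L0: "0 < L n" using Lb(1)[of n] elim(6,7) by (cases "L n") auto
      have "\<exists>K. finite K \<and> card K = L n \<and> (\<forall>k\<in>K. y / 2 \<le> p k \<and> p k \<le> y)"
      proof (rule slowly_decreasing_block[where J = "J n" and m = k0, OF p0 _ _ _ _ L0])
        fix j assume j: "j < J n + L n"
        have "(1 - c * real j / n) * p (k0 + j) \<le> 1 * p (k0 + j)"
          using cC p0 by (intro mult_right_mono) auto
        then show "p (k0 + Suc j) \<le> p (k0 + j)" using rr[OF j] by simp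
        have "real j + 1 \<le> real (J n) + real (L n)" using j by linarith
        then have jS: "real j \<le> ?S n" using Jb(2)[of n] Lb(2)[of n] elim(7) by simp
        have "C * (real j + 2) * (2 * real (L n)) \<le> C * (?S n + 2) * (2 * (A * ln (real n) + 1))"
          using jS cC S0 Lb(2)[of n] elim(6,7) by (intro mult_mono) auto
        also have "\<dots> \<le> real n" by (rule elim(4))
        finally have "C * (real j + 2) / n \<le> 1 / (2 * real (L n))" using L0 elim(7) by (simp add: field_simps)
        then have "(1 - 1 / (2 * real (L n))) * p (k0 + j) \<le> (1 - C * (real j + 2) / n) * p (k0 + j)"
          using p0 by (intro mult_right_mono) auto
        then show "(1 - 1 / (2 * real (L n))) * p (k0 + j) \<le> p (k0 + Suc j)" using rr[OF j] by simp
      next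
        show "y < p k0" using False by simp
        have "p (k0 + J n) \<le> exp (- c * (real (J n) * (real (J n) - 1)) / (2 * n)) * p (k0 + 0)"
          using prod_one_minus_le_exp[where p = "\<lambda>j. p (k0 + j)" and J = "J n" and n = "real n" and c = c] rr p0 by simp
        also have "\<dots> \<le> exp (- c * (real (J n) * (real (J n) - 1)) / (2 * n)) * 1"
          using p1 by (intro mult_left_mono) auto
        also have "\<dots> \<le> exp (- c * (real n powr (3/4) * (real n powr (3/4) - 1)) / (2 * real n))"
        proof -
          have "1 \<le> real n powr (3/4)" using elim(7) by (simp add: ge_one_powr_ge_zero)
          then have "real n powr (3/4) * (real n powr (3/4) - 1) \<le> real (J n) * (real (J n) - 1)"
            using Jb(1)[of n] by (intro mult_mono) auto
          then show ?thesis using cC elim(7) by (simp add: divide_right_mono mult_left_mono)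
        qed
        also have "\<dots> \<le> y" using elim(5) y by simp
        finally show "p (k0 + J n) \<le> y" .
      qed
      then show ?thesis using Lb(1)[of n] elim(7) unfolding p_def by (metis Suc_1 Suc_leD)
    qed
  qed
qed

section \<open>Random linear combinations\<close>

locale iid_std = prob_space M for M :: "'a measure" +
  fixes \<xi> :: "nat \<Rightarrow> 'a \<Rightarrow> real"
  assumes indep: "indep_vars (\<lambda>_. borel) \<xi> UNIV"
    and ident: "distr M borel (\<xi> k) = distr M borel (\<xi> 0)"
    and mean_zero: "expectation (\<xi> 0) = 0"
    and second_moment: "expectation (\<lambda>\<omega>. (\<xi> 0 \<omega>)\<^sup>2) = 1"
begin

lemma xi_measurable [measurable]: "\<xi> k \<in> borel_measurable M"
  using indep unfolding indep_vars_def by auto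

lemma integrable_xi2: "integrable M (\<lambda>\<omega>. (\<xi> k \<omega>)\<^sup>2)"
proof -
  \<comment> \<open>The Bochner integral of a non-integrable function is 0, so a second moment equal
    to 1 forces integrability.\<close>
  have "integrable M (\<lambda>\<omega>. (\<xi> 0 \<omega>)\<^sup>2)"
    using second_moment not_integrable_integral_eq by fastforce
  then have "integrable (distr M borel (\<xi> 0)) (\<lambda>x. x\<^sup>2)" by (subst integrable_distr_eq) auto
  then have "integrable (distr M borel (\<xi> k)) (\<lambda>x. x\<^sup>2)" by (simp only: ident[of k])
  then show ?thesis by (subst (asm) integrable_distr_eq) auto
qed

lemma expectation_xi2: "expectation (\<lambda>\<omega>. (\<xi> k \<omega>)\<^sup>2) = 1"
proof -
  have "expectation (\<lambda>\<omega>. (\<xi> k \<omega>)\<^sup>2) = (LINT x|distr M borel (\<xi> k). x\<^sup>2)"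
    by (subst integral_distr) auto
  also have "\<dots> = expectation (\<lambda>\<omega>. (\<xi> 0 \<omega>)\<^sup>2)"
    unfolding ident[of k] by (subst integral_distr) auto
  finally show ?thesis by (simp add: second_moment)
qed

lemma integrable_xi: "integrable M (\<xi> k)"
  by (rule square_integrable_imp_integrable[OF _ integrable_xi2]) simp

lemma expectation_xi: "expectation (\<xi> k) = 0"
proof -
  have "expectation (\<xi> k) = (LINT x|distr M borel (\<xi> k). x)"
    by (subst integral_distr) auto
  also have "\<dots> = expectation (\<xi> 0)"
    unfolding ident[of k] by (subst integral_distr) auto
  finally show ?thesis by (simp add: mean_zero)
qed

lemma expectation_abs_xi_le: "expectation (\<lambda>\<omega>. \<bar>\<xi> k \<omega>\<bar>) \<le> 1"
proof -
  have "expectation (\<lambda>\<omega>. \<bar>\<xi> k \<omega>\<bar>) \<le> expectation (\<lambda>\<omega>. (1 + (\<xi> k \<omega>)\<^sup>2) / 2)"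
  proof (rule integral_mono)
    show "\<bar>\<xi> k \<omega>\<bar> \<le> (1 + (\<xi> k \<omega>)\<^sup>2) / 2" for \<omega>
      using sum_squares_bound[of 1 "\<bar>\<xi> k \<omega>\<bar>"] by simp
  qed (use integrable_xi[of k] integrable_xi2[of k] in auto)
  also have "\<dots> = 1" using integrable_xi2[of k] by (simp add: expectation_xi2 prob_space)
  finally show ?thesis .
qed

lemma second_moment_lincomb:
  "integrable M (\<lambda>\<omega>. (\<Sum>k<N. a k * \<xi> k \<omega>)\<^sup>2) \<and> expectation (\<lambda>\<omega>. (\<Sum>k<N. a k * \<xi> k \<omega>)\<^sup>2) = (\<Sum>k<N. (a k)\<^sup>2)"
proof (induction N)
  case (Suc N)
  let ?S = "\<lambda>\<omega>. \<Sum>k<N. a k * \<xi> k \<omega>"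
  have iS: "integrable M ?S" "expectation ?S = 0" using integrable_xi by (simp_all add: expectation_xi)
  have "indep_vars (\<lambda>_. borel) (\<lambda>k \<omega>. a k * \<xi> k \<omega>) (insert N {..<N})"
    by (rule indep_vars_subset[OF indep_vars_compose2[OF indep]]) auto
  then have iv: "indep_var borel (\<lambda>\<omega>. a N * \<xi> N \<omega>) borel ?S"
    by (intro indep_vars_sum) auto
  have iN: "integrable M (\<lambda>\<omega>. a N * \<xi> N \<omega>)" "expectation (\<lambda>\<omega>. a N * \<xi> N \<omega>) = 0"
    using integrable_xi by (simp_all add: expectation_xi)
  have "expectation (\<lambda>\<omega>. (a N * \<xi> N \<omega>) * ?S \<omega>) = 0" "integrable M (\<lambda>\<omega>. (a N * \<xi> N \<omega>) * ?S \<omega>)"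
    using indep_var_lebesgue_integral[OF iv iN(1) iS(1)] indep_var_integrable[OF iv iN(1) iS(1)] iN iS by simp_all
  moreover have "(\<lambda>\<omega>. (\<Sum>k<Suc N. a k * \<xi> k \<omega>)\<^sup>2) = (\<lambda>\<omega>. (?S \<omega>)\<^sup>2 + (2 * ((a N * \<xi> N \<omega>) * ?S \<omega>) + (a N)\<^sup>2 * (\<xi> N \<omega>)\<^sup>2))"
    by (auto simp: fun_eq_iff power2_eq_square algebra_simps)
  ultimately show ?case using Suc integrable_xi2[of N] by (simp add: expectation_xi2)
qed simp

text \<open>The expected absolute series is finite because each \<open>|\<xi> k|\<close> has mean at
  most 1.\<close>

lemma AE_summable:
  assumes "summable c" "\<And>k. 0 \<le> c k"
  shows "AE \<omega> in M. summable (\<lambda>k. c k * \<bar>\<xi> k \<omega>\<bar>)"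
proof -
  have "(\<integral>\<^sup>+\<omega>. (\<Sum>k. ennreal (c k * \<bar>\<xi> k \<omega>\<bar>)) \<partial>M) = (\<Sum>k. \<integral>\<^sup>+\<omega>. ennreal (c k * \<bar>\<xi> k \<omega>\<bar>) \<partial>M)"
    by (rule nn_integral_suminf) simp
  also have "\<dots> \<le> (\<Sum>k. ennreal (c k))"
  proof (rule suminf_le)
    fix k
    have "(\<integral>\<^sup>+\<omega>. ennreal (c k * \<bar>\<xi> k \<omega>\<bar>) \<partial>M) = ennreal (expectation (\<lambda>\<omega>. c k * \<bar>\<xi> k \<omega>\<bar>))"
      by (rule nn_integral_eq_integral) (use assms integrable_xi[of k] in auto)
    also have "\<dots> \<le> ennreal (c k)"
      using expectation_abs_xi_le[of k] assms(2)[of k] by (intro ennreal_leI) (simp add: mult_left_le)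
    finally show "(\<integral>\<^sup>+\<omega>. ennreal (c k * \<bar>\<xi> k \<omega>\<bar>) \<partial>M) \<le> ennreal (c k)" .
  qed auto
  also have "\<dots> < \<infinity>" using assms by (simp add: suminf_ennreal2)
  finally have "AE \<omega> in M. (\<Sum>k. ennreal (c k * \<bar>\<xi> k \<omega>\<bar>)) \<noteq> \<infinity>"
    by (intro nn_integral_PInf_AE) auto
  then show ?thesis
    by eventually_elim (rule summable_suminf_not_top, use assms in auto)
qed

section \<open>Characteristic functions of linear combinations\<close>

definition cf :: "real \<Rightarrow> complex" where "cf = char (distr M borel (\<xi> 0))"

lemma cf_le_1: "norm (cf u) \<le> 1"
proof -
  interpret d: real_distribution "distr M borel (\<xi> 0)" by (rule real_distribution_distr) simp
  show ?thesis unfolding cf_def by (rule d.cmod_char_le_1)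
qed

text \<open>No third moment is available. The remainder of the Taylor expansion is an integral of
  \<open>min (6 * x^2) (|u| * |x|^3)\<close>, dominated by the integrable \<open>6 * x^2\<close> and
  tending to 0 with u.\<close>

lemma cf_expansion:
  assumes "0 < \<epsilon>"
  shows "\<exists>\<eta>>0. \<forall>u. \<bar>u\<bar> \<le> \<eta> \<longrightarrow> norm (cf u - of_real (exp (- u\<^sup>2 / 2))) \<le> \<epsilon> * u\<^sup>2"
proof -
  interpret d: real_distribution "distr M borel (\<xi> 0)" by (rule real_distribution_distr) simp
  let ?D = "distr M borel (\<xi> 0)"
  have i1: "integrable ?D (\<lambda>x. x)" using integrable_xi[of 0] by (subst integrable_distr_eq) auto
  have m1: "d.expectation (\<lambda>x. x) = 0" using mean_zero by (subst integral_distr) auto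
  have i2: "integrable ?D (\<lambda>x. x\<^sup>2)" using integrable_xi2[of 0] by (subst integrable_distr_eq) auto
  have m2: "d.variance (\<lambda>x. x) = 1" using second_moment m1 by (subst integral_distr) auto
  let ?R = "\<lambda>u. LINT x|?D. min (6 * x\<^sup>2) (\<bar>u\<bar> * \<bar>x\<bar> ^ 3)"
  have R: "norm (cf u - (1 - u\<^sup>2 / 2)) \<le> u\<^sup>2 / 6 * ?R u" for u
    using d.char_approx3[OF i1 m1 i2 m2, of u] by (simp add: cf_def)
  have "(?R \<longlongrightarrow> (LINT x|?D. 0)) (at 0)"
    unfolding tendsto_at_iff_sequentially comp_def
  proof (intro allI impI, rule integral_dominated_convergence[where w = "\<lambda>x. 6 * x\<^sup>2"])
    fix U :: "nat \<Rightarrow> real" assume U: "U \<longlonglongrightarrow> 0"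
    have "(\<lambda>i. min (6 * x\<^sup>2) (\<bar>U i\<bar> * \<bar>x\<bar> ^ 3)) \<longlonglongrightarrow> min (6 * x\<^sup>2) (\<bar>0\<bar> * \<bar>x\<bar> ^ 3)" for x :: real
      by (intro tendsto_intros U)
    then show "AE x in ?D. (\<lambda>i. min (6 * x\<^sup>2) (\<bar>U i\<bar> * \<bar>x\<bar> ^ 3)) \<longlonglongrightarrow> 0" by simp
  qed (use i2 in auto)
  then have "eventually (\<lambda>u. ?R u < \<epsilon>) (at 0)" using assms by (intro order_tendstoD(2)) auto
  then obtain h where h: "0 < h" "\<And>u. u \<noteq> 0 \<Longrightarrow> \<bar>u\<bar> < h \<Longrightarrow> ?R u < \<epsilon>"
    unfolding eventually_at by (auto simp: dist_real_def)
  \<comment> \<open>The bounds 1 and \<epsilon> make \<open>u^2 \<le> \<epsilon>\<close>, which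
    absorbs the fourth-order error of replacing \<open>1 - u^2 / 2\<close> by the
    exponential.\<close>
  define \<eta> where "\<eta> = min (h / 2) (min 1 \<epsilon>)"
  have "norm (cf u - of_real (exp (- u\<^sup>2 / 2))) \<le> \<epsilon> * u\<^sup>2" if u: "\<bar>u\<bar> \<le> \<eta>" for u
  proof (cases "u = 0")
    case True
    then show ?thesis using R[of 0] by simp
  next
    case False
    have ub: "\<bar>u\<bar> < h" "\<bar>u\<bar> \<le> 1" "\<bar>u\<bar> \<le> \<epsilon>" using u h(1) by (auto simp: \<eta>_def)
    define v where "v = u\<^sup>2 / 2"
    have u1: "u\<^sup>2 \<le> 1" using ub(2) by (simp add: abs_square_le_1)
    have u2: "u\<^sup>2 \<le> \<epsilon>" using mult_mono[OF ub(3) ub(2)] assms by (simp add: power2_eq_square)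
    have v: "0 \<le> v" by (simp add: v_def)
    have e1: "1 - v \<le> exp (- v)" using exp_ge_add_one_self[of "- v"] by simp
    have "exp (- v) \<le> 1 / (1 + v)" using v by (simp add: exp_minus divide_inverse)
    also have "\<dots> \<le> 1 - v + v\<^sup>2"
      using v by (simp add: divide_le_eq) (simp add: algebra_simps power2_eq_square)
    finally have "\<bar>(1 - v) - exp (- v)\<bar> \<le> v\<^sup>2" using e1 by simp
    also have "v\<^sup>2 \<le> \<epsilon> / 4 * u\<^sup>2"
    proof -
      have "v\<^sup>2 = u\<^sup>2 / 4 * u\<^sup>2" by (simp add: v_def power2_eq_square)
      also have "\<dots> \<le> \<epsilon> / 4 * u\<^sup>2" using u2 by (intro mult_right_mono) auto
      finally show ?thesis .
    qed
    finally have 1: "norm (complex_of_real (1 - v) - of_real (exp (- v))) \<le> \<epsilon> / 4 * u\<^sup>2"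
      unfolding of_real_diff[symmetric] norm_of_real .
    have "norm (cf u - (1 - u\<^sup>2 / 2)) \<le> u\<^sup>2 / 6 * \<epsilon>"
      using R[of u] h(2)[OF False ub(1)] by (intro order_trans[OF R[of u]] mult_left_mono) auto
    then have 2: "norm (cf u - complex_of_real (1 - v)) \<le> \<epsilon> / 6 * u\<^sup>2" by (simp add: v_def mult.commute)
    have "norm (cf u - of_real (exp (- v))) \<le> norm (cf u - complex_of_real (1 - v)) + norm (complex_of_real (1 - v) - of_real (exp (- v)))"
      using norm_triangle_ineq[of "cf u - complex_of_real (1 - v)" "complex_of_real (1 - v) - of_real (exp (- v))"] by simp
    also have "\<dots> \<le> \<epsilon> / 6 * u\<^sup>2 + \<epsilon> / 4 * u\<^sup>2" using 1 2 by simp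
    also have "\<dots> \<le> \<epsilon> * u\<^sup>2" using assms by (simp add: field_simps)
    finally show ?thesis by (simp add: v_def)
  qed
  moreover have "0 < \<eta>" using h(1) assms by (simp add: \<eta>_def)
  ultimately show ?thesis by blast
qed

text \<open>Near 0 the quadratic term of the expansion dominates. Halving the Gaussian exponent
  leaves room for its error.\<close>

lemma cf_small: "\<exists>u0>0. \<forall>u. \<bar>u\<bar> \<le> u0 \<longrightarrow> norm (cf u) \<le> exp (- u\<^sup>2 / 4)"
proof -
  obtain \<eta> where \<eta>: "\<eta> > 0" "\<And>u. \<bar>u\<bar> \<le> \<eta> \<Longrightarrow> norm (cf u - of_real (exp (- u\<^sup>2 / 2))) \<le> 1/8 * u\<^sup>2"
    using cf_expansion[of "1/8"] by auto
  have "norm (cf u) \<le> exp (- u\<^sup>2 / 4)" if "\<bar>u\<bar> \<le> min \<eta> (1/2)" for u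
  proof -
    define v where "v = u\<^sup>2 / 2"
    have v: "0 \<le> v" by (simp add: v_def)
    have "u\<^sup>2 \<le> (1/2)\<^sup>2" using that by (intro abs_le_square_iff[THEN iffD1]) simp
    then have v4: "v \<le> 1/8" by (simp add: v_def power2_eq_square)
    have "exp (- v) \<le> 1 / (1 + v)" using v by (simp add: exp_minus divide_inverse)
    also have "\<dots> \<le> 1 - v + v\<^sup>2"
      using v by (simp add: divide_le_eq) (simp add: algebra_simps power2_eq_square)
    also have "v\<^sup>2 \<le> v * (1/8)" unfolding power2_eq_square using v v4 by (intro mult_left_mono) auto
    finally have e: "exp (- v) \<le> 1 - 7/8 * v" by simp
    have "norm (cf u) \<le> norm (complex_of_real (exp (- v))) + norm (cf u - of_real (exp (- v)))"
      using norm_triangle_ineq[of "complex_of_real (exp (- v))" "cf u - of_real (exp (- v))"] by simp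
    also have "\<dots> \<le> exp (- v) + 1/8 * u\<^sup>2" using \<eta>(2)[of u] that by (simp add: v_def)
    also have "\<dots> \<le> 1 - 7/8 * v + v / 4" using e by (simp add: v_def)
    also have "\<dots> \<le> 1 + (- v / 2)" using v by simp
    also have "\<dots> \<le> exp (- v / 2)" by (rule exp_ge_add_one_self)
    finally show ?thesis by (simp add: v_def)
  qed
  then show ?thesis using \<eta>(1) by (intro exI[of _ "min \<eta> (1/2)"]) auto
qed

abbreviation lincomb :: "(nat \<Rightarrow> real) \<Rightarrow> 'a \<Rightarrow> real" where
  "lincomb a \<omega> \<equiv> (\<Sum>k. a k * \<xi> k \<omega>)"

lemma AE_lincomb_tendsto:
  assumes "summable (\<lambda>k. \<bar>a k\<bar>)"
  shows "AE \<omega> in M. (\<lambda>N. \<Sum>k<N. a k * \<xi> k \<omega>) \<longlonglongrightarrow> lincomb a \<omega>"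
proof -
  have "AE \<omega> in M. summable (\<lambda>k. \<bar>a k\<bar> * \<bar>\<xi> k \<omega>\<bar>)"
    by (rule AE_summable) (use assms in auto)
  then show ?thesis
  proof eventually_elim
    case (elim \<omega>)
    then have "summable (\<lambda>k. norm (a k * \<xi> k \<omega>))" by (simp add: abs_mult)
    then show ?case by (intro summable_LIMSEQ) (rule summable_norm_cancel)
  qed
qed

text \<open>Independence gives the product for partial sums; their almost sure limit passes through
  the integral by dominated convergence.\<close>

lemma char_lincomb:
  assumes "summable (\<lambda>k. \<bar>a k\<bar>)"
  shows "(\<lambda>N. \<Prod>k<N. cf (a k)) \<longlonglongrightarrow> (CLINT \<omega>|M. iexp (lincomb a \<omega>))"
proof -
  have "(\<Prod>k<N. cf (a k)) = (CLINT \<omega>|M. iexp (\<Sum>k<N. a k * \<xi> k \<omega>))" for N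
  proof -
    have "indep_vars (\<lambda>_. borel) (\<lambda>k \<omega>. a k * \<xi> k \<omega>) {..<N}"
      by (rule indep_vars_subset[OF indep_vars_compose2[OF indep]]) auto
    then have "char (distr M borel (\<lambda>\<omega>. \<Sum>k<N. a k * \<xi> k \<omega>)) 1 = (\<Prod>k<N. char (distr M borel (\<lambda>\<omega>. a k * \<xi> k \<omega>)) 1)"
      by (rule char_distr_sum)
    moreover have "char (distr M borel (\<lambda>\<omega>. a k * \<xi> k \<omega>)) 1 = cf (a k)" for k
    proof -
      have "cf (a k) = char (distr M borel (\<xi> k)) (a k)" by (simp add: cf_def ident[of k])
      then show ?thesis by (simp add: char_def integral_distr)
    qed
    ultimately show ?thesis by (simp add: char_def integral_distr)
  qed
  moreover have "(\<lambda>N. CLINT \<omega>|M. iexp (\<Sum>k<N. a k * \<xi> k \<omega>)) \<longlonglongrightarrow> (CLINT \<omega>|M. iexp (lincomb a \<omega>))"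
  proof (rule integral_dominated_convergence[where w = "\<lambda>_. 1"])
    show "AE \<omega> in M. (\<lambda>N. iexp (\<Sum>k<N. a k * \<xi> k \<omega>)) \<longlonglongrightarrow> iexp (lincomb a \<omega>)"
      using AE_lincomb_tendsto[OF assms]
      by eventually_elim (intro tendsto_intros)
  qed auto
  ultimately show ?thesis by simp
qed

text \<open>Factors outside K are only bounded by 1. Away from 0 nothing better holds in general,
  since the characteristic function of a lattice law returns to modulus 1; hence K collects indices
  whose arguments lie where \<open>cf\<close> is known to decay.\<close>

lemma norm_char_lincomb_le:
  assumes "summable (\<lambda>k. \<bar>a k\<bar>)" and u0: "\<And>u. \<bar>u\<bar> \<le> u0 \<Longrightarrow> norm (cf u) \<le> exp (- u\<^sup>2 / 4)"
    and K: "finite K" "\<And>k. k \<in> K \<Longrightarrow> \<bar>a k\<bar> \<le> u0"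
  shows "norm (CLINT \<omega>|M. iexp (lincomb a \<omega>)) \<le> exp (- (\<Sum>k\<in>K. (a k)\<^sup>2) / 4)"
proof (rule LIMSEQ_le_const2[OF tendsto_norm[OF char_lincomb[OF assms(1)]]])
  obtain N0 where N0: "K \<subseteq> {..<N0}" using K(1) finite_nat_bounded by blast
  have "norm (\<Prod>k<N. cf (a k)) \<le> exp (- (\<Sum>k\<in>K. (a k)\<^sup>2) / 4)" if "N \<ge> N0" for N
  proof -
    have sub: "K \<subseteq> {..<N}" using N0 that by auto
    have "norm (\<Prod>k<N. cf (a k)) = (\<Prod>k<N. norm (cf (a k)))" by (rule prod_norm[symmetric])
    also have "\<dots> = (\<Prod>k\<in>{..<N} - K. norm (cf (a k))) * (\<Prod>k\<in>K. norm (cf (a k)))"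
      by (rule prod.subset_diff[OF sub]) simp
    also have "\<dots> \<le> 1 * (\<Prod>k\<in>K. exp (- (a k)\<^sup>2 / 4))"
      by (intro mult_mono prod_le_1 prod_mono prod_nonneg) (use cf_le_1 u0 K in auto)
    also have "\<dots> = exp (- (\<Sum>k\<in>K. (a k)\<^sup>2) / 4)"
      using K(1) by (simp add: exp_sum[symmetric] sum_negf sum_divide_distrib[symmetric])
    finally show ?thesis .
  qed
  then show "\<exists>N0. \<forall>N\<ge>N0. norm (\<Prod>k<N. cf (a k)) \<le> exp (- (\<Sum>k\<in>K. (a k)\<^sup>2) / 4)" by blast
qed

text \<open>Lindeberg's replacement: all factors have modulus at most 1, so the difference of the
  two products is at most the sum of the differences of the factors, each small relative to the
  square of its argument.\<close>

lemma char_lincomb_normal: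
  assumes "0 < \<epsilon>"
  shows "\<exists>\<eta>>0. \<forall>a V. summable (\<lambda>k. \<bar>a k\<bar>) \<longrightarrow> (\<lambda>k. (a k)\<^sup>2) sums V \<longrightarrow> (\<forall>k. \<bar>a k\<bar> \<le> \<eta>) \<longrightarrow>
     norm ((CLINT \<omega>|M. iexp (lincomb a \<omega>)) - of_real (exp (- V / 2))) \<le> \<epsilon> * V"
proof -
  obtain \<eta> where \<eta>: "\<eta> > 0" "\<And>u. \<bar>u\<bar> \<le> \<eta> \<Longrightarrow> norm (cf u - of_real (exp (- u\<^sup>2 / 2))) \<le> \<epsilon> * u\<^sup>2"
    using cf_expansion[OF assms] by auto
  have "norm ((CLINT \<omega>|M. iexp (lincomb a \<omega>)) - of_real (exp (- V / 2))) \<le> \<epsilon> * V"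
    if a: "summable (\<lambda>k. \<bar>a k\<bar>)" "(\<lambda>k. (a k)\<^sup>2) sums V" "\<And>k. \<bar>a k\<bar> \<le> \<eta>" for a V
  proof (rule LIMSEQ_le_const2)
    have "(\<lambda>N. complex_of_real (exp (- (\<Sum>k<N. (a k)\<^sup>2) / 2))) \<longlonglongrightarrow> of_real (exp (- V / 2))"
      using a(2) unfolding sums_def by (intro tendsto_intros) auto
    then show "(\<lambda>N. norm ((\<Prod>k<N. cf (a k)) - of_real (exp (- (\<Sum>k<N. (a k)\<^sup>2) / 2))))
      \<longlonglongrightarrow> norm ((CLINT \<omega>|M. iexp (lincomb a \<omega>)) - of_real (exp (- V / 2)))"
      by (intro tendsto_norm tendsto_diff char_lincomb a(1))
    have "norm ((\<Prod>k<N. cf (a k)) - of_real (exp (- (\<Sum>k<N. (a k)\<^sup>2) / 2))) \<le> \<epsilon> * V" for N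
    proof -
      have "complex_of_real (exp (- (\<Sum>k<N. (a k)\<^sup>2) / 2)) = (\<Prod>k<N. of_real (exp (- (a k)\<^sup>2 / 2)))"
        by (simp add: exp_sum[symmetric] sum_negf sum_divide_distrib[symmetric] flip: of_real_prod)
      then have "norm ((\<Prod>k<N. cf (a k)) - of_real (exp (- (\<Sum>k<N. (a k)\<^sup>2) / 2)))
          \<le> (\<Sum>k<N. norm (cf (a k) - of_real (exp (- (a k)\<^sup>2 / 2))))"
        using norm_prod_diff[of "{..<N}" "\<lambda>k. cf (a k)" "\<lambda>k. of_real (exp (- (a k)\<^sup>2 / 2))"] cf_le_1 by simp
      also have "\<dots> \<le> (\<Sum>k<N. \<epsilon> * (a k)\<^sup>2)" by (intro sum_mono \<eta>(2) a(3))
      also have "\<dots> = \<epsilon> * (\<Sum>k<N. (a k)\<^sup>2)" by (simp add: sum_distrib_left)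
      also have "\<dots> \<le> \<epsilon> * V"
        using sum_le_suminf[of "\<lambda>k. (a k)\<^sup>2" "{..<N}"] a(2) assms by (intro mult_left_mono) (auto simp: sums_iff)
      finally show ?thesis .
    qed
    then show "\<exists>N0. \<forall>N\<ge>N0. norm ((\<Prod>k<N. cf (a k)) - of_real (exp (- (\<Sum>k<N. (a k)\<^sup>2) / 2))) \<le> \<epsilon> * V" by blast
  qed
  then show ?thesis using \<eta>(1) by blast
qed

end

text \<open>Gaussian smoothing: \<open>exp (- X\<^sup>2 / (2 x\<^sup>2))\<close> is the average of \<open>exp (\<i> g X / x)\<close>
  over a standard normal \<open>g\<close>.\<close>

lemma (in prob_space) small_ball_char:
  fixes X :: "'a \<Rightarrow> real"
  assumes [measurable]: "X \<in> borel_measurable M" and x: "0 < x" and S: "0 < S" and \<rho>: "0 \<le> \<rho>"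
    and char: "\<And>s. \<bar>s\<bar> \<le> S \<Longrightarrow> norm (CLINT \<omega>|M. iexp (s * X \<omega>)) \<le> exp (- s\<^sup>2 / 4) + \<rho>"
  shows "prob {\<omega>\<in>space M. \<bar>X \<omega>\<bar> \<le> x} \<le> 2 * (1 / (S * x)\<^sup>2 + \<rho> + sqrt 2 * x)"
proof -
  let ?N = std_normal_distribution
  interpret N: real_distribution ?N by (rule real_dist_normal_dist)
  interpret P: pair_prob_space M ?N ..
  let ?\<psi> = "\<lambda>s. CLINT \<omega>|M. iexp (s * X \<omega>)"
  have \<psi>1: "norm (?\<psi> s) \<le> 1" for s
  proof -
    interpret d: real_distribution "distr M borel X" by (rule real_distribution_distr) simp
    show ?thesis using d.cmod_char_le_1[of s] by (simp add: char_def integral_distr)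
  qed
  have int: "integrable (M \<Otimes>\<^sub>M ?N) (\<lambda>(\<omega>, g). iexp (g / x * X \<omega>))"
    by (intro P.integrable_const_bound[where B = 1]) (auto simp: case_prod_beta)
  have [measurable]: "?\<psi> \<in> borel_measurable borel"
  proof -
    interpret d: real_distribution "distr M borel X" by (rule real_distribution_distr) simp
    have "?\<psi> = char (distr M borel X)" by (auto simp: fun_eq_iff char_def integral_distr)
    then show ?thesis using d.char_measurable by simp
  qed
  have "(CLINT \<omega>|M. (CLINT g|?N. iexp (g / x * X \<omega>))) = (CLINT g|?N. ?\<psi> (g / x))"
    using P.Fubini_integral[OF int] by simp
  moreover have "(CLINT g|?N. iexp (g / x * X \<omega>)) = of_real (exp (- (X \<omega> / x)\<^sup>2 / 2))" for \<omega>
    using fun_cong[OF char_std_normal_distribution, of "X \<omega> / x"] by (simp add: char_def mult.commute)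
  ultimately have eq: "complex_of_real (expectation (\<lambda>\<omega>. exp (- (X \<omega> / x)\<^sup>2 / 2))) = (CLINT g|?N. ?\<psi> (g / x))"
    by simp
  have iX: "integrable M (\<lambda>\<omega>. exp (- (X \<omega> / x)\<^sup>2 / 2))"
    by (intro integrable_const_bound[where B = 1]) auto
  have "prob {\<omega>\<in>space M. \<bar>X \<omega>\<bar> \<le> x} = expectation (indicator {\<omega>\<in>space M. \<bar>X \<omega>\<bar> \<le> x})"
    by (simp add: Int_def cong: conj_cong)
  also have "\<dots> \<le> expectation (\<lambda>\<omega>. 2 * exp (- (X \<omega> / x)\<^sup>2 / 2))"
  proof (rule integral_mono)
    fix \<omega> assume "\<omega> \<in> space M"
    show "indicator {\<omega>\<in>space M. \<bar>X \<omega>\<bar> \<le> x} \<omega> \<le> 2 * exp (- (X \<omega> / x)\<^sup>2 / 2)"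
    proof (cases "\<bar>X \<omega>\<bar> \<le> x")
      case True
      then have "\<bar>X \<omega> / x\<bar> \<le> 1" using x by (simp add: abs_divide)
      then have "(X \<omega> / x)\<^sup>2 \<le> 1" by (simp add: abs_square_le_1)
      \<comment> \<open>The factor 2 in the bound compensates for
        \<open>exp (- 1 / 2) \<ge> 1 / 2\<close>.\<close>
      then have "1 / 2 \<le> 1 + (- (X \<omega> / x)\<^sup>2 / 2)" by simp
      also have "\<dots> \<le> exp (- (X \<omega> / x)\<^sup>2 / 2)" by (rule exp_ge_add_one_self)
      finally show ?thesis by (simp add: indicator_def)
    qed (simp add: indicator_def)
  qed (use iX in \<open>auto simp: integrable_indicator_iff emeasure_eq_measure\<close>)
  also have "\<dots> = 2 * norm (complex_of_real (expectation (\<lambda>\<omega>. exp (- (X \<omega> / x)\<^sup>2 / 2))))"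
    by (simp only: norm_of_real) (simp add: integral_nonneg_AE abs_of_nonneg)
  also have "\<dots> \<le> 2 * (LINT g|?N. norm (?\<psi> (g / x)))"
    unfolding eq by (intro mult_left_mono integral_norm_bound) simp
  also have "(LINT g|?N. norm (?\<psi> (g / x))) \<le> (LINT g|?N. g\<^sup>2 * (1 / (S * x)\<^sup>2) + \<rho> + exp (- (g / x)\<^sup>2 / 4))"
  proof (rule integral_mono)
    show "integrable ?N (\<lambda>g. norm (?\<psi> (g / x)))"
    proof (rule N.integrable_const_bound[where B = 1])
      show "AE g in ?N. norm (norm (?\<psi> (g / x))) \<le> 1"
        by (intro AE_I2) (simp only: real_norm_def abs_norm_cancel \<psi>1)
      have "(\<lambda>g. norm (?\<psi> (g / x))) \<in> borel_measurable borel"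
        by (rule measurable_compose[OF measurable_compose[OF _ \<open>?\<psi> \<in> borel_measurable borel\<close>] borel_measurable_norm]) simp
      then show "(\<lambda>g. norm (?\<psi> (g / x))) \<in> borel_measurable ?N" by simp
    qed
    have "integrable ?N (\<lambda>g. exp (- (g / x)\<^sup>2 / 4))"
      by (intro N.integrable_const_bound[where B = 1]) auto
    then show "integrable ?N (\<lambda>g. g\<^sup>2 * (1 / (S * x)\<^sup>2) + \<rho> + exp (- (g / x)\<^sup>2 / 4))"
      using integrable_std_normal_distribution_moment[of 2] by (intro Bochner_Integration.integrable_add integrable_mult_left) auto
    fix g
    show "norm (?\<psi> (g / x)) \<le> g\<^sup>2 * (1 / (S * x)\<^sup>2) + \<rho> + exp (- (g / x)\<^sup>2 / 4)"
    \<comment> \<open>Within the range S the hypothesis applies. Outside it the modulus is at most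
      \<open>1 \<le> g^2 / (S * x)^2\<close>, as in Chebyshev's inequality, and \<open>g^2\<close>
      has mean 1.\<close>
    proof (cases "\<bar>g / x\<bar> \<le> S")
      case True
      moreover have "0 \<le> g\<^sup>2 * (1 / (S * x)\<^sup>2)" by simp
      ultimately show ?thesis using char[OF True] by linarith
    next
      case False
      then have "S * x \<le> \<bar>g\<bar>" using x by (simp add: abs_divide field_simps)
      then have "(S * x)\<^sup>2 \<le> g\<^sup>2" using power_mono[of "S * x" "\<bar>g\<bar>" 2] S x by simp
      then have "1 \<le> g\<^sup>2 * (1 / (S * x)\<^sup>2)" using S x by (simp add: field_simps)
      then show ?thesis using \<psi>1[of "g / x"] \<rho> by (smt (verit) exp_ge_zero)
    qed
  qed
  also have "\<dots> = 1 / (S * x)\<^sup>2 + \<rho> + (LINT g|?N. exp (- (g / x)\<^sup>2 / 4))"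
  proof -
    have "(LINT g|?N. g\<^sup>2) = 1"
      using std_normal_distribution_even_moments[of 1] by simp
    moreover have "integrable ?N (\<lambda>g. exp (- (g / x)\<^sup>2 / 4))"
      by (intro N.integrable_const_bound[where B = 1]) auto
    ultimately show ?thesis using integrable_std_normal_distribution_moment[of 2] N.prob_space
      by simp
  qed
  also have "(LINT g|?N. exp (- (g / x)\<^sup>2 / 4)) \<le> sqrt 2 * x"
  proof -
    have s: "0 < sqrt 2 * x" using x by simp
    have "(LINT g|?N. exp (- (g / x)\<^sup>2 / 4)) = (LINT g|lborel. std_normal_density g * exp (- (g / x)\<^sup>2 / 4))"
      by (subst integral_density) auto
    \<comment> \<open>The standard normal density is at most \<open>1 / sqrt (2 * pi)\<close>; what
      remains is \<open>sqrt 2 * x\<close> times the normal density with standard deviation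
      \<open>sqrt 2 * x\<close>.\<close>
    also have "\<dots> \<le> (LINT g|lborel. (sqrt 2 * x) * normal_density 0 (sqrt 2 * x) g)"
    proof (rule integral_mono_AE')
      show "integrable lborel (\<lambda>g. (sqrt 2 * x) * normal_density 0 (sqrt 2 * x) g)"
        using s by (intro integrable_mult_right) auto
      have "std_normal_density g * exp (- (g / x)\<^sup>2 / 4) \<le> (sqrt 2 * x) * normal_density 0 (sqrt 2 * x) g" for g
      proof -
        have "(sqrt 2 * x) * normal_density 0 (sqrt 2 * x) g = 1 / sqrt (2 * pi) * exp (- (g / x)\<^sup>2 / 4)"
          using x by (simp add: normal_density_def real_sqrt_mult power_mult_distrib power_divide) (simp add: field_simps)
        moreover have "std_normal_density g \<le> 1 / sqrt (2 * pi)"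
          by (simp add: std_normal_density_def mult_left_le divide_right_mono)
        ultimately show ?thesis
          using mult_right_mono[of "std_normal_density g" "1 / sqrt (2 * pi)" "exp (- (g / x)\<^sup>2 / 4)"] by simp
      qed
      then show "AE g in lborel. std_normal_density g * exp (- (g / x)\<^sup>2 / 4) \<le> (sqrt 2 * x) * normal_density 0 (sqrt 2 * x) g" by simp
      show "AE g in lborel. 0 \<le> (sqrt 2 * x) * normal_density 0 (sqrt 2 * x) g"
        using x by (intro AE_I2 mult_nonneg_nonneg normal_density_nonneg) auto
    qed
    also have "\<dots> = sqrt 2 * x" using s by simp
    finally show ?thesis .
  qed
  finally show ?thesis by (simp add: algebra_simps)
qed

section \<open>Tilted continuity theorem and Gaussian quadrants\<close>

text \<open>Normalised by its mean, the weight W becomes a density, and the hypothesis says that the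
  characteristic functions of Y under the tilted measures converge. Levy's theorem in one dimension
  applies, and the half-line is a continuity set because \<open>Y'\<close> has no atom at 0. The
  lower bound 1 keeps the normalising constants away from 0.\<close>

lemma tilted_levy_continuity:
  fixes W Y :: "nat \<Rightarrow> 'a \<Rightarrow> real" and W' Y' :: "'b \<Rightarrow> real"
  assumes M: "prob_space M" and N: "prob_space N"
    and W: "\<And>n. W n \<in> borel_measurable M" "\<And>n \<omega>. 1 \<le> W n \<omega> \<and> W n \<omega> \<le> 3"
    and Y: "\<And>n. Y n \<in> borel_measurable M"
    and W': "W' \<in> borel_measurable N" "\<And>\<omega>. 1 \<le> W' \<omega> \<and> W' \<omega> \<le> 3"
    and Y': "Y' \<in> borel_measurable N" "AE \<omega> in N. Y' \<omega> \<noteq> 0"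
    and conv: "\<And>v. (\<lambda>n. CLINT \<omega>|M. W n \<omega> * iexp (v * Y n \<omega>)) \<longlonglongrightarrow> (CLINT \<omega>|N. W' \<omega> * iexp (v * Y' \<omega>))"
  shows "(\<lambda>n. LINT \<omega>|M. W n \<omega> * indicator {0<..} (Y n \<omega>)) \<longlonglongrightarrow> (LINT \<omega>|N. W' \<omega> * indicator {0<..} (Y' \<omega>))"
proof -
  have law: "0 < (LINT \<omega>|P. w \<omega>) \<and> real_distribution (distr (density P (\<lambda>\<omega>. ennreal (w \<omega> / (LINT \<omega>|P. w \<omega>)))) borel y) \<and>
      (\<forall>v. char (distr (density P (\<lambda>\<omega>. ennreal (w \<omega> / (LINT \<omega>|P. w \<omega>)))) borel y) v = (CLINT \<omega>|P. w \<omega> * iexp (v * y \<omega>)) / of_real (LINT \<omega>|P. w \<omega>)) \<and>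
      (\<forall>A\<in>sets borel. measure (distr (density P (\<lambda>\<omega>. ennreal (w \<omega> / (LINT \<omega>|P. w \<omega>)))) borel y) A = (LINT \<omega>|P. w \<omega> * indicator A (y \<omega>)) / (LINT \<omega>|P. w \<omega>))"
    if P: "prob_space P" and [measurable]: "w \<in> borel_measurable P" "y \<in> borel_measurable P" and w: "\<And>\<omega>. 1 \<le> w \<omega> \<and> w \<omega> \<le> 3"
    for P :: "'c measure" and w y :: "'c \<Rightarrow> real"
  proof -
    interpret P: prob_space P by (rule P)
    let ?c = "LINT \<omega>|P. w \<omega>"
    let ?D = "density P (\<lambda>\<omega>. ennreal (w \<omega> / ?c))"
    have wa: "\<bar>w \<omega>\<bar> \<le> 3" "0 \<le> w \<omega>" "0 < w \<omega>" for \<omega> using w[of \<omega>] by auto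
    have iw: "integrable P w" by (intro P.integrable_const_bound[where B = 3]) (use wa in auto)
    have "(LINT \<omega>|P. 1) \<le> ?c" by (intro integral_mono) (use iw w in auto)
    then have c: "0 < ?c" by (simp add: P.prob_space)
    have "emeasure ?D (space ?D) = (\<integral>\<^sup>+\<omega>. ennreal (w \<omega> / ?c) \<partial>P)"
      by (simp add: emeasure_density cong: nn_integral_cong)
    also have "\<dots> = ennreal (LINT \<omega>|P. w \<omega> / ?c)"
      by (rule nn_integral_eq_integral) (use iw c wa in auto)
    also have "\<dots> = 1" using c by simp
    finally have "emeasure ?D (space ?D) = 1" .
    then interpret D: prob_space ?D by (rule prob_spaceI)
    have y: "y \<in> borel_measurable ?D" by simp
    have rd: "real_distribution (distr ?D borel y)" by (rule D.real_distribution_distr) simp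
    have ch: "char (distr ?D borel y) v = (CLINT \<omega>|P. w \<omega> * iexp (v * y \<omega>)) / of_real ?c" for v
    proof -
      have "char (distr ?D borel y) v = (CLINT \<omega>|?D. iexp (v * y \<omega>))"
        unfolding char_def by (subst integral_distr) auto
      also have "\<dots> = (CLINT \<omega>|P. (w \<omega> / ?c) *\<^sub>R iexp (v * y \<omega>))"
        by (rule integral_density) (use c wa in auto)
      also have "\<dots> = (CLINT \<omega>|P. (w \<omega> * iexp (v * y \<omega>)) / of_real ?c)"
        by (simp add: scaleR_conv_of_real)
      finally show ?thesis by simp
    qed
    have me: "measure (distr ?D borel y) A = (LINT \<omega>|P. w \<omega> * indicator A (y \<omega>)) / ?c" if A[measurable]: "A \<in> sets borel" for A
    proof -
      interpret L: real_distribution "distr ?D borel y" by (rule rd)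
      have "measure (distr ?D borel y) A = (LINT x|distr ?D borel y. indicator A x)" by simp
      also have "\<dots> = (LINT \<omega>|?D. indicator A (y \<omega>))" by (subst integral_distr) auto
      also have "\<dots> = (LINT \<omega>|P. (w \<omega> / ?c) *\<^sub>R indicator A (y \<omega>))"
        by (rule integral_density) (use c wa in auto)
      also have "\<dots> = (LINT \<omega>|P. (w \<omega> * indicator A (y \<omega>)) / ?c)"
        by (simp add: mult.commute)
      finally show ?thesis by simp
    qed
    show ?thesis using c rd ch me by blast
  qed
  define c where "c n = (LINT \<omega>|M. W n \<omega>)" for n
  define c' where "c' = (LINT \<omega>|N. W' \<omega>)"
  define \<mu> where "\<mu> n = distr (density M (\<lambda>\<omega>. ennreal (W n \<omega> / c n))) borel (Y n)" for n
  define \<mu>' where "\<mu>' = distr (density N (\<lambda>\<omega>. ennreal (W' \<omega> / c'))) borel Y'"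
  have L: "0 < c n \<and> real_distribution (\<mu> n) \<and>
      (\<forall>v. char (\<mu> n) v = (CLINT \<omega>|M. W n \<omega> * iexp (v * Y n \<omega>)) / of_real (c n)) \<and>
      (\<forall>A\<in>sets borel. measure (\<mu> n) A = (LINT \<omega>|M. W n \<omega> * indicator A (Y n \<omega>)) / c n)" for n
    unfolding \<mu>_def c_def by (rule law[OF M W(1) Y W(2)])
  note L' = law[OF N W'(1) Y'(1) W'(2), folded c'_def, folded \<mu>'_def]
  have cc: "c \<longlonglongrightarrow> c'"
    using conv[of 0] unfolding c_def c'_def by (simp flip: of_real_mult add: tendsto_of_real_iff)
  have "weak_conv_m \<mu> \<mu>'"
  proof (rule levy_continuity)
    fix v
    have "(\<lambda>n. (CLINT \<omega>|M. W n \<omega> * iexp (v * Y n \<omega>)) / of_real (c n)) \<longlonglongrightarrow> (CLINT \<omega>|N. W' \<omega> * iexp (v * Y' \<omega>)) / of_real c'"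
      by (intro tendsto_divide tendsto_of_real conv cc) (use L' in auto)
    then show "(\<lambda>n. char (\<mu> n) v) \<longlonglongrightarrow> char \<mu>' v" using L L' by simp
  qed (use L L' in auto)
  moreover have "emeasure \<mu>' (frontier {0<..}) = 0"
  proof -
    have "frontier {0<..} = {0::real}" by (auto simp: frontier_def interior_open)
    moreover interpret L: real_distribution \<mu>' using L' by blast
    have "measure \<mu>' {0} = (LINT \<omega>|N. W' \<omega> * indicator {0} (Y' \<omega>)) / c'" using L' by simp
    moreover have "(LINT \<omega>|N. W' \<omega> * indicator {0} (Y' \<omega>)) = (LINT \<omega>|N. 0)"
      by (rule integral_cong_AE) (use Y' W' in \<open>auto simp: indicator_def elim: eventually_mono\<close>)
    ultimately show ?thesis by (simp add: L.emeasure_eq_measure)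
  qed
  ultimately have "(\<lambda>n. measure (\<mu> n) {0<..}) \<longlonglongrightarrow> measure \<mu>' {0<..}"
    using L L' by (intro weak_conv_imp_continuity_set_conv) auto
  then have "(\<lambda>n. c n * measure (\<mu> n) {0<..}) \<longlonglongrightarrow> c' * measure \<mu>' {0<..}"
    by (intro tendsto_mult cc)
  moreover have "c n * measure (\<mu> n) {0<..} = (LINT \<omega>|M. W n \<omega> * indicator {0<..} (Y n \<omega>))" for n
    using L[of n] by simp
  moreover have "c' * measure \<mu>' {0<..} = (LINT \<omega>|N. W' \<omega> * indicator {0<..} (Y' \<omega>))"
    using L' by simp
  ultimately show ?thesis by simp
qed

text \<open>Two applications of the tilted continuity theorem replace a two-dimensional one: first
  \<open>Y\<close> is tilted by \<open>2 + cos (u X)\<close> and \<open>2 + sin (u X)\<close>, then \<open>X\<close> by \<open>1 + indicator (Y > 0)\<close>.\<close>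

lemma quadrant_convergence:
  fixes X Y :: "nat \<Rightarrow> 'a \<Rightarrow> real" and X' Y' :: "'b \<Rightarrow> real"
  assumes M: "prob_space M" and N: "prob_space N"
    and XY [measurable]: "\<And>n. X n \<in> borel_measurable M" "\<And>n. Y n \<in> borel_measurable M"
    and XY' [measurable]: "X' \<in> borel_measurable N" "Y' \<in> borel_measurable N"
    and nz: "AE \<omega> in N. X' \<omega> \<noteq> 0" "AE \<omega> in N. Y' \<omega> \<noteq> 0"
    and conv: "\<And>u v. (\<lambda>n. CLINT \<omega>|M. iexp (u * X n \<omega> + v * Y n \<omega>)) \<longlonglongrightarrow> (CLINT \<omega>|N. iexp (u * X' \<omega> + v * Y' \<omega>))"
  shows "(\<lambda>n. measure M {\<omega>\<in>space M. 0 < X n \<omega> \<and> 0 < Y n \<omega>}) \<longlonglongrightarrow> measure N {\<omega>\<in>space N. 0 < X' \<omega> \<and> 0 < Y' \<omega>}"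
proof -
  interpret M: prob_space M by (rule M)
  interpret N: prob_space N by (rule N)
  define E where "E n u v = (CLINT \<omega>|M. iexp (u * X n \<omega> + v * Y n \<omega>))" for n u v
  define E' where "E' u v = (CLINT \<omega>|N. iexp (u * X' \<omega> + v * Y' \<omega>))" for u v
  have E: "(\<lambda>n. E n u v) \<longlonglongrightarrow> E' u v" for u v unfolding E_def E'_def by (rule conv)
  \<comment> \<open>With a trigonometric weight, the tilted characteristic function of Y is a
    combination of joint ones at (0, v), (u, v) and (-u, v), whose convergence is assumed.\<close>
  have expand:
    "(CLINT \<omega>|P. complex_of_real (2 + cos (u * x \<omega>)) * iexp (v * y \<omega>)) = 2 * (CLINT \<omega>|P. iexp (0 * x \<omega> + v * y \<omega>))
       + ((CLINT \<omega>|P. iexp (u * x \<omega> + v * y \<omega>)) + (CLINT \<omega>|P. iexp (- u * x \<omega> + v * y \<omega>))) / 2"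
    "(CLINT \<omega>|P. complex_of_real (2 + sin (u * x \<omega>)) * iexp (v * y \<omega>)) = 2 * (CLINT \<omega>|P. iexp (0 * x \<omega> + v * y \<omega>))
       + ((CLINT \<omega>|P. iexp (u * x \<omega> + v * y \<omega>)) - (CLINT \<omega>|P. iexp (- u * x \<omega> + v * y \<omega>))) / (2 * \<i>)"
    if P: "prob_space P" and [measurable]: "x \<in> borel_measurable P" "y \<in> borel_measurable P"
    for P :: "'c measure" and x y u v
  proof -
    interpret P: prob_space P by (rule P)
    have i: "integrable P (\<lambda>\<omega>. iexp (u * x \<omega> + v * y \<omega>))" for u v
      by (rule P.integrable_const_bound[where B = 1]) auto
    have e: "iexp (0 * x \<omega> + v * y \<omega>) = iexp (v * y \<omega>)" "iexp (u * x \<omega> + v * y \<omega>) = iexp (u * x \<omega>) * iexp (v * y \<omega>)"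
       "iexp (- u * x \<omega> + v * y \<omega>) = iexp (- u * x \<omega>) * iexp (v * y \<omega>)" for \<omega>
      by (simp_all add: exp_add[symmetric] algebra_simps)
    have c: "complex_of_real (2 + cos (u * x \<omega>)) * iexp (v * y \<omega>) = 2 * iexp (0 * x \<omega> + v * y \<omega>) + (iexp (u * x \<omega> + v * y \<omega>) + iexp (- u * x \<omega> + v * y \<omega>)) / 2" for \<omega>
    proof -
      have "complex_of_real (cos (u * x \<omega>)) = (iexp (u * x \<omega>) + iexp (- u * x \<omega>)) / 2"
        unfolding cos_of_real[symmetric] cos_exp_eq by simp
      then have "complex_of_real (2 + cos (u * x \<omega>)) = 2 + (iexp (u * x \<omega>) + iexp (- u * x \<omega>)) / 2"
        by (simp only: of_real_add of_real_numeral)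
      then show ?thesis unfolding e by (simp only: distrib_right times_divide_eq_left left_diff_distrib)
    qed
    have s: "complex_of_real (2 + sin (u * x \<omega>)) * iexp (v * y \<omega>) = 2 * iexp (0 * x \<omega> + v * y \<omega>) + (iexp (u * x \<omega> + v * y \<omega>) - iexp (- u * x \<omega> + v * y \<omega>)) / (2 * \<i>)" for \<omega>
    proof -
      have "complex_of_real (sin (u * x \<omega>)) = (iexp (u * x \<omega>) - iexp (- u * x \<omega>)) / (2 * \<i>)"
        unfolding sin_of_real[symmetric] sin_exp_eq by simp
      then have "complex_of_real (2 + sin (u * x \<omega>)) = 2 + (iexp (u * x \<omega>) - iexp (- u * x \<omega>)) / (2 * \<i>)"
        by (simp only: of_real_add of_real_numeral)
      then show ?thesis unfolding e by (simp only: distrib_right times_divide_eq_left left_diff_distrib)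
    qed
    show "(CLINT \<omega>|P. complex_of_real (2 + cos (u * x \<omega>)) * iexp (v * y \<omega>)) = 2 * (CLINT \<omega>|P. iexp (0 * x \<omega> + v * y \<omega>))
       + ((CLINT \<omega>|P. iexp (u * x \<omega> + v * y \<omega>)) + (CLINT \<omega>|P. iexp (- u * x \<omega> + v * y \<omega>))) / 2"
      unfolding c using i[of 0 v] i[of u v] i[of "-u" v] by (simp del: of_real_mult of_real_add of_real_minus)
    show "(CLINT \<omega>|P. complex_of_real (2 + sin (u * x \<omega>)) * iexp (v * y \<omega>)) = 2 * (CLINT \<omega>|P. iexp (0 * x \<omega> + v * y \<omega>))
       + ((CLINT \<omega>|P. iexp (u * x \<omega> + v * y \<omega>)) - (CLINT \<omega>|P. iexp (- u * x \<omega> + v * y \<omega>))) / (2 * \<i>)"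
      unfolding s using i[of 0 v] i[of u v] i[of "-u" v] by (simp del: of_real_mult of_real_add of_real_minus)
  qed
  have b13: "1 \<le> 2 + cos z \<and> 2 + cos z \<le> 3" "1 \<le> 2 + sin z \<and> 2 + sin z \<le> 3" for z :: real
    using cos_ge_minus_one[of z] sin_ge_minus_one[of z] cos_le_one[of z] sin_le_one[of z] by linarith+
  have cosc: "(\<lambda>n. LINT \<omega>|M. (2 + cos (u * X n \<omega>)) * indicator {0<..} (Y n \<omega>)) \<longlonglongrightarrow> (LINT \<omega>|N. (2 + cos (u * X' \<omega>)) * indicator {0<..} (Y' \<omega>))" for u
  proof (rule tilted_levy_continuity[OF M N _ b13(1) XY(2) _ b13(1) XY'(2) nz(2)])
    fix v
    show "(\<lambda>n. CLINT \<omega>|M. complex_of_real (2 + cos (u * X n \<omega>)) * iexp (v * Y n \<omega>)) \<longlonglongrightarrow> (CLINT \<omega>|N. complex_of_real (2 + cos (u * X' \<omega>)) * iexp (v * Y' \<omega>))"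
      unfolding expand(1)[OF M XY] expand(1)[OF N XY'] unfolding E_def[symmetric] E'_def[symmetric]
      by (intro tendsto_intros E) auto
  qed measurable
  have sinc: "(\<lambda>n. LINT \<omega>|M. (2 + sin (u * X n \<omega>)) * indicator {0<..} (Y n \<omega>)) \<longlonglongrightarrow> (LINT \<omega>|N. (2 + sin (u * X' \<omega>)) * indicator {0<..} (Y' \<omega>))" for u
  proof (rule tilted_levy_continuity[OF M N _ b13(2) XY(2) _ b13(2) XY'(2) nz(2)])
    fix v
    show "(\<lambda>n. CLINT \<omega>|M. complex_of_real (2 + sin (u * X n \<omega>)) * iexp (v * Y n \<omega>)) \<longlonglongrightarrow> (CLINT \<omega>|N. complex_of_real (2 + sin (u * X' \<omega>)) * iexp (v * Y' \<omega>))"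
      unfolding expand(2)[OF M XY] expand(2)[OF N XY'] unfolding E_def[symmetric] E'_def[symmetric]
      by (intro tendsto_intros E) auto
  qed measurable
  \<comment> \<open>\<open>sin (0 * x)\<close> is 0, so the subtracted integrals remove the constant
    2 from the weights and leave the real and imaginary parts of the transform of X on the event
    \<open>0 < y\<close>.\<close>
  have split: "(CLINT \<omega>|P. complex_of_real (1 + indicator {0<..} (y \<omega>)) * iexp (u * x \<omega>)) =
      (CLINT \<omega>|P. iexp (u * x \<omega> + 0 * y \<omega>)) +
      (of_real ((LINT \<omega>|P. (2 + cos (u * x \<omega>)) * indicator {0<..} (y \<omega>)) - (LINT \<omega>|P. (2 + sin (0 * x \<omega>)) * indicator {0<..} (y \<omega>)))
       + \<i> * of_real ((LINT \<omega>|P. (2 + sin (u * x \<omega>)) * indicator {0<..} (y \<omega>)) - (LINT \<omega>|P. (2 + sin (0 * x \<omega>)) * indicator {0<..} (y \<omega>))))"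
    if P: "prob_space P" and [measurable]: "x \<in> borel_measurable P" "y \<in> borel_measurable P"
    for P :: "'c measure" and x y u
  proof -
    interpret P: prob_space P by (rule P)
    let ?I = "\<lambda>\<omega>. indicator {0<..} (y \<omega>) :: real"
    have i: "integrable P (\<lambda>\<omega>. iexp (u * x \<omega>))" "integrable P (\<lambda>\<omega>. cos (u * x \<omega>) * ?I \<omega>)" "integrable P (\<lambda>\<omega>. sin (u * x \<omega>) * ?I \<omega>)" "integrable P ?I"
      by (rule P.integrable_const_bound[where B = 1], auto simp: indicator_def)+
    have e: "complex_of_real (1 + ?I \<omega>) * iexp (u * x \<omega>) = iexp (u * x \<omega>) + (of_real (cos (u * x \<omega>) * ?I \<omega>) + \<i> * of_real (sin (u * x \<omega>) * ?I \<omega>))" for \<omega>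
    proof -
      have "iexp t = of_real (cos t) + \<i> * of_real (sin t)" for t
        by (simp add: exp_Euler cos_of_real sin_of_real)
      then have "iexp (u * x \<omega>) = of_real (cos (u * x \<omega>)) + \<i> * of_real (sin (u * x \<omega>))" .
      then show ?thesis by (simp only: of_real_add of_real_1 of_real_mult[of _ "?I \<omega>"]) (simp only: algebra_simps mult_1_left mult_1_right)
    qed
    have "(CLINT \<omega>|P. complex_of_real (1 + ?I \<omega>) * iexp (u * x \<omega>)) = (CLINT \<omega>|P. iexp (u * x \<omega>)) +
       (of_real (LINT \<omega>|P. cos (u * x \<omega>) * ?I \<omega>) + \<i> * of_real (LINT \<omega>|P. sin (u * x \<omega>) * ?I \<omega>))"
      unfolding e using i by (simp del: of_real_mult)
    then show ?thesis using i by (simp add: distrib_right)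
  qed
  have conv2: "(\<lambda>n. LINT \<omega>|M. (1 + indicator {0<..} (Y n \<omega>) :: real) * indicator {0<..} (X n \<omega>)) \<longlonglongrightarrow> (LINT \<omega>|N. (1 + indicator {0<..} (Y' \<omega>)) * indicator {0<..} (X' \<omega>))"
  proof (rule tilted_levy_continuity[OF M N _ _ XY(1) _ _ XY'(1) nz(1)])
    fix u
    show "(\<lambda>n. CLINT \<omega>|M. complex_of_real (1 + indicator {0<..} (Y n \<omega>)) * iexp (u * X n \<omega>)) \<longlonglongrightarrow> (CLINT \<omega>|N. complex_of_real (1 + indicator {0<..} (Y' \<omega>)) * iexp (u * X' \<omega>))"
      unfolding split[OF M XY] split[OF N XY']
      by (intro tendsto_intros cosc sinc conv)
  qed (auto simp: indicator_def)
  have conv1: "(\<lambda>n. LINT \<omega>|M. (1 :: real) * indicator {0<..} (X n \<omega>)) \<longlonglongrightarrow> (LINT \<omega>|N. 1 * indicator {0<..} (X' \<omega>))"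
    by (rule tilted_levy_continuity[OF M N _ _ XY(1) _ _ XY'(1) nz(1)]) (use conv[of _ 0] in auto)
  \<comment> \<open>With I and J the indicators of \<open>0 < y\<close> and \<open>0 < x\<close>,
    this is \<open>(1 + I) * J - J = I * J\<close>.\<close>
  have fin: "(LINT \<omega>|P. (1 + indicator {0<..} (y \<omega>) :: real) * indicator {0<..} (x \<omega>)) - (LINT \<omega>|P. 1 * indicator {0<..} (x \<omega>)) =
      measure P {\<omega>\<in>space P. 0 < x \<omega> \<and> 0 < y \<omega>}"
    if P: "prob_space P" and [measurable]: "x \<in> borel_measurable P" "y \<in> borel_measurable P"
    for P :: "'c measure" and x y :: "'c \<Rightarrow> real"
  proof -
    interpret P: prob_space P by (rule P)
    let ?I = "\<lambda>\<omega>. indicator {0<..} (y \<omega>) :: real" let ?J = "\<lambda>\<omega>. indicator {0<..} (x \<omega>) :: real"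
    have i: "integrable P ?J" "integrable P (\<lambda>\<omega>. ?I \<omega> * ?J \<omega>)"
      by (rule P.integrable_const_bound[where B = 1], auto simp: indicator_def)+
    have "(LINT \<omega>|P. ?I \<omega> * ?J \<omega>) = (LINT \<omega>|P. indicator {\<omega>\<in>space P. 0 < x \<omega> \<and> 0 < y \<omega>} \<omega>)"
      by (intro Bochner_Integration.integral_cong) (auto simp: indicator_def)
    then show ?thesis using i by (simp add: distrib_right Int_def cong: conj_cong)
  qed
  show ?thesis using tendsto_diff[OF conv2 conv1] unfolding fin[OF M XY] fin[OF N XY'] .
qed

section \<open>Gaussian pairs and their quadrant probability\<close>

abbreviation (input) "gauss2 \<equiv> std_normal_distribution \<Otimes>\<^sub>M std_normal_distribution"

lemma AE_std_normal_neq: "AE y in std_normal_distribution. y \<noteq> c"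
  by (subst AE_density) (use AE_lborel_singleton[of c] in auto)

lemma prob_space_gauss2: "prob_space gauss2"
proof -
  interpret N: real_distribution std_normal_distribution by (rule real_dist_normal_dist)
  interpret P: pair_prob_space std_normal_distribution std_normal_distribution ..
  show ?thesis by (rule P.prob_space_axioms)
qed

lemma AE_gauss2_neq:
  assumes "s \<noteq> 0"
  shows "AE p in gauss2. fst p \<noteq> 0" "AE p in gauss2. r * fst p + s * snd p \<noteq> (0::real)"
proof -
  interpret N: real_distribution std_normal_distribution by (rule real_dist_normal_dist)
  interpret P: pair_prob_space std_normal_distribution std_normal_distribution ..
  have "AE x in std_normal_distribution. AE y in std_normal_distribution. fst (x, y) \<noteq> (0::real)"
    using AE_std_normal_neq[of 0] by auto
  then show "AE p in gauss2. fst p \<noteq> 0"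
    by (rule P.AE_pair_measure[rotated]) measurable
  have "AE y in std_normal_distribution. r * x + s * y \<noteq> 0" for x
    using AE_std_normal_neq[of "- r * x / s"]
  proof eventually_elim
    case (elim y)
    show ?case
    proof
      assume "r * x + s * y = 0"
      then have "s * y = - r * x" by simp
      then show False using elim assms by (simp add: field_simps)
    qed
  qed
  then have "AE x in std_normal_distribution. AE y in std_normal_distribution. r * fst (x, y) + s * snd (x, y) \<noteq> 0"
    by simp
  then show "AE p in gauss2. r * fst p + s * snd p \<noteq> (0::real)"
    by (rule P.AE_pair_measure[rotated]) measurable
qed

lemma char_gauss2:
  assumes "r\<^sup>2 < 1"
  shows "(CLINT p|gauss2. iexp (u * fst p + v * (r * fst p + sqrt (1 - r\<^sup>2) * snd p))) = of_real (exp (- (u\<^sup>2 + v\<^sup>2 + 2 * u * v * r) / 2))"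
proof -
  interpret N: real_distribution std_normal_distribution by (rule real_dist_normal_dist)
  interpret P: pair_prob_space std_normal_distribution std_normal_distribution ..
  let ?s = "sqrt (1 - r\<^sup>2)"
  have i: "integrable gauss2 (\<lambda>p. iexp (u * fst p + v * (r * fst p + ?s * snd p)))"
    by (rule P.integrable_const_bound[where B = 1]) auto
  have "(CLINT p|gauss2. iexp (u * fst p + v * (r * fst p + ?s * snd p))) =
     (CLINT x|std_normal_distribution. (CLINT y|std_normal_distribution. iexp ((u + v * r) * x) * iexp ((v * ?s) * y)))"
    using P.integral_fst'[OF i] by (simp add: exp_add[symmetric] algebra_simps)
  also have "\<dots> = (CLINT x|std_normal_distribution. iexp ((u + v * r) * x)) * (CLINT y|std_normal_distribution. iexp ((v * ?s) * y))"
    by (simp only: integral_mult_right_zero integral_mult_left_zero)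
  also have "\<dots> = of_real (exp (- (u + v * r)\<^sup>2 / 2)) * of_real (exp (- (v * ?s)\<^sup>2 / 2))"
    using fun_cong[OF char_std_normal_distribution, of "u + v * r"] fun_cong[OF char_std_normal_distribution, of "v * ?s"]
    unfolding char_def by (simp only:)
  also have "\<dots> = of_real (exp (- (u + v * r)\<^sup>2 / 2 + - (v * ?s)\<^sup>2 / 2))"
    by (simp only: exp_add of_real_mult)
  also have "- (u + v * r)\<^sup>2 / 2 + - (v * ?s)\<^sup>2 / 2 = - (u\<^sup>2 + v\<^sup>2 + 2 * u * v * r) / 2"
    using assms by (simp add: power_mult_distrib) (simp add: power2_eq_square field_simps)
  finally show ?thesis .
qed

lemma nn_integral_radial_gauss:
  assumes c: "0 < c"
  shows "(\<integral>\<^sup>+x. ennreal (x * exp (- x\<^sup>2 * c / 2)) * indicator {0..} x \<partial>lborel) = ennreal (1 / c)"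
proof -
  let ?F = "\<lambda>x. - exp (- x\<^sup>2 * c / 2) / c"
  have "(\<integral>\<^sup>+x. ennreal (x * exp (- x\<^sup>2 * c / 2)) * indicator {0..} x \<partial>lborel) = ennreal (0 - ?F 0)"
  proof (rule nn_integral_FTC_atLeast)
    show "(?F has_real_derivative x * exp (- x\<^sup>2 * c / 2)) (at x)" for x
      using c by (auto intro!: derivative_eq_intros)
    show "(?F \<longlongrightarrow> 0) at_top" using c by real_asymp
  qed auto
  then show ?thesis by simp
qed

text \<open>Sheppard's formula. The substitution \<open>y = x * w\<close> turns the quadrant into
  \<open>w > - \<alpha>\<close> and the joint density into
  \<open>x * exp (- x^2 * (1 + w^2) / 2) / (2 * pi)\<close>; integrating over x first leaves
  \<open>1 / (2 * pi * (1 + w^2))\<close>, with an arc tangent as primitive.\<close>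

lemma gauss2_quadrant:
  assumes r: "r\<^sup>2 < 1"
  shows "measure gauss2 {p\<in>space gauss2. 0 < fst p \<and> 0 < r * fst p + sqrt (1 - r\<^sup>2) * snd p} = 1 / 4 + arctan (r / sqrt (1 - r\<^sup>2)) / (2 * pi)"
proof -
  interpret N: real_distribution std_normal_distribution by (rule real_dist_normal_dist)
  interpret P: pair_prob_space std_normal_distribution std_normal_distribution ..
  define s where "s = sqrt (1 - r\<^sup>2)"
  have s: "0 < s" using r by (simp add: s_def)
  define \<alpha> where "\<alpha> = r / s"
  let ?A = "{p\<in>space gauss2. 0 < fst p \<and> 0 < r * fst p + s * snd p}"
  have A: "?A \<in> sets gauss2" by measurable
  let ?d = std_normal_density
  have slice: "emeasure std_normal_distribution (Pair x -` ?A) = (\<integral>\<^sup>+w. ennreal (x * ?d (x * w)) * indicator {- \<alpha> <..} w \<partial>lborel)" if "0 < x" for x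
  proof -
    have "Pair x -` ?A = {y. 0 < r * x + s * y}" using that by (auto simp: space_pair_measure)
    also have "\<dots> = {- \<alpha> * x <..}" using s by (auto simp: \<alpha>_def field_simps)
    finally have "emeasure std_normal_distribution (Pair x -` ?A) = (\<integral>\<^sup>+y. ennreal (?d y) * indicator {- \<alpha> * x <..} y \<partial>lborel)"
      by (simp add: emeasure_density)
    also have "\<dots> = \<bar>x\<bar> * (\<integral>\<^sup>+w. ennreal (?d (0 + x * w)) * indicator {- \<alpha> * x <..} (0 + x * w) \<partial>lborel)"
      by (rule nn_integral_real_affine) (use that in auto)
    also have "\<dots> = (\<integral>\<^sup>+w. \<bar>x\<bar> * (ennreal (?d (0 + x * w)) * indicator {- \<alpha> * x <..} (0 + x * w)) \<partial>lborel)"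
      by (rule nn_integral_cmult[symmetric]) measurable
    also have "\<dots> = (\<integral>\<^sup>+w. ennreal (x * ?d (x * w)) * indicator {- \<alpha> <..} w \<partial>lborel)"
    proof (rule nn_integral_cong)
      fix w
      have "(- \<alpha> * x < x * w) = (- \<alpha> < w)" using that mult_less_cancel_left_pos[of x "- \<alpha>" w] by (simp add: mult.commute)
      then show "\<bar>x\<bar> * (ennreal (?d (0 + x * w)) * indicator {- \<alpha> * x <..} (0 + x * w)) = ennreal (x * ?d (x * w)) * indicator {- \<alpha> <..} w"
        using that by (simp add: indicator_def ennreal_mult' mult.assoc[symmetric])
    qed
    finally show ?thesis .
  qed
  have dens: "?d x * (x * ?d (x * w)) = 1 / (2 * pi) * (x * exp (- x\<^sup>2 * (1 + w\<^sup>2) / 2))" for x w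
  proof -
    have "?d x * ?d (x * w) = (1 / sqrt (2 * pi) * (1 / sqrt (2 * pi))) * (exp (- x\<^sup>2 / 2) * exp (- (x * w)\<^sup>2 / 2))"
      by (simp add: std_normal_density_def)
    also have "\<dots> = 1 / (2 * pi) * exp (- x\<^sup>2 / 2 + - (x * w)\<^sup>2 / 2)"
      by (simp add: exp_add[symmetric])
    also have "- x\<^sup>2 / 2 + - (x * w)\<^sup>2 / 2 = - x\<^sup>2 * (1 + w\<^sup>2) / 2"
      by (simp add: power_mult_distrib field_simps)
    finally have "x * (?d x * ?d (x * w)) = x * (1 / (2 * pi) * exp (- x\<^sup>2 * (1 + w\<^sup>2) / 2))" by (rule arg_cong)
    then show ?thesis by (simp only: mult_ac)
  qed
  have "emeasure gauss2 ?A = (\<integral>\<^sup>+x. emeasure std_normal_distribution (Pair x -` ?A) \<partial>std_normal_distribution)"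
    by (rule N.emeasure_pair_measure_alt[OF A])
  also have "\<dots> = (\<integral>\<^sup>+x. ennreal (?d x) * emeasure std_normal_distribution (Pair x -` ?A) \<partial>lborel)"
    by (rule nn_integral_density) (use N.measurable_emeasure_Pair[OF A] in auto)
  also have "\<dots> = (\<integral>\<^sup>+x. (\<integral>\<^sup>+w. ennreal (1 / (2 * pi)) * (ennreal (x * exp (- x\<^sup>2 * (1 + w\<^sup>2) / 2)) * indicator {0..} x * indicator {- \<alpha> <..} w) \<partial>lborel) \<partial>lborel)"
  proof (rule nn_integral_cong)
    fix x :: real
    show "ennreal (?d x) * emeasure std_normal_distribution (Pair x -` ?A) = (\<integral>\<^sup>+w. ennreal (1 / (2 * pi)) * (ennreal (x * exp (- x\<^sup>2 * (1 + w\<^sup>2) / 2)) * indicator {0..} x * indicator {- \<alpha> <..} w) \<partial>lborel)"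
    proof (cases "0 < x")
      case True
      have "ennreal (?d x) * emeasure std_normal_distribution (Pair x -` ?A) = (\<integral>\<^sup>+w. ennreal (?d x) * (ennreal (x * ?d (x * w)) * indicator {- \<alpha> <..} w) \<partial>lborel)"
        unfolding slice[OF True] by (rule nn_integral_cmult[symmetric]) measurable
      also have "\<dots> = (\<integral>\<^sup>+w. ennreal (1 / (2 * pi)) * (ennreal (x * exp (- x\<^sup>2 * (1 + w\<^sup>2) / 2)) * indicator {0..} x * indicator {- \<alpha> <..} w) \<partial>lborel)"
      proof (rule nn_integral_cong)
        fix w
        have "ennreal (?d x) * ennreal (x * ?d (x * w)) = ennreal (1 / (2 * pi)) * ennreal (x * exp (- x\<^sup>2 * (1 + w\<^sup>2) / 2))"
          using True by (subst (1 2) ennreal_mult'[symmetric]) (simp_all only: dens, auto)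
        then show "ennreal (?d x) * (ennreal (x * ?d (x * w)) * indicator {- \<alpha> <..} w) = ennreal (1 / (2 * pi)) * (ennreal (x * exp (- x\<^sup>2 * (1 + w\<^sup>2) / 2)) * indicator {0..} x * indicator {- \<alpha> <..} w)"
          using True by (simp add: mult.assoc[symmetric])
      qed
      finally show ?thesis .
    next
      case False
      then have "Pair x -` ?A = {}" by auto
      then have L: "emeasure std_normal_distribution (Pair x -` ?A) = 0" by (simp only: emeasure_empty)
      have z: "ennreal (x * exp (- x\<^sup>2 * (1 + w\<^sup>2) / 2)) * indicator {0..} x = 0" for w
        using False by (cases "x = 0") auto
      show ?thesis unfolding L z by simp
    qed
  qed
  also have "\<dots> = (\<integral>\<^sup>+w. (\<integral>\<^sup>+x. ennreal (1 / (2 * pi)) * (ennreal (x * exp (- x\<^sup>2 * (1 + w\<^sup>2) / 2)) * indicator {0..} x * indicator {- \<alpha> <..} w) \<partial>lborel) \<partial>lborel)"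
    by (rule lborel_pair.Fubini'[symmetric]) measurable
  also have "\<dots> = (\<integral>\<^sup>+w. ennreal (1 / (2 * pi) * (1 / (1 + w\<^sup>2))) * indicator {- \<alpha> <..} w \<partial>lborel)"
  proof (rule nn_integral_cong)
    fix w
    have "(\<integral>\<^sup>+x. ennreal (1 / (2 * pi)) * (ennreal (x * exp (- x\<^sup>2 * (1 + w\<^sup>2) / 2)) * indicator {0..} x * indicator {- \<alpha> <..} w) \<partial>lborel)
      = ennreal (1 / (2 * pi)) * (ennreal (1 / (1 + w\<^sup>2)) * indicator {- \<alpha> <..} w)"
    proof -
      have "0 < 1 + w\<^sup>2" by (simp add: add_pos_nonneg)
      note nn_integral_radial_gauss[OF this, simplified]
      then show ?thesis by (simp add: nn_integral_cmult nn_integral_multc)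
    qed
    then show "(\<integral>\<^sup>+x. ennreal (1 / (2 * pi)) * (ennreal (x * exp (- x\<^sup>2 * (1 + w\<^sup>2) / 2)) * indicator {0..} x * indicator {- \<alpha> <..} w) \<partial>lborel)
      = ennreal (1 / (2 * pi) * (1 / (1 + w\<^sup>2))) * indicator {- \<alpha> <..} w"
      by (subst ennreal_mult') (auto simp: mult.assoc)
  qed
  also have "\<dots> = (\<integral>\<^sup>+w. ennreal (1 / (2 * pi) * (1 / (1 + w\<^sup>2))) * indicator {- \<alpha> ..} w \<partial>lborel)"
    by (rule nn_integral_cong_AE) (use AE_lborel_singleton[of "- \<alpha>"] in \<open>auto simp: indicator_def elim!: eventually_mono\<close>)
  also have "\<dots> = ennreal (1 / (2 * pi) * (pi / 2) - 1 / (2 * pi) * arctan (- \<alpha>))"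
  proof (rule nn_integral_FTC_atLeast)
    show "((\<lambda>w. 1 / (2 * pi) * arctan w) has_real_derivative 1 / (2 * pi) * (1 / (1 + w\<^sup>2))) (at w)" for w
      by (auto intro!: derivative_eq_intros simp: inverse_eq_divide)
    show "0 \<le> 1 / (2 * pi) * (1 / (1 + w\<^sup>2))" for w :: real by simp
    show "((\<lambda>w. 1 / (2 * pi) * arctan w) \<longlongrightarrow> 1 / (2 * pi) * (pi / 2)) at_top"
      by (intro tendsto_mult_left tendsto_arctan_at_top)
  qed simp
  also have "1 / (2 * pi) * (pi / 2) - 1 / (2 * pi) * arctan (- \<alpha>) = 1 / 4 + arctan \<alpha> / (2 * pi)"
    by (simp add: arctan_minus)
  finally have "ennreal (measure gauss2 ?A) = ennreal (1 / 4 + arctan \<alpha> / (2 * pi))"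
    by (simp add: P.emeasure_eq_measure)
  moreover have "0 \<le> 1 / 4 + arctan \<alpha> / (2 * pi)"
    using arctan_lbound[of \<alpha>] by (simp add: field_simps)
  ultimately show ?thesis by (simp add: \<alpha>_def s_def)
qed

section \<open>Normalisation and small balls\<close>

definition ens_re :: "ensemble \<Rightarrow> nat \<Rightarrow> (nat \<Rightarrow> real) \<Rightarrow> real \<Rightarrow> real" where
  "ens_re e n x t = (\<Sum>k. ens_coeff e n k * x k * t ^ k)"

text \<open>The almost sure event on which all arguments about a single realisation take place:
  absolute convergence on the whole domain, and with it holomorphy.\<close>

definition ens_good :: "ensemble \<Rightarrow> nat \<Rightarrow> (nat \<Rightarrow> real) \<Rightarrow> bool" where
  "ens_good e n x \<longleftrightarrow> (\<forall>r. 0 \<le> r \<longrightarrow> (e = HAF \<longrightarrow> r < 1) \<longrightarrow> summable (\<lambda>k. ens_coeff e n k * r ^ k * \<bar>x k\<bar>))"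

lemma ens_good_sums:
  assumes "ens_good e n x" "e = HAF \<longrightarrow> norm z < 1"
  shows "(\<lambda>k. complex_of_real (ens_coeff e n k * x k) * z ^ k) sums ens_fun e n x z"
proof -
  have "summable (\<lambda>k. ens_coeff e n k * norm z ^ k * \<bar>x k\<bar>)"
    using assms unfolding ens_good_def by (metis norm_ge_zero)
  then have "summable (\<lambda>k. norm (complex_of_real (ens_coeff e n k * x k) * z ^ k))"
    by (simp add: norm_mult norm_power mult_ac)
  then show ?thesis unfolding ens_fun_def by (intro summable_sums) (rule summable_norm_cancel)
qed

lemma ens_good_holomorphic:
  assumes "ens_good e n x" "e = HAF \<longrightarrow> norm c + R \<le> 1"
  shows "ens_fun e n x holomorphic_on ball c R"
proof -
  have "ens_fun e n x holomorphic_on ball 0 (norm c + R)"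
  proof (rule power_series_holomorphic)
    fix w :: complex assume "w \<in> ball 0 (norm c + R)"
    then show "(\<lambda>k. complex_of_real (ens_coeff e n k * x k) * (w - 0) ^ k) sums ens_fun e n x w"
      using ens_good_sums[OF assms(1), of w] assms(2) by auto
  qed
  moreover have "ball c R \<subseteq> ball 0 (norm c + R)"
  proof
    fix z assume "z \<in> ball c R"
    then show "z \<in> ball 0 (norm c + R)"
      using norm_triangle_ineq[of c "z - c"] by (auto simp: dist_norm norm_minus_commute)
  qed
  ultimately show ?thesis by (rule holomorphic_on_subset)
qed

lemma ens_fun_of_real:
  assumes "ens_good e n x" "e = HAF \<longrightarrow> \<bar>t\<bar> < 1"
  shows "ens_fun e n x (of_real t) = of_real (ens_re e n x t)"
    "(\<lambda>k. ens_coeff e n k * x k * t ^ k) sums ens_re e n x t"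
proof -
  have s: "(\<lambda>k. complex_of_real (ens_coeff e n k * x k * t ^ k)) sums ens_fun e n x (of_real t)"
    using ens_good_sums[OF assms(1), of "of_real t"] assms(2) by simp
  then have "summable (\<lambda>k. ens_coeff e n k * x k * t ^ k)"
    using sums_summable summable_of_real_iff by blast
  then show 1: "(\<lambda>k. ens_coeff e n k * x k * t ^ k) sums ens_re e n x t"
    unfolding ens_re_def by (rule summable_sums)
  show "ens_fun e n x (of_real t) = of_real (ens_re e n x t)"
    using sums_unique2[OF s sums_of_real[OF 1]] .
qed

text \<open>Coefficients of \<open>P n t\<close> divided by its standard deviation: a unit vector in
  l^2, and the inner product of two such vectors is the correlation of the values.\<close>

definition ens_unit :: "ensemble \<Rightarrow> nat \<Rightarrow> real \<Rightarrow> nat \<Rightarrow> real" where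
  "ens_unit e n t k = ens_coeff e n k * t ^ k / sqrt (ens_ker e n (t\<^sup>2))"

lemma ens_unit_square:
  assumes "n \<ge> 1" "e = HAF \<longrightarrow> \<bar>t\<bar> < 1"
  shows "(ens_unit e n t k)\<^sup>2 = ens_prob e n (t\<^sup>2) k"
proof -
  have "1 \<le> ens_ker e n (t\<^sup>2)" using assms by (intro ens_ker_ge_1) (auto simp: abs_square_less_1)
  then show ?thesis
    by (simp add: ens_unit_def ens_prob_def power_divide power_mult_distrib ens_w_def power_mult[symmetric] mult.commute)
qed

lemma ens_unit_summable:
  assumes "n \<ge> 1" "e = HAF \<longrightarrow> \<bar>t\<bar> < 1"
  shows "summable (\<lambda>k. \<bar>ens_unit e n t k\<bar>)"
proof -
  have "summable (\<lambda>k. ens_coeff e n k * \<bar>t\<bar> ^ k)" using assms by (intro ens_coeff_summable) auto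
  then have "summable (\<lambda>k. ens_coeff e n k * \<bar>t\<bar> ^ k / \<bar>sqrt (ens_ker e n (t\<^sup>2))\<bar>)" by (rule summable_divide)
  then show ?thesis by (simp add: ens_unit_def abs_mult power_abs)
qed

lemma ens_unit_sums_1:
  assumes "n \<ge> 1" "e = HAF \<longrightarrow> \<bar>t\<bar> < 1"
  shows "(\<lambda>k. (ens_unit e n t k)\<^sup>2) sums 1"
  unfolding ens_unit_square[OF assms] using assms by (intro ens_prob_sums) (auto simp: abs_square_less_1)

lemma ens_unit_inner_sums:
  assumes "n \<ge> 1" "e = HAF \<longrightarrow> \<bar>s\<bar> < 1 \<and> \<bar>t\<bar> < 1" "0 \<le> s * t"
  shows "(\<lambda>k. ens_unit e n s k * ens_unit e n t k) sums (ens_ker e n (s * t) / sqrt (ens_ker e n (s\<^sup>2) * ens_ker e n (t\<^sup>2)))"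
proof -
  have "s * t < 1" if "e = HAF"
  proof -
    have "\<bar>s\<bar> * \<bar>t\<bar> < 1 * 1" using assms that by (intro mult_strict_mono) auto
    then show ?thesis by (simp add: abs_mult[symmetric])
  qed
  then have "(\<lambda>k. ens_w e n k * (s * t) ^ k) sums ens_ker e n (s * t)"
    using assms by (intro ens_ker_sums) auto
  then have "(\<lambda>k. ens_w e n k * (s * t) ^ k / sqrt (ens_ker e n (s\<^sup>2) * ens_ker e n (t\<^sup>2))) sums
      (ens_ker e n (s * t) / sqrt (ens_ker e n (s\<^sup>2) * ens_ker e n (t\<^sup>2)))"
    by (rule sums_divide)
  then show ?thesis
    by (simp add: ens_unit_def ens_w_def power_mult_distrib real_sqrt_mult power2_eq_square mult_ac)
qed

lemma ens_re_normalised: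
  assumes "n \<ge> 1" "e = HAF \<longrightarrow> \<bar>t\<bar> < 1" "ens_good e n x"
  shows "ens_re e n x t = sqrt (ens_ker e n (t\<^sup>2)) * (\<Sum>k. ens_unit e n t k * x k)"
proof -
  have "1 \<le> ens_ker e n (t\<^sup>2)" using assms by (intro ens_ker_ge_1) (auto simp: abs_square_less_1)
  then have p: "sqrt (ens_ker e n (t\<^sup>2)) > 0" by simp
  have "(\<lambda>k. ens_coeff e n k * x k * t ^ k / sqrt (ens_ker e n (t\<^sup>2))) sums (ens_re e n x t / sqrt (ens_ker e n (t\<^sup>2)))"
    using ens_fun_of_real(2)[OF assms(3,2)] by (rule sums_divide)
  moreover have "ens_coeff e n k * x k * t ^ k / sqrt (ens_ker e n (t\<^sup>2)) = ens_unit e n t k * x k" for k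
    by (simp add: ens_unit_def)
  ultimately show ?thesis using p by (simp add: sums_iff)
qed

text \<open>The exponential factor makes the second moment almost constant on discs of
  radius \<open>1 / sqrt n\<close> about \<open>t\<close> without introducing or removing zeros.\<close>

definition ens_tilt :: "ensemble \<Rightarrow> nat \<Rightarrow> (nat \<Rightarrow> real) \<Rightarrow> real \<Rightarrow> complex \<Rightarrow> complex" where
  "ens_tilt e n x t z = ens_fun e n x z * exp (- (of_real (real n * ens_drift e t) * (z - of_real t)))"

lemma norm_ens_tilt_square:
  "(norm (ens_tilt e n x t z))\<^sup>2 = (norm (ens_fun e n x z))\<^sup>2 * exp (- 2 * real n * ens_drift e t * (Re z - t))"
proof -
  have "(exp (- (real n * ens_drift e t * (Re z - t))))\<^sup>2 = exp (2 * (- (real n * ens_drift e t * (Re z - t))))"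
    by (rule exp_double[symmetric])
  also have "2 * (- (real n * ens_drift e t * (Re z - t))) = - 2 * real n * ens_drift e t * (Re z - t)" by simp
  finally show ?thesis by (simp add: ens_tilt_def norm_mult power_mult_distrib)
qed

context iid_std
begin

definition Xi :: "'a \<Rightarrow> nat \<Rightarrow> real" where "Xi \<omega> = (\<lambda>k. \<xi> k \<omega>)"

lemma Xi_apply [simp]: "Xi \<omega> k = \<xi> k \<omega>" by (simp add: Xi_def)

text \<open>Convergence at a sequence of radii exhausting the domain implies convergence at all
  smaller ones, so a countable intersection of almost sure events suffices.\<close>

lemma AE_ens_good:
  assumes n: "n \<ge> 1"
  shows "AE \<omega> in M. ens_good e n (Xi \<omega>)"
proof -
  define r where "r j = (if e = HAF then 1 - 1 / real (Suc j) else real j)" for j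
  have r0: "0 \<le> r j" "e = HAF \<Longrightarrow> r j < 1" for j by (auto simp: r_def)
  have "AE \<omega> in M. \<forall>j. summable (\<lambda>k. ens_coeff e n k * r j ^ k * \<bar>\<xi> k \<omega>\<bar>)"
    unfolding AE_all_countable
    by (intro allI AE_summable ens_coeff_summable) (use n r0 in auto)
  then show ?thesis
  proof eventually_elim
    case (elim \<omega>)
    show ?case unfolding ens_good_def
    proof (intro allI impI)
      fix s :: real assume s: "0 \<le> s" "e = HAF \<longrightarrow> s < 1"
      have "\<exists>j. s \<le> r j"
      proof (cases "e = HAF")
        case True
        obtain j where "1 / (1 - s) < real j" using reals_Archimedean2 by blast
        then have "1 / real (Suc j) \<le> 1 - s" using s True by (simp add: field_simps)
        then show ?thesis using True by (intro exI[of _ j]) (simp add: r_def)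
      next
        case False
        then show ?thesis using real_arch_simple[of s] by (auto simp: r_def)
      qed
      then obtain j where j: "s \<le> r j" ..
      show "summable (\<lambda>k. ens_coeff e n k * s ^ k * \<bar>Xi \<omega> k\<bar>)"
      proof (rule summable_comparison_test'[OF elim[rule_format, of j]])
        fix k
        show "norm (ens_coeff e n k * s ^ k * \<bar>Xi \<omega> k\<bar>) \<le> ens_coeff e n k * r j ^ k * \<bar>\<xi> k \<omega>\<bar>"
          using s j by (auto simp: abs_mult intro!: mult_right_mono mult_left_mono power_mono)
      qed
    qed
  qed
qed

lemma ens_fun_measurable [measurable]:
  assumes [measurable]: "f \<in> N \<rightarrow>\<^sub>M M" "z \<in> borel_measurable N"
  shows "(\<lambda>x. ens_fun e n (Xi (f x)) (z x)) \<in> borel_measurable N"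
  unfolding ens_fun_def Xi_def by measurable

lemma ens_re_measurable [measurable]:
  assumes [measurable]: "f \<in> N \<rightarrow>\<^sub>M M" "t \<in> borel_measurable N"
  shows "(\<lambda>x. ens_re e n (Xi (f x)) (t x)) \<in> borel_measurable N"
  unfolding ens_re_def Xi_def by measurable

text \<open>Fatou's lemma along the partial sums; only the upper bound is asked for.\<close>

lemma nn_second_moment_lincomb:
  assumes "summable (\<lambda>k. \<bar>a k\<bar>)" "(\<lambda>k. (a k)\<^sup>2) sums V"
  shows "(\<integral>\<^sup>+\<omega>. ennreal ((lincomb a \<omega>)\<^sup>2) \<partial>M) \<le> ennreal V"
proof -
  have "(\<integral>\<^sup>+\<omega>. ennreal ((lincomb a \<omega>)\<^sup>2) \<partial>M) = (\<integral>\<^sup>+\<omega>. liminf (\<lambda>N. ennreal ((\<Sum>k<N. a k * \<xi> k \<omega>)\<^sup>2)) \<partial>M)"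
  proof (rule nn_integral_cong_AE)
    show "AE \<omega> in M. ennreal ((lincomb a \<omega>)\<^sup>2) = liminf (\<lambda>N. ennreal ((\<Sum>k<N. a k * \<xi> k \<omega>)\<^sup>2))"
      using AE_lincomb_tendsto[OF assms(1)]
    proof eventually_elim
      case (elim \<omega>)
      have "(\<lambda>N. ennreal ((\<Sum>k<N. a k * \<xi> k \<omega>)\<^sup>2)) \<longlonglongrightarrow> ennreal ((lincomb a \<omega>)\<^sup>2)"
        by (intro tendsto_ennrealI tendsto_power elim)
      then show ?case by (intro lim_imp_Liminf[symmetric]) auto
    qed
  qed
  also have "\<dots> \<le> liminf (\<lambda>N. \<integral>\<^sup>+\<omega>. ennreal ((\<Sum>k<N. a k * \<xi> k \<omega>)\<^sup>2) \<partial>M)"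
    by (rule nn_integral_liminf) measurable
  also have "\<dots> = liminf (\<lambda>N. ennreal (\<Sum>k<N. (a k)\<^sup>2))"
    using second_moment_lincomb[of a] by (subst nn_integral_eq_integral) auto
  also have "\<dots> = ennreal V"
    by (rule lim_imp_Liminf) (use assms(2) in \<open>auto simp: sums_def intro!: tendsto_ennrealI\<close>)
  finally show ?thesis .
qed

text \<open>Real and imaginary parts are linear combinations with real coefficients, and the squares
  of these coefficients add up to \<open>ens_w e n k * |z|^(2 k)\<close>.\<close>

lemma ens_fun_second_moment:
  assumes n: "n \<ge> 1" and z: "e = HAF \<longrightarrow> norm z < 1"
  shows "(\<integral>\<^sup>+\<omega>. ennreal ((norm (ens_fun e n (Xi \<omega>) z))\<^sup>2) \<partial>M) \<le> ennreal (ens_ker e n ((norm z)\<^sup>2))"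
proof -
  define a where "a k = ens_coeff e n k * Re (z ^ k)" for k
  define b where "b k = ens_coeff e n k * Im (z ^ k)" for k
  have sc: "summable (\<lambda>k. ens_coeff e n k * norm z ^ k)" using n z by (intro ens_coeff_summable) auto
  have ab: "\<bar>a k\<bar> \<le> ens_coeff e n k * norm z ^ k" "\<bar>b k\<bar> \<le> ens_coeff e n k * norm z ^ k" for k
    unfolding a_def b_def abs_mult norm_power[symmetric]
    using abs_Re_le_cmod[of "z ^ k"] abs_Im_le_cmod[of "z ^ k"] by (auto intro: mult_left_mono)
  have sa: "summable (\<lambda>k. \<bar>a k\<bar>)" and sb: "summable (\<lambda>k. \<bar>b k\<bar>)"
    by (rule summable_comparison_test'[OF sc, of 0]; use ab in simp)+
  have ab2: "(a k)\<^sup>2 + (b k)\<^sup>2 = ens_w e n k * ((norm z)\<^sup>2) ^ k" for k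
  proof -
    have "(a k)\<^sup>2 + (b k)\<^sup>2 = ens_w e n k * (norm (z ^ k))\<^sup>2"
      unfolding a_def b_def cmod_power2 ens_w_def by (simp add: power_mult_distrib distrib_left)
    then show ?thesis by (simp add: norm_power power_mult[symmetric] mult.commute)
  qed
  have ker: "(\<lambda>k. (a k)\<^sup>2 + (b k)\<^sup>2) sums ens_ker e n ((norm z)\<^sup>2)"
    unfolding ab2 using n z by (intro ens_ker_sums) (auto simp: abs_square_less_1)
  have sa2: "summable (\<lambda>k. (a k)\<^sup>2)" and sb2: "summable (\<lambda>k. (b k)\<^sup>2)"
    by (rule summable_comparison_test'[OF sums_summable[OF ker], of 0]; simp)+
  have V: "suminf (\<lambda>k. (a k)\<^sup>2) + suminf (\<lambda>k. (b k)\<^sup>2) = ens_ker e n ((norm z)\<^sup>2)"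
    using suminf_add[OF sa2 sb2] ker by (simp add: sums_iff)
  have "(\<integral>\<^sup>+\<omega>. ennreal ((norm (ens_fun e n (Xi \<omega>) z))\<^sup>2) \<partial>M) = (\<integral>\<^sup>+\<omega>. ennreal ((lincomb a \<omega>)\<^sup>2) + ennreal ((lincomb b \<omega>)\<^sup>2) \<partial>M)"
  proof (rule nn_integral_cong_AE)
    show "AE \<omega> in M. ennreal ((norm (ens_fun e n (Xi \<omega>) z))\<^sup>2) = ennreal ((lincomb a \<omega>)\<^sup>2) + ennreal ((lincomb b \<omega>)\<^sup>2)"
      using AE_ens_good[OF n, of e]
    proof eventually_elim
      case (elim \<omega>)
      note s = ens_good_sums[OF elim z]
      have "lincomb a \<omega> = Re (ens_fun e n (Xi \<omega>) z)" "lincomb b \<omega> = Im (ens_fun e n (Xi \<omega>) z)"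
        using sums_Re[OF s] sums_Im[OF s] by (auto simp: sums_iff a_def b_def mult_ac)
      then show ?case by (simp add: cmod_power2 ennreal_plus[symmetric] del: ennreal_plus)
    qed
  qed
  also have "\<dots> = (\<integral>\<^sup>+\<omega>. ennreal ((lincomb a \<omega>)\<^sup>2) \<partial>M) + (\<integral>\<^sup>+\<omega>. ennreal ((lincomb b \<omega>)\<^sup>2) \<partial>M)"
    by (rule nn_integral_add) measurable
  also have "\<dots> \<le> ennreal (suminf (\<lambda>k. (a k)\<^sup>2)) + ennreal (suminf (\<lambda>k. (b k)\<^sup>2))"
    by (intro add_mono nn_second_moment_lincomb sa sb summable_sums sa2 sb2)
  also have "\<dots> = ennreal (ens_ker e n ((norm z)\<^sup>2))"
    unfolding V[symmetric] by (rule ennreal_plus[symmetric]) (auto intro!: suminf_nonneg sa2 sb2)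
  finally show ?thesis .
qed

lemma circlepath_measurable [measurable]:
  assumes [measurable]: "c \<in> borel_measurable N" "x \<in> borel_measurable N"
  shows "(\<lambda>y. circlepath (c y) r (x y)) \<in> borel_measurable N"
  unfolding circlepath by measurable

lemma circ_mean_tilt_measurable [measurable]:
  assumes [measurable]: "f \<in> N \<rightarrow>\<^sub>M M" "t \<in> borel_measurable N"
  shows "(\<lambda>y. circ_mean (of_real (t y)) r (ens_tilt e n (Xi (f y)) (t y))) \<in> borel_measurable N"
proof -
  have [measurable]: "(\<lambda>y. ens_drift e (t y)) \<in> borel_measurable N"
    by (cases e) auto
  show ?thesis unfolding circ_mean_def ens_tilt_def by measurable
qed

lemma circ_mean_fun_measurable [measurable]:
  "(\<lambda>\<omega>. circ_mean c r (ens_fun e n (Xi \<omega>))) \<in> borel_measurable M"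
  unfolding circ_mean_def by measurable

lemma circ_mean_expectation_le:
  assumes [measurable]: "(\<lambda>(\<omega>, z). F \<omega> z) \<in> borel_measurable (M \<Otimes>\<^sub>M borel)"
    and B: "\<And>z. norm (z - c) = \<bar>r\<bar> \<Longrightarrow> (\<integral>\<^sup>+\<omega>. ennreal ((norm (F \<omega> z))\<^sup>2) \<partial>M) \<le> B"
  shows "(\<integral>\<^sup>+\<omega>. circ_mean c r (F \<omega>) \<partial>M) \<le> B"
proof -
  interpret P: pair_sigma_finite M lborel ..
  have "(\<integral>\<^sup>+\<omega>. circ_mean c r (F \<omega>) \<partial>M) = (\<integral>\<^sup>+x. (\<integral>\<^sup>+\<omega>. ennreal ((norm (F \<omega> (circlepath c r x)))\<^sup>2) * indicator {0..1} x \<partial>M) \<partial>lborel)"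
    unfolding circ_mean_def by (rule P.Fubini'[symmetric]) measurable
  also have "\<dots> \<le> (\<integral>\<^sup>+x. B * indicator {0..1} x \<partial>(lborel :: real measure))"
  proof (rule nn_integral_mono)
    fix x :: real
    have "norm (circlepath c r x - c) = \<bar>r\<bar>" by (simp add: circlepath norm_mult)
    then show "(\<integral>\<^sup>+\<omega>. ennreal ((norm (F \<omega> (circlepath c r x)))\<^sup>2) * indicator {0..1} x \<partial>M) \<le> B * indicator {0..1} x"
      using B[of "circlepath c r x"] by (cases "x \<in> {0..1}") auto
  qed
  also have "\<dots> = B" by (simp add: nn_integral_cmult_indicator)
  finally show ?thesis .
qed

text \<open>Compares the circle mean with the variance at the centre, uniformly in t. Without the
  exponential tilt the quotient could grow like \<open>exp (c * sqrt n)\<close>.\<close>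

lemma circ_mean_tilt_expectation:
  assumes b: "0 < b" "e \<in> {HAF, WP} \<Longrightarrow> b < 1"
  shows "\<exists>C. eventually (\<lambda>n. \<forall>t. \<bar>t\<bar> \<le> b \<longrightarrow>
     (\<integral>\<^sup>+\<omega>. circ_mean (of_real t) (1 / sqrt (real n)) (ens_tilt e n (Xi \<omega>) t) \<partial>M) \<le> ennreal (C * ens_ker e n (t\<^sup>2))) sequentially"
proof -
  obtain C where C: "eventually (\<lambda>n. \<forall>t z. \<bar>t\<bar> \<le> b \<longrightarrow> norm (z - complex_of_real t) = 1 / sqrt (real n) \<longrightarrow>
     (e = HAF \<longrightarrow> norm z < 1) \<and>
     ens_ker e n ((norm z)\<^sup>2) * exp (- 2 * real n * ens_drift e t * (Re z - t)) \<le> C * ens_ker e n (t\<^sup>2)) sequentially"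
    using ens_ker_local_growth[OF b] by blast
  show ?thesis
  proof (rule exI[of _ C], use C eventually_ge_at_top[of 1] in eventually_elim, intro allI impI)
    fix n t
    assume 1: "\<forall>t z. \<bar>t\<bar> \<le> b \<longrightarrow> norm (z - complex_of_real t) = 1 / sqrt (real n) \<longrightarrow>
     (e = HAF \<longrightarrow> norm z < 1) \<and>
     ens_ker e n ((norm z)\<^sup>2) * exp (- 2 * real n * ens_drift e t * (Re z - t)) \<le> C * ens_ker e n (t\<^sup>2)"
      and n: "1 \<le> n" and t: "\<bar>t\<bar> \<le> b"
    show "(\<integral>\<^sup>+\<omega>. circ_mean (of_real t) (1 / sqrt (real n)) (ens_tilt e n (Xi \<omega>) t) \<partial>M) \<le> ennreal (C * ens_ker e n (t\<^sup>2))"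
    proof (rule circ_mean_expectation_le)
      show "(\<lambda>(\<omega>, z). ens_tilt e n (Xi \<omega>) t z) \<in> borel_measurable (M \<Otimes>\<^sub>M borel)"
        unfolding ens_tilt_def by measurable
      fix z assume "norm (z - complex_of_real t) = \<bar>1 / sqrt (real n)\<bar>"
      then have z: "e = HAF \<longrightarrow> norm z < 1"
        "ens_ker e n ((norm z)\<^sup>2) * exp (- 2 * real n * ens_drift e t * (Re z - t)) \<le> C * ens_ker e n (t\<^sup>2)"
        using 1 t by auto
      have k0: "0 \<le> ens_ker e n ((norm z)\<^sup>2)"
        using ens_ker_ge_1[of n "(norm z)\<^sup>2" e] n z(1) by (fastforce simp: abs_square_less_1)
      have "(\<integral>\<^sup>+\<omega>. ennreal ((norm (ens_tilt e n (Xi \<omega>) t z))\<^sup>2) \<partial>M) =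
          (\<integral>\<^sup>+\<omega>. ennreal ((norm (ens_fun e n (Xi \<omega>) z))\<^sup>2) * ennreal (exp (- 2 * real n * ens_drift e t * (Re z - t))) \<partial>M)"
        unfolding norm_ens_tilt_square by (intro nn_integral_cong ennreal_mult) auto
      also have "\<dots> = (\<integral>\<^sup>+\<omega>. ennreal ((norm (ens_fun e n (Xi \<omega>) z))\<^sup>2) \<partial>M) * ennreal (exp (- 2 * real n * ens_drift e t * (Re z - t)))"
        by (rule nn_integral_multc) measurable
      also have "\<dots> \<le> ennreal (ens_ker e n ((norm z)\<^sup>2)) * ennreal (exp (- 2 * real n * ens_drift e t * (Re z - t)))"
        by (intro mult_right_mono ens_fun_second_moment n z(1)) simp
      also have "\<dots> = ennreal (ens_ker e n ((norm z)\<^sup>2) * exp (- 2 * real n * ens_drift e t * (Re z - t)))"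
        by (rule ennreal_mult[symmetric]) (use k0 in auto)
      also have "\<dots> \<le> ennreal (C * ens_ker e n (t\<^sup>2))" by (rule ennreal_leI) (rule z(2))
      finally show "(\<integral>\<^sup>+\<omega>. ennreal ((norm (ens_tilt e n (Xi \<omega>) t z))\<^sup>2) \<partial>M) \<le> ennreal (C * ens_ker e n (t\<^sup>2))" .
    qed
  qed
qed

lemma AE_lincomb_scale:
  assumes "summable (\<lambda>k. \<bar>a k\<bar>)"
  shows "AE \<omega> in M. lincomb (\<lambda>k. s * a k) \<omega> = s * lincomb a \<omega>"
  using AE_lincomb_tendsto[OF assms]
proof eventually_elim
  case (elim \<omega>)
  then have "(\<lambda>k. s * (a k * \<xi> k \<omega>)) sums (s * lincomb a \<omega>)" by (intro sums_mult) (simp add: sums_def)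
  then show ?case by (simp add: sums_iff mult.assoc)
qed

text \<open>If \<open>s^2\<close> times every variance share is at most \<open>u0^2\<close>, the
  decay of \<open>cf\<close> applies to all factors and gives the Gaussian bound. Otherwise the
  level \<open>u0^2 / s^2\<close> is crossed, and \<open>A * ln n\<close> indices contribute at
  least \<open>u0^2 / 2\<close> each to the sum of squares; with \<open>A = 16 / u0^2\<close> the
  resulting exponent is at most \<open>- 2 * ln n\<close>.\<close>

lemma ens_char_bound:
  assumes \<alpha>\<beta>: "0 < \<alpha>" "\<alpha> \<le> \<beta>" "e \<in> {HAF, WP} \<Longrightarrow> \<beta> < 1"
  shows "eventually (\<lambda>n. \<forall>t s. \<alpha> \<le> \<bar>t\<bar> \<longrightarrow> \<bar>t\<bar> \<le> \<beta> \<longrightarrow> \<bar>s\<bar> \<le> real n ^ 3 \<longrightarrow>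
     norm (CLINT \<omega>|M. iexp (s * lincomb (ens_unit e n t) \<omega>)) \<le> exp (- s\<^sup>2 / 4) + 1 / (real n)\<^sup>2) sequentially"
proof -
  obtain u0 where u0: "0 < u0" "\<And>u. \<bar>u\<bar> \<le> u0 \<Longrightarrow> norm (cf u) \<le> exp (- u\<^sup>2 / 4)" using cf_small by blast
  define A where "A = 16 / u0\<^sup>2"
  have A: "0 < A" using u0 by (simp add: A_def)
  have \<beta>2: "\<beta>\<^sup>2 < 1" if "e \<in> {HAF, WP}" using \<alpha>\<beta> that by (simp add: abs_square_less_1)
  have ev: "eventually (\<lambda>n. \<forall>x y. \<alpha>\<^sup>2 \<le> x \<longrightarrow> x \<le> \<beta>\<^sup>2 \<longrightarrow> 1 / real n ^ 7 \<le> y \<longrightarrow>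
     (\<forall>k. ens_prob e n x k \<le> y) \<or>
     (\<exists>K. finite K \<and> A * ln (real n) \<le> card K \<and> (\<forall>k\<in>K. y / 2 \<le> ens_prob e n x k \<and> ens_prob e n x k \<le> y))) sequentially"
    by (rule ens_prob_block) (use \<alpha>\<beta> \<beta>2 A in \<open>auto intro: power_mono\<close>)
  have ev2: "eventually (\<lambda>n. 1 / real n \<le> u0\<^sup>2) sequentially" using u0(1) by real_asymp
  from ev ev2 eventually_ge_at_top[of 1] show ?thesis
  proof (eventually_elim, intro allI impI)
    case (elim n)
    fix t s assume t: "\<alpha> \<le> \<bar>t\<bar>" "\<bar>t\<bar> \<le> \<beta>" and s: "\<bar>s\<bar> \<le> real n ^ 3"
    have hyp: "e = HAF \<longrightarrow> \<bar>t\<bar> < 1" using t \<alpha>\<beta> by auto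
    let ?a = "\<lambda>k. s * ens_unit e n t k"
    have sum_a: "summable (\<lambda>k. \<bar>?a k\<bar>)"
      unfolding abs_mult by (intro summable_mult ens_unit_summable elim hyp)
    have eq: "(CLINT \<omega>|M. iexp (s * lincomb (ens_unit e n t) \<omega>)) = (CLINT \<omega>|M. iexp (lincomb ?a \<omega>))"
      by (rule integral_cong_AE) (use AE_lincomb_scale[OF ens_unit_summable[OF elim(3) hyp], of s] in \<open>auto elim!: eventually_mono\<close>)
    have sq: "(?a k)\<^sup>2 = s\<^sup>2 * ens_prob e n (t\<^sup>2) k" for k
      by (simp add: power_mult_distrib ens_unit_square[OF elim(3) hyp])
    have bd: "norm (CLINT \<omega>|M. iexp (lincomb ?a \<omega>)) \<le> exp (- (\<Sum>k\<in>K. (?a k)\<^sup>2) / 4)"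
      if "finite K" "\<And>k. k \<in> K \<Longrightarrow> s\<^sup>2 * ens_prob e n (t\<^sup>2) k \<le> u0\<^sup>2" for K
    proof (rule norm_char_lincomb_le[OF sum_a u0(2) that(1)])
      fix k assume "k \<in> K"
      then have "(?a k)\<^sup>2 \<le> u0\<^sup>2" using that(2) by (simp add: sq)
      then show "\<bar>?a k\<bar> \<le> u0" using u0(1) by (simp add: abs_le_square_iff[symmetric])
    qed
    show "norm (CLINT \<omega>|M. iexp (s * lincomb (ens_unit e n t) \<omega>)) \<le> exp (- s\<^sup>2 / 4) + 1 / (real n)\<^sup>2"
    proof (cases "\<forall>k. s\<^sup>2 * ens_prob e n (t\<^sup>2) k \<le> u0\<^sup>2")
      case True
      have "(\<lambda>N. \<Sum>k<N. (?a k)\<^sup>2) \<longlonglongrightarrow> s\<^sup>2 * 1"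
        using sums_mult[OF ens_unit_sums_1[OF elim(3) hyp], of "s\<^sup>2"] by (simp add: sums_def power_mult_distrib)
      then have "(\<lambda>N. exp (- (\<Sum>k<N. (?a k)\<^sup>2) / 4)) \<longlonglongrightarrow> exp (- (s\<^sup>2 * 1) / 4)" by (intro tendsto_intros) auto
      then have "norm (CLINT \<omega>|M. iexp (lincomb ?a \<omega>)) \<le> exp (- (s\<^sup>2 * 1) / 4)"
        by (rule LIMSEQ_le_const) (use bd True in auto)
      then show ?thesis unfolding eq by (simp add: add_increasing2)
    next
      case False
      then have s0: "s \<noteq> 0" using u0(1) by auto
      define y where "y = u0\<^sup>2 / s\<^sup>2"
      have s2: "0 < s\<^sup>2" using s0 by simp
      have "s\<^sup>2 \<le> (real n ^ 3)\<^sup>2" using power_mono[OF s, of 2] by simp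
      then have s6: "s\<^sup>2 \<le> real n ^ 6" by (simp add: power_mult[symmetric])
      have "1 / real n ^ 7 = (1 / real n) / real n ^ 6" by (simp add: power_Suc[symmetric] del: power_Suc)
      also have "\<dots> \<le> u0\<^sup>2 / s\<^sup>2" using s2 s6 elim by (intro frac_le) auto
      finally have y7: "1 / real n ^ 7 \<le> y" by (simp add: y_def)
      have le_iff: "ens_prob e n (t\<^sup>2) k \<le> y \<longleftrightarrow> s\<^sup>2 * ens_prob e n (t\<^sup>2) k \<le> u0\<^sup>2" for k
        using s2 by (simp add: y_def field_simps)
      have "\<alpha>\<^sup>2 \<le> t\<^sup>2" "t\<^sup>2 \<le> \<beta>\<^sup>2" using t \<alpha>\<beta> power_mono[of \<alpha> "\<bar>t\<bar>" 2] power_mono[of "\<bar>t\<bar>" \<beta> 2] by auto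
      then have "(\<forall>k. ens_prob e n (t\<^sup>2) k \<le> y) \<or> (\<exists>K. finite K \<and> A * ln (real n) \<le> card K \<and> (\<forall>k\<in>K. y / 2 \<le> ens_prob e n (t\<^sup>2) k \<and> ens_prob e n (t\<^sup>2) k \<le> y))"
        using elim(1) y7 by blast
      then obtain K where K: "finite K" "A * ln (real n) \<le> card K" "\<And>k. k \<in> K \<Longrightarrow> y / 2 \<le> ens_prob e n (t\<^sup>2) k \<and> ens_prob e n (t\<^sup>2) k \<le> y"
        using False le_iff by blast
      have "norm (CLINT \<omega>|M. iexp (lincomb ?a \<omega>)) \<le> exp (- (\<Sum>k\<in>K. (?a k)\<^sup>2) / 4)"
        by (rule bd[OF K(1)]) (use K(3) le_iff in blast)
      also have "\<dots> \<le> exp (- 2 * ln (real n))"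
      proof -
        have "8 * ln (real n) = (A * ln (real n)) * (u0\<^sup>2 / 2)" using u0(1) by (simp add: A_def)
        also have "\<dots> \<le> card K * (u0\<^sup>2 / 2)" using K(2) by (intro mult_right_mono) auto
        also have "\<dots> = (\<Sum>k\<in>K. u0\<^sup>2 / 2)" by simp
        also have "\<dots> \<le> (\<Sum>k\<in>K. (?a k)\<^sup>2)"
        proof (rule sum_mono)
          fix k assume "k \<in> K"
          then have "s\<^sup>2 * (y / 2) \<le> s\<^sup>2 * ens_prob e n (t\<^sup>2) k" using K(3) s2 by (intro mult_left_mono) auto
          then show "u0\<^sup>2 / 2 \<le> (?a k)\<^sup>2" using s2 by (simp add: sq y_def)
        qed
        finally show ?thesis by simp
      qed
      also have "\<dots> = 1 / (real n)\<^sup>2" using elim(3) by (simp add: exp_minus exp_double inverse_eq_divide)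
      finally show ?thesis unfolding eq by (simp add: add_increasing)
    qed
  qed
qed

lemma ens_small_ball:
  assumes \<alpha>\<beta>: "0 < \<alpha>" "\<alpha> \<le> \<beta>" "e \<in> {HAF, WP} \<Longrightarrow> \<beta> < 1"
  shows "eventually (\<lambda>n. \<forall>t x. \<alpha> \<le> \<bar>t\<bar> \<longrightarrow> \<bar>t\<bar> \<le> \<beta> \<longrightarrow> 0 \<le> x \<longrightarrow>
     prob {\<omega>\<in>space M. \<bar>lincomb (ens_unit e n t) \<omega>\<bar> \<le> x} \<le> 8 * (x + 1 / (real n)\<^sup>2)) sequentially"
proof -
  have ev: "eventually (\<lambda>n. \<forall>t s. \<alpha> \<le> \<bar>t\<bar> \<longrightarrow> \<bar>t\<bar> \<le> \<beta> \<longrightarrow> \<bar>s\<bar> \<le> real n ^ 3 \<longrightarrow>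
     norm (CLINT \<omega>|M. iexp (s * lincomb (ens_unit e n t) \<omega>)) \<le> exp (- s\<^sup>2 / 4) + 1 / (real n)\<^sup>2) sequentially"
    by (rule ens_char_bound) (use \<alpha>\<beta> in auto)
  from ev eventually_ge_at_top[of 1] show ?thesis
  proof (eventually_elim, intro allI impI)
  case (elim n)
  fix t x :: real assume t: "\<alpha> \<le> \<bar>t\<bar>" "\<bar>t\<bar> \<le> \<beta>" and x: "0 \<le> x"
  \<comment> \<open>Raising x to at least \<open>n^(-2)\<close> makes \<open>n^3 * x'\<close> at
    least n, so the truncation of frequencies at \<open>n^3\<close> costs at most
    \<open>n^(-2)\<close>.\<close>
  define x' where "x' = max x (1 / (real n)\<^sup>2)"
  have n0: "0 < 1 / (real n)\<^sup>2" using elim by simp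
  have x': "0 < x'" "x \<le> x'" "1 / (real n)\<^sup>2 \<le> x'" "x' \<le> x + 1 / (real n)\<^sup>2" using n0 x by (auto simp: x'_def less_max_iff_disj)
  have "prob {\<omega>\<in>space M. \<bar>lincomb (ens_unit e n t) \<omega>\<bar> \<le> x} \<le> prob {\<omega>\<in>space M. \<bar>lincomb (ens_unit e n t) \<omega>\<bar> \<le> x'}"
    using x'(2) by (intro finite_measure_mono) auto
  also have "\<dots> \<le> 2 * (1 / (real n ^ 3 * x')\<^sup>2 + 1 / (real n)\<^sup>2 + sqrt 2 * x')"
    by (rule small_ball_char) (use elim t x' in auto)
  also have "\<dots> \<le> 2 * (1 / (real n)\<^sup>2 + 1 / (real n)\<^sup>2 + 2 * x')"
  proof -
    have "real n = real n ^ 3 * (1 / (real n)\<^sup>2)" using elim by (simp add: power3_eq_cube power2_eq_square)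
    also have "\<dots> \<le> real n ^ 3 * x'" using x' by (intro mult_left_mono) auto
    finally have "(real n)\<^sup>2 \<le> (real n ^ 3 * x')\<^sup>2" by (intro power_mono) auto
    then have "1 / (real n ^ 3 * x')\<^sup>2 \<le> 1 / (real n)\<^sup>2" using elim by (intro divide_left_mono mult_pos_pos) (auto simp: x')
    moreover have "sqrt 2 * x' \<le> 2 * x'" using x' by (intro mult_right_mono) (auto simp: real_le_lsqrt)
    ultimately show ?thesis by simp
  qed
  also have "\<dots> \<le> 8 * (x + 1 / (real n)\<^sup>2)" using x' x by simp
  finally show "prob {\<omega>\<in>space M. \<bar>lincomb (ens_unit e n t) \<omega>\<bar> \<le> x} \<le> 8 * (x + 1 / (real n)\<^sup>2)" .
  qed
qed

end

section \<open>Zeros in short windows\<close>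

text \<open>If some share exceeded \<eta>, at least \<open>3 / \<eta>\<close> indices would have a
  share of at least \<open>\<eta> / 2\<close>, and the total would be 3/2 instead of at most 1. This
  is the Lindeberg condition for the central limit theorem.\<close>

lemma ens_prob_small:
  fixes x0 x1 \<eta> :: real
  assumes x01: "0 < x0" "x0 \<le> x1" "e \<in> {HAF, WP} \<Longrightarrow> x1 < 1" and \<eta>: "0 < \<eta>"
  shows "eventually (\<lambda>n. \<forall>x k. x0 \<le> x \<longrightarrow> x \<le> x1 \<longrightarrow> ens_prob e n x k \<le> \<eta>) sequentially"
proof -
  have ev: "eventually (\<lambda>n. \<forall>x y. x0 \<le> x \<longrightarrow> x \<le> x1 \<longrightarrow> 1 / real n ^ 7 \<le> y \<longrightarrow>
     (\<forall>k. ens_prob e n x k \<le> y) \<or>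
     (\<exists>K. finite K \<and> (3 / \<eta>) * ln (real n) \<le> card K \<and> (\<forall>k\<in>K. y / 2 \<le> ens_prob e n x k \<and> ens_prob e n x k \<le> y))) sequentially"
    by (rule ens_prob_block) (use x01 \<eta> in auto)
  have ev2: "eventually (\<lambda>n. 1 / real n ^ 7 \<le> \<eta>) sequentially" using \<eta> by real_asymp
  have ev3: "eventually (\<lambda>n. 1 \<le> ln (real n)) sequentially" by real_asymp
  from ev ev2 ev3 eventually_ge_at_top[of 1] show ?thesis
  proof (eventually_elim, intro allI impI)
    case (elim n)
    fix x k assume x: "x0 \<le> x" "x \<le> x1"
    show "ens_prob e n x k \<le> \<eta>"
    proof (rule ccontr)
      assume "\<not> ?thesis"
      then have nle: "\<not> (\<forall>k. ens_prob e n x k \<le> \<eta>)" by auto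
      from elim(1)[rule_format, OF x elim(2)] nle
      obtain K where K: "finite K" "(3 / \<eta>) * ln (real n) \<le> card K" "\<And>k. k \<in> K \<Longrightarrow> \<eta> / 2 \<le> ens_prob e n x k"
        by (elim disjE exE conjE) auto
      have "3 / \<eta> * 1 \<le> (3 / \<eta>) * ln (real n)" using elim(3) \<eta> by (intro mult_left_mono) auto
      then have "3 / \<eta> \<le> card K" using K(2) by simp
      then have "3 / 2 \<le> card K * (\<eta> / 2)" using \<eta> by (simp add: field_simps)
      also have "\<dots> = (\<Sum>k\<in>K. \<eta> / 2)" by simp
      also have "\<dots> \<le> (\<Sum>k\<in>K. ens_prob e n x k)" by (intro sum_mono K(3))
      also have "\<dots> \<le> 1" by (rule sum_ens_prob_le_1) (use elim x x01 K in auto)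
      finally show False by simp
    qed
  qed
qed

text \<open>Cauchy's estimate for the k-th derivative at 0, which formal power series identify with
  \<open>fact k\<close> times the coefficient.\<close>

lemma ens_coeff_bound:
  assumes good: "ens_good e n x" and r: "0 < r" "e = HAF \<longrightarrow> r < 1"
    and B: "\<And>z. norm z = r \<Longrightarrow> norm (ens_fun e n x z) \<le> B"
  shows "ens_coeff e n k * \<bar>x k\<bar> * r ^ k \<le> B"
proof -
  define F where "F = Abs_fps (\<lambda>k. complex_of_real (ens_coeff e n k * x k))"
  have ev: "eval_fps F = ens_fun e n x"
    by (auto simp: fun_eq_iff eval_fps_def ens_fun_def F_def)
  have "summable (\<lambda>k. fps_nth F k * (of_real r) ^ k)"
    using ens_good_sums[OF good, of "of_real r"] r by (auto simp: F_def sums_iff)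
  then have "ereal (norm (complex_of_real r)) \<le> fps_conv_radius F"
    unfolding fps_conv_radius_def by (rule conv_radius_geI)
  then have "fps_conv_radius F > 0" using r(1) by (auto intro: less_le_trans[rotated])
  then have "fps_nth F k = (deriv ^^ k) (ens_fun e n x) 0 / fact k"
    using fps_nth_conv_deriv[of F k] by (simp only: ev)
  then have c: "complex_of_real (ens_coeff e n k * x k) = (deriv ^^ k) (ens_fun e n x) 0 / fact k"
    by (simp add: F_def)
  obtain R where R: "r < R" "e = HAF \<longrightarrow> R \<le> 1"
  proof (cases "e = HAF")
    case True
    then show ?thesis using that[of 1] r by simp
  next
    case False
    then show ?thesis using that[of "r + 1"] by simp
  qed
  have hol: "ens_fun e n x holomorphic_on ball 0 R" using ens_good_holomorphic[OF good, of 0 R] R by auto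
  have "norm ((deriv ^^ k) (ens_fun e n x) 0) \<le> fact k * B / r ^ k"
  proof (rule Cauchy_inequality)
    show "ens_fun e n x holomorphic_on ball 0 r" by (rule holomorphic_on_subset[OF hol]) (use R in auto)
    show "continuous_on (cball 0 r) (ens_fun e n x)"
      by (rule continuous_on_subset[OF holomorphic_on_imp_continuous_on[OF hol]]) (use R in auto)
  qed (use r B in auto)
  then have "norm (complex_of_real (ens_coeff e n k * x k)) \<le> B / r ^ k"
    unfolding c by (simp add: norm_divide field_simps)
  then show ?thesis using r(1) by (simp add: norm_mult abs_mult field_simps)
qed

text \<open>What m zeros in the window at t imply, stated without mention of zeros: the condition is
  measurable in t and the realisation, and its probability can be estimated directly.\<close>

definition small_cond :: "ensemble \<Rightarrow> nat \<Rightarrow> real \<Rightarrow> nat \<Rightarrow> real \<Rightarrow> (nat \<Rightarrow> real) \<Rightarrow> bool" where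
  "small_cond e n \<delta> m t x \<longleftrightarrow>
     ennreal ((ens_re e n x t)\<^sup>2) \<le> ennreal (\<delta> ^ (2 * m)) * circ_mean (of_real t) (1 / sqrt (real n)) (ens_tilt e n x t)"

text \<open>At the centre t of the disc the Blaschke denominators reduce to \<open>r^2\<close> and
  the prefactor to 1, so each zero within \<delta> r of t gains exactly a factor \<delta>. The list
  may contain repetitions.\<close>

lemma small_cond_of_factor:
  assumes good: "ens_good e n x" and n: "n \<ge> 1" and \<delta>: "0 < \<delta>" "\<delta> < 1"
    and t: "e = HAF \<longrightarrow> \<bar>t\<bar> + 2 / sqrt (real n) \<le> 1"
    and ws: "set ws \<subseteq> {t..t + \<delta> / sqrt (real n)}"
    and g: "g holomorphic_on ball (of_real t) (2 / sqrt (real n))"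
    and f: "\<And>z. ens_fun e n x z = (\<Prod>w\<leftarrow>ws. z - complex_of_real w) * g z"
  shows "small_cond e n \<delta> (length ws) t x"
proof -
  let ?r = "1 / sqrt (real n)"
  have r: "0 < ?r" using n by simp
  let ?E = "\<lambda>z. exp (- (of_real (real n * ens_drift e t) * (z - complex_of_real t)))"
  have "ennreal ((norm (ens_tilt e n x t (of_real t)))\<^sup>2)
     \<le> ennreal (?r / (?r - norm (complex_of_real t - of_real t)) * \<delta> ^ (2 * length (map complex_of_real ws))) * circ_mean (of_real t) ?r (ens_tilt e n x t)"
  proof (rule blaschke_bound_circ_mean[where R = "2 / sqrt (real n)" and g = "\<lambda>z. g z * ?E z"])
    show "ens_tilt e n x t z = (\<Prod>w\<leftarrow>map complex_of_real ws. z - w) * (g z * ?E z)" for z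
      by (simp add: ens_tilt_def f comp_def)
    show "(\<lambda>z. g z * ?E z) holomorphic_on ball (of_real t) (2 / sqrt (real n))"
      by (intro holomorphic_intros g)
    show "?r < 2 / sqrt (real n)" using n by (simp add: field_simps)
    fix w assume "w \<in> set (map complex_of_real ws)"
    then obtain v where v: "w = of_real v" "v \<in> {t..t + \<delta> / sqrt (real n)}" using ws by auto
    have "norm (complex_of_real t - w) = \<bar>t - v\<bar>" by (simp add: v(1) flip: of_real_diff)
    then have "norm (complex_of_real t - w) \<le> \<delta> * ?r" using v(2) by simp
    then have "?r * norm (complex_of_real t - w) \<le> ?r * (\<delta> * ?r)" using r by (intro mult_left_mono) auto
    also have "\<dots> = \<delta> * norm ((complex_of_real ?r)\<^sup>2 - cnj (w - of_real t) * (of_real t - of_real t))"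
      by (simp only: diff_self mult_zero_right diff_0_right norm_power norm_of_real) (simp add: power2_eq_square)
    finally show "?r * norm (complex_of_real t - w) \<le> \<delta> * norm ((complex_of_real ?r)\<^sup>2 - cnj (w - of_real t) * (of_real t - of_real t))" .
  qed (use r \<delta> in auto)
  moreover have "ens_tilt e n x t (of_real t) = of_real (ens_re e n x t)"
  proof -
    have "0 < 2 / sqrt (real n)" using n by simp
    then have "e = HAF \<longrightarrow> \<bar>t\<bar> < 1" using t by (smt (verit))
    then show ?thesis by (simp add: ens_tilt_def ens_fun_of_real(1)[OF good])
  qed
  ultimately show ?thesis using r unfolding small_cond_def by simp
qed

text \<open>A single zero means a sign change or a hidden second zero, hence the condition for 2.
  With N zeros, N between 2 and m1, the conditions for 2, ..., N all hold and N is at most 2 (N -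
  1). For more than m1 zeros only the condition for m1 is recorded, weighted with their full
  number.\<close>

lemma local_zero_count:
  assumes good: "ens_good e n x" and n: "n \<ge> 1" and \<delta>: "0 < \<delta>" "\<delta> < 1"
    and t: "e = HAF \<longrightarrow> \<bar>t\<bar> + 2 / sqrt (real n) \<le> 1"
    and Z: "finite Z" "Z \<subseteq> {t..t + \<delta> / sqrt (real n)}" "\<And>z. z \<in> Z \<Longrightarrow> ens_re e n x z = 0" and m1: "2 \<le> m1"
  shows "real (card Z) \<le> of_bool (ens_re e n x t * ens_re e n x (t + \<delta> / sqrt (real n)) \<le> 0)
     + 2 * (\<Sum>m=2..m1. of_bool (small_cond e n \<delta> m t x)) + real (card Z) * of_bool (small_cond e n \<delta> m1 t x)"
proof -
  let ?h = "\<delta> / sqrt (real n)" let ?R = "2 / sqrt (real n)"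
  let ?S = "ball (complex_of_real t) ?R"
  have R: "0 < ?R" using n by simp
  have hR: "?h < ?R" using n \<delta> by (intro divide_strict_right_mono) auto
  have hol: "ens_fun e n x holomorphic_on ?S" using ens_good_holomorphic[OF good, of "of_real t" ?R] t by simp
  have inS: "complex_of_real s \<in> ?S" if "s \<in> {t..t + ?h}" for s
  proof -
    have "norm (complex_of_real t - of_real s) = \<bar>t - s\<bar>" by (simp flip: of_real_diff)
    moreover have "\<bar>t - s\<bar> \<le> ?h" using that by simp
    ultimately show ?thesis using hR by (simp add: dist_norm)
  qed
  have real: "ens_fun e n x (of_real s) = of_real (ens_re e n x s)" if "s \<in> {t..t + ?h}" for s
  proof (rule ens_fun_of_real(1)[OF good])
    have "t \<le> s" "s \<le> t + ?h" using that by auto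
    then have "\<bar>s\<bar> < \<bar>t\<bar> + ?R" using hR by linarith
    then show "e = HAF \<longrightarrow> \<bar>s\<bar> < 1" using t by linarith
  qed
  have small: "small_cond e n \<delta> m t x" if mZ: "m \<le> card Z" for m
  proof -
    obtain Y where Y: "Y \<subseteq> Z" "card Y = m" "finite Y" using obtain_subset_with_card_n[OF mZ] by blast
    define ws where "ws = sorted_list_of_set Y"
    have ws: "set ws = Y" "distinct ws" "length ws = m" using Y by (auto simp: ws_def)
    obtain g where "g holomorphic_on ?S" "\<forall>z. ens_fun e n x z = (\<Prod>w\<leftarrow>map complex_of_real ws. z - w) * g z"
    proof -
      have "\<exists>g. g holomorphic_on ?S \<and> (\<forall>z. ens_fun e n x z = (\<Prod>w\<leftarrow>map complex_of_real ws. z - w) * g z)"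
      proof (rule holomorphic_factor_zeros[OF open_ball hol])
        show "distinct (map complex_of_real ws)" using ws(2) by (simp add: distinct_map inj_on_def)
        show "set (map complex_of_real ws) \<subseteq> ?S" using ws(1) Y Z inS by auto
        show "ens_fun e n x z = 0" if "z \<in> set (map complex_of_real ws)" for z
        proof -
          obtain v where v: "z = of_real v" "v \<in> Z" using \<open>z \<in> set (map complex_of_real ws)\<close> ws(1) Y by auto
          then have "v \<in> {t..t + ?h}" "ens_re e n x v = 0" using Z by auto
          then show ?thesis using real[of v] v(1) by simp
        qed
      qed
      then show ?thesis using that by metis
    qed
    note g = this
    have "small_cond e n \<delta> (length ws) t x"
    proof (rule small_cond_of_factor[OF good n \<delta> t _ g(1)])
      show "set ws \<subseteq> {t..t + ?h}" using ws(1) Y Z by auto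
      show "ens_fun e n x z = (\<Prod>w\<leftarrow>ws. z - complex_of_real w) * g z" for z
        using g(2) by (simp add: comp_def)
    qed
    then show ?thesis by (simp add: ws(3))
  qed
  let ?N = "card Z" let ?s = "\<lambda>m. of_bool (small_cond e n \<delta> m t x) :: real"
  have nn: "0 \<le> (\<Sum>m=2..m1. ?s m)" by (intro sum_nonneg) auto
  consider "?N = 0" | "?N = 1" | "2 \<le> ?N" "?N \<le> m1" | "m1 < ?N" by linarith
  then show ?thesis
  proof cases
    case 1
    then show ?thesis using nn by simp
  next
    case 2
    then obtain z where z: "Z = {z}" using card_1_singletonE by blast
    have zt: "z \<in> {t..t + ?h}" "ens_fun e n x (of_real z) = 0" using z Z real[of z] by auto
    have "Re (ens_fun e n x (of_real t)) * Re (ens_fun e n x (of_real (t + ?h))) \<le> 0 \<or>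
      (\<exists>ws g. length ws = 2 \<and> set ws \<subseteq> {t..t + ?h} \<and> g holomorphic_on ?S \<and>
       (\<forall>z. ens_fun e n x z = (\<Prod>w\<leftarrow>ws. z - of_real w) * g z))"
      by (rule holomorphic_zeros_or_sign_change[OF open_ball hol inS _ zt]) (use real in auto)
    then show ?thesis
    proof
      assume "Re (ens_fun e n x (of_real t)) * Re (ens_fun e n x (of_real (t + ?h))) \<le> 0"
      moreover have "t \<in> {t..t + ?h}" "t + ?h \<in> {t..t + ?h}" using \<delta> by auto
      ultimately have "ens_re e n x t * ens_re e n x (t + ?h) \<le> 0"
        by (simp only: real Re_complex_of_real)
      then show ?thesis using 2 nn by simp
    next
      assume "\<exists>ws g. length ws = 2 \<and> set ws \<subseteq> {t..t + ?h} \<and> g holomorphic_on ?S \<and>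
       (\<forall>z. ens_fun e n x z = (\<Prod>w\<leftarrow>ws. z - of_real w) * g z)"
      then obtain ws g where "length ws = 2" "set ws \<subseteq> {t..t + ?h}" "g holomorphic_on ?S"
        "\<And>z. ens_fun e n x z = (\<Prod>w\<leftarrow>ws. z - of_real w) * g z" by blast
      then have "small_cond e n \<delta> 2 t x" using small_cond_of_factor[OF good n \<delta> t] by metis
      moreover have "?s 2 \<le> (\<Sum>m=2..m1. ?s m)" using m1 by (intro member_le_sum) auto
      ultimately show ?thesis using 2 by simp
    qed
  next
    case 3
    have "real (?N - 1) = (\<Sum>m=2..?N. 1)" using 3 by simp
    also have "\<dots> = (\<Sum>m=2..?N. ?s m)" by (intro sum.cong refl) (use small in auto)
    also have "\<dots> \<le> (\<Sum>m=2..m1. ?s m)" using 3 by (intro sum_mono2) auto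
    finally have "real (?N - 1) \<le> (\<Sum>m=2..m1. ?s m)" .
    moreover have "real ?N \<le> 2 * real (?N - 1)" using 3 by linarith
    ultimately have "real ?N \<le> 2 * (\<Sum>m=2..m1. ?s m)" by linarith
    then show ?thesis by (simp add: add_increasing add_increasing2)
  next
    case 4
    then have "small_cond e n \<delta> m1 t x" using small by simp
    then show ?thesis using nn by simp
  qed
qed

context iid_std
begin

lemma small_cond_measurable [measurable]:
  assumes [measurable]: "f \<in> N \<rightarrow>\<^sub>M M" "t \<in> borel_measurable N"
  shows "Measurable.pred N (\<lambda>y. small_cond e n \<delta> m (t y) (Xi (f y)))"
  unfolding small_cond_def by measurable

text \<open>Either the circle mean exceeds the variance at t by the factor \<open>d^(-2 m)\<close>,
  which Markov's inequality bounds, or the normalised value is at most \<open>d^(2 m)\<close>, a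
  small-ball event. The cube supplies the exponent: \<open>d^(6 m) = d^(2 m) * d^(4 m)\<close>, one
  part for the circle mean and one for the squared value.\<close>

lemma small_cond_prob:
  assumes \<alpha>\<beta>: "0 < \<alpha>" "\<alpha> \<le> \<beta>" "e \<in> {HAF, WP} \<Longrightarrow> \<beta> < 1"
  shows "\<exists>C>0. eventually (\<lambda>n. \<forall>t m d. \<alpha> \<le> \<bar>t\<bar> \<longrightarrow> \<bar>t\<bar> \<le> \<beta> \<longrightarrow> 0 < d \<longrightarrow> d < 1 \<longrightarrow>
     prob {\<omega>\<in>space M. small_cond e n (d ^ 3) m t (Xi \<omega>)} \<le> C * (d ^ (2 * m) + 1 / (real n)\<^sup>2)) sequentially"
proof -
  have "\<exists>C. eventually (\<lambda>n. \<forall>t. \<bar>t\<bar> \<le> \<beta> \<longrightarrow>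
     (\<integral>\<^sup>+\<omega>. circ_mean (of_real t) (1 / sqrt (real n)) (ens_tilt e n (Xi \<omega>) t) \<partial>M) \<le> ennreal (C * ens_ker e n (t\<^sup>2))) sequentially"
    by (rule circ_mean_tilt_expectation) (use \<alpha>\<beta> in auto)
  then obtain C where C: "eventually (\<lambda>n. \<forall>t. \<bar>t\<bar> \<le> \<beta> \<longrightarrow>
     (\<integral>\<^sup>+\<omega>. circ_mean (of_real t) (1 / sqrt (real n)) (ens_tilt e n (Xi \<omega>) t) \<partial>M) \<le> ennreal (C * ens_ker e n (t\<^sup>2))) sequentially"
    by blast
  have sb: "eventually (\<lambda>n. \<forall>t x. \<alpha> \<le> \<bar>t\<bar> \<longrightarrow> \<bar>t\<bar> \<le> \<beta> \<longrightarrow> 0 \<le> x \<longrightarrow>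
     prob {\<omega>\<in>space M. \<bar>lincomb (ens_unit e n t) \<omega>\<bar> \<le> x} \<le> 8 * (x + 1 / (real n)\<^sup>2)) sequentially"
    by (rule ens_small_ball) (use \<alpha>\<beta> in auto)
  show ?thesis
  proof (intro exI[of _ "8 + \<bar>C\<bar>"] conjI, simp, use C sb eventually_ge_at_top[of 1] in eventually_elim, intro allI impI)
    fix n t m and d :: real
    assume 1: "\<forall>t. \<bar>t\<bar> \<le> \<beta> \<longrightarrow>
       (\<integral>\<^sup>+\<omega>. circ_mean (of_real t) (1 / sqrt (real n)) (ens_tilt e n (Xi \<omega>) t) \<partial>M) \<le> ennreal (C * ens_ker e n (t\<^sup>2))"
      and 2: "\<forall>t x. \<alpha> \<le> \<bar>t\<bar> \<longrightarrow> \<bar>t\<bar> \<le> \<beta> \<longrightarrow> 0 \<le> x \<longrightarrow>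
     prob {\<omega>\<in>space M. \<bar>lincomb (ens_unit e n t) \<omega>\<bar> \<le> x} \<le> 8 * (x + 1 / (real n)\<^sup>2)"
      and n: "1 \<le> n" and t: "\<alpha> \<le> \<bar>t\<bar>" "\<bar>t\<bar> \<le> \<beta>" and d: "0 < d" "d < 1"
    have hyp: "e = HAF \<longrightarrow> \<bar>t\<bar> < 1" using t \<alpha>\<beta> by auto
    let ?k = "ens_ker e n (t\<^sup>2)"
    have k: "1 \<le> ?k" using n hyp by (intro ens_ker_ge_1) (auto simp: abs_square_less_1)
    let ?D = "\<lambda>\<omega>. circ_mean (of_real t) (1 / sqrt (real n)) (ens_tilt e n (Xi \<omega>) t)"
    let ?c = "d ^ (2 * m) / ?k"
    have c: "0 \<le> ?c" using k d by simp
    let ?A = "{\<omega>\<in>space M. 1 \<le> ennreal ?c * ?D \<omega>}"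
    let ?B = "{\<omega>\<in>space M. \<bar>lincomb (ens_unit e n t) \<omega>\<bar> \<le> d ^ (2 * m)}"
    have "emeasure M ?A \<le> ennreal ?c * (\<integral>\<^sup>+\<omega>. ?D \<omega> * indicator (space M) \<omega> \<partial>M)"
      by (rule nn_integral_Markov_inequality) auto
    also have "(\<integral>\<^sup>+\<omega>. ?D \<omega> * indicator (space M) \<omega> \<partial>M) = (\<integral>\<^sup>+\<omega>. ?D \<omega> \<partial>M)"
      by (intro nn_integral_cong) simp
    also have "ennreal ?c * (\<integral>\<^sup>+\<omega>. ?D \<omega> \<partial>M) \<le> ennreal ?c * ennreal (C * ?k)" using 1 t by (intro mult_left_mono) auto
    also have "\<dots> = ennreal (?c * (C * ?k))" by (rule ennreal_mult'[symmetric]) (rule c)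
    also have "?c * (C * ?k) = C * d ^ (2 * m)" using k by simp
    also have "ennreal (C * d ^ (2 * m)) \<le> ennreal (\<bar>C\<bar> * d ^ (2 * m))"
      using d by (intro ennreal_leI mult_right_mono) auto
    finally have A: "prob ?A \<le> \<bar>C\<bar> * d ^ (2 * m)" using d by (simp add: emeasure_eq_measure del: Xi_apply)
    have B: "prob ?B \<le> 8 * (d ^ (2 * m) + 1 / (real n)\<^sup>2)" using 2 t d by simp
    have "AE \<omega> in M. \<omega> \<in> {\<omega>\<in>space M. small_cond e n (d ^ 3) m t (Xi \<omega>)} \<longrightarrow> \<omega> \<in> ?A \<union> ?B"
      using AE_ens_good[OF n, of e] AE_space[of M]
    proof eventually_elim
      case (elim \<omega>)
      show ?case
      proof (rule impI, rule ccontr)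
      assume as: "\<omega> \<in> {\<omega>\<in>space M. small_cond e n (d ^ 3) m t (Xi \<omega>)}" "\<omega> \<notin> ?A \<union> ?B"
      have sm: "small_cond e n (d ^ 3) m t (Xi \<omega>)" and nA: "\<not> 1 \<le> ennreal ?c * ?D \<omega>"
        and nB: "d ^ (2 * m) < \<bar>lincomb (ens_unit e n t) \<omega>\<bar>"
        using as elim(2) by (auto simp: not_le)
      define D where "D = enn2real (?D \<omega>)"
      have "?D \<omega> \<noteq> \<infinity>"
      proof
        assume "?D \<omega> = \<infinity>"
        then have "ennreal ?c * ?D \<omega> = \<infinity>" using k d by (simp add: ennreal_mult_top)
        then show False using nA by simp
      qed
      then have D: "?D \<omega> = ennreal D" "0 \<le> D" by (simp_all add: D_def less_top)
      have "ennreal ?c * ?D \<omega> = ennreal (?c * D)" unfolding D(1) by (rule ennreal_mult'[OF c, symmetric])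
      then have "?c * D < 1" using nA c D by (simp add: not_le)
      then have D1: "d ^ (2 * m) * D < ?k" using k by (simp add: field_simps)
      have "ennreal ((ens_re e n (Xi \<omega>) t)\<^sup>2) \<le> ennreal ((d ^ 3) ^ (2 * m) * D)"
        using sm D d unfolding small_cond_def by (simp add: ennreal_mult')
      then have re: "(ens_re e n (Xi \<omega>) t)\<^sup>2 \<le> (d ^ 3) ^ (2 * m) * D"
        using D d by (subst (asm) ennreal_le_iff) auto
      have "(ens_re e n (Xi \<omega>) t)\<^sup>2 = ?k * (lincomb (ens_unit e n t) \<omega>)\<^sup>2"
        using ens_re_normalised[OF n hyp elim(1)] k by (simp add: power_mult_distrib)
      moreover have "(d ^ (2 * m))\<^sup>2 < (lincomb (ens_unit e n t) \<omega>)\<^sup>2"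
        using power_strict_mono[OF nB, of 2] d by simp
      then have "?k * (d ^ (2 * m))\<^sup>2 < ?k * (lincomb (ens_unit e n t) \<omega>)\<^sup>2" using k by simp
      ultimately have "?k * (d ^ (2 * m))\<^sup>2 < (d ^ 3) ^ (2 * m) * D" using re by simp
      also have "(d ^ 3) ^ (2 * m) = (d ^ (2 * m))\<^sup>2 * d ^ (2 * m)"
        by (simp add: power_mult[symmetric] power_add[symmetric] mult.commute)
      finally have "(d ^ (2 * m))\<^sup>2 * ?k < (d ^ (2 * m))\<^sup>2 * (d ^ (2 * m) * D)" by (simp add: mult_ac)
      then have "?k < d ^ (2 * m) * D" using d by simp
      then show False using D1 by simp
      qed
    qed
    then have "prob {\<omega>\<in>space M. small_cond e n (d ^ 3) m t (Xi \<omega>)} \<le> prob (?A \<union> ?B)"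
      by (rule finite_measure_mono_AE) measurable
    also have "\<dots> \<le> prob ?A + prob ?B" by (rule measure_Un_le) measurable
    also have "\<dots> \<le> \<bar>C\<bar> * d ^ (2 * m) + 8 * (d ^ (2 * m) + 1 / (real n)\<^sup>2)" using A B by simp
    also have "\<dots> \<le> (8 + \<bar>C\<bar>) * (d ^ (2 * m) + 1 / (real n)\<^sup>2)"
    proof -
      have "0 \<le> \<bar>C\<bar> * (1 / (real n)\<^sup>2)" by simp
      then show ?thesis by (simp only: distrib_left distrib_right)
    qed
    finally show "prob {\<omega>\<in>space M. small_cond e n (d ^ 3) m t (Xi \<omega>)} \<le> (8 + \<bar>C\<bar>) * (d ^ (2 * m) + 1 / (real n)\<^sup>2)" .
  qed
qed

text \<open>A central limit theorem for the pair, by way of arbitrary linear combinations: their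
  variances converge by \<open>ens_corr_tendsto\<close>, and their coefficients become uniformly
  small by \<open>ens_prob_small\<close>.\<close>

lemma joint_char_tendsto:
  fixes t \<delta> :: real
  assumes t: "t \<in> ens_J e" "t \<noteq> 0"
  defines "s \<equiv> \<lambda>n. t + \<delta> / sqrt (real n)"
  defines "r \<equiv> exp (- (ens_kappa e t * \<delta>)\<^sup>2 / 2)"
  shows "(\<lambda>n. CLINT \<omega>|M. iexp (u * lincomb (ens_unit e n t) \<omega> + v * lincomb (ens_unit e n (s n)) \<omega>))
     \<longlonglongrightarrow> of_real (exp (- (u\<^sup>2 + v\<^sup>2 + 2 * u * v * r) / 2))"
proof -
  have s: "s \<longlonglongrightarrow> t" unfolding s_def by real_asymp
  obtain \<beta> where \<beta>: "\<bar>t\<bar> < \<beta>" "e \<in> {HAF, WP} \<Longrightarrow> \<beta> < 1"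
  proof (cases "e \<in> {HAF, WP}")
    case True
    then have "\<bar>t\<bar> < 1" using t by (auto simp: abs_less_iff)
    then obtain c where "\<bar>t\<bar> < c" "c < 1" using dense by blast
    then show ?thesis by (rule that)
  next
    case False
    then show ?thesis using that[of "\<bar>t\<bar> + 1"] by auto
  qed
  define \<alpha> where "\<alpha> = \<bar>t\<bar> / 2"
  have \<alpha>: "0 < \<alpha>" "\<alpha> < \<bar>t\<bar>" using t by (auto simp: \<alpha>_def)
  have as: "(\<lambda>n. \<bar>s n\<bar>) \<longlonglongrightarrow> \<bar>t\<bar>" and ts: "(\<lambda>n. t * s n) \<longlonglongrightarrow> t * t"
    by (rule tendsto_rabs[OF s], rule tendsto_mult[OF tendsto_const s])
  have evs: "eventually (\<lambda>n. \<alpha> < \<bar>s n\<bar>) sequentially" "eventually (\<lambda>n. \<bar>s n\<bar> < \<beta>) sequentially" "eventually (\<lambda>n. 0 < t * s n) sequentially"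
    subgoal by (rule order_tendstoD(1)[OF as \<alpha>(2)])
    subgoal by (rule order_tendstoD(2)[OF as \<beta>(1)])
    subgoal by (rule order_tendstoD(1)[OF ts]) (use t not_real_square_gt_zero[of t] in blast)
    done
  define rn where "rn n = ens_ker e n (t * s n) / sqrt (ens_ker e n (t\<^sup>2) * ens_ker e n ((s n)\<^sup>2))" for n
  have rn: "rn \<longlonglongrightarrow> r" unfolding rn_def s_def r_def by (rule ens_corr_tendsto[OF t])
  define V where "V n = u\<^sup>2 + v\<^sup>2 + 2 * u * v * rn n" for n
  define V0 where "V0 = u\<^sup>2 + v\<^sup>2 + 2 * u * v * r"
  have V: "V \<longlonglongrightarrow> V0" unfolding V_def V0_def by (intro tendsto_intros rn)
  define a where "a n k = u * ens_unit e n t k + v * ens_unit e n (s n) k" for n k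
  have key: "eventually (\<lambda>n. summable (\<lambda>k. \<bar>a n k\<bar>) \<and> (\<lambda>k. (a n k)\<^sup>2) sums V n \<and>
     (CLINT \<omega>|M. iexp (u * lincomb (ens_unit e n t) \<omega> + v * lincomb (ens_unit e n (s n)) \<omega>)) = (CLINT \<omega>|M. iexp (lincomb (a n) \<omega>))) sequentially"
    using evs eventually_ge_at_top[of 1]
  proof eventually_elim
    case (elim n)
    have ht: "e = HAF \<longrightarrow> \<bar>t\<bar> < 1" and hs: "e = HAF \<longrightarrow> \<bar>s n\<bar> < 1" using \<beta> elim by auto
    note st = ens_unit_summable[OF elim(4) ht] ens_unit_summable[OF elim(4) hs]
    have 1: "summable (\<lambda>k. \<bar>a n k\<bar>)"
    proof (rule summable_comparison_test')
      show "summable (\<lambda>k. \<bar>u\<bar> * \<bar>ens_unit e n t k\<bar> + \<bar>v\<bar> * \<bar>ens_unit e n (s n) k\<bar>)"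
        by (intro summable_add summable_mult st)
      show "norm \<bar>a n k\<bar> \<le> \<bar>u\<bar> * \<bar>ens_unit e n t k\<bar> + \<bar>v\<bar> * \<bar>ens_unit e n (s n) k\<bar>" for k
        using abs_triangle_ineq[of "u * ens_unit e n t k" "v * ens_unit e n (s n) k"] by (simp add: a_def abs_mult)
    qed
    have "(\<lambda>k. u\<^sup>2 * (ens_unit e n t k)\<^sup>2 + v\<^sup>2 * (ens_unit e n (s n) k)\<^sup>2 + 2 * u * v * (ens_unit e n t k * ens_unit e n (s n) k)) sums
       (u\<^sup>2 * 1 + v\<^sup>2 * 1 + 2 * u * v * rn n)"
      unfolding rn_def
      by (intro sums_add sums_mult ens_unit_sums_1 ens_unit_inner_sums elim(4) ht hs) (use ht hs elim in auto)
    then have 2: "(\<lambda>k. (a n k)\<^sup>2) sums V n" by (simp add: a_def V_def power2_sum power_mult_distrib mult_ac)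
    have "AE \<omega> in M. lincomb (a n) \<omega> = u * lincomb (ens_unit e n t) \<omega> + v * lincomb (ens_unit e n (s n)) \<omega>"
      using AE_lincomb_tendsto[OF st(1)] AE_lincomb_tendsto[OF st(2)]
    proof eventually_elim
      case (elim \<omega>)
      then have "(\<lambda>k. u * (ens_unit e n t k * \<xi> k \<omega>) + v * (ens_unit e n (s n) k * \<xi> k \<omega>)) sums
         (u * lincomb (ens_unit e n t) \<omega> + v * lincomb (ens_unit e n (s n)) \<omega>)"
        by (intro sums_add sums_mult) (auto simp: sums_def)
      then show ?case by (simp add: sums_iff a_def algebra_simps)
    qed
    then have "(CLINT \<omega>|M. iexp (u * lincomb (ens_unit e n t) \<omega> + v * lincomb (ens_unit e n (s n)) \<omega>)) = (CLINT \<omega>|M. iexp (lincomb (a n) \<omega>))"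
      by (intro integral_cong_AE) (auto elim!: eventually_mono)
    with 1 2 show ?case by blast
  qed
  have "(\<lambda>n. (CLINT \<omega>|M. iexp (lincomb (a n) \<omega>)) - of_real (exp (- V n / 2))) \<longlonglongrightarrow> 0"
  proof (rule tendstoI)
    fix \<epsilon> :: real assume \<epsilon>: "0 < \<epsilon>"
    \<comment> \<open>Eventually \<open>V n < |V0| + 1\<close>, so the error \<epsilon>' times
      \<open>V n\<close> stays below \<epsilon>.\<close>
    define \<epsilon>' where "\<epsilon>' = \<epsilon> / (\<bar>V0\<bar> + 2)"
    have \<epsilon>': "0 < \<epsilon>'" using \<epsilon> by (simp add: \<epsilon>'_def)
    obtain \<eta> where \<eta>: "0 < \<eta>" "\<And>a V. summable (\<lambda>k. \<bar>a k\<bar>) \<Longrightarrow> (\<lambda>k. (a k)\<^sup>2) sums V \<Longrightarrow> (\<And>k. \<bar>a k\<bar> \<le> \<eta>) \<Longrightarrow>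
      norm ((CLINT \<omega>|M. iexp (lincomb a \<omega>)) - of_real (exp (- V / 2))) \<le> \<epsilon>' * V"
      using char_lincomb_normal[OF \<epsilon>'] by blast
    define \<zeta> where "\<zeta> = \<eta> / (\<bar>u\<bar> + \<bar>v\<bar> + 1)"
    have \<zeta>: "0 < \<zeta>" using \<eta>(1) by (simp add: \<zeta>_def)
    have \<beta>2: "\<beta>\<^sup>2 < 1" if "e \<in> {HAF, WP}" using \<beta> that by (simp add: abs_square_less_1)
    have sm: "eventually (\<lambda>n. \<forall>x k. \<alpha>\<^sup>2 \<le> x \<longrightarrow> x \<le> \<beta>\<^sup>2 \<longrightarrow> ens_prob e n x k \<le> \<zeta>\<^sup>2) sequentially"
      by (rule ens_prob_small) (use \<alpha> \<beta> \<beta>2 \<zeta> in \<open>auto intro!: power_mono\<close>)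
    have "eventually (\<lambda>n. V n < \<bar>V0\<bar> + 1) sequentially" by (rule order_tendstoD(2)[OF V]) simp
    with key sm evs eventually_ge_at_top[of 1]
    show "eventually (\<lambda>n. dist ((CLINT \<omega>|M. iexp (lincomb (a n) \<omega>)) - of_real (exp (- V n / 2))) 0 < \<epsilon>) sequentially"
    proof eventually_elim
      case (elim n)
      have ht: "e = HAF \<longrightarrow> \<bar>t\<bar> < 1" and hs: "e = HAF \<longrightarrow> \<bar>s n\<bar> < 1" using \<beta> elim by auto
      have un: "\<bar>ens_unit e n y k\<bar> \<le> \<zeta>" if "\<alpha> \<le> \<bar>y\<bar>" "\<bar>y\<bar> \<le> \<beta>" "e = HAF \<longrightarrow> \<bar>y\<bar> < 1" for y k
      proof -
        have "\<alpha>\<^sup>2 \<le> y\<^sup>2" "y\<^sup>2 \<le> \<beta>\<^sup>2" using that \<alpha> power_mono[of \<alpha> "\<bar>y\<bar>" 2] power_mono[of "\<bar>y\<bar>" \<beta> 2] by auto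
        then have "(ens_unit e n y k)\<^sup>2 \<le> \<zeta>\<^sup>2" unfolding ens_unit_square[OF elim(6) that(3)] using elim by blast
        then show ?thesis using \<zeta> by (simp add: abs_le_square_iff[symmetric])
      qed
      have "\<bar>a n k\<bar> \<le> \<eta>" for k
      proof -
        have "\<bar>a n k\<bar> \<le> \<bar>u\<bar> * \<bar>ens_unit e n t k\<bar> + \<bar>v\<bar> * \<bar>ens_unit e n (s n) k\<bar>"
          using abs_triangle_ineq[of "u * ens_unit e n t k" "v * ens_unit e n (s n) k"] by (simp add: a_def abs_mult)
        also have "\<dots> \<le> \<bar>u\<bar> * \<zeta> + \<bar>v\<bar> * \<zeta>"
          using un[of t k] un[of "s n" k] \<alpha> \<beta> elim ht hs by (intro add_mono mult_left_mono) auto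
        also have "\<dots> \<le> (\<bar>u\<bar> + \<bar>v\<bar> + 1) * \<zeta>" using \<zeta> by (simp add: algebra_simps)
        also have "\<dots> = \<eta>" by (simp add: \<zeta>_def)
        finally show ?thesis .
      qed
      then have "norm ((CLINT \<omega>|M. iexp (lincomb (a n) \<omega>)) - of_real (exp (- V n / 2))) \<le> \<epsilon>' * V n"
        using elim by (intro \<eta>(2)) auto
      also have "\<dots> < \<epsilon>' * (\<bar>V0\<bar> + 2)" using elim \<epsilon>' by (intro mult_strict_left_mono) auto
      also have "\<dots> = \<epsilon>" by (simp add: \<epsilon>'_def)
      finally show ?case by simp
    qed
  qed
  moreover have "(\<lambda>n. complex_of_real (exp (- V n / 2))) \<longlonglongrightarrow> of_real (exp (- V0 / 2))"
    by (intro tendsto_intros V) auto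
  ultimately have "(\<lambda>n. ((CLINT \<omega>|M. iexp (lincomb (a n) \<omega>)) - of_real (exp (- V n / 2))) + of_real (exp (- V n / 2))) \<longlonglongrightarrow> 0 + of_real (exp (- V0 / 2))"
    by (rule tendsto_add)
  then have "(\<lambda>n. CLINT \<omega>|M. iexp (lincomb (a n) \<omega>)) \<longlonglongrightarrow> of_real (exp (- V0 / 2))" by simp
  then show ?thesis unfolding V0_def
    by (rule Lim_transform_eventually) (use key in \<open>auto elim: eventually_mono\<close>)
qed

end

section \<open>Sign changes and the total number of zeros\<close>

text \<open>For y > 0 this is \<open>arccos r / pi\<close> with \<open>r = exp (- y^2 / 2)\<close>,
  in the arc tangent form delivered by \<open>gauss2_quadrant\<close>.\<close>

definition sign_change_limit :: "real \<Rightarrow> real" where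
  "sign_change_limit y = 1 / 2 - arctan (exp (- y\<^sup>2 / 2) / sqrt (1 - (exp (- y\<^sup>2 / 2))\<^sup>2)) / pi"

lemma ens_kappa_pos: "t \<in> ens_J e \<Longrightarrow> 0 < ens_kappa e t"
proof (cases e)
  case HAF
  assume "t \<in> ens_J e"
  then have "t\<^sup>2 < 1" using HAF by (simp add: abs_square_less_1 abs_less_iff)
  then show ?thesis using HAF by simp
qed (auto intro: add_pos_nonneg)

text \<open>Finiteness of zeros on a compact disc, inside a larger disc that also contains a point
  where the function does not vanish. A constant function has to be treated apart: it then has no
  zeros at all.\<close>

lemma finite_ens_zeros:
  assumes good: "ens_good e n x" and nz: "\<not> (\<forall>z\<in>ens_domain e. ens_fun e n x z = 0)" and \<beta>: "e = HAF \<longrightarrow> \<beta> < 1"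
  shows "finite {t. \<bar>t\<bar> \<le> \<beta> \<and> ens_re e n x t = 0}"
proof -
  obtain z0 where z0: "z0 \<in> ens_domain e" "ens_fun e n x z0 \<noteq> 0" using nz by blast
  obtain R where R: "norm z0 < R" "\<beta> < R" "e = HAF \<longrightarrow> R \<le> 1"
  proof (cases "e = HAF")
    case True
    then show ?thesis using that[of 1] z0(1) \<beta> by auto
  next
    case False
    then show ?thesis using that[of "max (norm z0) \<beta> + 1"] by auto
  qed
  have hol: "ens_fun e n x holomorphic_on ball 0 R" using ens_good_holomorphic[OF good, of 0 R] R by auto
  have sub: "complex_of_real ` {t. \<bar>t\<bar> \<le> \<beta> \<and> ens_re e n x t = 0} \<subseteq> {z \<in> cball 0 \<beta>. ens_fun e n x z = 0}"
    using ens_fun_of_real(1)[OF good] \<beta> by auto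
  have "finite {z \<in> cball 0 \<beta>. ens_fun e n x z = 0}"
  proof (cases "ens_fun e n x constant_on ball 0 R")
    case True
    then obtain c where c: "\<And>z. z \<in> ball 0 R \<Longrightarrow> ens_fun e n x z = c" by (auto simp: constant_on_def)
    have "z0 \<in> ball 0 R" using R by simp
    then have "c \<noteq> 0" using z0(2) c by auto
    then have em: "{z \<in> cball 0 \<beta>. ens_fun e n x z = 0} = {}" using c R by force
    show ?thesis unfolding em by simp
  next
    case False
    show ?thesis
      by (rule holomorphic_compact_finite_zeros[OF hol]) (use R False in auto)
  qed
  then have "finite (complex_of_real ` {t. \<bar>t\<bar> \<le> \<beta> \<and> ens_re e n x t = 0})" using sub finite_subset by blast
  then show ?thesis by (rule finite_imageD) (simp add: inj_on_def)
qed

lemma card_zeros_polynomial: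
  assumes e: "e \<in> {SP, WP}" and nz: "\<not> (\<forall>z\<in>ens_domain e. ens_fun e n x z = 0)"
    and Z: "finite Z" "\<And>t. t \<in> Z \<Longrightarrow> ens_fun e n x (of_real t) = 0"
  shows "card Z \<le> n"
proof -
  define p where "p = (\<Sum>k\<le>n. monom (complex_of_real (ens_coeff e n k * x k)) k)"
  have p: "poly p z = ens_fun e n x z" for z
  proof -
    have "(\<lambda>k. complex_of_real (ens_coeff e n k * x k) * z ^ k) sums (\<Sum>k\<le>n. complex_of_real (ens_coeff e n k * x k) * z ^ k)"
      by (rule sums_finite) (use e in \<open>auto simp: not_le\<close>)
    then show ?thesis by (simp add: p_def poly_sum poly_monom ens_fun_def sums_iff)
  qed
  have p0: "p \<noteq> 0" using nz p by (metis poly_0)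
  have "card Z = card (complex_of_real ` Z)" by (simp add: card_image inj_on_def)
  also have "\<dots> \<le> card {z. poly p z = 0}"
    by (intro card_mono poly_roots_finite p0) (auto simp: p Z)
  also have "\<dots> \<le> degree p" using p0 by (rule card_poly_roots_bound)
  also have "\<dots> \<le> n" unfolding p_def by (intro degree_sum_le) (auto intro: order_trans[OF degree_monom_le])
  finally show ?thesis .
qed

text \<open>The Blaschke constant for zeros of modulus at most s and evaluation on the circle of
  radius \<open>r / 2\<close>. Positivity serves the case of an infinite circle mean, where the
  bound must remain infinite.\<close>

lemma blaschke_constant:
  fixes r s :: real
  assumes "0 \<le> s" "s < r"
  shows "0 < sqrt (1 - (r\<^sup>2 - s\<^sup>2) * (r\<^sup>2 - (r / 2)\<^sup>2) / (4 * r ^ 4))"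
    "sqrt (1 - (r\<^sup>2 - s\<^sup>2) * (r\<^sup>2 - (r / 2)\<^sup>2) / (4 * r ^ 4)) < 1"
proof -
  have s2: "s\<^sup>2 < r\<^sup>2" using assms by (intro power_strict_mono) auto
  have h2: "(r / 2)\<^sup>2 < r\<^sup>2" using assms by (intro power_strict_mono) auto
  have "(r\<^sup>2 - s\<^sup>2) * (r\<^sup>2 - (r / 2)\<^sup>2) \<le> r\<^sup>2 * r\<^sup>2"
    by (rule mult_mono) (use h2 in auto)
  then have "(r\<^sup>2 - s\<^sup>2) * (r\<^sup>2 - (r / 2)\<^sup>2) / (4 * r ^ 4) \<le> r\<^sup>2 * r\<^sup>2 / (4 * r ^ 4)" by (rule divide_right_mono) simp
  also have "\<dots> = 1 / 4" using assms by (simp add: power2_eq_square power4_eq_xxxx)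
  finally have "(r\<^sup>2 - s\<^sup>2) * (r\<^sup>2 - (r / 2)\<^sup>2) / (4 * r ^ 4) < 1" by linarith
  then show "0 < sqrt (1 - (r\<^sup>2 - s\<^sup>2) * (r\<^sup>2 - (r / 2)\<^sup>2) / (4 * r ^ 4))"
    by (intro real_sqrt_gt_zero) linarith
  have "0 < (r\<^sup>2 - s\<^sup>2) * (r\<^sup>2 - (r / 2)\<^sup>2) / (4 * r ^ 4)"
    by (intro divide_pos_pos mult_pos_pos) (use s2 h2 assms in auto)
  then have "sqrt (1 - (r\<^sup>2 - s\<^sup>2) * (r\<^sup>2 - (r / 2)\<^sup>2) / (4 * r ^ 4)) < sqrt 1" by (intro real_sqrt_less_mono) linarith
  then show "sqrt (1 - (r\<^sup>2 - s\<^sup>2) * (r\<^sup>2 - (r / 2)\<^sup>2) / (4 * r ^ 4)) < 1" by simp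
qed

text \<open>A substitute for Jensen's formula at the origin, which would give nothing when the
  constant coefficient vanishes. Many zeros make the function small on the whole circle of radius
  \<open>r / 2\<close>, and then Cauchy's estimates make every coefficient small, so that one low
  coefficient of normal size gives a contradiction.\<close>

lemma coeff_bound_of_zeros:
  assumes good: "ens_good e n x" and r: "0 < r" "e = HAF \<longrightarrow> r < 1" and s: "0 \<le> s" "s < r"
    and Z: "finite Z" "\<And>t. t \<in> Z \<Longrightarrow> \<bar>t\<bar> \<le> s \<and> ens_re e n x t = 0" "m \<le> card Z"
  defines "q \<equiv> sqrt (1 - (r\<^sup>2 - s\<^sup>2) * (r\<^sup>2 - (r / 2)\<^sup>2) / (4 * r ^ 4))"
  shows "ennreal (ens_w e n j * (x j)\<^sup>2 * (r / 2) ^ (2 * j)) \<le> ennreal (2 * q ^ (2 * m)) * circ_mean 0 r (ens_fun e n x)"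
proof (cases "circ_mean 0 r (ens_fun e n x) = \<infinity>")
  case True
  have "0 < q" unfolding q_def by (rule blaschke_constant) (use r s in auto)
  then show ?thesis using True by (simp add: ennreal_mult_top)
next
  case False
  define D where "D = enn2real (circ_mean 0 r (ens_fun e n x))"
  have D: "circ_mean 0 r (ens_fun e n x) = ennreal D" "0 \<le> D" using False by (simp_all add: D_def less_top)
  obtain R where R: "r < R" "e = HAF \<longrightarrow> R \<le> 1"
  proof (cases "e = HAF")
    case True
    then show ?thesis using that[of 1] r by simp
  next
    case False
    then show ?thesis using that[of "r + 1"] by simp
  qed
  have hol: "ens_fun e n x holomorphic_on ball 0 R" using ens_good_holomorphic[OF good, of 0 R] R by auto
  obtain Y where Y: "Y \<subseteq> Z" "card Y = m" "finite Y" using obtain_subset_with_card_n[OF Z(3)] by blast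
  define ws where "ws = map complex_of_real (sorted_list_of_set Y)"
  have ws: "set ws = complex_of_real ` Y" "distinct ws" "length ws = m"
    using Y by (auto simp: ws_def distinct_map inj_on_def)
  have wb: "norm w \<le> s" if "w \<in> set ws" for w using that ws Y Z by auto
  have "0 < q" unfolding q_def by (rule blaschke_constant) (use r s in auto)
  then have q0: "0 \<le> q" by simp
  have "\<exists>g. g holomorphic_on ball 0 R \<and> (\<forall>z. ens_fun e n x z = (\<Prod>w\<leftarrow>ws. z - w) * g z)"
  proof (rule holomorphic_factor_zeros[OF open_ball hol ws(2)])
    show "set ws \<subseteq> ball 0 R" using wb s R by force
    fix z assume "z \<in> set ws"
    then obtain t where t: "z = of_real t" "t \<in> Z" using ws Y by auto
    then have "\<bar>t\<bar> \<le> s" "ens_re e n x t = 0" using Z by auto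
    then show "ens_fun e n x z = 0" using ens_fun_of_real(1)[OF good, of t] t s r by auto
  qed
  then obtain g where g: "g holomorphic_on ball 0 R" "\<And>z. ens_fun e n x z = (\<Prod>w\<leftarrow>ws. z - w) * g z" by blast
  have circle: "norm (ens_fun e n x z) \<le> sqrt (2 * q ^ (2 * m) * D)" if z: "norm z = r / 2" for z
  proof -
    have "ennreal ((norm (ens_fun e n x z))\<^sup>2) \<le> ennreal (r / (r - norm (z - 0)) * q ^ (2 * length ws)) * circ_mean 0 r (ens_fun e n x)"
    proof (rule blaschke_bound_circ_mean[OF g(2,1)])
      show "r * norm (z - w) \<le> q * norm ((complex_of_real r)\<^sup>2 - cnj (w - 0) * (z - 0))" if "w \<in> set ws" for w
        using blaschke_factor_real[OF wb[OF that], of z "r / 2" r] z r s by (simp add: q_def)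
    qed (use r R z q0 in auto)
    \<comment> \<open>The evaluation circle has half the radius of the mean circle, which makes the
      prefactor 2.\<close>
    also have "r / (r - norm (z - 0)) * q ^ (2 * length ws) = 2 * q ^ (2 * m)" using z r ws by (simp add: field_simps)
    also have "ennreal (2 * q ^ (2 * m)) * circ_mean 0 r (ens_fun e n x) = ennreal (2 * q ^ (2 * m) * D)"
      unfolding D using D q0 by (simp add: ennreal_mult')
    finally have "(norm (ens_fun e n x z))\<^sup>2 \<le> 2 * q ^ (2 * m) * D"
      using D q0 by (subst (asm) ennreal_le_iff) auto
    then show ?thesis by (rule real_le_rsqrt)
  qed
  have "ens_coeff e n j * \<bar>x j\<bar> * (r / 2) ^ j \<le> sqrt (2 * q ^ (2 * m) * D)"
    by (rule ens_coeff_bound[OF good _ _ circle]) (use r in auto)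
  then have "(ens_coeff e n j * \<bar>x j\<bar> * (r / 2) ^ j)\<^sup>2 \<le> (sqrt (2 * q ^ (2 * m) * D))\<^sup>2"
    by (rule power_mono) (use r in auto)
  then have "ens_w e n j * (x j)\<^sup>2 * (r / 2) ^ (2 * j) \<le> 2 * q ^ (2 * m) * D"
    using D q0 by (simp add: ens_w_def power_mult_distrib power_mult[symmetric] mult.commute[of _ 2])
  then show ?thesis unfolding D using D q0 by (simp add: ennreal_mult'[symmetric] ennreal_leI)
qed

context iid_std
begin

text \<open>A negative product is a union of two open quadrants, a nonpositive one the complement of
  the other two. The limits agree because the Gaussian limit does not charge the axes; the strict
  version serves the lower bound for zeros and the weak one the upper bound.\<close>

lemma sign_change_tendsto:
  fixes t \<delta> :: real
  assumes t: "t \<in> ens_J e" "t \<noteq> 0" and \<delta>: "0 < \<delta>"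
  defines "s \<equiv> \<lambda>n. t + \<delta> / sqrt (real n)"
  shows "(\<lambda>n. prob {\<omega>\<in>space M. ens_re e n (Xi \<omega>) t * ens_re e n (Xi \<omega>) (s n) < 0}) \<longlonglongrightarrow> sign_change_limit (ens_kappa e t * \<delta>)"
    "(\<lambda>n. prob {\<omega>\<in>space M. ens_re e n (Xi \<omega>) t * ens_re e n (Xi \<omega>) (s n) \<le> 0}) \<longlonglongrightarrow> sign_change_limit (ens_kappa e t * \<delta>)"
proof -
  define r where "r = exp (- (ens_kappa e t * \<delta>)\<^sup>2 / 2)"
  have "0 < ens_kappa e t * \<delta>" using ens_kappa_pos[OF t(1)] \<delta> by simp
  then have "(ens_kappa e t * \<delta>)\<^sup>2 > 0" by (metis less_irrefl zero_less_power2)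
  then have r: "0 < r" "r < 1" by (simp_all add: r_def)
  then have r2: "r\<^sup>2 < 1" by (simp add: power_less_one_iff)
  let ?X = "\<lambda>n \<omega>. lincomb (ens_unit e n t) \<omega>" let ?Y = "\<lambda>n \<omega>. lincomb (ens_unit e n (s n)) \<omega>"
  \<comment> \<open>Flipping signs reduces each quadrant to the first one, with the correlation
    multiplied by \<open>\<sigma> * \<tau>\<close>.\<close>
  have Q: "(\<lambda>n. prob {\<omega>\<in>space M. 0 < \<sigma> * ?X n \<omega> \<and> 0 < \<tau> * ?Y n \<omega>}) \<longlonglongrightarrow> 1 / 4 + arctan (\<sigma> * \<tau> * r / sqrt (1 - r\<^sup>2)) / (2 * pi)"
    if \<sigma>\<tau>: "\<sigma>\<^sup>2 = 1" "\<tau>\<^sup>2 = 1" for \<sigma> \<tau> :: real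
  proof -
    define r' where "r' = \<sigma> * \<tau> * r"
    have r'2: "r'\<^sup>2 = r\<^sup>2" using \<sigma>\<tau> by (simp add: r'_def power_mult_distrib)
    have r'1: "r'\<^sup>2 < 1" using r2 r'2 by simp
    have sn: "sqrt (1 - r'\<^sup>2) \<noteq> 0" using r'1 by simp
    have "(\<lambda>n. prob {\<omega>\<in>space M. 0 < \<sigma> * ?X n \<omega> \<and> 0 < \<tau> * ?Y n \<omega>}) \<longlonglongrightarrow>
      measure gauss2 {p\<in>space gauss2. 0 < fst p \<and> 0 < r' * fst p + sqrt (1 - r'\<^sup>2) * snd p}"
    proof (rule quadrant_convergence[OF prob_space_axioms prob_space_gauss2])
      fix u v
      have T: "(\<lambda>n. CLINT \<omega>|M. iexp ((u * \<sigma>) * ?X n \<omega> + (v * \<tau>) * ?Y n \<omega>)) \<longlonglongrightarrow>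
          of_real (exp (- ((u * \<sigma>)\<^sup>2 + (v * \<tau>)\<^sup>2 + 2 * (u * \<sigma>) * (v * \<tau>) * r) / 2))"
        unfolding s_def r_def by (rule joint_char_tendsto[OF t])
      have eq: "(u * \<sigma>)\<^sup>2 + (v * \<tau>)\<^sup>2 + 2 * (u * \<sigma>) * (v * \<tau>) * r = u\<^sup>2 + v\<^sup>2 + 2 * u * v * r'"
        using \<sigma>\<tau> by (simp add: power_mult_distrib r'_def mult_ac)
      from T show "(\<lambda>n. CLINT \<omega>|M. iexp (u * (\<sigma> * ?X n \<omega>) + v * (\<tau> * ?Y n \<omega>))) \<longlonglongrightarrow>
          (CLINT p|gauss2. iexp (u * fst p + v * (r' * fst p + sqrt (1 - r'\<^sup>2) * snd p)))"
        unfolding char_gauss2[OF r'1] eq by (simp only: mult.assoc)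
    qed (use AE_gauss2_neq[OF sn] in auto)
    moreover have "1 / 4 + arctan (r' / sqrt (1 - r'\<^sup>2)) / (2 * pi) = 1 / 4 + arctan (\<sigma> * \<tau> * r / sqrt (1 - r\<^sup>2)) / (2 * pi)"
      unfolding r'2 by (simp only: r'_def)
    ultimately show ?thesis unfolding gauss2_quadrant[OF r'1] by (simp only:)
  qed
  have lim: "1 / 4 + arctan (1 * (-1) * r / sqrt (1 - r\<^sup>2)) / (2 * pi) + (1 / 4 + arctan ((-1) * 1 * r / sqrt (1 - r\<^sup>2)) / (2 * pi)) = sign_change_limit (ens_kappa e t * \<delta>)"
    "1 - (1 / 4 + arctan (1 * 1 * r / sqrt (1 - r\<^sup>2)) / (2 * pi) + (1 / 4 + arctan ((-1) * (-1) * r / sqrt (1 - r\<^sup>2)) / (2 * pi))) = sign_change_limit (ens_kappa e t * \<delta>)"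
    by (simp_all add: sign_change_limit_def r_def arctan_minus)
  have s: "s \<longlonglongrightarrow> t" unfolding s_def by real_asymp
  have evs: "eventually (\<lambda>n. e = HAF \<longrightarrow> \<bar>s n\<bar> < 1) sequentially"
  proof (cases "e = HAF")
    case True
    then have "\<bar>t\<bar> < 1" using t by (auto simp: abs_less_iff)
    then show ?thesis using order_tendstoD(2)[OF tendsto_rabs[OF s], of 1] by (auto elim: eventually_mono)
  qed auto
  have ev: "eventually (\<lambda>n. AE \<omega> in M. \<exists>c>0. ens_re e n (Xi \<omega>) t * ens_re e n (Xi \<omega>) (s n) = c * (?X n \<omega> * ?Y n \<omega>)) sequentially"
    using evs eventually_ge_at_top[of 1]
  proof eventually_elim
    case (elim n)
    have ht: "e = HAF \<longrightarrow> \<bar>t\<bar> < 1" using t by (auto simp: abs_less_iff)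
    have k: "1 \<le> ens_ker e n (t\<^sup>2)" "1 \<le> ens_ker e n ((s n)\<^sup>2)"
      using elim ht by (auto intro!: ens_ker_ge_1 simp: abs_square_less_1)
    show ?case using AE_ens_good[OF elim(2), of e]
    proof eventually_elim
      case el: (elim \<omega>)
      show ?case
        using k ens_re_normalised[OF elim(2) ht el] ens_re_normalised[OF elim(2) elim(1) el]
        by (intro exI[of _ "sqrt (ens_ker e n (t\<^sup>2)) * sqrt (ens_ker e n ((s n)\<^sup>2))"]) auto
    qed
  qed
  have "(\<lambda>n. prob {\<omega>\<in>space M. 0 < 1 * ?X n \<omega> \<and> 0 < (-1) * ?Y n \<omega>} + prob {\<omega>\<in>space M. 0 < (-1) * ?X n \<omega> \<and> 0 < 1 * ?Y n \<omega>})
     \<longlonglongrightarrow> sign_change_limit (ens_kappa e t * \<delta>)"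
    unfolding lim(1)[symmetric] by (intro tendsto_add Q) auto
  moreover have "eventually (\<lambda>n. prob {\<omega>\<in>space M. 0 < 1 * ?X n \<omega> \<and> 0 < (-1) * ?Y n \<omega>} + prob {\<omega>\<in>space M. 0 < (-1) * ?X n \<omega> \<and> 0 < 1 * ?Y n \<omega>}
     = prob {\<omega>\<in>space M. ens_re e n (Xi \<omega>) t * ens_re e n (Xi \<omega>) (s n) < 0}) sequentially"
    using ev
  proof eventually_elim
    case (elim n)
    have "prob {\<omega>\<in>space M. ens_re e n (Xi \<omega>) t * ens_re e n (Xi \<omega>) (s n) < 0} =
      prob ({\<omega>\<in>space M. 0 < 1 * ?X n \<omega> \<and> 0 < (-1) * ?Y n \<omega>} \<union> {\<omega>\<in>space M. 0 < (-1) * ?X n \<omega> \<and> 0 < 1 * ?Y n \<omega>})"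
    proof (rule finite_measure_eq_AE)
      show "AE \<omega> in M. (\<omega> \<in> {\<omega>\<in>space M. ens_re e n (Xi \<omega>) t * ens_re e n (Xi \<omega>) (s n) < 0}) =
        (\<omega> \<in> {\<omega>\<in>space M. 0 < 1 * ?X n \<omega> \<and> 0 < (-1) * ?Y n \<omega>} \<union> {\<omega>\<in>space M. 0 < (-1) * ?X n \<omega> \<and> 0 < 1 * ?Y n \<omega>})"
        using elim AE_space[of M]
      proof eventually_elim
        case el: (elim \<omega>)
        then obtain c where c: "0 < c" and eq: "ens_re e n (Xi \<omega>) t * ens_re e n (Xi \<omega>) (s n) = c * (?X n \<omega> * ?Y n \<omega>)" by blast
        have "(c * (?X n \<omega> * ?Y n \<omega>) < 0) = (?X n \<omega> * ?Y n \<omega> < 0)"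
          using mult_less_cancel_left_pos[OF c, of "?X n \<omega> * ?Y n \<omega>" 0] by simp
        also have "\<dots> = (0 < 1 * ?X n \<omega> \<and> 0 < (-1) * ?Y n \<omega> \<or> 0 < (-1) * ?X n \<omega> \<and> 0 < 1 * ?Y n \<omega>)"
          by (simp add: mult_less_0_iff)
        finally show ?case unfolding mem_Collect_eq Un_iff eq using el(2) by simp
      qed
    qed measurable
    also have "\<dots> = prob {\<omega>\<in>space M. 0 < 1 * ?X n \<omega> \<and> 0 < (-1) * ?Y n \<omega>} + prob {\<omega>\<in>space M. 0 < (-1) * ?X n \<omega> \<and> 0 < 1 * ?Y n \<omega>}"
      by (rule finite_measure_Union) auto
    finally show ?case by (rule sym)
  qed
  ultimately show "(\<lambda>n. prob {\<omega>\<in>space M. ens_re e n (Xi \<omega>) t * ens_re e n (Xi \<omega>) (s n) < 0}) \<longlonglongrightarrow> sign_change_limit (ens_kappa e t * \<delta>)"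
    by (rule Lim_transform_eventually)
  have "(\<lambda>n. 1 - (prob {\<omega>\<in>space M. 0 < 1 * ?X n \<omega> \<and> 0 < 1 * ?Y n \<omega>} + prob {\<omega>\<in>space M. 0 < (-1) * ?X n \<omega> \<and> 0 < (-1) * ?Y n \<omega>}))
     \<longlonglongrightarrow> sign_change_limit (ens_kappa e t * \<delta>)"
    unfolding lim(2)[symmetric] by (intro tendsto_diff tendsto_const tendsto_add Q) auto
  moreover have "eventually (\<lambda>n. 1 - (prob {\<omega>\<in>space M. 0 < 1 * ?X n \<omega> \<and> 0 < 1 * ?Y n \<omega>} + prob {\<omega>\<in>space M. 0 < (-1) * ?X n \<omega> \<and> 0 < (-1) * ?Y n \<omega>})
     = prob {\<omega>\<in>space M. ens_re e n (Xi \<omega>) t * ens_re e n (Xi \<omega>) (s n) \<le> 0}) sequentially"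
    using ev
  proof eventually_elim
    case (elim n)
    let ?U = "{\<omega>\<in>space M. 0 < 1 * ?X n \<omega> \<and> 0 < 1 * ?Y n \<omega>} \<union> {\<omega>\<in>space M. 0 < (-1) * ?X n \<omega> \<and> 0 < (-1) * ?Y n \<omega>}"
    have "prob {\<omega>\<in>space M. ens_re e n (Xi \<omega>) t * ens_re e n (Xi \<omega>) (s n) \<le> 0} = prob (space M - ?U)"
    proof (rule finite_measure_eq_AE)
      show "AE \<omega> in M. (\<omega> \<in> {\<omega>\<in>space M. ens_re e n (Xi \<omega>) t * ens_re e n (Xi \<omega>) (s n) \<le> 0}) = (\<omega> \<in> space M - ?U)"
        using elim AE_space[of M]
      proof eventually_elim
        case el: (elim \<omega>)
        then obtain c where c: "0 < c" and eq: "ens_re e n (Xi \<omega>) t * ens_re e n (Xi \<omega>) (s n) = c * (?X n \<omega> * ?Y n \<omega>)" by blast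
        have "(c * (?X n \<omega> * ?Y n \<omega>) \<le> 0) = (\<not> 0 < ?X n \<omega> * ?Y n \<omega>)"
          using mult_le_cancel_left_pos[OF c, of "?X n \<omega> * ?Y n \<omega>" 0] by (simp add: not_less)
        also have "\<dots> = (\<not> (0 < 1 * ?X n \<omega> \<and> 0 < 1 * ?Y n \<omega> \<or> 0 < (-1) * ?X n \<omega> \<and> 0 < (-1) * ?Y n \<omega>))"
          by (simp add: zero_less_mult_iff)
        finally show ?case unfolding mem_Collect_eq Un_iff Diff_iff eq using el(2) by simp
      qed
    qed measurable
    also have "\<dots> = 1 - prob ?U" by (rule prob_compl) measurable
    also have "prob ?U = prob {\<omega>\<in>space M. 0 < 1 * ?X n \<omega> \<and> 0 < 1 * ?Y n \<omega>} + prob {\<omega>\<in>space M. 0 < (-1) * ?X n \<omega> \<and> 0 < (-1) * ?Y n \<omega>}"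
      by (rule finite_measure_Union) auto
    finally show ?case by (rule sym)
  qed
  ultimately show "(\<lambda>n. prob {\<omega>\<in>space M. ens_re e n (Xi \<omega>) t * ens_re e n (Xi \<omega>) (s n) \<le> 0}) \<longlonglongrightarrow> sign_change_limit (ens_kappa e t * \<delta>)"
    by (rule Lim_transform_eventually)
qed

lemma prob_all_xi_small:
  "prob {\<omega>\<in>space M. \<forall>j\<le>J. \<bar>\<xi> j \<omega>\<bar> \<le> c} = (prob {\<omega>\<in>space M. \<bar>\<xi> 0 \<omega>\<bar> \<le> c}) ^ (J + 1)"
proof -
  have "prob (\<Inter>j\<in>{..J}. \<xi> j -` {-c..c} \<inter> space M) = (\<Prod>j\<in>{..J}. prob (\<xi> j -` {-c..c} \<inter> space M))"
    by (rule indep_varsD[OF indep]) auto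
  moreover have "prob (\<xi> j -` {-c..c} \<inter> space M) = prob {\<omega>\<in>space M. \<bar>\<xi> 0 \<omega>\<bar> \<le> c}" for j
  proof -
    have "prob (\<xi> j -` {-c..c} \<inter> space M) = measure (distr M borel (\<xi> j)) {-c..c}" by (simp add: measure_distr)
    also have "\<dots> = measure (distr M borel (\<xi> 0)) {-c..c}" by (simp only: ident[of j])
    also have "\<dots> = prob (\<xi> 0 -` {-c..c} \<inter> space M)" by (simp add: measure_distr)
    also have "\<xi> 0 -` {-c..c} \<inter> space M = {\<omega>\<in>space M. \<bar>\<xi> 0 \<omega>\<bar> \<le> c}" by (auto simp: abs_le_iff)
    finally show ?thesis .
  qed
  moreover have "(\<Inter>j\<in>{..J}. \<xi> j -` {-c..c} \<inter> space M) = {\<omega>\<in>space M. \<forall>j\<le>J. \<bar>\<xi> j \<omega>\<bar> \<le> c}"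
    by (auto simp: abs_le_iff)
  ultimately show ?thesis by simp
qed

text \<open>A variable bounded by 1/2 would have second moment at most 1/4. This gives the
  exponential rate at which long runs of small coefficients become unlikely.\<close>

lemma prob_xi_small_less_1: "prob {\<omega>\<in>space M. \<bar>\<xi> 0 \<omega>\<bar> \<le> 1 / 2} < 1"
proof (rule ccontr)
  assume "\<not> ?thesis"
  then have "prob {\<omega>\<in>space M. \<bar>\<xi> 0 \<omega>\<bar> \<le> 1 / 2} = 1" using prob_le_1 by (metis antisym_conv2)
  then have "AE \<omega> in M. \<bar>\<xi> 0 \<omega>\<bar> \<le> 1 / 2" by (subst (asm) prob_Collect_eq_1) auto
  then have "AE \<omega> in M. (\<xi> 0 \<omega>)\<^sup>2 \<le> 1 / 4"
  proof eventually_elim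
    case (elim \<omega>)
    then show ?case using power_mono[of "\<bar>\<xi> 0 \<omega>\<bar>" "1/2" 2] by (simp add: power2_eq_square)
  qed
  then have "expectation (\<lambda>\<omega>. (\<xi> 0 \<omega>)\<^sup>2) \<le> expectation (\<lambda>\<omega>. 1 / 4)"
    by (intro integral_mono_AE integrable_xi2) auto
  then show False by (simp add: second_moment prob_space)
qed

text \<open>If there are at least m zeros, then either the circle mean is at least
  \<open>q^(-m)\<close>, or the first sqrt m coefficients are all small. Since the circle mean has
  expectation at most \<open>G^n\<close>, the first event becomes exponentially unlikely once m is
  at least a multiple of n; the second has probability about \<open>p^(sqrt m)\<close>. Both are
  summable in m.\<close>

lemma total_zero_count_series:
  assumes \<beta>: "0 < \<beta>" "e = HAF \<Longrightarrow> \<beta> < 1" and e: "e \<in> {FAF, HAF}"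
  shows "\<exists>(C::nat) W. (\<forall>n. W n \<in> borel_measurable M) \<and> (\<lambda>n. \<integral>\<^sup>+\<omega>. W n \<omega> \<partial>M) \<longlonglongrightarrow> 0 \<and>
    eventually (\<lambda>n. \<forall>\<omega>. ens_good e n (Xi \<omega>) \<longrightarrow> \<omega> \<in> space M \<longrightarrow> finite {t. \<bar>t\<bar> \<le> \<beta> \<and> ens_re e n (Xi \<omega>) t = 0} \<longrightarrow>
      of_nat (card {t. \<bar>t\<bar> \<le> \<beta> \<and> ens_re e n (Xi \<omega>) t = 0}) \<le> of_nat (C * n) + (W n \<omega> :: ennreal)) sequentially"
proof -
  obtain r where r: "\<beta> < r" "e = HAF \<Longrightarrow> r < 1"
  proof (cases "e = HAF")
    case True
    then obtain c where "\<beta> < c" "c < 1" using dense \<beta> by blast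
    then show ?thesis by (rule that)
  next
    case False
    then show ?thesis using that[of "\<beta> + 1"] by simp
  qed
  have r0: "0 < r" using r \<beta> by simp
  have r21: "r\<^sup>2 < 1" if "e \<in> {HAF, WP}"
  proof -
    have "r < 1" using r that e by auto
    then show ?thesis using r0 by (simp add: power_less_one_iff)
  qed
  define q where "q = sqrt (1 - (r\<^sup>2 - \<beta>\<^sup>2) * (r\<^sup>2 - (r / 2)\<^sup>2) / (4 * r ^ 4))"
  have q: "0 < q" "q < 1"
    unfolding q_def by (rule blaschke_constant; use r \<beta> in simp)+
  define sq where "sq = sqrt q"
  have sq: "0 < sq" "sq < 1" "q = sq * sq" using q by (auto simp: sq_def)
  define p where "p = max (1 / 2) (prob {\<omega>\<in>space M. \<bar>\<xi> 0 \<omega>\<bar> \<le> 1 / 2})"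
  have p: "0 < p" "p < 1" using prob_xi_small_less_1 by (auto simp: p_def less_max_iff_disj)
  \<comment> \<open>With sqrt m coefficients the weights are still at least
    \<open>(\<rho> / m)^(sqrt m)\<close>, far above \<open>q^m\<close>, while
    \<open>p^(sqrt m)\<close> remains summable.\<close>
  define J where "J m = nat \<lfloor>sqrt (real m)\<rfloor>" for m
  have J: "real (J m) \<le> sqrt (real m)" "sqrt (real m) \<le> real (J m) + 1" for m
    unfolding J_def by (simp_all add: of_nat_floor)
  define G where "G = ens_g e (r\<^sup>2)"
  have G: "0 < G" using e r21 by (auto simp: G_def)
  have ker_le: "ens_ker e n (r\<^sup>2) \<le> G ^ n" if "n \<ge> 1" for n
  proof -
    have "\<exists>\<eta>. 0 \<le> \<eta> \<and> \<eta> < 1 \<and> (\<forall>n\<ge>1. \<forall>x. 0 \<le> x \<and> x \<le> r\<^sup>2 \<longrightarrow>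
     ens_g e x ^ n * (1 - \<eta> ^ n) \<le> ens_ker e n x \<and> ens_ker e n x \<le> ens_g e x ^ n)"
      by (rule ens_ker_bounds) (use r21 in auto)
    then show ?thesis using that unfolding G_def by (metis order_refl zero_le_power2)
  qed
  \<comment> \<open>One half of the exponent of \<open>q^m = sq^m * sq^m\<close> pays for
    \<open>G^n\<close> as soon as \<open>m \<ge> C * n\<close>; the other half is left as a summable
    bound.\<close>
  obtain C where C: "sq ^ C < 1 / G" using real_arch_pow_inv[of "1 / G" sq] G sq by auto
  define D0 where "D0 n \<omega> = circ_mean 0 r (ens_fun e n (Xi \<omega>))" for n \<omega>
  have [measurable]: "D0 n \<in> borel_measurable M" for n unfolding D0_def by measurable
  define U where "U n m = {\<omega>\<in>space M. 1 \<le> ennreal (q ^ m) * D0 n \<omega>} \<union> {\<omega>\<in>space M. \<forall>j\<le>J m. \<bar>\<xi> j \<omega>\<bar> \<le> 1 / 2}" for n m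
  have [measurable]: "U n m \<in> sets M" for n m unfolding U_def by measurable
  \<comment> \<open>W counts the exceptional indices m from \<open>C * n\<close> on; it is
    measurable and bounds the excess of the number of zeros.\<close>
  define W where "W n \<omega> = (\<Sum>m. (if C * n \<le> m then indicator (U n m) \<omega> else 0) :: ennreal)" for n \<omega>
  have Wm: "W n \<in> borel_measurable M" for n unfolding W_def by measurable
  define a where "a m = sq ^ m + p ^ (J m + 1)" for m
  have a0: "0 \<le> a m" for m using sq p by (simp add: a_def)
  have sum_a: "summable a" unfolding a_def
  proof (rule summable_add)
    show "summable (\<lambda>m. sq ^ m)" using sq by (intro summable_geometric) auto
    show "summable (\<lambda>m. p ^ (J m + 1))"
    proof (rule summable_comparison_test_ev)
      show "summable (\<lambda>m. inverse (real m ^ 2))" by (rule inverse_power_summable) simp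
      have "eventually (\<lambda>m. p powr sqrt (real m) \<le> inverse (real m ^ 2)) sequentially" using p by real_asymp
      then show "eventually (\<lambda>m. norm (p ^ (J m + 1)) \<le> inverse (real m ^ 2)) sequentially"
      proof eventually_elim
        case (elim m)
        have "p ^ (J m + 1) = p powr (real (J m) + 1)"
          using powr_realpow[OF p(1), of "J m + 1"] by (simp only: of_nat_add of_nat_1)
        also have "\<dots> \<le> p powr sqrt (real m)" using p J(2)[of m] by (intro powr_mono') auto
        finally show ?case using elim p by simp
      qed
    qed
  qed
  have PU: "emeasure M (U n m) \<le> ennreal (a m)" if n: "n \<ge> 1" and m: "C * n \<le> m" for n m
  proof -
    have "emeasure M {\<omega>\<in>space M. 1 \<le> ennreal (q ^ m) * D0 n \<omega>} \<le> ennreal (q ^ m) * (\<integral>\<^sup>+\<omega>. D0 n \<omega> * indicator (space M) \<omega> \<partial>M)"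
      by (rule nn_integral_Markov_inequality) auto
    also have "(\<integral>\<^sup>+\<omega>. D0 n \<omega> * indicator (space M) \<omega> \<partial>M) = (\<integral>\<^sup>+\<omega>. D0 n \<omega> \<partial>M)" by (intro nn_integral_cong) simp
    also have "ennreal (q ^ m) * (\<integral>\<^sup>+\<omega>. D0 n \<omega> \<partial>M) \<le> ennreal (q ^ m) * ennreal (G ^ n)"
    proof (intro mult_left_mono)
      show "(\<integral>\<^sup>+\<omega>. D0 n \<omega> \<partial>M) \<le> ennreal (G ^ n)" unfolding D0_def
      proof (rule circ_mean_expectation_le)
        fix z :: complex assume "norm (z - 0) = \<bar>r\<bar>"
        then have z: "norm z = r" using r0 by simp
        have "(\<integral>\<^sup>+\<omega>. ennreal ((norm (ens_fun e n (Xi \<omega>) z))\<^sup>2) \<partial>M) \<le> ennreal (ens_ker e n ((norm z)\<^sup>2))"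
          by (rule ens_fun_second_moment) (use n z r in auto)
        also have "\<dots> \<le> ennreal (G ^ n)" using ker_le[OF n] by (simp add: z ennreal_leI)
        finally show "(\<integral>\<^sup>+\<omega>. ennreal ((norm (ens_fun e n (Xi \<omega>) z))\<^sup>2) \<partial>M) \<le> ennreal (G ^ n)" .
      qed measurable
    qed simp
    also have "ennreal (q ^ m) * ennreal (G ^ n) = ennreal (q ^ m * G ^ n)"
      by (rule ennreal_mult'[symmetric]) (use q in simp)
    also have "q ^ m * G ^ n \<le> sq ^ m"
    proof -
      have "sq ^ m * G ^ n \<le> sq ^ (C * n) * G ^ n"
        using sq G m by (intro mult_right_mono power_decreasing) auto
      also have "\<dots> = (sq ^ C * G) ^ n" by (simp add: power_mult power_mult_distrib)
      also have "\<dots> \<le> 1" using C G sq by (intro power_le_one) (auto simp: field_simps)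
      finally have "sq ^ m * (sq ^ m * G ^ n) \<le> sq ^ m * 1" using sq by (intro mult_left_mono) auto
      then show ?thesis by (simp add: sq(3) power_mult_distrib mult.assoc)
    qed
    finally have 1: "emeasure M {\<omega>\<in>space M. 1 \<le> ennreal (q ^ m) * D0 n \<omega>} \<le> ennreal (sq ^ m)"
      by (simp add: ennreal_leI)
    have "prob {\<omega>\<in>space M. \<forall>j\<le>J m. \<bar>\<xi> j \<omega>\<bar> \<le> 1 / 2} \<le> p ^ (J m + 1)"
      unfolding prob_all_xi_small by (intro power_mono) (auto simp: p_def)
    then have 2: "emeasure M {\<omega>\<in>space M. \<forall>j\<le>J m. \<bar>\<xi> j \<omega>\<bar> \<le> 1 / 2} \<le> ennreal (p ^ (J m + 1))"
      by (simp add: emeasure_eq_measure ennreal_leI)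
    have "emeasure M (U n m) \<le> emeasure M {\<omega>\<in>space M. 1 \<le> ennreal (q ^ m) * D0 n \<omega>} + emeasure M {\<omega>\<in>space M. \<forall>j\<le>J m. \<bar>\<xi> j \<omega>\<bar> \<le> 1 / 2}"
      unfolding U_def by (rule emeasure_subadditive) measurable
    also have "\<dots> \<le> ennreal (sq ^ m) + ennreal (p ^ (J m + 1))" by (intro add_mono 1 2)
    also have "\<dots> = ennreal (a m)" unfolding a_def by (rule ennreal_plus[symmetric]) (use sq p in auto)
    finally show ?thesis .
  qed
  have int_W: "(\<integral>\<^sup>+\<omega>. W n \<omega> \<partial>M) \<le> ennreal (\<Sum>k. a (k + C * n))" if n: "n \<ge> 1" for n
  proof -
    let ?b = "\<lambda>m. if C * n \<le> m then a m else 0"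
    have sb: "summable ?b" by (rule summable_comparison_test'[OF sum_a, of 0]) (use a0 in auto)
    have "(\<integral>\<^sup>+\<omega>. W n \<omega> \<partial>M) = (\<Sum>m. \<integral>\<^sup>+\<omega>. (if C * n \<le> m then indicator (U n m) \<omega> else 0) \<partial>M)"
      unfolding W_def by (rule nn_integral_suminf) measurable
    also have "\<dots> \<le> (\<Sum>m. ennreal (?b m))"
      by (intro suminf_le) (use PU[OF n] in auto)
    also have "\<dots> = ennreal (\<Sum>m. ?b m)" by (rule suminf_ennreal2) (use a0 sb in auto)
    also have "(\<Sum>m. ?b m) = (\<Sum>k. a (k + C * n))"
      using suminf_split_initial_segment[OF sb, of "C * n"] by simp
    finally show ?thesis .
  qed
  have C1: "1 \<le> C"
  proof (rule ccontr)
    assume "\<not> 1 \<le> C"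
    then have "C = 0" by simp
    then have "G < 1" using C G by (simp add: field_simps)
    moreover have "1 \<le> ens_ker e 1 (r\<^sup>2)" by (rule ens_ker_ge_1) (use r21 in auto)
    ultimately show False using ker_le[of 1] by simp
  qed
  have tail0: "(\<lambda>n. \<Sum>k. a (k + C * n)) \<longlonglongrightarrow> 0"
  proof (rule LIMSEQ_I)
    fix \<epsilon> :: real assume "0 < \<epsilon>"
    then obtain N where N: "\<And>n. n \<ge> N \<Longrightarrow> norm (\<Sum>i. a (i + n)) < \<epsilon>" using suminf_exist_split[OF _ sum_a] by blast
    have "N \<le> C * n" if "n \<ge> N" for n using C1 that by (metis le_trans mult_le_mono nat_mult_1)
    then show "\<exists>no. \<forall>n\<ge>no. norm ((\<Sum>k. a (k + C * n)) - 0) < \<epsilon>" using N by (intro exI[of _ N]) auto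
  qed
  have W0: "(\<lambda>n. \<integral>\<^sup>+\<omega>. W n \<omega> \<partial>M) \<longlonglongrightarrow> 0"
  proof (rule tendsto_sandwich[of "\<lambda>_. 0" _ _ "\<lambda>n. ennreal (\<Sum>k. a (k + C * n))"])
    show "eventually (\<lambda>n. (\<integral>\<^sup>+\<omega>. W n \<omega> \<partial>M) \<le> ennreal (\<Sum>k. a (k + C * n))) sequentially"
      using eventually_ge_at_top[of 1] by eventually_elim (rule int_W)
    show "(\<lambda>n. ennreal (\<Sum>k. a (k + C * n))) \<longlonglongrightarrow> 0" using tendsto_ennrealI[OF tail0] by simp
  qed auto
  \<comment> \<open>\<rho> is at most 1, so its powers decrease, and at most
    \<open>(r / 2)^2\<close>. The 8 in the next inequality is 2 from
    \<open>coeff_bound_of_zeros\<close> times 4 from \<open>(\<xi> j)^2 \<ge> 1 / 4\<close>.\<close>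
  define \<rho> where "\<rho> = (min 1 (r / 2))\<^sup>2"
  have \<rho>: "0 < \<rho>" "\<rho> \<le> 1" using r0 by (auto simp: \<rho>_def power_le_one)
  have "eventually (\<lambda>m. 8 * q ^ m < (\<rho> / real m) powr sqrt (real m)) sequentially"
    using q \<rho>(1) by real_asymp
  then obtain m0 where m0: "\<And>m. m \<ge> m0 \<Longrightarrow> 8 * q ^ m < (\<rho> / real m) powr sqrt (real m)"
    by (auto simp: eventually_at_top_linorder)
  have inU: "\<omega> \<in> U n m"
    if n: "n \<ge> 1" and good: "ens_good e n (Xi \<omega>)" and \<omega>: "\<omega> \<in> space M"
      and fin: "finite {t. \<bar>t\<bar> \<le> \<beta> \<and> ens_re e n (Xi \<omega>) t = 0}"
      and m: "m0 \<le> m" "1 \<le> m" "m \<le> card {t. \<bar>t\<bar> \<le> \<beta> \<and> ens_re e n (Xi \<omega>) t = 0}" for n m \<omega>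
  proof (rule ccontr)
    assume "\<omega> \<notin> U n m"
    then have nU: "\<not> 1 \<le> ennreal (q ^ m) * D0 n \<omega>" "\<not> (\<forall>j\<le>J m. \<bar>\<xi> j \<omega>\<bar> \<le> 1 / 2)"
      using \<omega> unfolding U_def by blast+
    have D: "ennreal (q ^ m) * D0 n \<omega> \<le> 1" using nU(1) linear by blast
    from nU(2) have "\<exists>j\<le>J m. 1 / 2 < \<bar>\<xi> j \<omega>\<bar>" by (simp only: not_all not_imp not_le)
    then obtain j where j: "j \<le> J m" "1 / 2 < \<bar>\<xi> j \<omega>\<bar>" by blast
    have "ennreal (ens_w e n j * (Xi \<omega> j)\<^sup>2 * (r / 2) ^ (2 * j)) \<le> ennreal (2 * q ^ (2 * m)) * D0 n \<omega>"
      unfolding q_def D0_def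
    proof (rule coeff_bound_of_zeros[OF good r0 _ _ _ fin _ m(3)])
      show "e = HAF \<longrightarrow> r < 1" using r(2) by (rule impI)
      show "0 \<le> \<beta>" using \<beta>(1) by (rule less_imp_le)
      show "\<beta> < r" by (rule r(1))
    qed (simp only: mem_Collect_eq)
    also have "ennreal (2 * q ^ (2 * m)) = ennreal (2 * q ^ m) * ennreal (q ^ m)"
    proof -
      have "q ^ (2 * m) = q ^ m * q ^ m" by (simp only: mult_2 power_add)
      then have "2 * q ^ (2 * m) = (2 * q ^ m) * q ^ m" by (simp only: mult.assoc)
      moreover have "0 \<le> 2 * q ^ m" using q by simp
      ultimately show ?thesis using ennreal_mult'[of "2 * q ^ m" "q ^ m"] by (simp only:)
    qed
    also have "ennreal (2 * q ^ m) * ennreal (q ^ m) * D0 n \<omega> \<le> ennreal (2 * q ^ m) * 1"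
      unfolding mult.assoc by (intro mult_left_mono D) simp
    finally have up: "ens_w e n j * (\<xi> j \<omega>)\<^sup>2 * (r / 2) ^ (2 * j) \<le> 2 * q ^ m"
      using q by (simp add: ennreal_le_iff)
    have x2: "1 / 4 \<le> (\<xi> j \<omega>)\<^sup>2" using power_mono[of "1/2" "\<bar>\<xi> j \<omega>\<bar>" 2] j(2) by (simp add: power2_eq_square)
    have Jm: "J m \<le> m"
    proof -
      have "sqrt (real m) \<le> real m" using m(2) by (intro real_le_lsqrt) (auto simp: self_le_power)
      then show ?thesis using J(1)[of m] by linarith
    qed
    have "(1 / 4) * (\<rho> / real m) powr sqrt (real m) \<le> (1 / 4) * (\<rho> / real m) powr real (J m)"
      using J(1)[of m] \<rho> m(2) by (intro mult_left_mono powr_mono') (auto simp: field_simps)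
    also have "(\<rho> / real m) powr real (J m) = \<rho> ^ J m / real m ^ J m"
      using \<rho> m(2) by (simp add: powr_realpow power_divide)
    also have "(1 / 4) * (\<rho> ^ J m / real m ^ J m) \<le> (1 / 4) * (\<rho> ^ j * (1 / fact j))"
    proof -
      have "fact j \<le> (fact (J m) :: nat)" using j(1) by (rule fact_mono_nat)
      also have "\<dots> \<le> J m ^ J m" using fact_le_power[where ?'a = nat, of "J m"] by simp
      also have "\<dots> \<le> m ^ J m" using Jm by (rule power_mono) simp
      finally have "real (fact j) \<le> real (m ^ J m)" by (rule of_nat_mono)
      then have f: "fact j \<le> real m ^ J m" by simp
      have "\<rho> ^ J m * (1 / real m ^ J m) \<le> \<rho> ^ j * (1 / fact j)"
      proof (intro mult_mono)
        show "\<rho> ^ J m \<le> \<rho> ^ j" using \<rho> j(1) by (intro power_decreasing) auto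
        show "1 / real m ^ J m \<le> 1 / fact j" using f m(2) by (intro divide_left_mono mult_pos_pos) auto
      qed (use \<rho> in auto)
      then show ?thesis by simp
    qed
    also have "\<dots> \<le> (\<xi> j \<omega>)\<^sup>2 * ((r / 2) ^ (2 * j) * ens_w e n j)"
    proof (intro mult_mono x2)
      show "\<rho> ^ j \<le> (r / 2) ^ (2 * j)" unfolding \<rho>_def power_mult[symmetric]
        using r0 by (intro power_mono) auto
      show "1 / fact j \<le> ens_w e n j" by (rule ens_w_ge_inverse_fact[OF e n])
    qed (use \<rho> r0 in auto)
    also have "\<dots> \<le> 2 * q ^ m" using up by (simp add: mult_ac)
    finally show False using m0[OF m(1)] by simp
  qed
  have "eventually (\<lambda>n. \<forall>\<omega>. ens_good e n (Xi \<omega>) \<longrightarrow> \<omega> \<in> space M \<longrightarrow> finite {t. \<bar>t\<bar> \<le> \<beta> \<and> ens_re e n (Xi \<omega>) t = 0} \<longrightarrow>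
      of_nat (card {t. \<bar>t\<bar> \<le> \<beta> \<and> ens_re e n (Xi \<omega>) t = 0}) \<le> of_nat (C * n) + W n \<omega>) sequentially"
    using eventually_ge_at_top[of 1] eventually_ge_at_top[of m0]
  proof (eventually_elim, intro allI impI)
    case (elim n)
    fix \<omega> assume good: "ens_good e n (Xi \<omega>)" and \<omega>: "\<omega> \<in> space M"
      and fin: "finite {t. \<bar>t\<bar> \<le> \<beta> \<and> ens_re e n (Xi \<omega>) t = 0}"
    let ?N = "card {t. \<bar>t\<bar> \<le> \<beta> \<and> ens_re e n (Xi \<omega>) t = 0}"
    have nC: "n \<le> C * n" using C1 by simp
    \<comment> \<open>Every m from \<open>C * n\<close> up to \<open>?N - 1\<close> is exceptional,
      so \<open>?N\<close> exceeds \<open>C * n\<close> by at most their number.\<close>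
    have "(of_nat ?N :: ennreal) \<le> of_nat (C * n + card {C * n..<?N})" by (intro of_nat_mono) simp
    also have "\<dots> = of_nat (C * n) + (\<Sum>m\<in>{C * n..<?N}. 1)" by simp
    also have "(\<Sum>m\<in>{C * n..<?N}. 1) = (\<Sum>m\<in>{C * n..<?N}. (if C * n \<le> m then indicator (U n m) \<omega> else 0) :: ennreal)"
    proof (intro sum.cong refl)
      fix m assume "m \<in> {C * n..<?N}"
      then have m: "C * n \<le> m" "m < ?N" by auto
      then have "m0 \<le> m" "1 \<le> m" "m \<le> ?N" using elim nC by linarith+
      then have "\<omega> \<in> U n m" by (rule inU[OF elim(1) good \<omega> fin])
      then show "(1 :: ennreal) = (if C * n \<le> m then indicator (U n m) \<omega> else 0)" using m(1) by simp
    qed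
    also have "\<dots> \<le> W n \<omega>" unfolding W_def by (intro sum_le_suminf) auto
    finally show "of_nat ?N \<le> of_nat (C * n) + W n \<omega>" by (simp add: add_left_mono del: Xi_apply)
  qed
  then show ?thesis using Wm W0 by blast
qed

lemma total_zero_count:
  assumes \<beta>: "0 < \<beta>" "e \<in> {HAF, WP} \<Longrightarrow> \<beta> < 1"
  shows "\<exists>(C::nat) W. (\<forall>n. W n \<in> borel_measurable M) \<and> (\<lambda>n. \<integral>\<^sup>+\<omega>. W n \<omega> \<partial>M) \<longlonglongrightarrow> 0 \<and>
    eventually (\<lambda>n. \<forall>\<omega>. ens_good e n (Xi \<omega>) \<longrightarrow> \<omega> \<in> space M \<longrightarrow> \<not> (\<forall>z\<in>ens_domain e. ens_fun e n (Xi \<omega>) z = 0) \<longrightarrow>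
      of_nat (card {t. \<bar>t\<bar> \<le> \<beta> \<and> ens_re e n (Xi \<omega>) t = 0}) \<le> of_nat (C * n) + (W n \<omega> :: ennreal)) sequentially"
proof -
  have hyp: "e = HAF \<longrightarrow> \<beta> < 1" using \<beta> by auto
  show ?thesis
  proof (cases "e \<in> {FAF, HAF}")
    case True
    have "\<exists>(C::nat) W. (\<forall>n. W n \<in> borel_measurable M) \<and> (\<lambda>n. \<integral>\<^sup>+\<omega>. W n \<omega> \<partial>M) \<longlonglongrightarrow> 0 \<and>
      eventually (\<lambda>n. \<forall>\<omega>. ens_good e n (Xi \<omega>) \<longrightarrow> \<omega> \<in> space M \<longrightarrow> finite {t. \<bar>t\<bar> \<le> \<beta> \<and> ens_re e n (Xi \<omega>) t = 0} \<longrightarrow>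
      of_nat (card {t. \<bar>t\<bar> \<le> \<beta> \<and> ens_re e n (Xi \<omega>) t = 0}) \<le> of_nat (C * n) + (W n \<omega> :: ennreal)) sequentially"
      by (rule total_zero_count_series) (use \<beta> True in auto)
    then obtain C W where CW: "\<forall>n. W n \<in> borel_measurable M" "(\<lambda>n. \<integral>\<^sup>+\<omega>. W n \<omega> \<partial>M) \<longlonglongrightarrow> 0"
      "eventually (\<lambda>n. \<forall>\<omega>. ens_good e n (Xi \<omega>) \<longrightarrow> \<omega> \<in> space M \<longrightarrow> finite {t. \<bar>t\<bar> \<le> \<beta> \<and> ens_re e n (Xi \<omega>) t = 0} \<longrightarrow>
      of_nat (card {t. \<bar>t\<bar> \<le> \<beta> \<and> ens_re e n (Xi \<omega>) t = 0}) \<le> of_nat (C * n) + (W n \<omega> :: ennreal)) sequentially"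
      by blast
    show ?thesis
      by (intro exI[of _ C] exI[of _ W] conjI CW(1,2) eventually_mono[OF CW(3)])
         (use finite_ens_zeros[OF _ _ hyp] in blast)
  next
    case False
    then have e: "e \<in> {SP, WP}" by (cases e) auto
    show ?thesis
    proof (intro exI[of _ 1] exI[of _ "\<lambda>_ _. 0"] conjI always_eventually allI impI)
      fix n \<omega> assume good: "ens_good e n (Xi \<omega>)" and nz: "\<not> (\<forall>z\<in>ens_domain e. ens_fun e n (Xi \<omega>) z = 0)"
      have "card {t. \<bar>t\<bar> \<le> \<beta> \<and> ens_re e n (Xi \<omega>) t = 0} \<le> n"
      proof (rule card_zeros_polynomial[OF e nz finite_ens_zeros[OF good nz hyp]])
        fix t assume "t \<in> {t. \<bar>t\<bar> \<le> \<beta> \<and> ens_re e n (Xi \<omega>) t = 0}"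
        then show "ens_fun e n (Xi \<omega>) (of_real t) = 0"
          using ens_fun_of_real(1)[OF good, of t] e by auto
      qed
      then show "of_nat (card {t. \<bar>t\<bar> \<le> \<beta> \<and> ens_re e n (Xi \<omega>) t = 0}) \<le> of_nat (1 * n) + (0 :: ennreal)"
        by simp
    qed auto
  qed
qed

end

section \<open>Counting zeros by windows\<close>

lemma ens_J_HAF: "t \<in> ens_J e \<Longrightarrow> e = HAF \<longrightarrow> \<bar>t\<bar> < 1"
  by (auto simp: abs_less_iff)

lemma sign_change_limit_asymp: "((\<lambda>y. sign_change_limit y / y) \<longlongrightarrow> 1 / pi) (at_right 0)"
proof -
  have "((\<lambda>y. sign_change_limit y / y) \<longlongrightarrow> inverse pi) (at_right 0)"
    unfolding sign_change_limit_def by real_asymp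
  then show ?thesis by (simp add: inverse_eq_divide)
qed

lemma sign_change_limit_bounds:
  assumes "0 < \<epsilon>"
  shows "\<exists>y0>0. \<forall>y. 0 < y \<longrightarrow> y < y0 \<longrightarrow> (1 / pi - \<epsilon>) * y \<le> sign_change_limit y \<and> sign_change_limit y \<le> (1 / pi + \<epsilon>) * y"
proof -
  have "eventually (\<lambda>y. dist (sign_change_limit y / y) (1 / pi) < \<epsilon>) (at_right 0)"
    using tendstoD[OF sign_change_limit_asymp assms] .
  then obtain y0 where y0: "0 < y0" "\<And>y. 0 < y \<Longrightarrow> y < y0 \<Longrightarrow> \<bar>sign_change_limit y / y - 1 / pi\<bar> < \<epsilon>"
    unfolding eventually_at_right_field by (auto simp: dist_real_def)
  have "(1 / pi - \<epsilon>) * y \<le> sign_change_limit y \<and> sign_change_limit y \<le> (1 / pi + \<epsilon>) * y" if "0 < y" "y < y0" for y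
  proof -
    have "1 / pi - \<epsilon> \<le> sign_change_limit y / y" "sign_change_limit y / y \<le> 1 / pi + \<epsilon>"
      using y0(2)[OF that] unfolding abs_less_iff by linarith+
    then show ?thesis using that(1) by (simp add: pos_le_divide_eq pos_divide_le_eq)
  qed
  then show ?thesis using y0(1) by blast
qed

lemma sign_change_limit_range: "\<bar>sign_change_limit y\<bar> \<le> 1"
proof -
  let ?v = "arctan (exp (- y\<^sup>2 / 2) / sqrt (1 - (exp (- y\<^sup>2 / 2))\<^sup>2))"
  have "- (pi / 2) < ?v" "?v < pi / 2" using arctan_lbound arctan_ubound by auto
  then have "- (1 / 2) \<le> ?v / pi" "?v / pi \<le> 1 / 2" by (simp_all add: field_simps)
  then show ?thesis unfolding sign_change_limit_def abs_le_iff by linarith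
qed

lemma ens_kappa_measurable [measurable]: "ens_kappa e \<in> borel_measurable borel"
  by (cases e) (auto simp: fun_eq_iff cong: measurable_cong)

lemma ens_kappa_continuous: "continuous_on (ens_J e) (ens_kappa e)"
proof (cases e)
  case SP
  have "1 + x\<^sup>2 \<noteq> 0" for x :: real using sum_power2_eq_zero_iff[of 1 x] by simp
  then have "continuous_on UNIV (\<lambda>t::real. 1 / (1 + t\<^sup>2))" by (intro continuous_intros) auto
  then show ?thesis using SP by (auto cong: continuous_on_cong)
next
  case HAF
  have "1 - x\<^sup>2 \<noteq> 0" if "x \<in> {-1<..<1}" for x :: real
    using that abs_square_less_1[of x] by (auto simp: abs_less_iff)
  then have "continuous_on {-1<..<1} (\<lambda>t::real. 1 / (1 - t\<^sup>2))" by (intro continuous_intros) auto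
  then show ?thesis using HAF by (auto cong: continuous_on_cong)
qed (auto cong: continuous_on_cong)

text \<open>The radicand is \<open>(2 * ens_kappa e t)^2\<close>. As \<open>ens_J e\<close> is open,
  the formula for the first derivative holds near t and may be differentiated again.\<close>

lemma ens_density:
  assumes t: "t \<in> ens_J e" "t \<noteq> 0"
  shows "sqrt (deriv (ens_p e) t / t + deriv (deriv (ens_p e)) t) = 2 * ens_kappa e t"
proof -
  have J: "open (ens_J e)" by (cases e) auto
  have two: "deriv (ens_p e) t = d t \<and> deriv (deriv (ens_p e)) t = d2"
    if d: "\<And>s. s \<in> ens_J e \<Longrightarrow> (ens_p e has_real_derivative d s) (at s)" and d2: "(d has_real_derivative d2) (at t)" for d d2
  proof -
    have "(deriv (ens_p e) has_real_derivative d2) (at t)"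
      by (rule has_field_derivative_transform_within_open[OF d2 J t(1)]) (use d DERIV_imp_deriv in fastforce)
    then show ?thesis using d[OF t(1)] by (auto intro: DERIV_imp_deriv)
  qed
  \<comment> \<open>Both rational cases have this form: c is \<open>1 + t^2\<close> for SP and
    \<open>1 - t^2\<close> for HAF, N is the numerator of the second derivative, and
    \<open>2 * c + N = 4\<close>.\<close>
  have two_c: "2 / c + N / c\<^sup>2 = (2 / c)\<^sup>2" if "c \<noteq> 0" "2 * c + N = 4" for c N :: real
  proof -
    have "2 / c = 2 * c / c\<^sup>2" using that(1) by (simp add: power2_eq_square)
    then have "2 / c + N / c\<^sup>2 = (2 * c + N) / c\<^sup>2" by (simp add: add_divide_distrib)
    then show ?thesis by (simp add: that(2) power_divide)
  qed
  have quad: ?thesis if "\<And>s. ens_p e s = s\<^sup>2" "ens_kappa e t = 1"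
  proof -
    have e: "ens_p e = (\<lambda>s. s\<^sup>2)" using that by auto
    have "deriv (ens_p e) t = 2 * t \<and> deriv (deriv (ens_p e)) t = 2"
      by (rule two) (auto simp: e intro!: derivative_eq_intros)
    moreover have "sqrt 4 = 2" by (simp add: real_sqrt_unique)
    ultimately show ?thesis using t that by simp
  qed
  show ?thesis
  proof (cases e)
    case SP
    have p: "0 < 1 + s\<^sup>2" for s :: real by (simp add: add_pos_nonneg)
    have e: "ens_p e = (\<lambda>s. ln (1 + s\<^sup>2))" using SP by auto
    have "deriv (ens_p e) t = 2 * t / (1 + t\<^sup>2) \<and> deriv (deriv (ens_p e)) t = (2 * (1 + t\<^sup>2) - 2 * t * (2 * t)) / (1 + t\<^sup>2)\<^sup>2"
    proof (rule two)
      show "(ens_p e has_real_derivative 2 * s / (1 + s\<^sup>2)) (at s)" for s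
        unfolding e using p[of s] by (auto intro!: derivative_eq_intros)
      show "((\<lambda>s. 2 * s / (1 + s\<^sup>2)) has_real_derivative (2 * (1 + t\<^sup>2) - 2 * t * (2 * t)) / (1 + t\<^sup>2)\<^sup>2) (at t)"
        using p[of t] by (auto intro!: derivative_eq_intros simp: power2_eq_square)
    qed
    moreover have "2 / (1 + t\<^sup>2) + (2 * (1 + t\<^sup>2) - 2 * t * (2 * t)) / (1 + t\<^sup>2)\<^sup>2 = (2 / (1 + t\<^sup>2))\<^sup>2"
      by (rule two_c) (use p[of t] in \<open>simp_all add: power2_eq_square\<close>)
    moreover have "2 * t / (1 + t\<^sup>2) / t = 2 / (1 + t\<^sup>2)" using t by simp
    ultimately have "deriv (ens_p e) t / t + deriv (deriv (ens_p e)) t = (2 / (1 + t\<^sup>2))\<^sup>2" by simp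
    then show ?thesis using SP p[of t] by (simp add: real_sqrt_unique)
  next
    case HAF
    have p: "0 < 1 - s\<^sup>2" if "s \<in> ens_J e" for s :: real
      using that HAF by (simp add: abs_square_less_1 abs_less_iff)
    have e: "ens_p e = (\<lambda>s. - ln (1 - s\<^sup>2))" using HAF by auto
    have "deriv (ens_p e) t = 2 * t / (1 - t\<^sup>2) \<and> deriv (deriv (ens_p e)) t = (2 * (1 - t\<^sup>2) + 2 * t * (2 * t)) / (1 - t\<^sup>2)\<^sup>2"
    proof (rule two)
      show "(ens_p e has_real_derivative 2 * s / (1 - s\<^sup>2)) (at s)" if "s \<in> ens_J e" for s
        unfolding e using p[OF that] by (auto intro!: derivative_eq_intros)
      show "((\<lambda>s. 2 * s / (1 - s\<^sup>2)) has_real_derivative (2 * (1 - t\<^sup>2) + 2 * t * (2 * t)) / (1 - t\<^sup>2)\<^sup>2) (at t)"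
        using p[OF t(1)] by (auto intro!: derivative_eq_intros simp: power2_eq_square)
    qed
    moreover have "2 / (1 - t\<^sup>2) + (2 * (1 - t\<^sup>2) + 2 * t * (2 * t)) / (1 - t\<^sup>2)\<^sup>2 = (2 / (1 - t\<^sup>2))\<^sup>2"
      by (rule two_c) (use p[OF t(1)] in \<open>simp_all add: power2_eq_square\<close>)
    moreover have "2 * t / (1 - t\<^sup>2) / t = 2 / (1 - t\<^sup>2)" using t by simp
    ultimately have "deriv (ens_p e) t / t + deriv (deriv (ens_p e)) t = (2 / (1 - t\<^sup>2))\<^sup>2" by simp
    then show ?thesis using HAF p[OF t(1)] by (simp add: real_sqrt_unique)
  qed (use quad in auto)
qed

text \<open>The left ends t of the windows containing a given z fill the interval from
  \<open>z - h\<close> to z, of length h. All these t lie between \<open>a - h\<close> and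
  b.\<close>

lemma card_eq_window_integral:
  fixes Z :: "real set"
  assumes Z: "finite Z" "Z \<subseteq> {a..b}" and h: "0 \<le> h"
  shows "ennreal h * of_nat (card Z) = (\<integral>\<^sup>+t\<in>{a - h..b}. of_nat (card (Z \<inter> {t..t + h})) \<partial>lborel)"
proof -
  have "(\<integral>\<^sup>+t\<in>{a - h..b}. of_nat (card (Z \<inter> {t..t + h})) \<partial>lborel) = (\<integral>\<^sup>+t. (\<Sum>z\<in>Z. indicator {z - h..z} t) \<partial>lborel)"
  proof (rule nn_integral_cong)
    fix t
    have "(\<Sum>z\<in>Z. indicator {z - h..z} t :: ennreal) = (\<Sum>z\<in>Z. if z \<in> {t..t + h} then 1 else 0)"
      by (intro sum.cong refl) (auto simp: indicator_def)
    also have "\<dots> = (\<Sum>z\<in>Z \<inter> {t..t + h}. 1)" by (rule sum.inter_restrict[OF Z(1), symmetric])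
    also have "\<dots> = of_nat (card (Z \<inter> {t..t + h}))" by simp
    finally have eq: "(\<Sum>z\<in>Z. indicator {z - h..z} t :: ennreal) = of_nat (card (Z \<inter> {t..t + h}))" .
    show "of_nat (card (Z \<inter> {t..t + h})) * indicator {a - h..b} t = (\<Sum>z\<in>Z. indicator {z - h..z} t :: ennreal)"
    proof (cases "t \<in> {a - h..b}")
      case True
      then show ?thesis unfolding eq by simp
    next
      case False
      then have "Z \<inter> {t..t + h} = {}" using Z(2) h by auto
      then show ?thesis using False by (simp add: eq)
    qed
  qed
  also have "\<dots> = (\<Sum>z\<in>Z. \<integral>\<^sup>+t. indicator {z - h..z} t \<partial>lborel)" by (rule nn_integral_sum) auto
  also have "\<dots> = ennreal h * of_nat (card Z)" using h by (simp add: mult.commute)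
  finally show ?thesis by simp
qed

lemma num_zeros_eq_card:
  assumes good: "ens_good e n x" and J: "{a..b} \<subseteq> ens_J e"
    and nz: "\<not> (\<forall>z\<in>ens_domain e. ens_fun e n x z = 0)"
  shows "num_zeros e n x a b = of_nat (card {t\<in>{a..b}. ens_re e n x t = 0}) \<and> finite {t\<in>{a..b}. ens_re e n x t = 0}"
proof -
  define \<beta> where "\<beta> = max \<bar>a\<bar> \<bar>b\<bar>"
  have \<beta>: "e = HAF \<longrightarrow> \<beta> < 1 \<or> b < a"
  proof (cases "b < a")
    case False
    then have "a \<in> ens_J e" "b \<in> ens_J e" using J by auto
    then show ?thesis by (auto simp: \<beta>_def abs_less_iff)
  qed simp
  have fin: "finite {t\<in>{a..b}. ens_re e n x t = 0}"
  proof (cases "b < a")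
    case False
    then have "finite {t. \<bar>t\<bar> \<le> \<beta> \<and> ens_re e n x t = 0}" using finite_ens_zeros[OF good nz] \<beta> by blast
    then show ?thesis by (rule rev_finite_subset) (auto simp: \<beta>_def)
  qed simp
  have eq: "{t \<in> {a..b}. ens_fun e n x (complex_of_real t) = 0} = {t\<in>{a..b}. ens_re e n x t = 0}"
  proof (rule Collect_cong)
    fix t
    have "e = HAF \<longrightarrow> \<bar>t\<bar> < 1" if "t \<in> {a..b}" using that J ens_J_HAF by blast
    then show "(t \<in> {a..b} \<and> ens_fun e n x (complex_of_real t) = 0) = (t \<in> {a..b} \<and> ens_re e n x t = 0)"
      using ens_fun_of_real(1)[OF good, of t] by auto
  qed
  have "num_zeros e n x a b = emeasure (count_space UNIV) {t\<in>{a..b}. ens_re e n x t = 0}"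
    unfolding num_zeros_def eq by (rule if_not_P[OF nz])
  then show ?thesis using fin by (simp add: emeasure_count_space_finite)
qed

lemma ens_re_continuous:
  assumes good: "ens_good e n x"
  shows "continuous_on (ens_J e) (ens_re e n x)"
proof (rule continuous_on_eq[of _ "\<lambda>t. Re (ens_fun e n x (of_real t))"])
  have *: "isCont (\<lambda>t. Re (ens_fun e n x (of_real t))) t" if t: "t \<in> ens_J e" "e = HAF \<longrightarrow> \<bar>t\<bar> < 1" for t
  proof -
    obtain R where R: "\<bar>t\<bar> < R" "e = HAF \<longrightarrow> R \<le> 1"
    proof (cases "e = HAF")
      case True
      then show ?thesis using that[of 1] t by simp
    next
      case False
      then show ?thesis using that[of "\<bar>t\<bar> + 1"] by simp
    qed
    have "ens_fun e n x holomorphic_on ball 0 R" using ens_good_holomorphic[OF good, of 0 R] R by auto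
    then have "isCont (ens_fun e n x) (of_real t)"
      using R by (intro continuous_on_interior[OF holomorphic_on_imp_continuous_on]) auto
    then have "isCont (\<lambda>t. ens_fun e n x (of_real t)) t" by (rule isCont_o2[rotated]) (intro continuous_intros)
    then show ?thesis by (rule continuous_Re)
  qed
  show "continuous_on (ens_J e) (\<lambda>t. Re (ens_fun e n x (of_real t)))"
    by (intro continuous_at_imp_continuous_on ballI *) (auto simp: abs_less_iff)
  show "Re (ens_fun e n x (of_real t)) = ens_re e n x t" if "t \<in> ens_J e" for t
    using ens_fun_of_real(1)[OF good ens_J_HAF[OF that]] by simp
qed

text \<open>Only windows inside the interval are used, and each strict sign change supplies a zero
  by the intermediate value theorem. Strictness also covers the identically vanishing case, where
  the count is 0 by convention.\<close>

lemma num_zeros_lower: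
  assumes good: "ens_good e n x" and J: "{a..b} \<subseteq> ens_J e" and h: "0 < h"
  shows "(\<integral>\<^sup>+t\<in>{a..b - h}. indicator {..<0} (ens_re e n x t * ens_re e n x (t + h)) \<partial>lborel) \<le> ennreal h * num_zeros e n x a b"
proof (cases "\<forall>z\<in>ens_domain e. ens_fun e n x z = 0")
  case True
  have "ens_re e n x t = 0" if "t \<in> {a..b}" for t
  proof -
    have tJ: "t \<in> ens_J e" using that J by blast
    then have "complex_of_real t \<in> ens_domain e" "e = HAF \<longrightarrow> \<bar>t\<bar> < 1" by (cases e; auto simp: abs_less_iff)+
    then show ?thesis using True ens_fun_of_real(1)[OF good, of t] by auto
  qed
  then have "(\<integral>\<^sup>+t\<in>{a..b - h}. indicator {..<0} (ens_re e n x t * ens_re e n x (t + h)) \<partial>lborel) = (\<integral>\<^sup>+t. 0 \<partial>(lborel :: real measure))"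
    using h by (intro nn_integral_cong) (auto simp: indicator_def)
  then show ?thesis by simp
next
  case False
  define Z where "Z = {t\<in>{a..b}. ens_re e n x t = 0}"
  have N: "num_zeros e n x a b = of_nat (card Z)" and Z: "finite Z" "Z \<subseteq> {a..b}"
    using num_zeros_eq_card[OF good J False] by (auto simp: Z_def)
  have "(\<integral>\<^sup>+t\<in>{a..b - h}. indicator {..<0} (ens_re e n x t * ens_re e n x (t + h)) \<partial>lborel) \<le> (\<integral>\<^sup>+t\<in>{a - h..b}. of_nat (card (Z \<inter> {t..t + h})) \<partial>lborel)"
  proof (rule nn_integral_mono)
    fix t
    show "indicator {..<0} (ens_re e n x t * ens_re e n x (t + h)) * indicator {a..b - h} t \<le> (of_nat (card (Z \<inter> {t..t + h})) * indicator {a - h..b} t :: ennreal)"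
    proof (cases "t \<in> {a..b - h} \<and> ens_re e n x t * ens_re e n x (t + h) < 0")
      case True
      then have sub: "{t..t + h} \<subseteq> {a..b}" by auto
      have cont: "continuous_on {t..t + h} (ens_re e n x)"
        by (rule continuous_on_subset[OF ens_re_continuous[OF good]]) (use sub J in blast)
      have "\<exists>z. t \<le> z \<and> z \<le> t + h \<and> ens_re e n x z = 0"
        using True IVT'[of "ens_re e n x" t 0 "t + h"] IVT2'[of "ens_re e n x" "t + h" 0 t] cont h
        by (auto simp: mult_less_0_iff)
      then obtain z where z: "t \<le> z" "z \<le> t + h" "ens_re e n x z = 0" by blast
      then have "z \<in> Z \<inter> {t..t + h}" using True by (auto simp: Z_def)
      then have "1 \<le> card (Z \<inter> {t..t + h})" using Z(1) by (metis One_nat_def Suc_leI card_gt_0_iff empty_iff finite_Int)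
      then have "(1 :: ennreal) \<le> of_nat (card (Z \<inter> {t..t + h}))" by (metis of_nat_1 of_nat_mono)
      then show ?thesis using True h by (auto simp: indicator_def)
    qed (auto simp: indicator_def)
  qed
  also have "\<dots> = ennreal h * of_nat (card Z)" by (rule card_eq_window_integral[symmetric]) (use Z h in auto)
  finally show ?thesis by (simp add: N)
qed

text \<open>Windows protrude from the interval on the left, so constants uniform on a slightly
  larger set are needed that still avoids 0 and the boundary.\<close>

lemma ens_interval_margin:
  assumes "a \<le> b" "{a..b} \<subseteq> ens_J e - {0}"
  shows "\<exists>\<alpha> \<beta> \<eta>. 0 < \<alpha> \<and> \<alpha> \<le> \<beta> \<and> (e \<in> {HAF, WP} \<longrightarrow> \<beta> < 1) \<and> 0 < \<eta> \<and> (\<forall>t\<in>{a - \<eta>..b + \<eta>}. \<alpha> \<le> \<bar>t\<bar> \<and> \<bar>t\<bar> \<le> \<beta>)"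
proof -
  have ab: "a \<in> ens_J e" "b \<in> ens_J e" "0 \<notin> {a..b}" using assms by auto
  then have s: "0 < a \<or> b < 0" by auto
  define \<mu> where "\<mu> = max \<bar>a\<bar> \<bar>b\<bar>"
  have \<mu>1: "\<mu> < 1" if "e \<in> {HAF, WP}" using that ab by (auto simp: \<mu>_def abs_less_iff)
  obtain \<beta> where \<beta>: "\<mu> < \<beta>" "e \<in> {HAF, WP} \<longrightarrow> \<beta> < 1"
  proof (cases "e \<in> {HAF, WP}")
    case True
    then obtain c where "\<mu> < c" "c < 1" using dense[OF \<mu>1] by blast
    then show ?thesis using that by blast
  next
    case False
    then show ?thesis using that[of "\<mu> + 1"] by simp
  qed
  define \<alpha> where "\<alpha> = min \<bar>a\<bar> \<bar>b\<bar> / 2"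
  have \<alpha>: "0 < \<alpha>" using s assms(1) by (auto simp: \<alpha>_def)
  have \<alpha>\<mu>: "\<alpha> \<le> \<mu>" "2 * \<alpha> \<le> \<bar>a\<bar>" "2 * \<alpha> \<le> \<bar>b\<bar>" "\<bar>a\<bar> \<le> \<mu>" "\<bar>b\<bar> \<le> \<mu>" by (auto simp: \<alpha>_def \<mu>_def)
  define \<eta> where "\<eta> = min \<alpha> (\<beta> - \<mu>)"
  have \<eta>: "0 < \<eta>" "\<eta> \<le> \<alpha>" "\<eta> \<le> \<beta> - \<mu>" using \<alpha> \<beta> by (auto simp: \<eta>_def)
  have "\<alpha> \<le> \<bar>t\<bar> \<and> \<bar>t\<bar> \<le> \<beta>" if "t \<in> {a - \<eta>..b + \<eta>}" for t
    using s
  proof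
    assume "0 < a"
    then show ?thesis using that \<eta> \<alpha>\<mu> \<alpha> assms(1) by auto
  next
    assume "b < 0"
    then show ?thesis using that \<eta> \<alpha>\<mu> \<alpha> assms(1) by auto
  qed
  moreover have "\<alpha> \<le> \<beta>" using \<alpha>\<mu>(1) \<beta>(1) by simp
  ultimately show ?thesis using \<alpha> \<beta>(2) \<eta>(1) by blast
qed

text \<open>The global bound B replaces the number of zeros in the window only where the condition
  for m1 holds. It is asked for only when the function does not vanish identically.\<close>

lemma num_zeros_upper:
  assumes good: "ens_good e n x" and n: "n \<ge> 1" and \<delta>: "0 < \<delta>" "\<delta> < 1"
    and J: "{a..b} \<subseteq> ens_J e" and m1: "2 \<le> m1"
  defines "h \<equiv> \<delta> / sqrt (real n)"
  assumes win: "\<And>t. t \<in> {a - h..b} \<Longrightarrow> e = HAF \<longrightarrow> \<bar>t\<bar> + 2 / sqrt (real n) \<le> 1"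
    and B: "\<not> (\<forall>z\<in>ens_domain e. ens_fun e n x z = 0) \<Longrightarrow> of_nat (card {t\<in>{a..b}. ens_re e n x t = 0}) \<le> B"
  shows "ennreal h * num_zeros e n x a b \<le>
    (\<integral>\<^sup>+t\<in>{a - h..b}. (ennreal (of_bool (ens_re e n x t * ens_re e n x (t + h) \<le> 0) + 2 * (\<Sum>m=2..m1. of_bool (small_cond e n \<delta> m t x)))
        + B * of_bool (small_cond e n \<delta> m1 t x)) \<partial>lborel)"
proof (cases "\<forall>z\<in>ens_domain e. ens_fun e n x z = 0")
  case True
  then show ?thesis by (simp add: num_zeros_def)
next
  case False
  define Z where "Z = {t\<in>{a..b}. ens_re e n x t = 0}"
  have N: "num_zeros e n x a b = of_nat (card Z)" and Z: "finite Z" "Z \<subseteq> {a..b}"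
    using num_zeros_eq_card[OF good J False] by (auto simp: Z_def)
  have h: "0 \<le> h" using \<delta> by (simp add: h_def)
  have "ennreal h * num_zeros e n x a b = (\<integral>\<^sup>+t\<in>{a - h..b}. of_nat (card (Z \<inter> {t..t + h})) \<partial>lborel)"
    unfolding N by (rule card_eq_window_integral) (use Z h in auto)
  also have "\<dots> \<le> (\<integral>\<^sup>+t\<in>{a - h..b}. (ennreal (of_bool (ens_re e n x t * ens_re e n x (t + h) \<le> 0) + 2 * (\<Sum>m=2..m1. of_bool (small_cond e n \<delta> m t x)))
        + B * of_bool (small_cond e n \<delta> m1 t x)) \<partial>lborel)"
  proof (rule nn_integral_mono)
    fix t
    show "of_nat (card (Z \<inter> {t..t + h})) * indicator {a - h..b} t \<le>
      (ennreal (of_bool (ens_re e n x t * ens_re e n x (t + h) \<le> 0) + 2 * (\<Sum>m=2..m1. of_bool (small_cond e n \<delta> m t x)))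
        + B * of_bool (small_cond e n \<delta> m1 t x)) * indicator {a - h..b} t"
    proof (cases "t \<in> {a - h..b}")
      case True
      let ?N = "card (Z \<inter> {t..t + h})"
      let ?R = "of_bool (ens_re e n x t * ens_re e n x (t + h) \<le> 0) + 2 * (\<Sum>m=2..m1. of_bool (small_cond e n \<delta> m t x)) :: real"
      have "real ?N \<le> ?R + real ?N * of_bool (small_cond e n \<delta> m1 t x)"
        unfolding h_def
        by (rule local_zero_count[OF good n \<delta> _ _ _ _ m1]) (use win[OF True] Z in \<open>auto simp: Z_def h_def\<close>)
      moreover have "of_nat ?N \<le> B"
      proof -
        have "(of_nat ?N :: ennreal) \<le> of_nat (card Z)" using Z(1) by (intro of_nat_mono card_mono) auto
        also have "\<dots> \<le> B" using B[OF False] by (simp add: Z_def)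
        finally show ?thesis .
      qed
      ultimately have "of_nat ?N \<le> ennreal ?R + B * of_bool (small_cond e n \<delta> m1 t x)"
      proof (cases "small_cond e n \<delta> m1 t x")
        case False
        assume "real ?N \<le> ?R + real ?N * of_bool (small_cond e n \<delta> m1 t x)"
        then have "real ?N \<le> ?R" using False by simp
        then have "ennreal (real ?N) \<le> ennreal ?R" by (rule ennreal_leI)
        then show ?thesis using False by (simp add: ennreal_of_nat_eq_real_of_nat)
      qed (simp add: add_increasing)
      then show ?thesis using True by simp
    qed simp
  qed
  finally show ?thesis .
qed

context iid_std
begin

text \<open>As a simplification rule, \<open>Xi_apply\<close> would eta-expand \<open>Xi \<omega>\<close> inside \<open>ens_re e n (Xi \<omega>)\<close>.\<close>

declare Xi_apply [simp del]

lemma prob_section_measurable: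
  assumes "Measurable.pred (N \<Otimes>\<^sub>M M) (\<lambda>(t, \<omega>). P t \<omega>)"
  shows "(\<lambda>t. prob {\<omega>\<in>space M. P t \<omega>}) \<in> borel_measurable N"
proof -
  let ?Q = "{p \<in> space (N \<Otimes>\<^sub>M M). P (fst p) (snd p)}"
  have Q: "?Q \<in> sets (N \<Otimes>\<^sub>M M)" using assms by (simp add: pred_def case_prod_beta)
  have "(\<lambda>t. enn2real (emeasure M (Pair t -` ?Q))) \<in> borel_measurable N"
    using measurable_emeasure_Pair[OF Q] by measurable
  moreover have "enn2real (emeasure M (Pair t -` ?Q)) = prob {\<omega>\<in>space M. P t \<omega>}" if "t \<in> space N" for t
  proof -
    have "Pair t -` ?Q = {\<omega>\<in>space M. P t \<omega>}" using that by (auto simp: space_pair_measure)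
    then show ?thesis by (simp add: measure_def)
  qed
  ultimately show ?thesis by (simp cong: measurable_cong)
qed

lemma expected_num_zeros_upper:
  assumes n: "n \<ge> 1" and \<delta>: "0 < \<delta>" "\<delta> < 1"
    and J: "{a..b} \<subseteq> ens_J e" and m1: "2 \<le> m1"
  defines "h \<equiv> \<delta> / sqrt (real n)"
  assumes win: "\<And>t. t \<in> {a - h..b} \<Longrightarrow> e = HAF \<longrightarrow> \<bar>t\<bar> + 2 / sqrt (real n) \<le> 1"
    and W: "W \<in> borel_measurable M"
    and B: "\<And>\<omega>. ens_good e n (Xi \<omega>) \<Longrightarrow> \<omega> \<in> space M \<Longrightarrow> \<not> (\<forall>z\<in>ens_domain e. ens_fun e n (Xi \<omega>) z = 0) \<Longrightarrow>
      of_nat (card {t\<in>{a..b}. ens_re e n (Xi \<omega>) t = 0}) \<le> of_nat C + W \<omega>"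
    and P: "\<And>t m. t \<in> {a - h..b} \<Longrightarrow> prob {\<omega>\<in>space M. small_cond e n \<delta> m t (Xi \<omega>)} \<le> p m"
  shows "ennreal h * (\<integral>\<^sup>+\<omega>. num_zeros e n (Xi \<omega>) a b \<partial>M) \<le>
    (\<integral>\<^sup>+t\<in>{a - h..b}. (ennreal (prob {\<omega>\<in>space M. ens_re e n (Xi \<omega>) t * ens_re e n (Xi \<omega>) (t + h) \<le> 0} + 2 * (\<Sum>m=2..m1. p m) + real C * p m1)
        + (\<integral>\<^sup>+\<omega>. W \<omega> \<partial>M)) \<partial>lborel)"
proof -
  note [measurable] = W
  interpret L: pair_sigma_finite M "lborel :: real measure" ..
  let ?R = "\<lambda>\<omega> t. of_bool (ens_re e n (Xi \<omega>) t * ens_re e n (Xi \<omega>) (t + h) \<le> 0) + 2 * (\<Sum>m=2..m1. of_bool (small_cond e n \<delta> m t (Xi \<omega>))) :: real"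
  let ?G = "\<lambda>\<omega> t. (ennreal (?R \<omega> t) + (of_nat C + W \<omega>) * of_bool (small_cond e n \<delta> m1 t (Xi \<omega>))) * indicator {a - h..b} t"
  have h: "0 < h" using \<delta> n by (simp add: h_def)
  have G[measurable]: "(\<lambda>(\<omega>, t). ?G \<omega> t) \<in> borel_measurable (M \<Otimes>\<^sub>M lborel)" by measurable
  have "AE \<omega> in M. ennreal h * num_zeros e n (Xi \<omega>) a b \<le> (\<integral>\<^sup>+t. ?G \<omega> t \<partial>lborel)"
    using AE_ens_good[OF n, of e] AE_space[of M]
  proof eventually_elim
    case (elim \<omega>)
    show ?case unfolding h_def
      by (rule num_zeros_upper[OF elim(1) n \<delta> J m1]) (use win B[OF elim] in \<open>auto simp: h_def\<close>)
  qed
  \<comment> \<open>The constant goes to the measurable right-hand side before it leaves the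
    integral: \<open>nn_integral_cmult\<close> asks for measurability, monotonicity does
    not.\<close>
  have "(\<integral>\<^sup>+\<omega>. num_zeros e n (Xi \<omega>) a b \<partial>M) \<le> (\<integral>\<^sup>+\<omega>. ennreal (1 / h) * (\<integral>\<^sup>+t. ?G \<omega> t \<partial>lborel) \<partial>M)"
  proof (rule nn_integral_mono_AE)
    show "AE \<omega> in M. num_zeros e n (Xi \<omega>) a b \<le> ennreal (1 / h) * (\<integral>\<^sup>+t. ?G \<omega> t \<partial>lborel)"
      using \<open>AE \<omega> in M. ennreal h * num_zeros e n (Xi \<omega>) a b \<le> (\<integral>\<^sup>+t. ?G \<omega> t \<partial>lborel)\<close>
    proof eventually_elim
      case (elim \<omega>)
      have "ennreal (1 / h) * (ennreal h * num_zeros e n (Xi \<omega>) a b) \<le> ennreal (1 / h) * (\<integral>\<^sup>+t. ?G \<omega> t \<partial>lborel)"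
        using elim by (rule mult_left_mono) simp
      moreover have "ennreal (1 / h) * ennreal h = 1" using h by (simp flip: ennreal_mult')
      ultimately show ?case by (simp only: mult.assoc[symmetric] mult_1_left)
    qed
  qed
  also have "\<dots> = ennreal (1 / h) * (\<integral>\<^sup>+\<omega>. (\<integral>\<^sup>+t. ?G \<omega> t \<partial>lborel) \<partial>M)"
    by (rule nn_integral_cmult) measurable
  finally have "ennreal h * (\<integral>\<^sup>+\<omega>. num_zeros e n (Xi \<omega>) a b \<partial>M) \<le> ennreal h * (ennreal (1 / h) * (\<integral>\<^sup>+\<omega>. (\<integral>\<^sup>+t. ?G \<omega> t \<partial>lborel) \<partial>M))"
    by (rule mult_left_mono) simp
  also have "\<dots> = (\<integral>\<^sup>+\<omega>. (\<integral>\<^sup>+t. ?G \<omega> t \<partial>lborel) \<partial>M)"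
  proof -
    have "ennreal h * ennreal (1 / h) = 1" using h by (simp flip: ennreal_mult')
    then show ?thesis by (simp only: mult.assoc[symmetric] mult_1_left)
  qed
  also have "\<dots> = (\<integral>\<^sup>+t. (\<integral>\<^sup>+\<omega>. ?G \<omega> t \<partial>M) \<partial>lborel)"
    by (rule L.Fubini'[symmetric]) (rule G)
  also have "\<dots> \<le> (\<integral>\<^sup>+t\<in>{a - h..b}. (ennreal (prob {\<omega>\<in>space M. ens_re e n (Xi \<omega>) t * ens_re e n (Xi \<omega>) (t + h) \<le> 0} + 2 * (\<Sum>m=2..m1. p m) + real C * p m1)
        + (\<integral>\<^sup>+\<omega>. W \<omega> \<partial>M)) \<partial>lborel)"
  proof (rule nn_integral_mono)
    fix t :: real
    let ?pl = "prob {\<omega>\<in>space M. ens_re e n (Xi \<omega>) t * ens_re e n (Xi \<omega>) (t + h) \<le> 0}"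
    show "(\<integral>\<^sup>+\<omega>. ?G \<omega> t \<partial>M) \<le> (ennreal (?pl + 2 * (\<Sum>m=2..m1. p m) + real C * p m1) + (\<integral>\<^sup>+\<omega>. W \<omega> \<partial>M)) * indicator {a - h..b} t"
    proof (cases "t \<in> {a - h..b}")
      case True
      have eb: "(\<integral>\<^sup>+\<omega>. of_bool (Q \<omega>) \<partial>M) = ennreal (prob {\<omega>\<in>space M. Q \<omega>})" if [measurable]: "Measurable.pred M Q" for Q
      proof -
        have "(\<integral>\<^sup>+\<omega>. of_bool (Q \<omega>) \<partial>M) = (\<integral>\<^sup>+\<omega>. indicator {\<omega>\<in>space M. Q \<omega>} \<omega> \<partial>M)"
          by (intro nn_integral_cong) (auto simp: indicator_def)
        then show ?thesis by (simp add: emeasure_eq_measure)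
      qed
      have p0: "0 \<le> p m" for m using P[OF True, of m] measure_nonneg order_trans by blast
      have "(\<integral>\<^sup>+\<omega>. ?G \<omega> t \<partial>M) \<le> (\<integral>\<^sup>+\<omega>. (of_bool (ens_re e n (Xi \<omega>) t * ens_re e n (Xi \<omega>) (t + h) \<le> 0) + (\<Sum>m=2..m1. 2 * of_bool (small_cond e n \<delta> m t (Xi \<omega>))))
          + (of_nat C * of_bool (small_cond e n \<delta> m1 t (Xi \<omega>)) + W \<omega>) \<partial>M)"
      proof (rule nn_integral_mono)
        fix \<omega>
        have "ennreal (?R \<omega> t) = of_bool (ens_re e n (Xi \<omega>) t * ens_re e n (Xi \<omega>) (t + h) \<le> 0) + (\<Sum>m=2..m1. 2 * of_bool (small_cond e n \<delta> m t (Xi \<omega>)))"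
        proof -
          have s: "ennreal (\<Sum>m=2..m1. 2 * of_bool (small_cond e n \<delta> m t (Xi \<omega>))) = (\<Sum>m=2..m1. 2 * of_bool (small_cond e n \<delta> m t (Xi \<omega>)))"
          proof -
            have "(\<Sum>m=2..m1. 2 * of_bool (small_cond e n \<delta> m t (Xi \<omega>)) :: ennreal) = (\<Sum>m=2..m1. ennreal (2 * of_bool (small_cond e n \<delta> m t (Xi \<omega>))))"
              by (intro sum.cong refl) (simp add: of_bool_def)
            then show ?thesis by (subst sum_ennreal[symmetric]) simp_all
          qed
          have "ennreal (?R \<omega> t) = ennreal (of_bool (ens_re e n (Xi \<omega>) t * ens_re e n (Xi \<omega>) (t + h) \<le> 0)) + ennreal (\<Sum>m=2..m1. 2 * of_bool (small_cond e n \<delta> m t (Xi \<omega>)))"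
            unfolding sum_distrib_left by (rule ennreal_plus) (auto intro: sum_nonneg)
          then show ?thesis unfolding s by simp
        qed
        \<comment> \<open>The deterministic part keeps the indicator, since it is of order n and has
          to be paid for by a small probability; W already has small mean.\<close>
        moreover have "(of_nat C + W \<omega>) * of_bool (small_cond e n \<delta> m1 t (Xi \<omega>)) \<le> of_nat C * of_bool (small_cond e n \<delta> m1 t (Xi \<omega>)) + W \<omega>"
          by simp
        ultimately show "?G \<omega> t \<le> (of_bool (ens_re e n (Xi \<omega>) t * ens_re e n (Xi \<omega>) (t + h) \<le> 0) + (\<Sum>m=2..m1. 2 * of_bool (small_cond e n \<delta> m t (Xi \<omega>))))
          + (of_nat C * of_bool (small_cond e n \<delta> m1 t (Xi \<omega>)) + W \<omega>)"
          using True by (simp add: add_left_mono)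
      qed
      also have "\<dots> = (\<integral>\<^sup>+\<omega>. of_bool (ens_re e n (Xi \<omega>) t * ens_re e n (Xi \<omega>) (t + h) \<le> 0) \<partial>M) + (\<Sum>m=2..m1. 2 * (\<integral>\<^sup>+\<omega>. of_bool (small_cond e n \<delta> m t (Xi \<omega>)) \<partial>M))
          + (of_nat C * (\<integral>\<^sup>+\<omega>. of_bool (small_cond e n \<delta> m1 t (Xi \<omega>)) \<partial>M) + (\<integral>\<^sup>+\<omega>. W \<omega> \<partial>M))"
      proof -
        let ?f = "\<lambda>\<omega>. of_bool (ens_re e n (Xi \<omega>) t * ens_re e n (Xi \<omega>) (t + h) \<le> 0) :: ennreal"
        let ?g = "\<lambda>m \<omega>. of_bool (small_cond e n \<delta> m t (Xi \<omega>)) :: ennreal"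
        have [measurable]: "?f \<in> borel_measurable M" "?g m \<in> borel_measurable M" for m by measurable
        have "(\<integral>\<^sup>+\<omega>. (?f \<omega> + (\<Sum>m=2..m1. 2 * ?g m \<omega>)) + (of_nat C * ?g m1 \<omega> + W \<omega>) \<partial>M)
          = (\<integral>\<^sup>+\<omega>. ?f \<omega> + (\<Sum>m=2..m1. 2 * ?g m \<omega>) \<partial>M) + (\<integral>\<^sup>+\<omega>. of_nat C * ?g m1 \<omega> + W \<omega> \<partial>M)"
          by (rule nn_integral_add) measurable
        also have "(\<integral>\<^sup>+\<omega>. ?f \<omega> + (\<Sum>m=2..m1. 2 * ?g m \<omega>) \<partial>M) = (\<integral>\<^sup>+\<omega>. ?f \<omega> \<partial>M) + (\<integral>\<^sup>+\<omega>. (\<Sum>m=2..m1. 2 * ?g m \<omega>) \<partial>M)"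
          by (rule nn_integral_add) measurable
        also have "(\<integral>\<^sup>+\<omega>. (\<Sum>m=2..m1. 2 * ?g m \<omega>) \<partial>M) = (\<Sum>m=2..m1. \<integral>\<^sup>+\<omega>. 2 * ?g m \<omega> \<partial>M)"
          by (rule nn_integral_sum) measurable
        also have "\<dots> = (\<Sum>m=2..m1. 2 * (\<integral>\<^sup>+\<omega>. ?g m \<omega> \<partial>M))"
          by (intro sum.cong refl nn_integral_cmult) measurable
        also have "(\<integral>\<^sup>+\<omega>. of_nat C * ?g m1 \<omega> + W \<omega> \<partial>M) = (\<integral>\<^sup>+\<omega>. of_nat C * ?g m1 \<omega> \<partial>M) + (\<integral>\<^sup>+\<omega>. W \<omega> \<partial>M)"
          by (rule nn_integral_add) measurable
        also have "(\<integral>\<^sup>+\<omega>. of_nat C * ?g m1 \<omega> \<partial>M) = of_nat C * (\<integral>\<^sup>+\<omega>. ?g m1 \<omega> \<partial>M)"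
          by (rule nn_integral_cmult) measurable
        finally show ?thesis .
      qed
      also have "\<dots> = ennreal ?pl + (\<Sum>m=2..m1. 2 * ennreal (prob {\<omega>\<in>space M. small_cond e n \<delta> m t (Xi \<omega>)}))
          + (of_nat C * ennreal (prob {\<omega>\<in>space M. small_cond e n \<delta> m1 t (Xi \<omega>)}) + (\<integral>\<^sup>+\<omega>. W \<omega> \<partial>M))"
        by (subst (1 2 3) eb) measurable
      also have "\<dots> \<le> ennreal ?pl + (\<Sum>m=2..m1. 2 * ennreal (p m)) + (of_nat C * ennreal (p m1) + (\<integral>\<^sup>+\<omega>. W \<omega> \<partial>M))"
        by (intro add_mono sum_mono mult_left_mono ennreal_leI P[OF True]) auto
      also have "\<dots> = ennreal (?pl + 2 * (\<Sum>m=2..m1. p m) + real C * p m1) + (\<integral>\<^sup>+\<omega>. W \<omega> \<partial>M)"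
      proof -
        have s: "(\<Sum>m=2..m1. 2 * ennreal (p m)) = ennreal (2 * (\<Sum>m=2..m1. p m))"
        proof -
          have "(\<Sum>m=2..m1. 2 * ennreal (p m)) = (\<Sum>m=2..m1. ennreal (2 * p m))"
            by (intro sum.cong refl) (simp add: ennreal_mult' p0)
          also have "\<dots> = ennreal (\<Sum>m=2..m1. 2 * p m)" by (rule sum_ennreal) (simp add: p0)
          finally show ?thesis by (simp add: sum_distrib_left)
        qed
        have c: "of_nat C * ennreal (p m1) = ennreal (real C * p m1)"
          by (simp add: ennreal_mult' ennreal_of_nat_eq_real_of_nat)
        have "0 \<le> (\<Sum>m=2..m1. p m)" by (intro sum_nonneg p0)
        then show ?thesis unfolding s c using p0 by (simp add: ennreal_plus add.assoc)
      qed
      finally show ?thesis using True by simp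
    next
      case False
      then show ?thesis by simp
    qed
  qed
  finally show ?thesis .
qed

lemma sign_change_integral_tendsto:
  fixes cl :: "real set" and lo up :: "nat \<Rightarrow> real"
  assumes J: "{a..b} \<subseteq> ens_J e - {0}" and \<delta>: "0 < \<delta>"
    and lo: "lo \<longlonglongrightarrow> a" "\<And>n. a - 1 \<le> lo n \<and> lo n \<le> a" and up: "up \<longlonglongrightarrow> b" "\<And>n. up n \<le> b"
    and pn: "\<And>n t. pn n t = prob {\<omega>\<in>space M. Q (ens_re e n (Xi \<omega>) t * ens_re e n (Xi \<omega>) (t + \<delta> / sqrt (real n)))}"
    and Q: "Q = (\<lambda>x. x < 0) \<or> Q = (\<lambda>x. x \<le> 0)"
  shows "(\<lambda>n. LINT t|lborel. indicator {lo n..up n} t * pn n t) \<longlonglongrightarrow> (LINT t|lborel. indicator {a..b} t * sign_change_limit (ens_kappa e t * \<delta>))"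
    "pn n \<in> borel_measurable borel"
proof -
  have meas: "pn n \<in> borel_measurable borel" for n
  proof -
    have "(\<lambda>t. prob {\<omega>\<in>space M. Q (ens_re e n (Xi \<omega>) t * ens_re e n (Xi \<omega>) (t + \<delta> / sqrt (real n)))}) \<in> borel_measurable borel"
    proof (rule prob_section_measurable)
      have [measurable]: "Measurable.pred borel Q" using Q by (elim disjE) simp_all
      show "Measurable.pred (borel \<Otimes>\<^sub>M M) (\<lambda>(t, \<omega>). Q (ens_re e n (Xi \<omega>) t * ens_re e n (Xi \<omega>) (t + \<delta> / sqrt (real n))))"
        by measurable
    qed
    then show ?thesis by (simp only: pn[abs_def])
  qed
  then show "pn n \<in> borel_measurable borel" .
  note [measurable] = meas
  have p01: "0 \<le> pn n t" "pn n t \<le> 1" for n t unfolding pn by auto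
  have lim: "(\<lambda>n. pn n t) \<longlonglongrightarrow> sign_change_limit (ens_kappa e t * \<delta>)" if "t \<in> {a..b}" for t
  proof -
    have "t \<in> ens_J e" "t \<noteq> 0" using that J by auto
    note sc = sign_change_tendsto[OF this \<delta>]
    from Q show ?thesis unfolding pn
    proof (elim disjE)
      assume "Q = (\<lambda>x. x < 0)"
      then show "(\<lambda>n. prob {\<omega>\<in>space M. Q (ens_re e n (Xi \<omega>) t * ens_re e n (Xi \<omega>) (t + \<delta> / sqrt (real n)))}) \<longlonglongrightarrow> sign_change_limit (ens_kappa e t * \<delta>)"
        using sc(1) by (simp only:)
    next
      assume "Q = (\<lambda>x. x \<le> 0)"
      then show "(\<lambda>n. prob {\<omega>\<in>space M. Q (ens_re e n (Xi \<omega>) t * ens_re e n (Xi \<omega>) (t + \<delta> / sqrt (real n)))}) \<longlonglongrightarrow> sign_change_limit (ens_kappa e t * \<delta>)"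
        using sc(2) by (simp only:)
    qed
  qed
  have [measurable]: "sign_change_limit \<in> borel_measurable borel" unfolding sign_change_limit_def by measurable
  show "(\<lambda>n. LINT t|lborel. indicator {lo n..up n} t * pn n t) \<longlonglongrightarrow> (LINT t|lborel. indicator {a..b} t * sign_change_limit (ens_kappa e t * \<delta>))"
  proof (rule integral_dominated_convergence[where w = "\<lambda>t. indicator {a - 1..b} t :: real"])
    show "AE t in lborel. (\<lambda>n. indicator {lo n..up n} t * pn n t) \<longlonglongrightarrow> indicator {a..b} t * sign_change_limit (ens_kappa e t * \<delta>)"
      \<comment> \<open>The right endpoints may approach b from below, so pointwise convergence can
        fail at \<open>t = b\<close>.\<close>
      using AE_lborel_singleton[of b]
    proof eventually_elim
      case (elim t)
      consider "t < a" | "b < t" | "a \<le> t" "t < b" using elim by linarith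
      then show ?case
      proof cases
        case 1
        have "eventually (\<lambda>n. t < lo n) sequentially" using order_tendstoD(1)[OF lo(1) 1] .
        then have "eventually (\<lambda>n. indicator {lo n..up n} t * pn n t = 0) sequentially" by eventually_elim simp
        then show ?thesis using 1 by (simp add: tendsto_eventually)
      next
        case 2
        have z: "indicator {lo n..up n} t * pn n t = 0" for n using up(2)[of n] 2 by simp
        have "(indicator {a..b} t :: real) = 0" using 2 by simp
        then show ?thesis by (simp only: z mult_zero_left tendsto_const)
      next
        case 3
        have "eventually (\<lambda>n. t < up n) sequentially" using order_tendstoD(1)[OF up(1) 3(2)] .
        then have ev: "eventually (\<lambda>n. pn n t = indicator {lo n..up n} t * pn n t) sequentially"
        proof eventually_elim
          case (elim n)
          then show ?case using lo(2)[of n] 3 by (simp add: indicator_def)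
        qed
        have ind: "indicator {a..b} t * sign_change_limit (ens_kappa e t * \<delta>) = sign_change_limit (ens_kappa e t * \<delta>)"
          using 3 by simp
        have "(\<lambda>n. pn n t) \<longlonglongrightarrow> sign_change_limit (ens_kappa e t * \<delta>)" by (rule lim) (use 3 in simp)
        then show ?thesis unfolding ind by (rule Lim_transform_eventually[OF _ ev])
      qed
    qed
    show "AE t in lborel. norm (indicator {lo n..up n} t * pn n t) \<le> indicator {a - 1..b} t" for n
    proof (rule AE_I2)
      fix t
      show "norm (indicator {lo n..up n} t * pn n t) \<le> indicator {a - 1..b} t"
      proof (cases "t \<in> {lo n..up n}")
        case True
        then have "a - 1 \<le> t" "t \<le> b" using lo(2)[of n] up(2)[of n] by auto
        then show ?thesis using True p01[of n t] by simp
      qed simp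
    qed
    show "integrable lborel (\<lambda>t. indicator {a - 1..b} t :: real)"
      by (rule integrable_real_indicator) (simp_all add: emeasure_lborel_Icc_eq)
  qed measurable
qed

lemma expected_num_zeros_lower:
  assumes n: "n \<ge> 1" and J: "{a..b} \<subseteq> ens_J e" and h: "0 < h"
  shows "(\<integral>\<^sup>+t\<in>{a..b - h}. ennreal (prob {\<omega>\<in>space M. ens_re e n (Xi \<omega>) t * ens_re e n (Xi \<omega>) (t + h) < 0}) \<partial>lborel)
    \<le> ennreal h * (\<integral>\<^sup>+\<omega>. num_zeros e n (Xi \<omega>) a b \<partial>M)"
proof -
  interpret L: pair_sigma_finite M "lborel :: real measure" ..
  let ?I = "\<lambda>\<omega> t. indicator {..<0} (ens_re e n (Xi \<omega>) t * ens_re e n (Xi \<omega>) (t + h)) * indicator {a..b - h} t :: ennreal"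
  have G[measurable]: "(\<lambda>(\<omega>, t). ?I \<omega> t) \<in> borel_measurable (M \<Otimes>\<^sub>M lborel)" by measurable
  have one: "ennreal (1 / h) * ennreal h = 1" "ennreal h * ennreal (1 / h) = 1" using h by (simp_all flip: ennreal_mult')
  have "(\<integral>\<^sup>+t\<in>{a..b - h}. ennreal (prob {\<omega>\<in>space M. ens_re e n (Xi \<omega>) t * ens_re e n (Xi \<omega>) (t + h) < 0}) \<partial>lborel) = (\<integral>\<^sup>+t. (\<integral>\<^sup>+\<omega>. ?I \<omega> t \<partial>M) \<partial>lborel)"
  proof (rule nn_integral_cong)
    fix t
    have "(\<integral>\<^sup>+\<omega>. ?I \<omega> t \<partial>M) = (\<integral>\<^sup>+\<omega>. indicator {\<omega>\<in>space M. ens_re e n (Xi \<omega>) t * ens_re e n (Xi \<omega>) (t + h) < 0} \<omega> * indicator {a..b - h} t \<partial>M)"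
      by (intro nn_integral_cong) (auto simp: indicator_def)
    also have "\<dots> = ennreal (prob {\<omega>\<in>space M. ens_re e n (Xi \<omega>) t * ens_re e n (Xi \<omega>) (t + h) < 0}) * indicator {a..b - h} t"
      by (subst nn_integral_multc) (auto simp: emeasure_eq_measure)
    finally show "ennreal (prob {\<omega>\<in>space M. ens_re e n (Xi \<omega>) t * ens_re e n (Xi \<omega>) (t + h) < 0}) * indicator {a..b - h} t = (\<integral>\<^sup>+\<omega>. ?I \<omega> t \<partial>M)"
      by (rule sym)
  qed
  also have "\<dots> = (\<integral>\<^sup>+\<omega>. (\<integral>\<^sup>+t. ?I \<omega> t \<partial>lborel) \<partial>M)" by (rule L.Fubini') (rule G)
  also have "\<dots> = ennreal h * (ennreal (1 / h) * (\<integral>\<^sup>+\<omega>. (\<integral>\<^sup>+t. ?I \<omega> t \<partial>lborel) \<partial>M))"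
    by (simp only: mult.assoc[symmetric] one mult_1_left)
  also have "ennreal (1 / h) * (\<integral>\<^sup>+\<omega>. (\<integral>\<^sup>+t. ?I \<omega> t \<partial>lborel) \<partial>M) = (\<integral>\<^sup>+\<omega>. ennreal (1 / h) * (\<integral>\<^sup>+t. ?I \<omega> t \<partial>lborel) \<partial>M)"
    by (rule nn_integral_cmult[symmetric]) measurable
  also have "ennreal h * (\<integral>\<^sup>+\<omega>. ennreal (1 / h) * (\<integral>\<^sup>+t. ?I \<omega> t \<partial>lborel) \<partial>M) \<le> ennreal h * (\<integral>\<^sup>+\<omega>. num_zeros e n (Xi \<omega>) a b \<partial>M)"
  proof (intro mult_left_mono nn_integral_mono_AE)
    show "AE \<omega> in M. ennreal (1 / h) * (\<integral>\<^sup>+t. ?I \<omega> t \<partial>lborel) \<le> num_zeros e n (Xi \<omega>) a b"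
      using AE_ens_good[OF n, of e]
    proof eventually_elim
      case (elim \<omega>)
      have "ennreal (1 / h) * (\<integral>\<^sup>+t. ?I \<omega> t \<partial>lborel) \<le> ennreal (1 / h) * (ennreal h * num_zeros e n (Xi \<omega>) a b)"
        by (intro mult_left_mono num_zeros_lower[OF elim J h]) simp
      then show ?case by (simp only: mult.assoc[symmetric] one mult_1_left)
    qed
  qed simp
  finally show ?thesis .
qed

section \<open>Short windows: asymptotics of the integrated sign-change probability\<close>

lemma kappa_integrable_bound:
  assumes "{a..b} \<subseteq> ens_J e"
  shows "\<exists>K>0. (\<forall>t\<in>{a..b}. ens_kappa e t \<le> K) \<and> integrable lborel (\<lambda>t. indicator {a..b} t * ens_kappa e t)"
proof -
  have "compact (ens_kappa e ` {a..b})"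
    by (intro compact_continuous_image continuous_on_subset[OF ens_kappa_continuous assms]) simp
  then have "bounded (ens_kappa e ` {a..b})" by (rule compact_imp_bounded)
  then obtain K where K: "0 < K" "\<And>y. y \<in> ens_kappa e ` {a..b} \<Longrightarrow> norm y \<le> K" unfolding bounded_pos by blast
  have "set_integrable lborel {a..b} (ens_kappa e)"
    by (rule borel_integrable_atLeastAtMost') (rule continuous_on_subset[OF ens_kappa_continuous assms])
  then have "integrable lborel (\<lambda>t. indicator {a..b} t * ens_kappa e t)" by (simp add: set_integrable_def)
  moreover have "ens_kappa e t \<le> K" if "t \<in> {a..b}" for t using K(2)[of "ens_kappa e t"] that by auto
  ultimately show ?thesis using K(1) by blast
qed

lemma sign_change_limit_integral_bounds:
  assumes J: "{a..b} \<subseteq> ens_J e" and \<epsilon>: "0 < \<epsilon>"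
  defines "I \<equiv> LINT t|lborel. indicator {a..b} t * ens_kappa e t"
  shows "\<exists>\<delta>0>0. \<forall>\<delta>. 0 < \<delta> \<longrightarrow> \<delta> < \<delta>0 \<longrightarrow>
    \<delta> * (I / pi - \<epsilon>) \<le> (LINT t|lborel. indicator {a..b} t * sign_change_limit (ens_kappa e t * \<delta>)) \<and>
    (LINT t|lborel. indicator {a..b} t * sign_change_limit (ens_kappa e t * \<delta>)) \<le> \<delta> * (I / pi + \<epsilon>)"
proof -
  obtain K where K: "0 < K" "\<And>t. t \<in> {a..b} \<Longrightarrow> ens_kappa e t \<le> K" and int: "integrable lborel (\<lambda>t. indicator {a..b} t * ens_kappa e t)"
    using kappa_integrable_bound[OF J] by blast
  have kpos: "0 < ens_kappa e t" if "t \<in> {a..b}" for t using ens_kappa_pos that J by blast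
  have I0: "0 \<le> I" unfolding I_def by (rule integral_nonneg_AE) (use kpos in \<open>auto simp: indicator_def intro: less_imp_le\<close>)
  \<comment> \<open>An error \<epsilon>1 relative to \<open>ens_kappa e t * \<delta>\<close>
    integrates to \<epsilon>1 times I times \<delta>; the summand 1 covers
    \<open>I = 0\<close>.\<close>
  define \<epsilon>1 where "\<epsilon>1 = \<epsilon> / (I + 1)"
  have \<epsilon>1: "0 < \<epsilon>1" "\<epsilon>1 * I \<le> \<epsilon>" using \<epsilon> I0 by (auto simp: \<epsilon>1_def field_simps)
  obtain y0 where y0: "0 < y0" "\<And>y. 0 < y \<Longrightarrow> y < y0 \<Longrightarrow> (1 / pi - \<epsilon>1) * y \<le> sign_change_limit y \<and> sign_change_limit y \<le> (1 / pi + \<epsilon>1) * y"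
    using sign_change_limit_bounds[OF \<epsilon>1(1)] by blast
  show ?thesis
  \<comment> \<open>K bounds the local scale on the interval, so
    \<open>ens_kappa e t * \<delta>\<close> stays below \<open>y0\<close> for all t at once.\<close>
  proof (intro exI[of _ "y0 / K"] conjI allI impI)
    show "0 < y0 / K" using y0 K by simp
    fix \<delta> :: real assume \<delta>: "0 < \<delta>" "\<delta> < y0 / K"
    have y: "0 < ens_kappa e t * \<delta> \<and> ens_kappa e t * \<delta> < y0" if "t \<in> {a..b}" for t
    proof -
      have "ens_kappa e t * \<delta> \<le> K * \<delta>" using K(2)[OF that] \<delta> by (intro mult_right_mono) auto
      also have "\<dots> < y0" using \<delta> K(1) by (simp add: field_simps)
      finally show ?thesis using kpos[OF that] \<delta> by simp
    qed
    have [measurable]: "sign_change_limit \<in> borel_measurable borel" unfolding sign_change_limit_def by measurable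
    have iS: "integrable lborel (\<lambda>t. indicator {a..b} t * sign_change_limit (ens_kappa e t * \<delta>))"
    proof (rule Bochner_Integration.integrable_bound)
      show "integrable lborel (\<lambda>t. indicator {a..b} t :: real)"
        by (rule integrable_real_indicator) (simp_all add: emeasure_lborel_Icc_eq)
      show "AE t in lborel. norm (indicator {a..b} t * sign_change_limit (ens_kappa e t * \<delta>)) \<le> norm (indicator {a..b} t :: real)"
        using sign_change_limit_range by (intro AE_I2) (simp add: indicator_def)
    qed measurable
    have "(LINT t|lborel. \<delta> * (1 / pi - \<epsilon>1) * (indicator {a..b} t * ens_kappa e t)) \<le> (LINT t|lborel. indicator {a..b} t * sign_change_limit (ens_kappa e t * \<delta>))"
    proof (rule integral_mono)
      show "integrable lborel (\<lambda>t. \<delta> * (1 / pi - \<epsilon>1) * (indicator {a..b} t * ens_kappa e t))" using int by (rule integrable_mult_right)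
      show "\<delta> * (1 / pi - \<epsilon>1) * (indicator {a..b} t * ens_kappa e t) \<le> indicator {a..b} t * sign_change_limit (ens_kappa e t * \<delta>)" for t
        using y0(2)[of "ens_kappa e t * \<delta>"] y[of t] by (cases "t \<in> {a..b}") (auto simp: mult_ac)
    qed (rule iS)
    then have lo: "\<delta> * (1 / pi - \<epsilon>1) * I \<le> (LINT t|lborel. indicator {a..b} t * sign_change_limit (ens_kappa e t * \<delta>))"
      by (simp only: integral_mult_right_zero I_def)
    have "(LINT t|lborel. indicator {a..b} t * sign_change_limit (ens_kappa e t * \<delta>)) \<le> (LINT t|lborel. \<delta> * (1 / pi + \<epsilon>1) * (indicator {a..b} t * ens_kappa e t))"
    proof (rule integral_mono)
      show "integrable lborel (\<lambda>t. \<delta> * (1 / pi + \<epsilon>1) * (indicator {a..b} t * ens_kappa e t))" using int by (rule integrable_mult_right)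
      show "indicator {a..b} t * sign_change_limit (ens_kappa e t * \<delta>) \<le> \<delta> * (1 / pi + \<epsilon>1) * (indicator {a..b} t * ens_kappa e t)" for t
        using y0(2)[of "ens_kappa e t * \<delta>"] y[of t] by (cases "t \<in> {a..b}") (auto simp: mult_ac)
    qed (rule iS)
    then have up: "(LINT t|lborel. indicator {a..b} t * sign_change_limit (ens_kappa e t * \<delta>)) \<le> \<delta> * (1 / pi + \<epsilon>1) * I"
      by (simp only: integral_mult_right_zero I_def)
    have "\<delta> * (I / pi - \<epsilon>) \<le> \<delta> * ((1 / pi - \<epsilon>1) * I)"
      using \<delta> \<epsilon>1 by (intro mult_left_mono) (auto simp: left_diff_distrib)
    with lo show "\<delta> * (I / pi - \<epsilon>) \<le> (LINT t|lborel. indicator {a..b} t * sign_change_limit (ens_kappa e t * \<delta>))" by (simp add: mult.assoc)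
    have "\<delta> * ((1 / pi + \<epsilon>1) * I) \<le> \<delta> * (I / pi + \<epsilon>)"
      using \<delta> \<epsilon>1 by (intro mult_left_mono) (auto simp: distrib_right)
    with up show "(LINT t|lborel. indicator {a..b} t * sign_change_limit (ens_kappa e t * \<delta>)) \<le> \<delta> * (I / pi + \<epsilon>)" by (simp add: mult.assoc)
  qed
qed

lemma divide_sqrt_eq:
  fixes E :: ennreal
  assumes "n \<ge> 1" "0 < \<delta>"
  shows "E / ennreal (sqrt (real n)) = ennreal (1 / \<delta>) * (ennreal (\<delta> / sqrt (real n)) * E)"
proof -
  have "ennreal (1 / \<delta>) * ennreal (\<delta> / sqrt (real n)) = ennreal (1 / \<delta> * (\<delta> / sqrt (real n)))"
    by (rule ennreal_mult'[symmetric]) (use assms in simp)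
  also have "1 / \<delta> * (\<delta> / sqrt (real n)) = inverse (sqrt (real n))" using assms by (simp add: inverse_eq_divide)
  also have "ennreal (inverse (sqrt (real n))) = inverse (ennreal (sqrt (real n)))"
    by (rule inverse_ennreal[symmetric]) (use assms in simp)
  finally have eq: "ennreal (1 / \<delta>) * ennreal (\<delta> / sqrt (real n)) = inverse (ennreal (sqrt (real n)))" .
  have "E / ennreal (sqrt (real n)) = inverse (ennreal (sqrt (real n))) * E" unfolding divide_ennreal_def by (rule mult.commute)
  also have "\<dots> = ennreal (1 / \<delta>) * (ennreal (\<delta> / sqrt (real n)) * E)" unfolding eq[symmetric] by (rule mult.assoc)
  finally show ?thesis .
qed

lemma set_nn_integral_eq_ennreal:
  fixes f :: "real \<Rightarrow> real" and u v :: real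
  assumes [measurable]: "f \<in> borel_measurable borel" and f: "\<And>t. 0 \<le> f t \<and> f t \<le> 1"
  shows "(\<integral>\<^sup>+t\<in>{u..v}. ennreal (f t) \<partial>lborel) = ennreal (LINT t|lborel. indicator {u..v} t * f t)"
proof -
  have "integrable lborel (\<lambda>t. indicator {u..v} t * f t)"
  proof (rule Bochner_Integration.integrable_bound)
    show "integrable lborel (\<lambda>t. indicator {u..v} t :: real)"
      by (rule integrable_real_indicator) (auto simp: emeasure_lborel_Icc_eq)
    show "AE t in lborel. norm (indicator {u..v} t * f t) \<le> norm (indicator {u..v} t :: real)"
      using f by (intro AE_I2) (simp add: indicator_def)
  qed measurable
  moreover have "(\<integral>\<^sup>+t\<in>{u..v}. ennreal (f t) \<partial>lborel) = (\<integral>\<^sup>+t. ennreal (indicator {u..v} t * f t) \<partial>lborel)"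
    by (intro nn_integral_cong) (simp add: indicator_def)
  ultimately show ?thesis using f by (simp add: nn_integral_eq_integral)
qed

text \<open>\<delta> is fixed before n grows. Half of \<epsilon> is spent on the expansion in
  \<delta>; the other half provides the strict inequality that survives the limit in n.\<close>

lemma eventually_num_zeros_lower:
  assumes J: "{a..b} \<subseteq> ens_J e - {0}" and \<epsilon>: "0 < \<epsilon>"
  defines "I \<equiv> LINT t|lborel. indicator {a..b} t * ens_kappa e t"
  shows "eventually (\<lambda>n. ennreal (I / pi - \<epsilon>) \<le> (\<integral>\<^sup>+\<omega>. num_zeros e n (Xi \<omega>) a b \<partial>M) / ennreal (sqrt (real n))) sequentially"
proof -
  have J': "{a..b} \<subseteq> ens_J e" using J by blast
  obtain \<delta>0 where \<delta>0: "0 < \<delta>0" "\<And>\<delta>. 0 < \<delta> \<Longrightarrow> \<delta> < \<delta>0 \<Longrightarrow> \<delta> * (I / pi - \<epsilon> / 2) \<le> (LINT t|lborel. indicator {a..b} t * sign_change_limit (ens_kappa e t * \<delta>))"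
    using sign_change_limit_integral_bounds[OF J', of "\<epsilon> / 2"] \<epsilon> unfolding I_def by auto
  define \<delta> where "\<delta> = \<delta>0 / 2"
  have \<delta>: "0 < \<delta>" "\<delta> < \<delta>0" using \<delta>0(1) by (auto simp: \<delta>_def)
  define S where "S = (LINT t|lborel. indicator {a..b} t * sign_change_limit (ens_kappa e t * \<delta>))"
  have S: "\<delta> * (I / pi - \<epsilon> / 2) \<le> S" unfolding S_def by (rule \<delta>0(2)[OF \<delta>])
  define pn where "pn n t = prob {\<omega>\<in>space M. ens_re e n (Xi \<omega>) t * ens_re e n (Xi \<omega>) (t + \<delta> / sqrt (real n)) < 0}" for n t
  have lim0: "(\<lambda>n. b - \<delta> / sqrt (real n)) \<longlonglongrightarrow> b" by real_asymp
  note sc = sign_change_integral_tendsto[where Q = "\<lambda>x. x < 0" and lo = "\<lambda>_. a" and up = "\<lambda>n. b - \<delta> / sqrt (real n)" and pn = pn, OF J \<delta>(1) tendsto_const _ lim0 _ pn_def]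
  have lim: "(\<lambda>n. LINT t|lborel. indicator {a..b - \<delta> / sqrt (real n)} t * pn n t) \<longlonglongrightarrow> S"
    unfolding S_def by (rule sc(1)) (use \<delta> in auto)
  have meas: "pn n \<in> borel_measurable borel" for n by (rule sc(2)) (use \<delta> in auto)
  have "\<delta> * (I / pi - \<epsilon>) < S"
  proof -
    have "\<delta> * (I / pi - \<epsilon>) < \<delta> * (I / pi - \<epsilon> / 2)" using \<delta> \<epsilon> by (intro mult_strict_left_mono) auto
    then show ?thesis using S by simp
  qed
  then have "eventually (\<lambda>n. \<delta> * (I / pi - \<epsilon>) < (LINT t|lborel. indicator {a..b - \<delta> / sqrt (real n)} t * pn n t)) sequentially"
    by (rule order_tendstoD(1)[OF lim])
  then show ?thesis using eventually_ge_at_top[of 1]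
  proof eventually_elim
    case (elim n)
    let ?h = "\<delta> / sqrt (real n)"
    let ?E = "\<integral>\<^sup>+\<omega>. num_zeros e n (Xi \<omega>) a b \<partial>M"
    have h: "0 < ?h" using \<delta> elim by simp
    have "ennreal (LINT t|lborel. indicator {a..b - ?h} t * pn n t) = (\<integral>\<^sup>+t\<in>{a..b - ?h}. ennreal (pn n t) \<partial>lborel)"
      by (rule set_nn_integral_eq_ennreal[symmetric]) (use meas in \<open>auto simp: pn_def\<close>)
    also have "\<dots> \<le> ennreal ?h * ?E"
      unfolding pn_def by (rule expected_num_zeros_lower[OF elim(2) J' h])
    finally have le: "ennreal (LINT t|lborel. indicator {a..b - ?h} t * pn n t) \<le> ennreal ?h * ?E" .
    have "ennreal (I / pi - \<epsilon>) = ennreal (1 / \<delta> * (\<delta> * (I / pi - \<epsilon>)))" using \<delta> by simp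
    also have "\<dots> = ennreal (1 / \<delta>) * ennreal (\<delta> * (I / pi - \<epsilon>))" by (rule ennreal_mult') (use \<delta> in simp)
    also have "\<dots> \<le> ennreal (1 / \<delta>) * (ennreal ?h * ?E)"
      by (intro mult_left_mono order_trans[OF ennreal_leI le]) (use elim in auto)
    also have "\<dots> = ?E / ennreal (sqrt (real n))" by (rule divide_sqrt_eq[OF elim(2) \<delta>(1), symmetric])
    finally show ?case .
  qed
qed

text \<open>Here \<delta> must also beat the contribution of windows with several zeros, which is of
  order d^4 for \<delta> = d^3. Relative to \<delta> this is of order d, so a small d
  suffices.\<close>

lemma eventually_num_zeros_upper:
  assumes ab: "a \<le> b" and J: "{a..b} \<subseteq> ens_J e - {0}" and \<epsilon>: "0 < \<epsilon>"
  defines "I \<equiv> LINT t|lborel. indicator {a..b} t * ens_kappa e t"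
  shows "eventually (\<lambda>n. (\<integral>\<^sup>+\<omega>. num_zeros e n (Xi \<omega>) a b \<partial>M) / ennreal (sqrt (real n)) \<le> ennreal (I / pi + \<epsilon>)) sequentially"
proof -
  have J': "{a..b} \<subseteq> ens_J e" using J by blast
  obtain \<alpha> \<beta> \<eta> where \<alpha>\<beta>: "0 < \<alpha>" "\<alpha> \<le> \<beta>" "e \<in> {HAF, WP} \<longrightarrow> \<beta> < 1" and \<eta>: "0 < \<eta>"
    and range: "\<And>t. t \<in> {a - \<eta>..b + \<eta>} \<Longrightarrow> \<alpha> \<le> \<bar>t\<bar> \<and> \<bar>t\<bar> \<le> \<beta>"
    using ens_interval_margin[OF ab J] by blast
  have "\<exists>C>0. eventually (\<lambda>n. \<forall>t m d. \<alpha> \<le> \<bar>t\<bar> \<longrightarrow> \<bar>t\<bar> \<le> \<beta> \<longrightarrow> 0 < d \<longrightarrow> d < 1 \<longrightarrow>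
     prob {\<omega>\<in>space M. small_cond e n (d ^ 3) m t (Xi \<omega>)} \<le> C * (d ^ (2 * m) + 1 / (real n)\<^sup>2)) sequentially"
    by (rule small_cond_prob) (use \<alpha>\<beta> in auto)
  then obtain Cs where Cs: "0 < Cs" and small: "eventually (\<lambda>n. \<forall>t m d. \<alpha> \<le> \<bar>t\<bar> \<longrightarrow> \<bar>t\<bar> \<le> \<beta> \<longrightarrow> 0 < d \<longrightarrow> d < 1 \<longrightarrow>
     prob {\<omega>\<in>space M. small_cond e n (d ^ 3) m t (Xi \<omega>)} \<le> Cs * (d ^ (2 * m) + 1 / (real n)\<^sup>2)) sequentially" by blast
  have "\<exists>(C::nat) W. (\<forall>n. W n \<in> borel_measurable M) \<and> (\<lambda>n. \<integral>\<^sup>+\<omega>. W n \<omega> \<partial>M) \<longlonglongrightarrow> 0 \<and>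
    eventually (\<lambda>n. \<forall>\<omega>. ens_good e n (Xi \<omega>) \<longrightarrow> \<omega> \<in> space M \<longrightarrow> \<not> (\<forall>z\<in>ens_domain e. ens_fun e n (Xi \<omega>) z = 0) \<longrightarrow>
      of_nat (card {t. \<bar>t\<bar> \<le> \<beta> \<and> ens_re e n (Xi \<omega>) t = 0}) \<le> of_nat (C * n) + (W n \<omega> :: ennreal)) sequentially"
    by (rule total_zero_count) (use \<alpha>\<beta> in auto)
  then obtain C :: nat and W where W: "\<And>n. W n \<in> borel_measurable M" "(\<lambda>n. \<integral>\<^sup>+\<omega>. W n \<omega> \<partial>M) \<longlonglongrightarrow> 0"
    and total: "eventually (\<lambda>n. \<forall>\<omega>. ens_good e n (Xi \<omega>) \<longrightarrow> \<omega> \<in> space M \<longrightarrow> \<not> (\<forall>z\<in>ens_domain e. ens_fun e n (Xi \<omega>) z = 0) \<longrightarrow>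
      of_nat (card {t. \<bar>t\<bar> \<le> \<beta> \<and> ens_re e n (Xi \<omega>) t = 0}) \<le> of_nat (C * n) + (W n \<omega> :: ennreal)) sequentially"
    by blast
  obtain \<delta>0 where \<delta>0: "0 < \<delta>0" "\<And>\<delta>. 0 < \<delta> \<Longrightarrow> \<delta> < \<delta>0 \<Longrightarrow> (LINT t|lborel. indicator {a..b} t * sign_change_limit (ens_kappa e t * \<delta>)) \<le> \<delta> * (I / pi + \<epsilon> / 4)"
    using sign_change_limit_integral_bounds[OF J', of "\<epsilon> / 4"] \<epsilon> unfolding I_def by auto
  define l where "l = b - a + 1"
  have l: "0 < l" using ab by (simp add: l_def)
  \<comment> \<open>The bound 1/2 makes the sum of \<open>d^(2 m)\<close> over m \<ge> 2 at most
    \<open>2 * d^4\<close>, \<open>\<delta>0 / 2\<close> puts \<delta> into the range of the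
    expansion, and the last bound gives \<open>4 * Cs * l * d \<le> \<epsilon> / 4\<close>.\<close>
  define d where "d = min (1 / 2) (min (\<delta>0 / 2) (\<epsilon> / (16 * Cs * l)))"
  have e16: "0 < \<epsilon> / (16 * Cs * l)" using \<epsilon> Cs l by simp
  have "0 < d" "d \<le> 1 / 2" "d \<le> \<delta>0 / 2" and d5: "d \<le> \<epsilon> / (16 * Cs * l)"
    unfolding d_def using \<delta>0(1) e16 by linarith+
  then have d: "0 < d" "d < 1" "d \<le> 1 / 2" "d < \<delta>0" "d \<le> \<epsilon> / (16 * Cs * l)"
    using \<delta>0(1) by simp_all
  define \<delta> where "\<delta> = d ^ 3"
  have "d ^ 3 \<le> d ^ 1" by (rule power_decreasing) (use d in auto)
  then have \<delta>: "0 < \<delta>" "\<delta> < 1" "\<delta> \<le> d" using d by (simp_all add: \<delta>_def)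
  then have \<delta>lt: "\<delta> < \<delta>0" using d by simp
  define S where "S = (LINT t|lborel. indicator {a..b} t * sign_change_limit (ens_kappa e t * \<delta>))"
  have S: "S \<le> \<delta> * (I / pi + \<epsilon> / 4)" unfolding S_def by (rule \<delta>0(2)[OF \<delta>(1) \<delta>lt])
  define pn where "pn n t = prob {\<omega>\<in>space M. ens_re e n (Xi \<omega>) t * ens_re e n (Xi \<omega>) (t + \<delta> / sqrt (real n)) \<le> 0}" for n t
  have lim0: "(\<lambda>n. a - \<delta> / sqrt (real n)) \<longlonglongrightarrow> a" by real_asymp
  have h1: "\<delta> / sqrt (real n) \<le> 1" for n
  proof (cases "n = 0")
    case False
    then have "1 \<le> sqrt (real n)" by simp
    with \<delta>(2) have "\<delta> \<le> sqrt (real n)" by linarith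
    then show ?thesis using False by simp
  qed simp
  have h0: "0 \<le> \<delta> / sqrt (real n)" for n using \<delta> by simp
  note sc = sign_change_integral_tendsto[where Q = "\<lambda>x. x \<le> 0" and lo = "\<lambda>n. a - \<delta> / sqrt (real n)" and up = "\<lambda>_. b" and pn = pn, OF J \<delta>(1) lim0 _ tendsto_const _ pn_def]
  have lim: "(\<lambda>n. LINT t|lborel. indicator {a - \<delta> / sqrt (real n)..b} t * pn n t) \<longlonglongrightarrow> S"
    unfolding S_def by (rule sc(1)) (use h1 h0 in auto)
  have meas: "pn n \<in> borel_measurable borel" for n by (rule sc(2)) (use h1 h0 in auto)
  \<comment> \<open>The budget for the mean of W: over a length of at most l it contributes at most
    \<open>\<delta> * \<epsilon> / 8\<close>.\<close>
  define \<epsilon>2 where "\<epsilon>2 = \<delta> * \<epsilon> / (8 * l)"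
  have \<epsilon>2: "0 < \<epsilon>2" using \<delta> \<epsilon> l by (simp add: \<epsilon>2_def)
  \<comment> \<open>Error per window with cut-off \<open>m1 = n + 2\<close>: the geometric part of
    twice the sum over m, the n + 1 terms \<open>Cs / n^2\<close> of that sum, and
    \<open>C * n\<close> times the probability bound for m1. Only the first survives as n tends to
    infinity.\<close>
  define K where "K n = 4 * Cs * d ^ 4 + 2 * Cs * (real n + 1) / (real n)\<^sup>2 + real C * real n * Cs * (d ^ (2 * (n + 2)) + 1 / (real n)\<^sup>2)" for n
  have K: "K \<longlonglongrightarrow> 4 * Cs * d ^ 4"
  proof -
    have "(\<lambda>n. real n * (d\<^sup>2) ^ n) \<longlonglongrightarrow> 0"
      by (rule powser_times_n_limit_0) (use d in \<open>simp add: power_less_one_iff\<close>)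
    then have "(\<lambda>n. (real C * Cs * d ^ 4) * (real n * (d\<^sup>2) ^ n)) \<longlonglongrightarrow> (real C * Cs * d ^ 4) * 0" by (intro tendsto_intros)
    moreover have "(\<lambda>n. real C * real n * Cs * (1 / (real n)\<^sup>2)) \<longlonglongrightarrow> 0" by real_asymp
    moreover have "(\<lambda>n. 2 * Cs * (real n + 1) / (real n)\<^sup>2) \<longlonglongrightarrow> 0" by real_asymp
    ultimately have "(\<lambda>n. 4 * Cs * d ^ 4 + 2 * Cs * (real n + 1) / (real n)\<^sup>2 + ((real C * Cs * d ^ 4) * (real n * (d\<^sup>2) ^ n) + real C * real n * Cs * (1 / (real n)\<^sup>2)))
       \<longlonglongrightarrow> 4 * Cs * d ^ 4 + 0 + ((real C * Cs * d ^ 4) * 0 + 0)" by (intro tendsto_add tendsto_const)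
    moreover have "(real C * Cs * d ^ 4) * (real n * (d\<^sup>2) ^ n) + real C * real n * Cs * (1 / (real n)\<^sup>2) = real C * real n * Cs * (d ^ (2 * (n + 2)) + 1 / (real n)\<^sup>2)" for n
    proof -
      have "d ^ (2 * (n + 2)) = d ^ (2 * n + 4)" by (rule arg_cong[of _ _ "power d"]) simp
      also have "\<dots> = (d\<^sup>2) ^ n * d ^ 4" by (simp only: power_add power_mult)
      finally have "d ^ (2 * (n + 2)) = (d\<^sup>2) ^ n * d ^ 4" .
      then show ?thesis by (simp only: distrib_left mult_ac)
    qed
    ultimately show ?thesis by (simp only: K_def[abs_def]) simp
  qed
  define X where "X n = 1 / \<delta> * ((LINT t|lborel. indicator {a - \<delta> / sqrt (real n)..b} t * pn n t) + (b - a + \<delta> / sqrt (real n)) * (K n + \<epsilon>2))" for n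
  have Xlim: "X \<longlonglongrightarrow> 1 / \<delta> * (S + (b - a + 0) * (4 * Cs * d ^ 4 + \<epsilon>2))"
  proof -
    have "(\<lambda>n. \<delta> / sqrt (real n)) \<longlonglongrightarrow> 0" by real_asymp
    then show ?thesis unfolding X_def by (intro tendsto_intros lim K)
  qed
  \<comment> \<open>The errors are \<epsilon>/4 from the expansion in \<delta>, \<epsilon>/4 from
    several zeros in a window and \<epsilon>/8 from W, together
    \<open>5 / 8 * \<epsilon>\<close>.\<close>
  have "1 / \<delta> * (S + (b - a + 0) * (4 * Cs * d ^ 4 + \<epsilon>2)) < I / pi + \<epsilon>"
  proof -
    have "(b - a + 0) * (4 * Cs * d ^ 4 + \<epsilon>2) \<le> l * (4 * Cs * d ^ 4 + \<epsilon>2)"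
      using Cs d \<epsilon>2 by (intro mult_right_mono) (auto simp: l_def)
    also have "\<dots> = \<delta> * (4 * Cs * l * d) + \<delta> * (\<epsilon> / 8)"
      using l by (simp add: \<epsilon>2_def \<delta>_def distrib_left power4_eq_xxxx power3_eq_cube)
    also have "4 * Cs * l * d \<le> \<epsilon> / 4"
      using d(5) Cs l by (simp add: field_simps)
    finally have "(b - a + 0) * (4 * Cs * d ^ 4 + \<epsilon>2) \<le> \<delta> * (\<epsilon> / 4) + \<delta> * (\<epsilon> / 8)" using \<delta> by simp
    with S have "S + (b - a + 0) * (4 * Cs * d ^ 4 + \<epsilon>2) \<le> \<delta> * (I / pi + \<epsilon> * (5 / 8))" by (simp add: algebra_simps)
    also have "\<dots> < \<delta> * (I / pi + \<epsilon>)" using \<delta> \<epsilon> by (intro mult_strict_left_mono) auto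
    finally show ?thesis using \<delta> by (simp add: field_simps)
  qed
  then have evX: "eventually (\<lambda>n. X n < I / pi + \<epsilon>) sequentially" by (rule order_tendstoD(2)[OF Xlim])
  have evW: "eventually (\<lambda>n. (\<integral>\<^sup>+\<omega>. W n \<omega> \<partial>M) < ennreal \<epsilon>2) sequentially"
    by (rule order_tendstoD(2)[OF W(2)]) (use \<epsilon>2 in simp)
  have evh: "eventually (\<lambda>n. \<delta> / sqrt (real n) < \<eta>) sequentially"
    using \<eta> by (intro order_tendstoD(2)[of _ 0]) real_asymp+
  have evd: "eventually (\<lambda>n. e = HAF \<longrightarrow> \<beta> + 2 / sqrt (real n) \<le> 1) sequentially"
  proof (cases "e = HAF")
    case True
    then have "\<beta> < 1" using \<alpha>\<beta> by simp
    moreover have "(\<lambda>n. \<beta> + 2 / sqrt (real n)) \<longlonglongrightarrow> \<beta>" by real_asymp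
    ultimately have "eventually (\<lambda>n. \<beta> + 2 / sqrt (real n) < 1) sequentially" by (intro order_tendstoD(2))
    then show ?thesis by eventually_elim simp
  qed simp
  from small total evX evW evh evd eventually_ge_at_top[of 1] show ?thesis
  proof eventually_elim
    case (elim n)
    let ?h = "\<delta> / sqrt (real n)"
    let ?E = "\<integral>\<^sup>+\<omega>. num_zeros e n (Xi \<omega>) a b \<partial>M"
    define p where "p m = Cs * (d ^ (2 * m) + 1 / (real n)\<^sup>2)" for m
    have rg: "\<alpha> \<le> \<bar>t\<bar> \<and> \<bar>t\<bar> \<le> \<beta>" if "t \<in> {a - ?h..b}" for t
      by (rule range) (use that elim(5) \<eta> in auto)
    have "ennreal ?h * ?E \<le> (\<integral>\<^sup>+t\<in>{a - ?h..b}. (ennreal (prob {\<omega>\<in>space M. ens_re e n (Xi \<omega>) t * ens_re e n (Xi \<omega>) (t + ?h) \<le> 0} + 2 * (\<Sum>m=2..n+2. p m) + real (C * n) * p (n + 2))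
        + (\<integral>\<^sup>+\<omega>. W n \<omega> \<partial>M)) \<partial>lborel)"
    proof (rule expected_num_zeros_upper[OF elim(7) \<delta>(1,2) J' _ _ W(1)])
      show "e = HAF \<longrightarrow> \<bar>t\<bar> + 2 / sqrt (real n) \<le> 1" if "t \<in> {a - ?h..b}" for t
        using rg[OF that] elim(6) by auto
      show "of_nat (card {t\<in>{a..b}. ens_re e n (Xi \<omega>) t = 0}) \<le> of_nat (C * n) + W n \<omega>"
        if w: "ens_good e n (Xi \<omega>)" "\<omega> \<in> space M" "\<not> (\<forall>z\<in>ens_domain e. ens_fun e n (Xi \<omega>) z = 0)" for \<omega>
      proof -
        have "finite {t. \<bar>t\<bar> \<le> \<beta> \<and> ens_re e n (Xi \<omega>) t = 0}"
          by (rule finite_ens_zeros[OF w(1,3)]) (use \<alpha>\<beta> in auto)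
        moreover have "{t\<in>{a..b}. ens_re e n (Xi \<omega>) t = 0} \<subseteq> {t. \<bar>t\<bar> \<le> \<beta> \<and> ens_re e n (Xi \<omega>) t = 0}"
          using range \<eta> by auto
        ultimately have "(of_nat (card {t\<in>{a..b}. ens_re e n (Xi \<omega>) t = 0}) :: ennreal) \<le> of_nat (card {t. \<bar>t\<bar> \<le> \<beta> \<and> ens_re e n (Xi \<omega>) t = 0})"
          by (intro of_nat_mono card_mono)
        also have "\<dots> \<le> of_nat (C * n) + W n \<omega>" using elim(2) w by blast
        finally show ?thesis .
      qed
      show "prob {\<omega>\<in>space M. small_cond e n \<delta> m t (Xi \<omega>)} \<le> p m" if "t \<in> {a - ?h..b}" for t m
        unfolding p_def \<delta>_def using elim(1) rg[OF that] d by blast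
    qed simp
    also have "\<dots> \<le> (\<integral>\<^sup>+t\<in>{a - ?h..b}. (ennreal (pn n t) + ennreal (K n + \<epsilon>2)) \<partial>lborel)"
    proof (rule nn_integral_mono)
      fix t
      have Kn: "2 * (\<Sum>m=2..n+2. p m) + real (C * n) * p (n + 2) \<le> K n"
      proof -
        have "(\<Sum>m=2..n+2. p m) = Cs * (\<Sum>m=2..n+2. d ^ (2 * m)) + Cs * (real n + 1) / (real n)\<^sup>2"
        proof -
          have "(\<Sum>m=2..n+2. p m) = Cs * (\<Sum>m=2..n+2. d ^ (2 * m)) + (\<Sum>m=2..n+2. Cs / (real n)\<^sup>2)"
            unfolding p_def sum_distrib_left sum.distrib[symmetric] by (rule sum.cong) (simp_all add: distrib_left)
          also have "(\<Sum>m=2..n+2. Cs / (real n)\<^sup>2) = (real n + 1) * (Cs / (real n)\<^sup>2)"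
            unfolding sum_constant by simp
          finally show ?thesis by (simp only: times_divide_eq_right mult.commute)
        qed
        moreover have "(\<Sum>m=2..n+2. d ^ (2 * m)) \<le> 2 * d ^ 4"
        proof -
          have "(\<Sum>m=2..n+2. d ^ (2 * m)) = (\<Sum>m=0..n. d ^ (2 * (m + 2)))"
            using sum.shift_bounds_cl_nat_ivl[of "\<lambda>m. d ^ (2 * m)" 0 2 n] by (simp only: add_0)
          also have "\<dots> \<le> (\<Sum>m=0..n. d ^ 4 * (1 / 2) ^ m)"
          proof (rule sum_mono)
            fix m
            have "d ^ (2 * (m + 2)) = d ^ (4 + 2 * m)" by (rule arg_cong[of _ _ "power d"]) simp
            also have "\<dots> = d ^ 4 * (d\<^sup>2) ^ m" by (simp only: power_add power_mult)
            also have "\<dots> \<le> d ^ 4 * (1 / 2) ^ m"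
            proof (intro mult_left_mono power_mono)
              have "d\<^sup>2 \<le> 1 / 2 * 1" unfolding power2_eq_square using d by (intro mult_mono) auto
              then show "d\<^sup>2 \<le> 1 / 2" by simp
            qed auto
            finally show "d ^ (2 * (m + 2)) \<le> d ^ 4 * (1 / 2) ^ m" .
          qed
          also have "\<dots> = d ^ 4 * (\<Sum>m=0..n. (1 / 2) ^ m)" by (simp add: sum_distrib_left)
          also have "(\<Sum>m=0..n. (1 / 2 :: real) ^ m) = 2 - (1 / 2) ^ n"
            by (induction n) simp_all
          also have "d ^ 4 * (2 - (1 / 2) ^ n) \<le> d ^ 4 * 2" by (intro mult_left_mono) auto
          finally show ?thesis by simp
        qed
        then have "Cs * (\<Sum>m=2..n+2. d ^ (2 * m)) \<le> Cs * (2 * d ^ 4)" using Cs by (intro mult_left_mono) auto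
        moreover have "real (C * n) * p (n + 2) = real C * real n * Cs * (d ^ (2 * (n + 2)) + 1 / (real n)\<^sup>2)"
          by (simp add: p_def)
        moreover have "2 * Cs * (real n + 1) / (real n)\<^sup>2 = 2 * (Cs * (real n + 1) / (real n)\<^sup>2)"
          "4 * Cs * d ^ 4 = 2 * (Cs * (2 * d ^ 4))" by simp_all
        ultimately show ?thesis unfolding K_def by linarith
      qed
      have pn: "prob {\<omega>\<in>space M. ens_re e n (Xi \<omega>) t * ens_re e n (Xi \<omega>) (t + ?h) \<le> 0} = pn n t" by (simp add: pn_def)
      have pn0: "0 \<le> pn n t" by (simp add: pn_def)
      have p0: "0 \<le> p m" for m using Cs d by (simp add: p_def)
      have k0: "0 \<le> 2 * (\<Sum>m=2..n+2. p m) + real (C * n) * p (n + 2)"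
        by (intro add_nonneg_nonneg mult_nonneg_nonneg sum_nonneg p0) auto
      have "ennreal (pn n t + 2 * (\<Sum>m=2..n+2. p m) + real (C * n) * p (n + 2)) + (\<integral>\<^sup>+\<omega>. W n \<omega> \<partial>M)
          \<le> ennreal (pn n t + K n) + ennreal \<epsilon>2"
      proof (rule add_mono)
        show "ennreal (pn n t + 2 * (\<Sum>m=2..n+2. p m) + real (C * n) * p (n + 2)) \<le> ennreal (pn n t + K n)"
          using Kn by (intro ennreal_leI) linarith
        show "(\<integral>\<^sup>+\<omega>. W n \<omega> \<partial>M) \<le> ennreal \<epsilon>2" using elim(4) by (rule less_imp_le)
      qed
      also have "\<dots> = ennreal (pn n t) + ennreal (K n + \<epsilon>2)"
        using pn0 order_trans[OF k0 Kn] \<epsilon>2 by (simp add: ennreal_plus add.assoc)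
      finally show "(ennreal (prob {\<omega>\<in>space M. ens_re e n (Xi \<omega>) t * ens_re e n (Xi \<omega>) (t + ?h) \<le> 0} + 2 * (\<Sum>m=2..n+2. p m) + real (C * n) * p (n + 2))
        + (\<integral>\<^sup>+\<omega>. W n \<omega> \<partial>M)) * indicator {a - ?h..b} t \<le> (ennreal (pn n t) + ennreal (K n + \<epsilon>2)) * indicator {a - ?h..b} t"
        unfolding pn by (rule mult_right_mono) simp
    qed
    also have "\<dots> = (\<integral>\<^sup>+t\<in>{a - ?h..b}. ennreal (pn n t) \<partial>lborel) + ennreal (K n + \<epsilon>2) * emeasure lborel {a - ?h..b}"
    proof -
      have [measurable]: "pn n \<in> borel_measurable borel" by (rule meas)
      have "(\<integral>\<^sup>+t\<in>{a - ?h..b}. (ennreal (pn n t) + ennreal (K n + \<epsilon>2)) \<partial>lborel)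
        = (\<integral>\<^sup>+t. ennreal (pn n t) * indicator {a - ?h..b} t + ennreal (K n + \<epsilon>2) * indicator {a - ?h..b} t \<partial>lborel)"
        by (simp add: distrib_right)
      also have "\<dots> = (\<integral>\<^sup>+t\<in>{a - ?h..b}. ennreal (pn n t) \<partial>lborel) + (\<integral>\<^sup>+t\<in>{a - ?h..b}. ennreal (K n + \<epsilon>2) \<partial>lborel)"
        by (rule nn_integral_add) measurable
      finally show ?thesis by (simp add: nn_integral_cmult_indicator)
    qed
    also have "(\<integral>\<^sup>+t\<in>{a - ?h..b}. ennreal (pn n t) \<partial>lborel) = ennreal (LINT t|lborel. indicator {a - ?h..b} t * pn n t)"
      by (rule set_nn_integral_eq_ennreal[OF meas]) (auto simp: pn_def)
    also have "emeasure lborel {a - ?h..b} = ennreal (b - a + ?h)"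
      using ab h0[of n] by (simp add: algebra_simps)
    finally have up: "ennreal ?h * ?E \<le> ennreal (LINT t|lborel. indicator {a - ?h..b} t * pn n t) + ennreal (K n + \<epsilon>2) * ennreal (b - a + ?h)" .
    have Kn0: "0 \<le> K n + \<epsilon>2" using Cs d \<epsilon>2 by (simp add: K_def)
    have L0: "0 \<le> (LINT t|lborel. indicator {a - ?h..b} t * pn n t)"
      by (rule integral_nonneg_AE) (simp add: pn_def)
    have "ennreal (K n + \<epsilon>2) * ennreal (b - a + ?h) = ennreal ((b - a + ?h) * (K n + \<epsilon>2))"
      using ennreal_mult'[OF Kn0, of "b - a + ?h"] by (simp add: mult.commute)
    then have up2: "ennreal ?h * ?E \<le> ennreal ((LINT t|lborel. indicator {a - ?h..b} t * pn n t) + (b - a + ?h) * (K n + \<epsilon>2))"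
      using up L0 Kn0 ab h0[of n] by (simp add: ennreal_plus)
    have "?E / ennreal (sqrt (real n)) = ennreal (1 / \<delta>) * (ennreal ?h * ?E)" by (rule divide_sqrt_eq[OF elim(7) \<delta>(1)])
    also have "\<dots> \<le> ennreal (1 / \<delta>) * ennreal ((LINT t|lborel. indicator {a - ?h..b} t * pn n t) + (b - a + ?h) * (K n + \<epsilon>2))"
      by (intro mult_left_mono up2) simp
    also have "\<dots> = ennreal (X n)" unfolding X_def by (rule ennreal_mult'[symmetric]) (use \<delta> in simp)
    also have "\<dots> \<le> ennreal (I / pi + \<epsilon>)" using elim(3) by (intro ennreal_leI) simp
    finally show ?case .
  qed
qed

lemma num_zeros_tendsto:
  assumes ab: "a \<le> b" and J: "{a..b} \<subseteq> ens_J e - {0}"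
  shows "(\<lambda>n. (\<integral>\<^sup>+\<omega>. num_zeros e n (\<lambda>k. \<xi> k \<omega>) a b \<partial>M) / ennreal (sqrt (real n)))
    \<longlonglongrightarrow> ennreal (1 / (2 * pi) * integral {a..b} (\<lambda>t. sqrt (deriv (ens_p e) t / t + deriv (deriv (ens_p e)) t)))"
proof -
  have J': "{a..b} \<subseteq> ens_J e" using J by blast
  define I where "I = (LINT t|lborel. indicator {a..b} t * ens_kappa e t)"
  have kpos: "0 < ens_kappa e t" if "t \<in> {a..b}" for t using ens_kappa_pos that J by blast
  have I0: "0 \<le> I" unfolding I_def by (rule integral_nonneg_AE) (use kpos in \<open>auto simp: indicator_def intro: less_imp_le\<close>)
  have "set_integrable lborel {a..b} (ens_kappa e)"
    by (rule borel_integrable_atLeastAtMost') (rule continuous_on_subset[OF ens_kappa_continuous J'])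
  then have I_eq: "integral {a..b} (ens_kappa e) = I"
    using set_borel_integral_eq_integral(2)[of "{a..b}" "ens_kappa e"] by (simp add: set_lebesgue_integral_def I_def)
  have "integral {a..b} (\<lambda>t. sqrt (deriv (ens_p e) t / t + deriv (deriv (ens_p e)) t)) = integral {a..b} (\<lambda>t. 2 * ens_kappa e t)"
    by (rule Henstock_Kurzweil_Integration.integral_cong) (use ens_density J in blast)
  also have "\<dots> = 2 * I" by (simp add: I_eq)
  finally have target: "1 / (2 * pi) * integral {a..b} (\<lambda>t. sqrt (deriv (ens_p e) t / t + deriv (deriv (ens_p e)) t)) = I / pi" by simp
  let ?f = "\<lambda>n. (\<integral>\<^sup>+\<omega>. num_zeros e n (Xi \<omega>) a b \<partial>M) / ennreal (sqrt (real n))"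
  have "?f \<longlonglongrightarrow> ennreal (I / pi)"
  proof (rule order_tendstoI)
    fix y assume y: "y < ennreal (I / pi)"
    then obtain x where x: "y = ennreal x" "0 \<le> x" by (cases y) auto
    then have xI: "x < I / pi" using y by (simp add: ennreal_less_iff)
    have "eventually (\<lambda>n. ennreal (I / pi - (I / pi - x) / 2) \<le> ?f n) sequentially"
      unfolding I_def by (rule eventually_num_zeros_lower[OF J]) (use xI in \<open>simp add: I_def\<close>)
    then show "eventually (\<lambda>n. y < ?f n) sequentially"
    proof eventually_elim
      case (elim n)
      have "x < I / pi - (I / pi - x) / 2" using xI by (simp add: field_simps)
      then have "y < ennreal (I / pi - (I / pi - x) / 2)" using x by (simp add: ennreal_less_iff)
      also note elim
      finally show ?case .
    qed
  next
    fix y assume y: "ennreal (I / pi) < y"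
    show "eventually (\<lambda>n. ?f n < y) sequentially"
    proof (cases "y = top")
      case True
      have "eventually (\<lambda>n. ?f n \<le> ennreal (I / pi + 1)) sequentially"
        unfolding I_def by (rule eventually_num_zeros_upper[OF ab J]) simp
      then show ?thesis by eventually_elim (use True in \<open>auto intro: le_less_trans\<close>)
    next
      case False
      then obtain x where x: "y = ennreal x" "0 \<le> x" by (cases y) auto
      then have xI: "I / pi < x" using y I0 by (simp add: ennreal_less_iff)
      have "eventually (\<lambda>n. ?f n \<le> ennreal (I / pi + (x - I / pi) / 2)) sequentially"
        unfolding I_def by (rule eventually_num_zeros_upper[OF ab J]) (use xI in \<open>simp add: I_def\<close>)
      then show ?thesis
      proof eventually_elim
        case (elim n)
        have "0 \<le> I / pi" using I0 by simp
        moreover have "c + (x - c) / 2 < x \<and> c \<le> c + (x - c) / 2" if "c < x" for c by (use that in \<open>simp add: field_simps\<close>)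
        ultimately have "I / pi + (x - I / pi) / 2 < x" "0 \<le> I / pi + (x - I / pi) / 2" using xI by (metis order_trans)+
        then have "ennreal (I / pi + (x - I / pi) / 2) < y" unfolding x(1) by (simp only: ennreal_less_iff)
        with elim show ?case by (rule le_less_trans)
      qed
    qed
  qed
  then show ?thesis unfolding target Xi_def .
qed

end

theorem theorem1p1:
  fixes M :: "'a measure" and \<xi> :: "nat \<Rightarrow> 'a \<Rightarrow> real"
    and e :: ensemble and a b :: real
  assumes "prob_space M"
    and "prob_space.indep_vars M (\<lambda>_. borel) \<xi> UNIV"
    and "\<And>k. distr M borel (\<xi> k) = distr M borel (\<xi> 0)"
    and "prob_space.expectation M (\<xi> 0) = 0"
    and "prob_space.expectation M (\<lambda>\<omega>. (\<xi> 0 \<omega>)\<^sup>2) = 1"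
    and "a \<le> b"
    and "{a..b} \<subseteq> ens_J e - {0}"
  shows "(\<lambda>n. (\<integral>\<^sup>+\<omega>. num_zeros e n (\<lambda>k. \<xi> k \<omega>) a b \<partial>M) / ennreal (sqrt (real n)))
           \<longlonglongrightarrow> ennreal (1 / (2 * pi) *
                integral {a..b} (\<lambda>t. sqrt (deriv (ens_p e) t / t + deriv (deriv (ens_p e)) t)))"
proof -
  interpret prob_space M by (rule assms(1))
  interpret iid_std M \<xi>
    by unfold_locales (use assms(2-5) in auto)
  show ?thesis by (rule num_zeros_tendsto[OF assms(6,7)])
qed

end
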